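(* Let $h$ be sufficiently small. Suppose that the solutions $(\eta,u)$ of the initial-boundary-value problems (CB) and (SCB) (stated in the context) are such that $\eta\in C(0,T;W_\infty^4)$ and $u\in C(0,T;W_\infty^4\cap H_0^1)$. Then the semidiscrete problems (CB$_h$) and (SCB$_h$) (stated in the context), i.e. the standard Galerkin semidiscretizations with $C^2$ cubic splines on a quasiuniform mesh with initial values $\eta_h(0)=P\eta_0$, $u_h(0)=R_hu_0$, have unique solutions $(\eta_h,u_h)$ for $0\le t\le T$, and there is a constant $C$ independent of $h$ such that, in each case, \[ \max_{0\le t\le T}\|\eta(t)-\eta_h(t)\|\le Ch^3,\qquad \max_{0\le t\le T}\|u(t)-u_h(t)\|_1\le Ch^3. \]
   Context: Function spaces on $(0,1)$: $H^1$, $H_0^1$ (elements of $H^1$ vanishing at $0$ and $1$) and $W^k_\infty$ are the usual Sobolev spaces; $(\cdot,\cdot)$ and $\|\cdot\|$ are the inner product and norm of $L^2(0,1)$; $\|v\|_1=(\|v\|^2+\tfrac13\|v'\|^2)^{1/2}$. $C(0,T;X)$ is the space of functions $\phi=\phi(t)$ with values in the Banach space $X$ for each $t\in[0,T]$ and such that $t\mapsto\|\phi(t)\|_X$ is continuous on $[0,T]$. $0<T<\infty$ is such that the problems below have solutions on $[0,T]$; solutions are assumed to be sufficiently smooth (in $x$ and $t$) for the equations to hold in the classical sense. Problem (CB): $\eta_t+u_x+(\eta u)_x=0$, $u_t+\eta_x+uu_x-\tfrac13u_{xxt}=0$ for $(x,t)\in[0,1]\times[0,T]$; $\eta(x,0)=\eta_0(x)$,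 $u(x,0)=u_0(x)$ for $x\in[0,1]$; $u(0,t)=u(1,t)=0$ for $t\in[0,T]$. Problem (SCB): $\eta_t+u_x+\tfrac12(\eta u)_x=0$, $u_t+\eta_x+\tfrac32uu_x+\tfrac12\eta\eta_x-\tfrac13u_{xxt}=0$ for $(x,t)\in[0,1]\times[0,T]$, with the same initial and boundary conditions. Mesh and spaces: $0=x_1<x_2<\dots<x_{N+1}=1$ is a partition from a quasiuniform family (the ratio $\max_i(x_{i+1}-x_i)/\min_i(x_{i+1}-x_i)$ is bounded by a constant independent of the partition), $h=\max_i(x_{i+1}-x_i)$; $S_h^4=\{\phi\in C^2[0,1]:\phi|_{[x_j,x_{j+1}]}\in\mathbb P_3,\ 1\le j\le N\}$ ($\mathbb P_r$: polynomials of degree $\le r$), $S_{h,0}^4=\{\phi\in S_h^4:\phi(0)=\phi(1)=0\}$. $P:L^2\to S_h^4$ is the $L^2$-projection onto $S_h^4$. $a(\psi,\chi)=(\psi,\chi)+\tfrac13(\psi',\chi')$, and $R_h:H^1\to S_{h,0}^4$ is defined by $a(R_hv,\chi)=a(v,\chi)$ for all $\chi\in S_{h,0}^4$. Semidiscrete problem (CB$_h$): find $\eta_h:[0,T]\to S_h^4$, $u_h:[0,T]\to S_{h,0}^4$ such that for $t\in[0,T]$ $(\eta_{ht},\phi)+(u_{hx},\phi)+((\eta_hu_h)_x,\phi)=0$ for all $\phi\in S_h^4$, and $a(u_{ht},\chi)+(\eta_{hx},\chi)+(u_hu_{hx},\chi)=0$ for all $\chi\in S_{h,0}^4$, with $\eta_h(0)=P\eta_0$,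 $u_h(0)=R_hu_0$. Semidiscrete problem (SCB$_h$): the same with the equations replaced by $(\eta_{ht},\phi)+(u_{hx},\phi)+\tfrac12((\eta_hu_h)_x,\phi)=0$ for all $\phi\in S_h^4$, and $a(u_{ht},\chi)+(\eta_{hx},\chi)+\tfrac32(u_hu_{hx},\chi)+\tfrac12(\eta_h\eta_{hx},\chi)=0$ for all $\chi\in S_{h,0}^4$. *)

theory Defs
  imports
    "HOL-Analysis.Analysis"
    "HOL-Computational_Algebra.Polynomial"
    "HOL-Probability.Essential_Supremum"
begin

(* A function of x and t is curried as \<open>f t x\<close>, so that \<open>f t\<close> is the spatial
   function f(t).  Only the values on [0,T] x [0,1] ever matter. *)

section \<open>Function spaces on (0,1)\<close>

abbreviation I01 :: "real measure" where
  "I01 \<equiv> lebesgue_on {0<..<1}"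

definition L2_space :: "(real \<Rightarrow> real) set" where
  "L2_space = {v. v \<in> borel_measurable I01 \<and> integrable I01 (\<lambda>x. (v x)\<^sup>2)}"

definition l2_inner :: "(real \<Rightarrow> real) \<Rightarrow> (real \<Rightarrow> real) \<Rightarrow> real" where
  "l2_inner v w = (LINT x|I01. v x * w x)"

definition l2_norm :: "(real \<Rightarrow> real) \<Rightarrow> real" where
  "l2_norm v = sqrt (l2_inner v v)"

definition Linf_space :: "(real \<Rightarrow> real) set" where
  "Linf_space = {v. v \<in> borel_measurable I01 \<and> esssup I01 (\<lambda>x. ereal \<bar>v x\<bar>) < \<infinity>}"

definition Linf_norm :: "(real \<Rightarrow> real) \<Rightarrow> real" where
  "Linf_norm v = real_of_ereal (esssup I01 (\<lambda>x. ereal \<bar>v x\<bar>))"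

definition test_function :: "(real \<Rightarrow> real) \<Rightarrow> bool" where
  "test_function \<phi> \<longleftrightarrow>
     (\<forall>n x. ((deriv ^^ n) \<phi>) field_differentiable (at x)) \<and>
     (\<exists>a b. 0 < a \<and> a < b \<and> b < 1 \<and> (\<forall>x. x \<notin> {a..b} \<longrightarrow> \<phi> x = 0))"

definition loc_integrable :: "(real \<Rightarrow> real) \<Rightarrow> bool" where
  "loc_integrable v \<longleftrightarrow> (\<forall>a b. 0 < a \<and> a < b \<and> b < 1 \<longrightarrow> set_integrable lebesgue {a..b} v)"

definition has_weak_deriv :: "nat \<Rightarrow> (real \<Rightarrow> real) \<Rightarrow> (real \<Rightarrow> real) \<Rightarrow> bool" where
  "has_weak_deriv k v g \<longleftrightarrow> loc_integrable v \<and> loc_integrable g \<and>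
     (\<forall>\<phi>. test_function \<phi> \<longrightarrow>
        (LINT x|I01. v x * (deriv ^^ k) \<phi> x) = (-1) ^ k * (LINT x|I01. g x * \<phi> x))"

(* Weak derivatives are unique almost everywhere in (0,1), so the norms and forms below do not
   depend on the chosen representative. *)
definition weak_deriv :: "nat \<Rightarrow> (real \<Rightarrow> real) \<Rightarrow> (real \<Rightarrow> real)" where
  "weak_deriv k v = (SOME g. has_weak_deriv k v g)"

definition W_inf :: "nat \<Rightarrow> (real \<Rightarrow> real) set" where
  "W_inf k = {v. \<forall>j\<le>k. \<exists>g\<in>Linf_space. has_weak_deriv j v g}"

definition W_inf_norm :: "nat \<Rightarrow> (real \<Rightarrow> real) \<Rightarrow> real" where
  "W_inf_norm k v = Max ((\<lambda>j. Linf_norm (weak_deriv j v)) ` {..k})"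

definition H1_space :: "(real \<Rightarrow> real) set" where
  "H1_space = {v \<in> L2_space. \<exists>g\<in>L2_space. has_weak_deriv 1 v g}"

(* Boundary values are those of the continuous representative. *)
definition H10_space :: "(real \<Rightarrow> real) set" where
  "H10_space = {v \<in> H1_space. \<exists>w. continuous_on {0..1} w \<and> (AE x in I01. v x = w x) \<and>
                                  w 0 = 0 \<and> w 1 = 0}"

definition a_form :: "(real \<Rightarrow> real) \<Rightarrow> (real \<Rightarrow> real) \<Rightarrow> real" where
  "a_form v w = l2_inner v w + 1/3 * l2_inner (weak_deriv 1 v) (weak_deriv 1 w)"

definition norm1 :: "(real \<Rightarrow> real) \<Rightarrow> real" where
  "norm1 v = sqrt ((l2_norm v)\<^sup>2 + 1/3 * (l2_norm (weak_deriv 1 v))\<^sup>2)"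

(* C(0,T;X) in the weak sense that only t |-> ||f(t)||_X is required to be continuous. *)
definition C_time ::
  "real \<Rightarrow> (real \<Rightarrow> real) set \<Rightarrow> ((real \<Rightarrow> real) \<Rightarrow> real) \<Rightarrow> (real \<Rightarrow> real \<Rightarrow> real) set" where
  "C_time T X nrm = {f. (\<forall>t\<in>{0..T}. f t \<in> X) \<and> continuous_on {0..T} (\<lambda>t. nrm (f t))}"

section \<open>Classical solutions\<close>

(* Partial derivatives relative to the closed intervals: one-sided at the endpoints. *)
definition dx :: "(real \<Rightarrow> real) \<Rightarrow> (real \<Rightarrow> real)" where
  "dx v x = vector_derivative v (at x within {0..1})"

definition dt :: "real \<Rightarrow> (real \<Rightarrow> real \<Rightarrow> real) \<Rightarrow> (real \<Rightarrow> real \<Rightarrow> real)" where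
  "dt T f t x = vector_derivative (\<lambda>s. f s x) (at t within {0..T})"

definition x_differentiable :: "real \<Rightarrow> (real \<Rightarrow> real \<Rightarrow> real) \<Rightarrow> bool" where
  "x_differentiable T f \<longleftrightarrow> (\<forall>t\<in>{0..T}. \<forall>x\<in>{0..1}. f t differentiable (at x within {0..1}))"

definition t_differentiable :: "real \<Rightarrow> (real \<Rightarrow> real \<Rightarrow> real) \<Rightarrow> bool" where
  "t_differentiable T f \<longleftrightarrow>
     (\<forall>t\<in>{0..T}. \<forall>x\<in>{0..1}. (\<lambda>s. f s x) differentiable (at t within {0..T}))"

definition jointly_continuous :: "real \<Rightarrow> (real \<Rightarrow> real \<Rightarrow> real) \<Rightarrow> bool" where
  "jointly_continuous T f \<longleftrightarrow> continuous_on ({0..T} \<times> {0..1}) (\<lambda>(t, x). f t x)"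

(* The smoothness needed for the equations to make classical sense: all derivatives occurring in
   them, i.e. eta_t, eta_x, u_t, u_x, u_xxt, exist and are continuous on [0,T] x [0,1]. *)
definition classically_smooth ::
  "real \<Rightarrow> (real \<Rightarrow> real \<Rightarrow> real) \<Rightarrow> (real \<Rightarrow> real \<Rightarrow> real) \<Rightarrow> bool" where
  "classically_smooth T \<eta> u \<longleftrightarrow>
     x_differentiable T \<eta> \<and> t_differentiable T \<eta> \<and>
     x_differentiable T u \<and> t_differentiable T u \<and>
     x_differentiable T (\<lambda>t. dx (u t)) \<and> t_differentiable T (\<lambda>t. dx (dx (u t))) \<and>
     jointly_continuous T \<eta> \<and> jointly_continuous T (\<lambda>t. dx (\<eta> t)) \<and>
     jointly_continuous T (dt T \<eta>) \<and>
     jointly_continuous T u \<and> jointly_continuous T (\<lambda>t. dx (u t)) \<and>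
     jointly_continuous T (dt T u) \<and>
     jointly_continuous T (\<lambda>t. dx (dx (u t))) \<and>
     jointly_continuous T (dt T (\<lambda>t. dx (dx (u t))))"

definition initial_boundary_values ::
  "real \<Rightarrow> (real \<Rightarrow> real) \<Rightarrow> (real \<Rightarrow> real) \<Rightarrow>
   (real \<Rightarrow> real \<Rightarrow> real) \<Rightarrow> (real \<Rightarrow> real \<Rightarrow> real) \<Rightarrow> bool" where
  "initial_boundary_values T \<eta>0 u0 \<eta> u \<longleftrightarrow>
     (\<forall>x\<in>{0..1}. \<eta> 0 x = \<eta>0 x \<and> u 0 x = u0 x) \<and>
     (\<forall>t\<in>{0..T}. u t 0 = 0 \<and> u t 1 = 0)"

definition CB_solution ::
  "real \<Rightarrow> (real \<Rightarrow> real) \<Rightarrow> (real \<Rightarrow> real) \<Rightarrow>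
   (real \<Rightarrow> real \<Rightarrow> real) \<Rightarrow> (real \<Rightarrow> real \<Rightarrow> real) \<Rightarrow> bool" where
  "CB_solution T \<eta>0 u0 \<eta> u \<longleftrightarrow>
     classically_smooth T \<eta> u \<and> initial_boundary_values T \<eta>0 u0 \<eta> u \<and>
     (\<forall>t\<in>{0..T}. \<forall>x\<in>{0..1}.
        dt T \<eta> t x + dx (u t) x + dx (\<lambda>y. \<eta> t y * u t y) x = 0 \<and>
        dt T u t x + dx (\<eta> t) x + u t x * dx (u t) x
          - 1/3 * dt T (\<lambda>s. dx (dx (u s))) t x = 0)"

definition SCB_solution ::
  "real \<Rightarrow> (real \<Rightarrow> real) \<Rightarrow> (real \<Rightarrow> real) \<Rightarrow>
   (real \<Rightarrow> real \<Rightarrow> real) \<Rightarrow> (real \<Rightarrow> real \<Rightarrow> real) \<Rightarrow> bool" where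
  "SCB_solution T \<eta>0 u0 \<eta> u \<longleftrightarrow>
     classically_smooth T \<eta> u \<and> initial_boundary_values T \<eta>0 u0 \<eta> u \<and>
     (\<forall>t\<in>{0..T}. \<forall>x\<in>{0..1}.
        dt T \<eta> t x + dx (u t) x + 1/2 * dx (\<lambda>y. \<eta> t y * u t y) x = 0 \<and>
        dt T u t x + dx (\<eta> t) x + 3/2 * (u t x * dx (u t) x) + 1/2 * (\<eta> t x * dx (\<eta> t) x)
          - 1/3 * dt T (\<lambda>s. dx (dx (u s))) t x = 0)"

section \<open>Meshes and cubic splines\<close>

(* A mesh is the list of its nodes, indexed from 0 rather than from 1. *)
definition is_mesh :: "real list \<Rightarrow> bool" where
  "is_mesh xs \<longleftrightarrow> length xs \<ge> 2 \<and> sorted_wrt (<) xs \<and> hd xs = 0 \<and> last xs = 1"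

definition mesh_widths :: "real list \<Rightarrow> real set" where
  "mesh_widths xs = {xs ! Suc j - xs ! j | j. Suc j < length xs}"

definition mesh_h :: "real list \<Rightarrow> real" where
  "mesh_h xs = Max (mesh_widths xs)"

definition quasiuniform_family :: "real list set \<Rightarrow> bool" where
  "quasiuniform_family \<M> \<longleftrightarrow> (\<forall>xs\<in>\<M>. is_mesh xs) \<and>
     (\<exists>\<kappa>. \<forall>xs\<in>\<M>. Max (mesh_widths xs) / Min (mesh_widths xs) \<le> \<kappa>)"

definition C2_space :: "(real \<Rightarrow> real) set" where
  "C2_space = {v. (\<forall>x\<in>{0..1}. v differentiable (at x within {0..1})) \<and>
                  (\<forall>x\<in>{0..1}. dx v differentiable (at x within {0..1})) \<and>
                  continuous_on {0..1} (dx (dx v))}"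

definition S4 :: "real list \<Rightarrow> (real \<Rightarrow> real) set" where
  "S4 xs = {\<phi> \<in> C2_space. \<forall>j. Suc j < length xs \<longrightarrow>
              (\<exists>p::real poly. degree p \<le> 3 \<and> (\<forall>x\<in>{xs ! j..xs ! Suc j}. \<phi> x = poly p x))}"

definition S40 :: "real list \<Rightarrow> (real \<Rightarrow> real) set" where
  "S40 xs = {\<phi> \<in> S4 xs. \<phi> 0 = 0 \<and> \<phi> 1 = 0}"

(* The projections P and R_h as relations ("w = Pv", "w = R_h v"), because elements of S4 are
   functions on the whole real line and are determined only on [0,1]. *)
definition is_L2_projection :: "real list \<Rightarrow> (real \<Rightarrow> real) \<Rightarrow> (real \<Rightarrow> real) \<Rightarrow> bool" where
  "is_L2_projection xs v w \<longleftrightarrow> w \<in> S4 xs \<and> (\<forall>\<phi>\<in>S4 xs. l2_inner w \<phi> = l2_inner v \<phi>)"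

definition is_elliptic_projection :: "real list \<Rightarrow> (real \<Rightarrow> real) \<Rightarrow> (real \<Rightarrow> real) \<Rightarrow> bool" where
  "is_elliptic_projection xs v w \<longleftrightarrow> w \<in> S40 xs \<and> (\<forall>\<psi>\<in>S40 xs. a_form w \<psi> = a_form v \<psi>)"

section \<open>Semidiscrete problems\<close>

(* The spline spaces are finite dimensional (as spaces of functions on [0,1]), so differentiability
   in t of a curve in them is the same as differentiability at each point x. *)
definition semidiscrete_curve ::
  "real \<Rightarrow> real list \<Rightarrow> (real \<Rightarrow> real \<Rightarrow> real) \<Rightarrow> (real \<Rightarrow> real \<Rightarrow> real) \<Rightarrow> bool" where
  "semidiscrete_curve T xs \<eta>h uh \<longleftrightarrow>
     (\<forall>t\<in>{0..T}. \<eta>h t \<in> S4 xs \<and> uh t \<in> S40 xs) \<and>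
     t_differentiable T \<eta>h \<and> t_differentiable T uh"

definition CBh_solution ::
  "real \<Rightarrow> (real \<Rightarrow> real) \<Rightarrow> (real \<Rightarrow> real) \<Rightarrow> real list \<Rightarrow>
   (real \<Rightarrow> real \<Rightarrow> real) \<Rightarrow> (real \<Rightarrow> real \<Rightarrow> real) \<Rightarrow> bool" where
  "CBh_solution T \<eta>0 u0 xs \<eta>h uh \<longleftrightarrow>
     semidiscrete_curve T xs \<eta>h uh \<and>
     is_L2_projection xs \<eta>0 (\<eta>h 0) \<and> is_elliptic_projection xs u0 (uh 0) \<and>
     (\<forall>t\<in>{0..T}.
        (\<forall>\<phi>\<in>S4 xs.
           l2_inner (dt T \<eta>h t) \<phi> + l2_inner (dx (uh t)) \<phi>
             + l2_inner (dx (\<lambda>x. \<eta>h t x * uh t x)) \<phi> = 0) \<and>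
        (\<forall>\<psi>\<in>S40 xs.
           a_form (dt T uh t) \<psi> + l2_inner (dx (\<eta>h t)) \<psi>
             + l2_inner (\<lambda>x. uh t x * dx (uh t) x) \<psi> = 0))"

definition SCBh_solution ::
  "real \<Rightarrow> (real \<Rightarrow> real) \<Rightarrow> (real \<Rightarrow> real) \<Rightarrow> real list \<Rightarrow>
   (real \<Rightarrow> real \<Rightarrow> real) \<Rightarrow> (real \<Rightarrow> real \<Rightarrow> real) \<Rightarrow> bool" where
  "SCBh_solution T \<eta>0 u0 xs \<eta>h uh \<longleftrightarrow>
     semidiscrete_curve T xs \<eta>h uh \<and>
     is_L2_projection xs \<eta>0 (\<eta>h 0) \<and> is_elliptic_projection xs u0 (uh 0) \<and>
     (\<forall>t\<in>{0..T}.
        (\<forall>\<phi>\<in>S4 xs.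
           l2_inner (dt T \<eta>h t) \<phi> + l2_inner (dx (uh t)) \<phi>
             + 1/2 * l2_inner (dx (\<lambda>x. \<eta>h t x * uh t x)) \<phi> = 0) \<and>
        (\<forall>\<psi>\<in>S40 xs.
           a_form (dt T uh t) \<psi> + l2_inner (dx (\<eta>h t)) \<psi>
             + 3/2 * l2_inner (\<lambda>x. uh t x * dx (uh t) x) \<psi>
             + 1/2 * l2_inner (\<lambda>x. \<eta>h t x * dx (\<eta>h t) x) \<psi> = 0))"

end

theory Submission
  imports Defs
begin

text \<open>Both schemes are compared with the projections \<open>(P \<eta>, R\<^sub>h u)\<close> of the exact solution, not with the exact
  solution itself. The reason is that \<open>P\<close> and \<open>R\<^sub>h\<close> commute with \<open>\<partial>\<^sub>t\<close>, so that the differences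
  \<open>\<theta> = P \<eta> - \<eta>\<^sub>h\<close> and \<open>\<xi> = R\<^sub>h u - u\<^sub>h\<close> satisfy equations whose right-hand sides contain spatial terms only
  (lemma \<open>Y_derivative\<close>). Tested with \<open>\<theta>\<close> and \<open>\<xi>\<close> themselves, these equations express
  \<open>d/dt (\<parallel>\<theta>\<parallel>\<^sup>2 + \<parallel>\<xi>\<parallel>\<^sub>1\<^sup>2)\<close> through products in which \<open>\<theta>\<^sub>x\<close> occurs; but \<open>\<theta>\<^sub>x\<close> occurs only inside exact derivatives
  of quantities that vanish at both ends (lemma \<open>energy_estimate\<close>). The rest is bounded by
  \<open>\<parallel>\<theta>\<parallel>\<^sup>2 + \<parallel>\<xi>\<parallel>\<^sub>1\<^sup>2\<close> and by the squared \<open>H\<^sup>1\<close> errors of the two projections, which are \<open>O(h\<^sup>6)\<close>. Gronwall's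
  inequality yields \<open>\<parallel>\<theta>\<parallel>\<^sup>2 + \<parallel>\<xi>\<parallel>\<^sub>1\<^sup>2 \<le> C h\<^sup>6\<close>, which is third-order convergence.

  The projection errors come from approximation by splines. A continuous element of \<open>W\<^sub>\<infinity>\<^sup>4\<close> is three times
  continuously differentiable with Lipschitz third derivative (\<open>W_inf_4_regularity\<close>, by the lemma of
  du Bois-Reymond along the chain of weak derivatives). Its complete cubic spline interpolant, whose second
  derivative is the \<open>L\<^sup>2\<close> projection of \<open>v''\<close> onto broken lines, is accurate to order four in \<open>L\<^sup>2\<close> and three in
  \<open>H\<^sup>1\<close> (\<open>spline_approximation\<close>). Inverse inequalities, which are scaled estimates for cubics on single cells,
  transfer these orders to the \<open>H\<^sup>1\<close> error of \<open>P\<close> and give pointwise bounds (\<open>projection_bounds\<close>); here the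
  mesh is quasiuniform.

  The constant in the energy estimate involves the maximum of the discrete solution, which is not known
  beforehand. As long as \<open>\<parallel>\<theta>\<parallel>\<^sup>2 + \<parallel>\<xi>\<parallel>\<^sub>1\<^sup>2 \<le> h\<close>, the inverse inequality bounds that maximum; and for small \<open>h\<close> the
  resulting bound \<open>C h\<^sup>6\<close> is strictly smaller than \<open>h\<close>. Hence the assumption can never fail
  (\<open>continuation_bound\<close>, \<open>error_growth\<close>).

  In orthonormal coordinates the semidiscrete problem is a system of ordinary differential equations with
  quadratic right-hand side. With clipped coordinates it becomes globally Lipschitz and has a solution on
  \<open>[0, T]\<close> by Banach's fixed point theorem; the error bound shows that the clipping is never
  active (\<open>existence\<close>). For uniqueness, the coordinates of any semidiscrete solution are combinations of
  point values, hence differentiable and bounded, so that two solutions satisfy one common Lipschitz system.\<close>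

section \<open>Smooth functions and test functions\<close>

definition smooth_fun :: "(real \<Rightarrow> real) \<Rightarrow> bool" where
  "smooth_fun f \<longleftrightarrow> (\<forall>n x. ((deriv ^^ n) f) field_differentiable (at x))"

text \<open>Closure properties of smoothness follow by exhibiting a set of functions that contains a derivative of each of
  its members; no formula for the \<open>n\<close>-th derivative has to be found.\<close>
lemma smooth_fun_closed_set:
  assumes "f \<in> D" and D: "\<And>g. g \<in> D \<Longrightarrow> \<exists>g'\<in>D. \<forall>x. (g has_real_derivative g' x) (at x)"
  shows "smooth_fun f"
proof -
  have der: "deriv g \<in> D \<and> (\<forall>x. g field_differentiable (at x))" if g: "g \<in> D" for g
  proof -
    obtain g' where g': "g' \<in> D" "\<And>x. (g has_real_derivative g' x) (at x)" using D[OF g] by blast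
    then have "deriv g = g'" by (auto intro: DERIV_imp_deriv)
    with g' show ?thesis by (auto simp: field_differentiable_def)
  qed
  have "(deriv ^^ n) f \<in> D" for n
    by (induction n) (use assms(1) der in auto)
  then show ?thesis using der by (auto simp: smooth_fun_def)
qed

lemma smooth_fun_has_derivative:
  assumes "smooth_fun f" shows "(f has_real_derivative deriv f x) (at x)"
  using assms unfolding smooth_fun_def by (metis DERIV_deriv_iff_field_differentiable funpow_0)

lemma smooth_fun_continuous: "smooth_fun f \<Longrightarrow> continuous_on S f"
  by (meson DERIV_isCont continuous_at_imp_continuous_on smooth_fun_has_derivative)

lemma smooth_fun_deriv: assumes "smooth_fun f" shows "smooth_fun (deriv f)"
  unfolding smooth_fun_def
proof (intro allI)
  fix n x
  have "(deriv ^^ Suc n) f field_differentiable at x" using assms unfolding smooth_fun_def by blast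
  then show "(deriv ^^ n) (deriv f) field_differentiable at x" by (simp add: funpow_swap1)
qed

lemma smooth_fun_antideriv:
  assumes "\<And>x. (f has_real_derivative g x) (at x)" "smooth_fun g"
  shows "smooth_fun f"
proof -
  have "deriv f = g" using assms(1) by (auto intro: DERIV_imp_deriv)
  then show ?thesis
    using smooth_fun_closed_set[where D = "insert f {g. smooth_fun g}" and f = f] assms
      smooth_fun_has_derivative smooth_fun_deriv by (metis insertE insertI1 insertI2 mem_Collect_eq)
qed

lemma smooth_fun_add:
  assumes "smooth_fun f" "smooth_fun g" shows "smooth_fun (\<lambda>x. f x + g x)"
proof (rule smooth_fun_closed_set[where D = "{\<lambda>x. f x + g x | f g. smooth_fun f \<and> smooth_fun g}"])
  fix h assume "h \<in> {\<lambda>x. f x + g x | f g. smooth_fun f \<and> smooth_fun g}"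
  then obtain f g where h: "h = (\<lambda>x. f x + g x)" "smooth_fun f" "smooth_fun g" by auto
  show "\<exists>g'\<in>{\<lambda>x. f x + g x | f g. smooth_fun f \<and> smooth_fun g}. \<forall>x. (h has_real_derivative g' x) (at x)"
    by (rule bexI[where x = "\<lambda>x. deriv f x + deriv g x"])
       (use h in \<open>auto intro!: DERIV_add smooth_fun_has_derivative smooth_fun_deriv\<close>)
qed (use assms in auto)

lemma smooth_fun_affine:
  assumes "smooth_fun f" shows "smooth_fun (\<lambda>x. c * f (a * x + b))"
proof (rule smooth_fun_closed_set[where D = "{\<lambda>x. c * f (a * x + b) | c f. smooth_fun f}"])
  fix h assume "h \<in> {\<lambda>x. c * f (a * x + b) | c f. smooth_fun f}"
  then obtain c f where h: "h = (\<lambda>x. c * f (a * x + b))" "smooth_fun f" by auto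
  have "(h has_real_derivative (c * a) * deriv f (a * x + b)) (at x)" for x
    unfolding h(1)
    by (rule derivative_eq_intros DERIV_chain2[OF smooth_fun_has_derivative[OF h(2)]] refl | simp)+
  then show "\<exists>g'\<in>{\<lambda>x. c * f (a * x + b) | c f. smooth_fun f}. \<forall>x. (h has_real_derivative g' x) (at x)"
    by (intro bexI[where x = "\<lambda>x. (c * a) * deriv f (a * x + b)"])
       (use smooth_fun_deriv[OF h(2)] in auto)
qed (use assms in auto)

text \<open>Products of smooth functions are not closed under differentiation, but finite sums of such products are.\<close>
inductive_set sums_of_smooth_products :: "(real \<Rightarrow> real) set" where
  prod: "smooth_fun f \<Longrightarrow> smooth_fun g \<Longrightarrow> (\<lambda>x. f x * g x) \<in> sums_of_smooth_products"
| sum: "p \<in> sums_of_smooth_products \<Longrightarrow> q \<in> sums_of_smooth_products \<Longrightarrow>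
        (\<lambda>x. p x + q x) \<in> sums_of_smooth_products"

lemma smooth_fun_mult:
  assumes "smooth_fun f" "smooth_fun g" shows "smooth_fun (\<lambda>x. f x * g x)"
proof (rule smooth_fun_closed_set[where D = sums_of_smooth_products])
  fix h assume "h \<in> sums_of_smooth_products"
  then show "\<exists>g'\<in>sums_of_smooth_products. \<forall>x. (h has_real_derivative g' x) (at x)"
  proof induction
    case (prod f g)
    have "((\<lambda>x. f x * g x) has_real_derivative deriv f x * g x + f x * deriv g x) (at x)" for x
      by (rule derivative_eq_intros smooth_fun_has_derivative[OF prod(1)]
               smooth_fun_has_derivative[OF prod(2)] refl | simp)+
    then show ?case
      by (intro bexI[where x = "\<lambda>x. deriv f x * g x + f x * deriv g x"])
         (auto intro!: sums_of_smooth_products.intros smooth_fun_deriv prod)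
  next
    case (sum p q)
    then obtain p' q' where pq: "p' \<in> sums_of_smooth_products" "q' \<in> sums_of_smooth_products"
      "\<And>x. (p has_real_derivative p' x) (at x)" "\<And>x. (q has_real_derivative q' x) (at x)" by blast
    have "((\<lambda>x. p x + q x) has_real_derivative p' x + q' x) (at x)" for x
      by (intro DERIV_add pq)
    then show ?case
      by (intro bexI[where x = "\<lambda>x. p' x + q' x"]) (auto intro: sums_of_smooth_products.intros pq)
  qed
qed (use assms in \<open>auto intro: sums_of_smooth_products.prod\<close>)

text \<open>The functions \<open>p(1/x) exp(-1/x)\<close>, extended by zero to \<open>x \<le> 0\<close>. With all polynomials \<open>p\<close> admitted, this family
  is closed under differentiation, which proves that its members are smooth at \<open>0\<close>.\<close>
definition flat_exp :: "real poly \<Rightarrow> real \<Rightarrow> real" where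
  "flat_exp p x = (if x \<le> 0 then 0 else poly p (1 / x) * exp (- (1 / x)))"

lemma tendsto_poly_exp_neg: "((\<lambda>x. poly p x * exp (- x)) \<longlongrightarrow> 0) at_top" for p :: "real poly"
proof (induction p)
  case (pCons a p)
  have *: "((\<lambda>x::real. x ^ k * exp (- x)) \<longlongrightarrow> 0) at_top" for k
    using tendsto_power_div_exp_0[of k] by (simp add: exp_minus field_simps)
  have "((\<lambda>x. \<Sum>i\<le>degree (pCons a p). coeff (pCons a p) i * (x ^ i * exp (- x))) \<longlongrightarrow>
         (\<Sum>i\<le>degree (pCons a p). coeff (pCons a p) i * 0)) at_top"
    by (intro tendsto_sum tendsto_mult tendsto_const *)
  then show ?case by (simp add: poly_altdef sum_distrib_right mult.assoc del: pCons_0_0)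
qed auto

lemma flat_exp_has_derivative:
  "(flat_exp p has_real_derivative flat_exp ([:0,0,1:] * (p - pderiv p)) x) (at x)"
proof -
  consider "x < 0" | "x > 0" | "x = 0" by linarith
  then show ?thesis
  proof cases
    case 1
    have "((\<lambda>x. 0) has_real_derivative 0) (at x)" by simp
    then have "(flat_exp p has_real_derivative 0) (at x)"
      by (rule has_field_derivative_transform_within_open[of _ _ _ "{..<0}"])
         (use 1 in \<open>auto simp: flat_exp_def\<close>)
    then show ?thesis using 1 by (simp add: flat_exp_def)
  next
    case 2
    have "((\<lambda>x. poly p (1 / x) * exp (- (1 / x))) has_real_derivative
            (poly (pderiv p) (1 / x) * (- 1 / (x * x)) * exp (- (1/x)) +
             poly p (1 / x) * (exp (- (1 / x)) * (1 / (x * x))))) (at x)"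
      using 2 by (auto intro!: derivative_eq_intros simp: power2_eq_square divide_simps)
    then have "(flat_exp p has_real_derivative
            (poly (pderiv p) (1 / x) * (- 1 / (x * x)) * exp (- (1/x)) +
             poly p (1 / x) * (exp (- (1 / x)) * (1 / (x * x))))) (at x)"
      by (rule has_field_derivative_transform_within_open[of _ _ _ "{0<..}"])
         (use 2 in \<open>auto simp: flat_exp_def\<close>)
    then show ?thesis using 2 by (simp add: flat_exp_def algebra_simps)
  next
    case 3
    have right: "((\<lambda>h. flat_exp p h / h) \<longlongrightarrow> 0) (at_right 0)"
    proof -
      have "((\<lambda>x. poly (pCons 0 p) (inverse x) * exp (- (inverse x))) \<longlongrightarrow> 0) (at_right 0)"
        by (rule filterlim_compose[OF tendsto_poly_exp_neg filterlim_inverse_at_top_right])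
      then show ?thesis
        by (rule Lim_transform_eventually)
           (auto simp: eventually_at_right_field flat_exp_def field_simps intro!: exI[of _ 1])
    qed
    have left: "((\<lambda>h. flat_exp p h / h) \<longlongrightarrow> 0) (at_left 0)"
      by (rule Lim_transform_eventually[OF tendsto_const])
         (auto simp: eventually_at_left_field flat_exp_def intro!: exI[of _ "-1"])
    have "((\<lambda>h. (flat_exp p (0 + h) - flat_exp p 0) / h) \<longlongrightarrow> 0) (at 0)"
      using filterlim_split_at[OF left right] by (simp add: flat_exp_def)
    then show ?thesis using 3 by (simp add: DERIV_def flat_exp_def)
  qed
qed

lemma smooth_flat_exp: "smooth_fun (flat_exp p)"
  by (rule smooth_fun_closed_set[where D = "range flat_exp"]) (use flat_exp_has_derivative in blast)+

text \<open>Starting the integral at \<open>-1\<close> gives a primitive that is differentiable on both sides of \<open>0\<close>.\<close>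
lemma smooth_primitive:
  assumes sb: "smooth_fun b" and bz: "\<And>x. x \<le> 0 \<Longrightarrow> b x = 0"
  obtains B where "smooth_fun B" "\<And>x. (B has_real_derivative b x) (at x)"
    "\<And>x. x \<le> 0 \<Longrightarrow> B x = 0"
proof -
  have cb: "continuous_on S b" for S using sb by (rule smooth_fun_continuous)
  define B where "B = (\<lambda>x. integral {-1..x} b)"
  have Bd: "(B has_real_derivative b x) (at x)" if "x > -1" for x
  proof -
    have "(B has_real_derivative b x) (at x within {-1..x+1})"
      unfolding B_def using integral_has_real_derivative[of "-1" "x+1" b x] cb that by auto
    then show ?thesis using that by (simp add: at_within_Icc_at)
  qed
  have B0: "B x = 0" if "x \<le> 0" for x
    unfolding B_def by (subst integral_cong[where g = "\<lambda>_. 0"]) (use that bz in auto)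
  have dB: "(B has_real_derivative b x) (at x)" for x
  proof (cases "x > -1")
    case False
    have "((\<lambda>x. 0) has_real_derivative 0) (at x)" by simp
    then have "(B has_real_derivative 0) (at x)"
      by (rule has_field_derivative_transform_within_open[of _ _ _ "{..<0}"]) (use False B0 in auto)
    then show ?thesis using bz[of x] False by simp
  qed (rule Bd)
  show thesis
    by (rule that[OF smooth_fun_antideriv[OF dB sb] dB B0])
qed

text \<open>A smooth transition from 0 to 1: the normalised primitive of a bump on the unit interval.\<close>
lemma smooth_step_exists:
  obtains \<sigma> :: "real \<Rightarrow> real" where "smooth_fun \<sigma>" "\<And>x. x \<le> 0 \<Longrightarrow> \<sigma> x = 0" "\<And>x. x \<ge> 1 \<Longrightarrow> \<sigma> x = 1"
    "\<And>x. 0 \<le> \<sigma> x \<and> \<sigma> x \<le> 1"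
proof -
  define b where "b = (\<lambda>x. flat_exp 1 x * (1 * flat_exp 1 ((-1) * x + 1)))"
  have sb: "smooth_fun b"
    unfolding b_def by (intro smooth_fun_mult smooth_fun_affine smooth_flat_exp)
  have b0: "b x \<ge> 0" for x by (simp add: b_def flat_exp_def)
  have bz: "b x = 0" if "x \<le> 0 \<or> x \<ge> 1" for x using that by (auto simp: b_def flat_exp_def)
  obtain B where sB: "smooth_fun B" and Bd: "\<And>x. (B has_real_derivative b x) (at x)"
    and B0: "\<And>x. x \<le> 0 \<Longrightarrow> B x = 0"
    using smooth_primitive[OF sb] bz by blast
  have Bmono: "B x \<le> B y" if "x \<le> y" for x y
    by (rule DERIV_nonneg_imp_nondecreasing[OF that]) (use Bd b0 in blast)
  have Bc: "B x = B 1" if "x \<ge> 1" for x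
  proof -
    have "\<exists>c. \<forall>y\<in>{1..x}. B y = c"
      by (rule has_field_derivative_zero_constant)
         (use Bd bz in \<open>auto, metis has_field_derivative_at_within\<close>)
    then show ?thesis using that by force
  qed
  have "B 1 \<noteq> 0"
  proof
    assume "B 1 = 0"
    then have "B x = 0" if "x \<in> {0..1}" for x using Bmono[of 0 x] Bmono[of x 1] B0[of 0] that by auto
    then have "((\<lambda>x. 0) has_real_derivative b (1/2)) (at (1/2))"
      by (intro has_field_derivative_transform_within_open[OF Bd, of "{0<..<1}"]) auto
    then have "b (1/2) = 0" using DERIV_unique DERIV_const by blast
    then show False by (simp add: b_def flat_exp_def)
  qed
  then have Bp: "B 1 > 0" using Bmono[of 0 1] B0[of 0] by simp
  have "smooth_fun (\<lambda>x. 1 / B 1 * B (1 * x + 0))" using sB by (rule smooth_fun_affine)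
  then have "smooth_fun (\<lambda>x. B x / B 1)" by simp
  moreover have "B x / B 1 = 1" if "x \<ge> 1" for x using Bc[OF that] Bp by simp
  moreover have "B x / B 1 = 0" if "x \<le> 0" for x using B0[OF that] by simp
  moreover have "0 \<le> B x / B 1 \<and> B x / B 1 \<le> 1" for x
    using Bmono[of x 1] Bmono[of 0 x] B0[of x] B0[of 0] Bc[of x] Bp
    by (cases "x \<le> 0"; cases "x \<ge> 1") auto
  ultimately show thesis using that[of "\<lambda>x. B x / B 1"] by blast
qed

lemma test_function_iff:
  "test_function \<phi> \<longleftrightarrow> smooth_fun \<phi> \<and>
     (\<exists>a b. 0 < a \<and> a < b \<and> b < 1 \<and> (\<forall>x. x \<notin> {a..b} \<longrightarrow> \<phi> x = 0))"
  by (simp add: test_function_def smooth_fun_def)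

lemma test_function_deriv:
  assumes "test_function \<phi>" shows "test_function (deriv \<phi>)"
proof -
  obtain a b where ab: "0 < a" "a < b" "b < 1" and z: "\<And>x. x \<notin> {a..b} \<Longrightarrow> \<phi> x = 0"
    and s: "smooth_fun \<phi>" using assms by (auto simp: test_function_iff)
  have "deriv \<phi> x = 0" if "x \<notin> {a..b}" for x
  proof -
    have "((\<lambda>x. 0) has_real_derivative 0) (at x)" by simp
    then have "(\<phi> has_real_derivative 0) (at x)"
      by (rule has_field_derivative_transform_within_open[of _ _ _ "- {a..b}"])
         (use that z in \<open>auto simp del: not_le atLeastAtMost_iff intro: open_Compl closed_atLeastAtMost\<close>)
    then show ?thesis by (rule DERIV_imp_deriv)
  qed
  then show ?thesis using ab s smooth_fun_deriv by (auto simp: test_function_iff)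
qed

text \<open>Differences of two smooth steps, one rising just to the right of \<open>a\<close> and one just to the left of \<open>b\<close>, with
  slopes of order \<open>K n\<close>. The summand \<open>1 / (b - a)\<close> in \<open>K n\<close> keeps the two transitions from overlapping.\<close>
lemma indicator_approximation:
  assumes "0 < a" "a < b" "b < (1::real)"
  obtains \<psi> :: "nat \<Rightarrow> real \<Rightarrow> real" where "\<And>n. test_function (\<psi> n)"
    "\<And>n x. x \<notin> {a..b} \<Longrightarrow> \<psi> n x = 0" "\<And>n x. \<bar>\<psi> n x\<bar> \<le> 1"
    "\<And>x. (\<lambda>n. \<psi> n x) \<longlonglongrightarrow> indicator {a<..<b} x"
proof -
  obtain \<sigma> :: "real \<Rightarrow> real" where \<sigma>: "smooth_fun \<sigma>" "\<And>x. x \<le> 0 \<Longrightarrow> \<sigma> x = 0"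
    "\<And>x. x \<ge> 1 \<Longrightarrow> \<sigma> x = 1" "\<And>x. 0 \<le> \<sigma> x \<and> \<sigma> x \<le> 1" using smooth_step_exists by blast
  define K where "K n = real n + 1 / (b - a)" for n
  have K: "K n * (b - a) \<ge> 1" "K n > 0" "K n \<ge> real n" for n
  proof -
    have p: "1 / (b - a) > 0" using assms by simp
    have "K n * (b - a) = real n * (b - a) + 1" using assms by (simp add: K_def distrib_right)
    then show "K n * (b - a) \<ge> 1" using assms by simp
    show "K n > 0" "K n \<ge> real n" using p by (auto simp: K_def add_nonneg_pos)
  qed
  define \<psi> where "\<psi> n x = 1 * \<sigma> (K n * x + (- K n * a)) + (- 1) * \<sigma> (K n * x + (1 - K n * b))" for n x
  have sm: "smooth_fun (\<psi> n)" for n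
    unfolding \<psi>_def[abs_def] by (intro smooth_fun_add smooth_fun_affine \<sigma>)
  have left: "\<psi> n x = 0" if "x \<le> a" for n x
  proof -
    have "K n * x \<le> K n * a" using K(2)[of n] that by simp
    then show ?thesis using K(1)[of n] by (simp add: \<psi>_def \<sigma>(2) algebra_simps)
  qed
  have right: "\<psi> n x = 0" if "x \<ge> b" for n x
  proof -
    have "K n * x \<ge> K n * b" using K(2)[of n] that by simp
    then show ?thesis using K(1)[of n] by (simp add: \<psi>_def \<sigma>(3) algebra_simps)
  qed
  have z: "\<psi> n x = 0" if "x \<notin> {a..b}" for n x using that left right by (meson atLeastAtMost_iff linear)
  have bd: "\<bar>\<psi> n x\<bar> \<le> 1" for n x
    using \<sigma>(4)[of "K n * x + (- K n * a)"] \<sigma>(4)[of "K n * x + (1 - K n * b)"] by (simp add: \<psi>_def abs_le_iff)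
  have lim: "(\<lambda>n. \<psi> n x) \<longlonglongrightarrow> indicator {a<..<b} x" for x
  proof (cases "x \<in> {a<..<b}")
    case False
    then have "\<psi> n x = 0" for n using left right by (meson greaterThanLessThan_iff not_le)
    with False show ?thesis by simp
  next
    case True
    obtain m where m: "real m \<ge> 1 / (x - a)" "real m \<ge> 1 / (b - x)"
      using real_arch_simple[of "max (1 / (x - a)) (1 / (b - x))"] by auto
    have "\<psi> n x = 1" if "n \<ge> m" for n
    proof -
      have "K n \<ge> 1 / (x - a)" "K n \<ge> 1 / (b - x)" using K(3)[of n] m that by (auto intro: order_trans)
      then have "K n * (x - a) \<ge> 1" "K n * (b - x) \<ge> 1" using True by (auto simp: divide_simps mult.commute)
      then show ?thesis by (simp add: \<psi>_def \<sigma>(2) \<sigma>(3) algebra_simps)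
    qed
    then have "eventually (\<lambda>n. \<psi> n x = 1) sequentially" by (auto simp: eventually_sequentially)
    then show ?thesis using True by (simp add: tendsto_eventually)
  qed
  have "test_function (\<psi> n)" for n using sm z assms unfolding test_function_iff by blast
  then show thesis using that z bd lim by blast
qed

section \<open>Bounded measurable functions and weak derivatives\<close>

definition bdd_meas :: "(real \<Rightarrow> real) \<Rightarrow> bool" where
  "bdd_meas f \<longleftrightarrow> f \<in> borel_measurable (lebesgue_on {0..1}) \<and> (\<exists>M. \<forall>x\<in>{0..1}. \<bar>f x\<bar> \<le> M)"

lemma bdd_meas_continuous: assumes "continuous_on {0..1} f" shows "bdd_meas f"
proof -
  have "bounded (f ` {0..1})" using assms by (intro compact_imp_bounded compact_continuous_image) auto
  then show ?thesis using assms
    by (auto simp: bdd_meas_def bounded_iff intro: continuous_imp_measurable_on_sets_lebesgue)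
qed

lemma bdd_meas_mult: assumes "bdd_meas f" "bdd_meas g" shows "bdd_meas (\<lambda>x. f x * g x)"
proof -
  obtain M N where "\<And>x. x \<in> {0..1} \<Longrightarrow> \<bar>f x\<bar> \<le> M" "\<And>x. x \<in> {0..1} \<Longrightarrow> \<bar>g x\<bar> \<le> N"
    using assms unfolding bdd_meas_def by blast
  then have "\<forall>x\<in>{0..1}. \<bar>f x * g x\<bar> \<le> M * N" by (auto simp: abs_mult intro!: mult_mono')
  then show ?thesis using assms by (auto simp: bdd_meas_def)
qed

lemma bdd_meas_add: assumes "bdd_meas f" "bdd_meas g" shows "bdd_meas (\<lambda>x. f x + g x)"
proof -
  obtain M N where "\<And>x. x \<in> {0..1} \<Longrightarrow> \<bar>f x\<bar> \<le> M" "\<And>x. x \<in> {0..1} \<Longrightarrow> \<bar>g x\<bar> \<le> N"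
    using assms unfolding bdd_meas_def by blast
  then have "\<forall>x\<in>{0..1}. \<bar>f x + g x\<bar> \<le> M + N" by (meson abs_triangle_ineq add_mono order_trans)
  then show ?thesis using assms by (auto simp: bdd_meas_def)
qed

lemma bdd_meas_const: "bdd_meas (\<lambda>x. c)" by (intro bdd_meas_continuous continuous_intros)

lemma bdd_meas_diff: "bdd_meas f \<Longrightarrow> bdd_meas g \<Longrightarrow> bdd_meas (\<lambda>x. f x - g x)"
  using bdd_meas_add[of f "\<lambda>x. (-1) * g x"] bdd_meas_mult[OF bdd_meas_const] by fastforce

lemma bdd_meas_integrable:
  assumes "bdd_meas f" "0 \<le> a" "b \<le> 1"
  shows "f absolutely_integrable_on {a..b}" "f integrable_on {a..b}"
proof -
  obtain M where M: "\<And>x. x \<in> {0..1} \<Longrightarrow> \<bar>f x\<bar> \<le> M" using assms unfolding bdd_meas_def by blast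
  have "f \<in> borel_measurable (lebesgue_on {a..b})"
    using assms(1) by (rule_tac measurable_restrict_mono[of _ _ "{0..1}"]) (use assms in \<open>auto simp: bdd_meas_def\<close>)
  then show "f absolutely_integrable_on {a..b}"
    by (rule measurable_bounded_by_integrable_imp_absolutely_integrable[where g = "\<lambda>_. M"])
       (use M assms in auto)
  then show "f integrable_on {a..b}" using absolutely_integrable_on_def by blast
qed

lemma bdd_meas_LINT:
  assumes "bdd_meas f"
  shows "integrable I01 f" "(LINT x|I01. f x) = integral {0..1} f"
proof -
  have "f absolutely_integrable_on {0<..<1}"
    by (rule set_integrable_subset[OF bdd_meas_integrable(1)[OF assms, of 0 1]]) auto
  then show "integrable I01 f" by (rule absolutely_integrable_imp_integrable) auto
  then show "(LINT x|I01. f x) = integral {0..1} f"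
    by (subst lebesgue_integral_eq_integral) (auto simp: integral_open_interval_real)
qed

lemma test_function_bdd_meas: "test_function \<phi> \<Longrightarrow> bdd_meas \<phi>"
  by (auto simp: test_function_iff intro!: bdd_meas_continuous smooth_fun_continuous)

text \<open>An integrable function with vanishing integral over every half-line is zero: the measures with
  densities \<open>g\<^sup>+\<close> and \<open>g\<^sup>-\<close> agree on half-lines, hence everywhere.\<close>
lemma AE_zero_if_tail_integrals_zero:
  fixes g :: "real \<Rightarrow> real"
  assumes g: "integrable lebesgue g" and z: "\<And>c. (LINT x|lebesgue. indicator {c<..} x * g x) = 0"
  shows "AE x in lebesgue. g x = 0"
proof -
  obtain f where f[measurable]: "f \<in> borel_measurable lborel" and fg: "AE x in lborel. g x = f x"
    using completion_ex_borel_measurable_real[OF borel_measurable_integrable[OF g]] by blast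
  have fg': "AE x in lebesgue. g x = f x" using fg by (rule AE_completion)
  have f'[measurable]: "f \<in> borel_measurable lebesgue" using f by (simp add: measurable_completion)
  have "integrable lebesgue f"
    using integrable_cong_AE[OF borel_measurable_integrable[OF g] f' fg'] g by blast
  then have fi: "integrable lborel f" by (simp add: integrable_completion)
  have fz: "(LINT x|lborel. indicator {c<..} x * f x) = 0" for c
  proof -
    have "(LINT x|lborel. indicator {c<..} x * f x) = (LINT x|lebesgue. indicator {c<..} x * f x)"
      by (rule integral_completion[symmetric]) auto
    also have "\<dots> = (LINT x|lebesgue. indicator {c<..} x * g x)"
    proof (rule integral_cong_AE)
      have [measurable]: "g \<in> borel_measurable lebesgue" using g by blast
      show "(\<lambda>x. indicator {c<..} x * f x) \<in> borel_measurable lebesgue"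
        "(\<lambda>x. indicator {c<..} x * g x) \<in> borel_measurable lebesgue"
        by (intro borel_measurable_times borel_measurable_indicator; simp)+
    qed (use fg' in auto)
    finally show ?thesis using z by simp
  qed
  let ?P = "\<lambda>x. max 0 (f x)" and ?N = "\<lambda>x. max 0 (- f x)"
  have PN: "integrable lborel ?P" "integrable lborel ?N" using fi by auto
  have PI: "integrable lborel (\<lambda>x. indicator {c<..} x * ?P x)" "integrable lborel (\<lambda>x. indicator {c<..} x * ?N x)" for c
    using PN by (auto intro: integrable_real_mult_indicator simp: mult.commute[of "indicator _ _"])
  have ev: "emeasure (density lborel (\<lambda>x. ennreal (h x))) {c<..} = ennreal (LINT x|lborel. indicator {c<..} x * h x)"
    if "integrable lborel (\<lambda>x. indicator {c<..} x * h x)" "h \<in> borel_measurable lborel" "\<And>x. h x \<ge> 0" for h and c :: real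
  proof -
    have "emeasure (density lborel (\<lambda>x. ennreal (h x))) {c<..} = (\<integral>\<^sup>+x. ennreal (indicator {c<..} x * h x) \<partial>lborel)"
    proof (subst emeasure_density)
      show "(\<integral>\<^sup>+x. ennreal (h x) * indicator {c<..} x \<partial>lborel) = (\<integral>\<^sup>+x. ennreal (indicator {c<..} x * h x) \<partial>lborel)"
        by (intro nn_integral_cong) (simp add: indicator_def)
    qed (use that in \<open>simp_all\<close>)
    also have "\<dots> = ennreal (LINT x|lborel. indicator {c<..} x * h x)"
      by (rule nn_integral_eq_integral) (use that in auto)
    finally show ?thesis .
  qed
  have "density lborel (\<lambda>x. ennreal (?P x)) = density lborel (\<lambda>x. ennreal (?N x))"
  proof (rule measure_eqI_lessThan)
    fix c
    have "(LINT x|lborel. indicator {c<..} x * ?P x) - (LINT x|lborel. indicator {c<..} x * ?N x)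
       = (LINT x|lborel. indicator {c<..} x * f x)"
      unfolding Bochner_Integration.integral_diff[OF PI, symmetric]
      by (rule Bochner_Integration.integral_cong) (auto simp: indicator_def max_def)
    then have "(LINT x|lborel. indicator {c<..} x * ?P x) = (LINT x|lborel. indicator {c<..} x * ?N x)"
      using fz[of c] by simp
    then show "emeasure (density lborel (\<lambda>x. ennreal (?P x))) {c<..} = emeasure (density lborel (\<lambda>x. ennreal (?N x))) {c<..}"
      using ev[OF PI(1)] ev[OF PI(2)] by auto
    show "emeasure (density lborel (\<lambda>x. ennreal (?P x))) {c<..} < \<infinity>" using ev[OF PI(1)] by auto
  qed auto
  then have "AE x in lborel. ennreal (?P x) = ennreal (?N x)"
    using sigma_finite_measure.density_unique_iff[OF sigma_finite_lborel, of "\<lambda>x. ennreal (?P x)" "\<lambda>x. ennreal (?N x)"] by auto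
  then have "AE x in lborel. f x = 0"
    by eventually_elim (auto simp: max_def split: if_splits)
  then show ?thesis using AE_completion fg' by fastforce
qed

text \<open>Extension by zero turns the integrals over \<open>[c, b]\<close> into integrals over half-lines.\<close>
lemma AE_zero_if_interval_integrals_zero:
  fixes h :: "real \<Rightarrow> real"
  assumes "h absolutely_integrable_on {a..b}" and z: "\<And>c. a \<le> c \<Longrightarrow> c < b \<Longrightarrow> integral {c..b} h = 0"
  shows "AE x in lebesgue. x \<in> {a..b} \<longrightarrow> h x = 0"
proof -
  let ?g = "\<lambda>x. indicator {a..b} x * h x"
  have gi: "integrable lebesgue ?g" using assms(1) by (simp add: set_integrable_def)
  have "(LINT x|lebesgue. indicator {c<..} x * ?g x) = 0" for c
  proof (cases "c < b")
    case False
    then have "(\<lambda>x. indicator {c<..} x * ?g x) = (\<lambda>x. 0)" by (auto simp: indicator_def fun_eq_iff)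
    then show ?thesis by (simp only: integral_zero)
  next
    case True
    have hi: "h absolutely_integrable_on {max a c..b}"
      by (rule set_integrable_subset[OF assms(1)]) auto
    have "(LINT x|lebesgue. indicator {c<..} x * ?g x) = (LINT x:{max a c..b}|lebesgue. h x)"
      unfolding set_lebesgue_integral_def
    proof (rule integral_cong_AE)
      have "AE x in lebesgue. x \<noteq> c" by (rule AE_I'[of "{c}"]) auto
      then show "AE x in lebesgue. indicator {c<..} x * ?g x = indicator {max a c..b} x *\<^sub>R h x"
        by eventually_elim (auto simp: indicator_def)
      show "(\<lambda>x. indicator {c<..} x * ?g x) \<in> borel_measurable lebesgue"
        by (intro borel_measurable_times[of "indicator {c<..}"] borel_measurable_integrable[OF gi]
            borel_measurable_indicator) simp
      show "(\<lambda>x. indicator {max a c..b} x *\<^sub>R h x) \<in> borel_measurable lebesgue"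
        using hi by (auto simp: set_integrable_def)
    qed
    also have "\<dots> = integral {max a c..b} h" by (rule set_lebesgue_integral_eq_integral(2)[OF hi])
    also have "\<dots> = 0"
      using z[of "max a c"] integral_null[of "max a c" b h]
      by (cases "max a c < b") (auto simp: content_real_if)
    finally show ?thesis .
  qed
  from AE_zero_if_tail_integrals_zero[OF gi this]
  show ?thesis by eventually_elim (auto simp: indicator_def)
qed

text \<open>The fundamental lemma of the calculus of variations on the unit interval. Test functions approximate
  indicators of compact subintervals boundedly, so the integral of \<open>f\<close> over each such interval vanishes.\<close>
lemma AE_zero_if_orthogonal_to_test_functions:
  assumes f: "loc_integrable f" and z: "\<And>\<phi>. test_function \<phi> \<Longrightarrow> (LINT x|I01. f x * \<phi> x) = 0"
  shows "AE x in I01. f x = 0"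
proof -
  have I0: "integral {a..b} f = 0" if ab: "0 < a" "a < b" "b < 1" for a b
  proof -
    obtain \<psi> :: "nat \<Rightarrow> real \<Rightarrow> real" where \<psi>: "\<And>n. test_function (\<psi> n)"
      "\<And>n x. x \<notin> {a..b} \<Longrightarrow> \<psi> n x = 0" "\<And>n x. \<bar>\<psi> n x\<bar> \<le> 1"
      "\<And>x. (\<lambda>n. \<psi> n x) \<longlonglongrightarrow> indicator {a<..<b} x" using indicator_approximation[OF ab] by blast
    have fi: "f absolutely_integrable_on {a..b}" using f ab by (auto simp: loc_integrable_def)
    have fpi: "(\<lambda>x. f x * \<psi> n x) absolutely_integrable_on {a..b}" for n
    proof -
      have c: "continuous_on {a..b} (\<psi> n)" using \<psi>(1)[of n] by (auto simp: test_function_iff smooth_fun_continuous)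
      have "(\<lambda>x. \<psi> n x *\<^sub>R f x) absolutely_integrable_on {a..b}"
        using absolutely_integrable_bounded_measurable_product_real[OF continuous_imp_measurable_on_sets_lebesgue[OF c] _ _ fi]
          boundedI[of "\<psi> n ` {a..b}" 1] \<psi>(3) by auto
      then show ?thesis by (simp add: mult.commute)
    qed
    have "integral {a..b} (\<lambda>x. f x * \<psi> n x) = 0" for n
    proof -
      have "integral {a..b} (\<lambda>x. f x * \<psi> n x) = (LINT x:{a..b}|lebesgue. f x * \<psi> n x)"
        by (rule set_lebesgue_integral_eq_integral(2)[OF fpi, symmetric])
      also have "\<dots> = (LINT x|I01. f x * \<psi> n x)"
        unfolding set_lebesgue_integral_def
      proof (subst integral_restrict_space)
        have "indicator {a..b} x *\<^sub>R (f x * \<psi> n x) = indicator {0<..<1} x *\<^sub>R (f x * \<psi> n x)" for x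
          using \<psi>(2)[of x n] ab by (cases "x \<in> {a..b}") (auto simp: indicator_def)
        then show "(LINT x|lebesgue. indicator {a..b} x *\<^sub>R (f x * \<psi> n x)) = (LINT x|lebesgue. indicator {0<..<1} x *\<^sub>R (f x * \<psi> n x))"
          by presburger
      qed auto
      finally show ?thesis using z[OF \<psi>(1)] by simp
    qed
    moreover have "(\<lambda>n. integral {a..b} (\<lambda>x. f x * \<psi> n x)) \<longlonglongrightarrow> integral {a..b} (\<lambda>x. f x * indicator {a<..<b} x)"
    proof (rule dominated_convergence(2)[where h = "\<lambda>x. \<bar>f x\<bar>"])
      show "(\<lambda>x. f x * \<psi> n x) integrable_on {a..b}" for n
        using fpi absolutely_integrable_on_def by blast
      show "(\<lambda>x. \<bar>f x\<bar>) integrable_on {a..b}" using fi by (auto simp: absolutely_integrable_on_def)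
      show "norm (f x * \<psi> n x) \<le> \<bar>f x\<bar>" for n x using \<psi>(3)[of n x] by (simp add: abs_mult mult_left_le)
    qed (intro tendsto_intros \<psi>)
    ultimately have "integral {a..b} (\<lambda>x. f x * indicator {a<..<b} x) = 0"
      by (simp add: LIMSEQ_const_iff)
    moreover have "integral {a..b} (\<lambda>x. f x * indicator {a<..<b} x) = integral {a..b} f"
      by (rule integral_spike[of "{a,b}"]) auto
    ultimately show ?thesis by simp
  qed
  \<comment> \<open>Local integrability gives no control up to the boundary, so the open interval is exhausted by compact ones;
    the shift by 3 makes the first of them nondegenerate.\<close>
  have "AE x in lebesgue. x \<in> {1 / (real n + 3)..1 - 1 / (real n + 3)} \<longrightarrow> f x = 0" for n
  proof (rule AE_zero_if_interval_integrals_zero)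
    have p: "0 < 1 / (real n + 3)" "1 / (real n + 3) < 1 - 1 / (real n + 3)" "1 - 1 / (real n + 3) < 1"
      by (auto simp: divide_simps)
    show "f absolutely_integrable_on {1 / (real n + 3)..1 - 1 / (real n + 3)}"
      using f p by (auto simp: loc_integrable_def)
    show "integral {c..1 - 1 / (real n + 3)} f = 0" if "1 / (real n + 3) \<le> c" "c < 1 - 1 / (real n + 3)" for c
      by (rule I0[OF less_le_trans[OF p(1) that(1)] that(2) p(3)])
  qed
  then have "AE x in lebesgue. \<forall>n. x \<in> {1 / (real n + 3)..1 - 1 / (real n + 3)} \<longrightarrow> f x = 0"
    by (subst AE_all_countable) blast
  then have "AE x in lebesgue. x \<in> {0<..<1} \<longrightarrow> f x = 0"
  proof eventually_elim
    case (elim x)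
    show ?case
    proof
      assume x: "x \<in> {0<..<1}"
      obtain n where n: "real n \<ge> max (1 / x) (1 / (1 - x))" using real_arch_simple by blast
      then have "1 \<le> real n * x" "1 \<le> real n * (1 - x)" using x by (auto simp: divide_simps mult.commute)
      then have "1 / (real n + 3) \<le> x" "1 / (real n + 3) \<le> 1 - x" using x
        by (auto simp: divide_simps algebra_simps)
      then show "f x = 0" using elim by (auto simp: algebra_simps)
    qed
  qed
  then show ?thesis by (subst AE_restrict_space_iff) auto
qed

lemma loc_integrable_times_test:
  assumes "loc_integrable f" "test_function \<phi>" shows "integrable I01 (\<lambda>x. f x * \<phi> x)"
proof -
  obtain a b where ab: "0 < a" "a < b" "b < 1" and z: "\<And>x. x \<notin> {a..b} \<Longrightarrow> \<phi> x = 0"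
    and s: "smooth_fun \<phi>" using assms by (auto simp: test_function_iff)
  have c: "continuous_on {a..b} \<phi>" using s by (rule smooth_fun_continuous)
  then have "bounded (\<phi> ` {a..b})" by (intro compact_imp_bounded compact_continuous_image) auto
  moreover have "f absolutely_integrable_on {a..b}" using assms ab by (auto simp: loc_integrable_def)
  ultimately have "(\<lambda>x. \<phi> x *\<^sub>R f x) absolutely_integrable_on {a..b}"
    using absolutely_integrable_bounded_measurable_product_real[OF continuous_imp_measurable_on_sets_lebesgue[OF c]]
    by auto
  then have "integrable lebesgue (\<lambda>x. indicator {a..b} x * (\<phi> x * f x))" by (simp add: set_integrable_def)
  also have "(\<lambda>x. indicator {a..b} x * (\<phi> x * f x)) = (\<lambda>x. indicator {0<..<1} x *\<^sub>R (f x * \<phi> x))"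
    using z ab by (auto simp: indicator_def fun_eq_iff)
  finally show ?thesis by (simp add: integrable_restrict_space)
qed

lemma has_weak_deriv_unique:
  assumes "has_weak_deriv k v g" "has_weak_deriv k v g'"
  shows "AE x in I01. g x = g' x"
proof -
  have li: "loc_integrable g" "loc_integrable g'" using assms by (auto simp: has_weak_deriv_def)
  have "AE x in I01. g x - g' x = 0"
  proof (rule AE_zero_if_orthogonal_to_test_functions)
    show "loc_integrable (\<lambda>x. g x - g' x)" using li by (auto simp: loc_integrable_def)
    fix \<phi> assume t: "test_function \<phi>"
    then have "(-1) ^ k * (LINT x|I01. g x * \<phi> x) = (-1) ^ k * (LINT x|I01. g' x * \<phi> x)"
      using assms by (simp add: has_weak_deriv_def)
    then show "(LINT x|I01. (g x - g' x) * \<phi> x) = 0"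
      using loc_integrable_times_test[OF li(1) t] loc_integrable_times_test[OF li(2) t]
      by (simp add: left_diff_distrib)
  qed
  then show ?thesis by simp
qed

lemma weak_deriv_AE:
  assumes "has_weak_deriv k v g" shows "AE x in I01. weak_deriv k v x = g x"
  by (rule has_weak_deriv_unique[OF _ assms]) (auto simp: weak_deriv_def intro: someI[of "has_weak_deriv k v"] assms)

lemma bdd_meas_loc_integrable: "bdd_meas f \<Longrightarrow> loc_integrable f"
  by (auto simp: loc_integrable_def intro!: bdd_meas_integrable)

text \<open>Continuous differentiability on the closed interval. The derivative is an argument, so that chains such as
  \<open>C1 v v1\<close>, \<open>C1 v1 v2\<close> express higher regularity.\<close>
definition C1 :: "(real \<Rightarrow> real) \<Rightarrow> (real \<Rightarrow> real) \<Rightarrow> bool" where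
  "C1 f f' \<longleftrightarrow> (\<forall>x\<in>{0..1}. (f has_real_derivative f' x) (at x within {0..1})) \<and> continuous_on {0..1} f'"

lemma C1_continuous: "C1 f f' \<Longrightarrow> continuous_on {0..1} f" "C1 f f' \<Longrightarrow> continuous_on {0..1} f'"
  by (auto simp: C1_def intro!: DERIV_continuous_on)

lemma C1_integral: assumes "C1 f f'" shows "integral {0..1} f' = f 1 - f 0"
  using assms by (intro integral_unique fundamental_theorem_of_calculus)
    (auto simp: C1_def has_real_derivative_iff_has_vector_derivative)

lemma C1_mult: "C1 f f' \<Longrightarrow> C1 g g' \<Longrightarrow> C1 (\<lambda>x. f x * g x) (\<lambda>x. f' x * g x + f x * g' x)"
  using C1_continuous[of f f'] C1_continuous[of g g'] unfolding C1_def
  by (auto intro!: derivative_eq_intros continuous_intros)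

lemma test_function_C1: "test_function \<phi> \<Longrightarrow> C1 \<phi> (deriv \<phi>)"
  by (auto simp: C1_def test_function_iff intro!: smooth_fun_continuous smooth_fun_deriv
      has_field_derivative_at_within smooth_fun_has_derivative)

lemma has_weak_deriv_C1: assumes "C1 f f'" shows "has_weak_deriv 1 f f'"
  unfolding has_weak_deriv_def
proof (intro conjI allI impI)
  note b = bdd_meas_continuous[OF C1_continuous(1)[OF assms]] bdd_meas_continuous[OF C1_continuous(2)[OF assms]]
  show "loc_integrable f" "loc_integrable f'" using b by (auto intro: bdd_meas_loc_integrable)
  fix \<phi> assume t: "test_function \<phi>"
  then have z: "\<phi> 0 = 0" "\<phi> 1 = 0" by (auto simp: test_function_iff)
  from C1_integral[OF C1_mult[OF assms test_function_C1[OF t]]] z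
  have "integral {0..1} (\<lambda>x. f' x * \<phi> x + f x * deriv \<phi> x) = 0" by simp
  moreover note p = bdd_meas_mult[OF b(2) test_function_bdd_meas[OF t]]
    bdd_meas_mult[OF b(1) test_function_bdd_meas[OF test_function_deriv[OF t]]]
  ultimately show "(LINT x|I01. f x * (deriv ^^ 1) \<phi> x) = (- 1) ^ 1 * (LINT x|I01. f' x * \<phi> x)"
    using bdd_meas_LINT(2)[OF p(1)] bdd_meas_LINT(2)[OF p(2)] bdd_meas_integrable(2)[OF p(1), of 0 1]
      bdd_meas_integrable(2)[OF p(2), of 0 1]
    by (simp add: Henstock_Kurzweil_Integration.integral_add)
qed

lemma weak_deriv_C1: "C1 f f' \<Longrightarrow> AE x in I01. weak_deriv 1 f x = f' x"
  by (rule weak_deriv_AE[OF has_weak_deriv_C1])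

text \<open>Integration by parts against a merely bounded measurable \<open>g\<close>. The defect of the identity on
  \<open>[0,x]\<close> changes by \<open>O(|x-y|\<^sup>2)\<close> between \<open>x\<close> and \<open>y\<close>, so its derivative vanishes even where
  the primitive of \<open>g\<close> is not differentiable.\<close>
lemma integral_by_parts_bdd_meas:
  assumes g: "bdd_meas g" and \<phi>: "C1 \<phi> \<phi>'" and z: "\<phi> 1 = 0"
  shows "integral {0..1} (\<lambda>x. integral {0..x} g * \<phi>' x) = - integral {0..1} (\<lambda>x. g x * \<phi> x)"
proof -
  define G where "G = (\<lambda>x. integral {0..x} g)"
  note gi = bdd_meas_integrable(2)[OF g]
  obtain M where M: "\<And>x. x \<in> {0..1} \<Longrightarrow> \<bar>g x\<bar> \<le> M" using g unfolding bdd_meas_def by blast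
  have M0: "M \<ge> 0" using M[of 0] by auto
  note c\<phi> = C1_continuous[OF \<phi>]
  have "bounded (\<phi>' ` {0..1})" using c\<phi> by (intro compact_imp_bounded compact_continuous_image) auto
  then obtain K where K: "\<And>x. x \<in> {0..1} \<Longrightarrow> \<bar>\<phi>' x\<bar> \<le> K"
    unfolding bounded_iff by (metis image_eqI real_norm_def)
  have cG: "continuous_on {0..1} G" unfolding G_def
    by (rule indefinite_integral_continuous_1) (use gi in auto)
  have b1: "bdd_meas (\<lambda>x. g x * \<phi> x)" by (intro bdd_meas_mult g bdd_meas_continuous c\<phi>)
  have b2: "bdd_meas (\<lambda>x. G x * \<phi>' x)" by (intro bdd_meas_mult bdd_meas_continuous cG c\<phi>)
  define H where "H x = G x * \<phi> x - integral {0..x} (\<lambda>y. g y * \<phi> y) - integral {0..x} (\<lambda>y. G y * \<phi>' y)" for x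
  have Gdiff: "\<bar>G y - G x\<bar> \<le> M * (y - x)" if "0 \<le> x" "x \<le> y" "y \<le> 1" for x y
  proof -
    have "G y - G x = integral {x..y} g" unfolding G_def
      using Henstock_Kurzweil_Integration.integral_combine[of 0 x y g] that gi by auto
    moreover have "norm (integral {x..y} g) \<le> integral {x..y} (\<lambda>_. M)"
      by (rule integral_norm_bound_integral) (use that gi M in auto)
    ultimately show ?thesis using that by (simp add: mult.commute)
  qed
  have \<phi>int: "(\<phi>' has_integral (\<phi> y - \<phi> x)) {x..y}" if "0 \<le> x" "x \<le> y" "y \<le> 1" for x y
  proof (rule fundamental_theorem_of_calculus)
    fix t assume "t \<in> {x..y}"
    with \<phi> that have "(\<phi> has_vector_derivative \<phi>' t) (at t within {0..1})"
      by (auto simp: C1_def has_real_derivative_iff_has_vector_derivative)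
    then show "(\<phi> has_vector_derivative \<phi>' t) (at t within {x..y})"
      by (rule has_vector_derivative_within_subset) (use that in auto)
  qed (use that in auto)
  have \<phi>diff: "\<bar>\<phi> y - \<phi> x\<bar> \<le> K * (y - x)" if "0 \<le> x" "x \<le> y" "y \<le> 1" for x y
  proof -
    have "norm (integral {x..y} \<phi>') \<le> integral {x..y} (\<lambda>_. K)"
      by (rule integral_norm_bound_integral) (use that \<phi>int[OF that] K in auto)
    then show ?thesis using that integral_unique[OF \<phi>int[OF that]] by (simp add: mult.commute)
  qed
  have Hdiff: "\<bar>H y - H x\<bar> \<le> 2 * M * K * (y - x)\<^sup>2" if xy: "0 \<le> x" "x \<le> y" "y \<le> 1" for x y
  proof -
    have sub: "{x..y} \<subseteq> {0..1}" using xy by auto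
    have i1: "(\<lambda>t. g t * \<phi> t) integrable_on {x..y}" "(\<lambda>t. G t * \<phi>' t) integrable_on {x..y}"
      using bdd_meas_integrable(2)[OF b1] bdd_meas_integrable(2)[OF b2] xy by auto
    have d1: "integral {0..y} (\<lambda>t. g t * \<phi> t) - integral {0..x} (\<lambda>t. g t * \<phi> t) = integral {x..y} (\<lambda>t. g t * \<phi> t)"
      using Henstock_Kurzweil_Integration.integral_combine[of 0 x y "\<lambda>t. g t * \<phi> t"] xy bdd_meas_integrable(2)[OF b1] by auto
    have d2: "integral {0..y} (\<lambda>t. G t * \<phi>' t) - integral {0..x} (\<lambda>t. G t * \<phi>' t) = integral {x..y} (\<lambda>t. G t * \<phi>' t)"
      using Henstock_Kurzweil_Integration.integral_combine[of 0 x y "\<lambda>t. G t * \<phi>' t"] xy bdd_meas_integrable(2)[OF b2] by auto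
    have gxy: "(g has_integral (G y - G x)) {x..y}" unfolding G_def
      using Henstock_Kurzweil_Integration.integral_combine[of 0 x y g] xy gi
      by (simp add: has_integral_integral[symmetric] has_integral_iff)
    have h1: "((\<lambda>t. \<phi> y * g t - g t * \<phi> t) has_integral (\<phi> y * (G y - G x) - integral {x..y} (\<lambda>t. g t * \<phi> t))) {x..y}"
      by (intro has_integral_diff has_integral_mult_right gxy integrable_integral i1)
    have e1: "\<bar>\<phi> y * (G y - G x) - integral {x..y} (\<lambda>t. g t * \<phi> t)\<bar> \<le> M * K * (y - x) * (y - x)"
    proof -
      have "norm (integral {x..y} (\<lambda>t. \<phi> y * g t - g t * \<phi> t)) \<le> integral {x..y} (\<lambda>t. M * K * (y - x))"
      proof (rule integral_norm_bound_integral)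
        fix t assume t: "t \<in> {x..y}"
        have "\<bar>g t\<bar> * \<bar>\<phi> y - \<phi> t\<bar> \<le> M * (K * (y - x))"
        proof (rule mult_mono)
          show "\<bar>g t\<bar> \<le> M" using M t xy by auto
          have "K \<ge> 0" using K[of 0] by auto
          then have "K * (y - t) \<le> K * (y - x)" using t by (intro mult_left_mono) auto
          then show "\<bar>\<phi> y - \<phi> t\<bar> \<le> K * (y - x)" using \<phi>diff[of t y] t xy by auto
        qed (use M0 in auto)
        then show "norm (\<phi> y * g t - g t * \<phi> t) \<le> M * K * (y - x)"
          by (simp add: abs_mult[symmetric] algebra_simps)
      qed (use h1 in auto)
      then show ?thesis using integral_unique[OF h1] xy by (simp add: mult_ac)
    qed
    have h2: "((\<lambda>t. G x * \<phi>' t - G t * \<phi>' t) has_integral (G x * (\<phi> y - \<phi> x) - integral {x..y} (\<lambda>t. G t * \<phi>' t))) {x..y}"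
      by (intro has_integral_diff has_integral_mult_right \<phi>int xy integrable_integral i1)
    have e2: "\<bar>G x * (\<phi> y - \<phi> x) - integral {x..y} (\<lambda>t. G t * \<phi>' t)\<bar> \<le> M * K * (y - x) * (y - x)"
    proof -
      have "norm (integral {x..y} (\<lambda>t. G x * \<phi>' t - G t * \<phi>' t)) \<le> integral {x..y} (\<lambda>t. M * K * (y - x))"
      proof (rule integral_norm_bound_integral)
        fix t assume t: "t \<in> {x..y}"
        have "\<bar>G t - G x\<bar> * \<bar>\<phi>' t\<bar> \<le> (M * (y - x)) * K"
        proof (rule mult_mono)
          show "\<bar>\<phi>' t\<bar> \<le> K" using K t xy by auto
          have "M * (t - x) \<le> M * (y - x)" using t M0 by (intro mult_left_mono) auto
          then show "\<bar>G t - G x\<bar> \<le> M * (y - x)" using Gdiff[of x t] t xy by auto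
        qed (use M0 xy in auto)
        moreover have "norm (G x * \<phi>' t - G t * \<phi>' t) = \<bar>G t - G x\<bar> * \<bar>\<phi>' t\<bar>"
          by (simp add: abs_mult[symmetric] left_diff_distrib abs_minus_commute)
        ultimately show "norm (G x * \<phi>' t - G t * \<phi>' t) \<le> M * K * (y - x)" by (simp add: mult_ac)
      qed (use h2 in auto)
      then show ?thesis using integral_unique[OF h2] xy by (simp add: mult_ac)
    qed
    have "H y - H x = (\<phi> y * (G y - G x) - integral {x..y} (\<lambda>t. g t * \<phi> t)) + (G x * (\<phi> y - \<phi> x) - integral {x..y} (\<lambda>t. G t * \<phi>' t))"
      unfolding H_def d1[symmetric] d2[symmetric] by (simp add: algebra_simps)
    then show ?thesis using e1 e2 by (simp add: power2_eq_square algebra_simps)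
  qed
  have "(H has_real_derivative 0) (at x within {0..1})" if x: "x \<in> {0..1}" for x
    unfolding has_field_derivative_iff
  proof (rule tendsto_sandwich[where f = "\<lambda>y. - (2 * M * K * \<bar>y - x\<bar>)" and h = "\<lambda>y. 2 * M * K * \<bar>y - x\<bar>"])
    have b: "\<bar>(H y - H x) / (y - x)\<bar> \<le> 2 * M * K * \<bar>y - x\<bar>" if "y \<in> {0..1}" "y \<noteq> x" for y
    proof -
      have "\<bar>H y - H x\<bar> \<le> 2 * M * K * (y - x)\<^sup>2"
        using Hdiff[of x y] Hdiff[of y x] x that by (cases "x \<le> y") (auto simp: abs_minus_commute power2_commute)
      also have "\<dots> = (2 * M * K * \<bar>y - x\<bar>) * \<bar>y - x\<bar>" by (simp add: power2_eq_square abs_mult[symmetric])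
      finally show ?thesis using that by (simp add: abs_divide divide_le_eq)
    qed
    show "\<forall>\<^sub>F y in at x within {0..1}. - (2 * M * K * \<bar>y - x\<bar>) \<le> (H y - H x) / (y - x)"
      "\<forall>\<^sub>F y in at x within {0..1}. (H y - H x) / (y - x) \<le> 2 * M * K * \<bar>y - x\<bar>"
      using b[unfolded abs_le_iff minus_le_iff[of "_ / _"]]
      by (auto simp: eventually_at_filter simp del: abs_divide intro!: always_eventually)
    show "((\<lambda>y. 2 * M * K * \<bar>y - x\<bar>) \<longlongrightarrow> 0) (at x within {0..1})"
      by (rule tendsto_eq_intros refl tendsto_ident_at | simp)+
    then show "((\<lambda>y. - (2 * M * K * \<bar>y - x\<bar>)) \<longlongrightarrow> 0) (at x within {0..1})"
      using tendsto_minus by fastforce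
  qed
  then obtain c where "\<And>x. x \<in> {0..1} \<Longrightarrow> H x = c"
    using has_field_derivative_zero_constant[of "{0..1}" H] by auto
  from this[of 0] this[of 1] have "H 1 = H 0" by simp
  then show ?thesis using z by (simp add: H_def G_def)
qed

text \<open>The primitive vanishes near both ends: near \<open>0\<close> trivially, near \<open>1\<close> because the mean is zero.\<close>
lemma test_function_primitive:
  assumes t: "test_function b" and z: "integral {0..1} b = 0"
  obtains B where "test_function B" "deriv B = b"
proof -
  obtain l r where lr: "0 < l" "l < r" "r < 1" and bz: "\<And>x. x \<notin> {l..r} \<Longrightarrow> b x = 0" and sb: "smooth_fun b"
    using t by (auto simp: test_function_iff)
  have bz0: "b x = 0" if "x \<le> 0" for x using bz[of x] that lr by auto
  obtain B where sB: "smooth_fun B" and Bd: "\<And>x. (B has_real_derivative b x) (at x)"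
    and B0: "\<And>x. x \<le> 0 \<Longrightarrow> B x = 0"
    by (rule smooth_primitive[OF sb bz0]) (assumption | (rule that; assumption))+
  have B1: "B 1 = 0"
  proof -
    have "C1 B b" unfolding C1_def
      using has_field_derivative_at_within[OF Bd] smooth_fun_continuous[OF sb] by blast
    then have "integral {0..1} b = B 1 - B 0" by (rule C1_integral)
    then show ?thesis using z B0[of 0] by simp
  qed
  have const: "B x = B y" if e: "{x..y} \<inter> {l..r} = {}" and "x < y" for x y
  proof -
    have z: "b w = 0" if "w \<in> {x..y}" for w using bz that e by blast
    have "(B has_real_derivative 0) (at w within {x..y})" if "w \<in> {x..y}" for w
      using has_field_derivative_at_within[OF Bd, of w "{x..y}"] z[OF that] by simp
    then obtain c where "\<And>w. w \<in> {x..y} \<Longrightarrow> B w = c"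
      using has_field_derivative_zero_constant[of "{x..y}" B] by auto
    from this[of x] this[of y] show ?thesis using \<open>x < y\<close> by simp
  qed
  have "B x = 0" if "x \<notin> {l / 2..(r + 1) / 2}" for x
  proof (cases "x < l / 2")
    case True
    then show ?thesis using const[of 0 x] B0[of 0] B0[of x] lr by (cases "x \<le> 0") auto
  next
    case False
    then have "x > (r + 1) / 2" using that by auto
    then show ?thesis using const[of x 1] const[of 1 x] B1 lr
      by (cases "x < 1"; cases "x = 1") (auto simp: disjoint_iff)
  qed
  then have "test_function B" using sB lr unfolding test_function_iff
    by (intro conjI exI[of _ "l / 2"] exI[of _ "(r + 1) / 2"]) auto
  moreover have "deriv B = b" using Bd by (auto intro: DERIV_imp_deriv)
  ultimately show thesis by (rule that)
qed

text \<open>The du Bois-Reymond lemma: \<open>W\<close> is constant almost everywhere, expressed through its indefinite integral. Subtracting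
  a multiple of a fixed \<open>\<psi>\<^sub>0\<close> gives any test function mean zero and hence makes it a derivative, so
  \<open>\<psi> \<mapsto> \<integral> W \<psi>\<close> is proportional to \<open>\<psi> \<mapsto> \<integral> \<psi>\<close>; indicators of intervals are limits of test functions.\<close>
lemma du_Bois_Reymond:
  assumes W: "bdd_meas W" and z: "\<And>\<phi>. test_function \<phi> \<Longrightarrow> integral {0..1} (\<lambda>x. W x * deriv \<phi> x) = 0"
  obtains c where "\<And>x. x \<in> {0..1} \<Longrightarrow> integral {0..x} W = c * x"
proof -
  note Wi = bdd_meas_integrable(2)[OF W]
  have ti: "(\<lambda>x. W x * \<psi> x) integrable_on {0..1}" "\<psi> integrable_on {0..1}" if "test_function \<psi>" for \<psi>
    using bdd_meas_integrable(2)[OF bdd_meas_mult[OF W test_function_bdd_meas[OF that]]]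
      bdd_meas_integrable(2)[OF test_function_bdd_meas[OF that]] by auto
  have approx: "\<exists>\<psi>. (\<forall>n. test_function (\<psi> n)) \<and> (\<lambda>n. integral {0..1} (\<psi> n)) \<longlonglongrightarrow> b - a \<and>
      (\<lambda>n. integral {0..1} (\<lambda>x. W x * \<psi> n x)) \<longlonglongrightarrow> integral {a..b} W" if ab: "0 < a" "a < b" "b < 1" for a b
  proof -
    obtain \<psi> :: "nat \<Rightarrow> real \<Rightarrow> real" where \<psi>: "\<And>n. test_function (\<psi> n)"
      "\<And>n x. x \<notin> {a..b} \<Longrightarrow> \<psi> n x = 0" "\<And>n x. \<bar>\<psi> n x\<bar> \<le> 1"
      "\<And>x. (\<lambda>n. \<psi> n x) \<longlonglongrightarrow> indicator {a<..<b} x" using indicator_approximation[OF ab] by blast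
    have lim: "(\<lambda>n. integral {0..1} (\<lambda>x. V x * \<psi> n x)) \<longlonglongrightarrow> integral {a..b} V" if V: "bdd_meas V" for V
    proof -
      have "(\<lambda>n. integral {0..1} (\<lambda>x. V x * \<psi> n x)) \<longlonglongrightarrow> integral {0..1} (\<lambda>x. V x * indicator {a<..<b} x)"
      proof (rule dominated_convergence(2)[where h = "\<lambda>x. \<bar>V x\<bar>"])
        show "(\<lambda>x. V x * \<psi> n x) integrable_on {0..1}" for n
          by (intro bdd_meas_integrable bdd_meas_mult V test_function_bdd_meas \<psi>) auto
        show "(\<lambda>x. \<bar>V x\<bar>) integrable_on {0..1}"
          using bdd_meas_integrable(1)[OF V, of 0 1] by (auto simp: absolutely_integrable_on_def)
        show "norm (V x * \<psi> n x) \<le> \<bar>V x\<bar>" for n x using \<psi>(3)[of n x] by (simp add: abs_mult mult_left_le)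
      qed (intro tendsto_intros \<psi>)
      moreover have "integral {0..1} (\<lambda>x. V x * indicator {a<..<b} x) = integral {a..b} V"
      proof -
        have "integral {0..1} (\<lambda>x. V x * indicator {a<..<b} x) = integral {0..1} (\<lambda>x. if x \<in> {a..b} then V x else 0)"
          by (rule integral_spike[of "{a,b}"]) auto
        also have "\<dots> = integral ({0..1} \<inter> {a..b}) V"
          using integral_restrict_Int[of "{0..1}" "{a..b}" V] by (simp only: Int_commute)
        also have "{0..1} \<inter> {a..b} = {a..b}" using ab by auto
        finally show ?thesis .
      qed
      ultimately show ?thesis by simp
    qed
    have "(\<lambda>n. integral {0..1} (\<psi> n)) \<longlonglongrightarrow> b - a" using lim[OF bdd_meas_const[of 1]] ab by simp
    then show ?thesis using \<psi>(1) lim[OF W] by blast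
  qed
  obtain \<psi>0 where t0: "test_function \<psi>0" and n0: "integral {0..1} \<psi>0 \<noteq> 0"
  proof -
    obtain \<psi> where \<psi>: "\<And>n. test_function (\<psi> n)" "(\<lambda>n. integral {0..1} (\<psi> n)) \<longlonglongrightarrow> 2/3 - (1/3::real)"
      using approx[of "1/3" "2/3"] by auto
    have "\<exists>n. integral {0..1} (\<psi> n) \<noteq> 0"
    proof (rule ccontr)
      assume "\<not> ?thesis"
      then have "(\<lambda>n. integral {0..1} (\<psi> n)) = (\<lambda>n. 0::real)" by auto
      then show False using \<psi>(2) by (simp add: LIMSEQ_const_iff)
    qed
    then show thesis using that \<psi>(1) by blast
  qed
  define c where "c = integral {0..1} (\<lambda>x. W x * \<psi>0 x) / integral {0..1} \<psi>0"
  have key: "integral {0..1} (\<lambda>x. W x * \<psi> x) = c * integral {0..1} \<psi>" if t: "test_function \<psi>" for \<psi>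
  proof -
    define k where "k = integral {0..1} \<psi> / integral {0..1} \<psi>0"
    define b where "b = (\<lambda>x. 1 * \<psi> (1 * x + 0) + (-k) * \<psi>0 (1 * x + 0))"
    have tb: "test_function b"
    proof -
      obtain l r where 1: "0 < l" "l < r" "r < 1" "\<And>x. x \<notin> {l..r} \<Longrightarrow> \<psi> x = 0" "smooth_fun \<psi>"
        using t by (auto simp: test_function_iff)
      obtain l' r' where 2: "0 < l'" "l' < r'" "r' < 1" "\<And>x. x \<notin> {l'..r'} \<Longrightarrow> \<psi>0 x = 0" "smooth_fun \<psi>0"
        using t0 by (auto simp: test_function_iff)
      have "smooth_fun b" unfolding b_def by (intro smooth_fun_add smooth_fun_affine 1 2)
      moreover have "b x = 0" if "x \<notin> {min l l'..max r r'}" for x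
      proof -
        have "x \<notin> {l..r}" "x \<notin> {l'..r'}" using that by auto
        then show ?thesis using 1(4) 2(4) by (simp add: b_def)
      qed
      ultimately show ?thesis unfolding test_function_iff using 1 2
        by (intro conjI exI[of _ "min l l'"] exI[of _ "max r r'"]) auto
    qed
    have "integral {0..1} b = integral {0..1} \<psi> - k * integral {0..1} \<psi>0"
      unfolding b_def using has_integral_diff[OF integrable_integral[OF ti(2)[OF t]]
        has_integral_mult_right[OF integrable_integral[OF ti(2)[OF t0]], of k]] by (auto dest: integral_unique)
    then have "integral {0..1} b = 0" using n0 by (simp add: k_def)
    then obtain B where "test_function B" "deriv B = b" using test_function_primitive[OF tb] by blast
    then have "integral {0..1} (\<lambda>x. W x * b x) = 0" using z by blast
    moreover have "integral {0..1} (\<lambda>x. W x * b x) = integral {0..1} (\<lambda>x. W x * \<psi> x) - k * integral {0..1} (\<lambda>x. W x * \<psi>0 x)"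
    proof -
      have "(\<lambda>x. W x * b x) = (\<lambda>x. W x * \<psi> x - k * (W x * \<psi>0 x))" by (auto simp: b_def algebra_simps)
      then show ?thesis using has_integral_diff[OF integrable_integral[OF ti(1)[OF t]]
        has_integral_mult_right[OF integrable_integral[OF ti(1)[OF t0]], of k]] by (auto dest: integral_unique)
    qed
    ultimately show ?thesis using n0 by (simp add: c_def k_def field_simps)
  qed
  have inner: "integral {a..b} W = c * (b - a)" if ab: "0 < a" "a < b" "b < 1" for a b
  proof -
    obtain \<psi> where \<psi>: "\<forall>n. test_function (\<psi> n)" "(\<lambda>n. integral {0..1} (\<psi> n)) \<longlonglongrightarrow> b - a"
      "(\<lambda>n. integral {0..1} (\<lambda>x. W x * \<psi> n x)) \<longlonglongrightarrow> integral {a..b} W" using approx[OF ab] by auto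
    have "(\<lambda>n. integral {0..1} (\<lambda>x. W x * \<psi> n x)) \<longlonglongrightarrow> c * (b - a)"
      using tendsto_mult_left[OF \<psi>(2), of c] key \<psi>(1) by simp
    then show ?thesis using \<psi>(3) LIMSEQ_unique by blast
  qed
  define F where "F x = integral {0..x} W - c * x" for x
  have cF: "continuous_on {0..1} F" unfolding F_def
    by (intro continuous_intros indefinite_integral_continuous_1) (use Wi in auto)
  have "F x = F (1/2)" if x: "x \<in> {0<..<1}" for x
  proof -
    have *: "F y = F x" if "0 < x" "x < y" "y < 1" for x y
      using inner[OF that] Henstock_Kurzweil_Integration.integral_combine[of 0 x y W] Wi that
      by (auto simp: F_def algebra_simps)
    consider "x < 1/2" | "x = 1/2" | "x > 1/2" by linarith
    then show ?thesis
    proof cases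
      case 1
      then show ?thesis using *[of x "1/2"] x by simp
    next
      case 3
      show ?thesis by (rule *) (use 3 x in auto)
    next
      case 2
      then show ?thesis by (rule arg_cong)
    qed
  qed
  then have Fc: "F x = F (1/2)" if "x \<in> {0..1}" for x
    using continuous_constant_on_closure[of "{0<..<1}" F "F (1/2)" x] cF that
    by (metis closure_greaterThanLessThan zero_less_one)
  have F0: "F x = 0" if "x \<in> {0..1}" for x
  proof -
    have "F x = F 0" using Fc[OF that] Fc[of 0] by (simp only: atLeastAtMost_iff order_refl zero_le_one simp_thms)
    also have "F 0 = 0" by (simp add: F_def)
    finally show ?thesis .
  qed
  show thesis
  proof (rule that[of c])
    fix x :: real assume "x \<in> {0..1}"
    from F0[OF this] show "integral {0..x} W = c * x" by (simp add: F_def)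
  qed
qed

text \<open>If \<open>g\<close> is the weak derivative of \<open>w\<close>, then \<open>w\<close> differs from the primitive of \<open>g\<close> by a function orthogonal to all
  derivatives of test functions.\<close>
lemma weak_primitive:
  assumes w: "bdd_meas w" and g: "bdd_meas g"
    and eq: "\<And>\<phi>. test_function \<phi> \<Longrightarrow> integral {0..1} (\<lambda>x. w x * deriv \<phi> x) = - integral {0..1} (\<lambda>x. g x * \<phi> x)"
  obtains c where "\<And>x. x \<in> {0..1} \<Longrightarrow> integral {0..x} w = integral {0..x} (\<lambda>y. c + integral {0..y} g)"
proof -
  define G where "G = (\<lambda>x. integral {0..x} g)"
  have cG: "continuous_on {0..1} G" unfolding G_def
    by (rule indefinite_integral_continuous_1) (use bdd_meas_integrable(2)[OF g] in auto)
  have bG: "bdd_meas G" by (rule bdd_meas_continuous[OF cG])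
  have "integral {0..1} (\<lambda>x. (w x - G x) * deriv \<phi> x) = 0" if t: "test_function \<phi>" for \<phi>
  proof -
    have t1: "\<phi> 1 = 0" using t by (auto simp: test_function_iff)
    have b: "bdd_meas (deriv \<phi>)" using t test_function_bdd_meas test_function_deriv by blast
    have "integral {0..1} (\<lambda>x. (w x - G x) * deriv \<phi> x) =
        integral {0..1} (\<lambda>x. w x * deriv \<phi> x) - integral {0..1} (\<lambda>x. G x * deriv \<phi> x)"
      unfolding left_diff_distrib
      by (intro Henstock_Kurzweil_Integration.integral_diff bdd_meas_integrable bdd_meas_mult w bG b) auto
    then show ?thesis using eq[OF t] integral_by_parts_bdd_meas[OF g test_function_C1[OF t] t1]
      by (simp add: G_def)
  qed
  then obtain c where c: "\<And>x. x \<in> {0..1} \<Longrightarrow> integral {0..x} (\<lambda>y. w y - G y) = c * x"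
    by (rule du_Bois_Reymond[OF bdd_meas_diff[OF w bG]]) (assumption | (rule that; assumption))+
  show thesis
  proof (rule that[of c])
    fix x :: real assume x: "x \<in> {0..1}"
    have i: "w integrable_on {0..x}" "G integrable_on {0..x}"
      using bdd_meas_integrable(2)[OF w] bdd_meas_integrable(2)[OF bG] x by auto
    then have "integral {0..x} w - integral {0..x} G = c * x"
      using c[OF x] by (simp add: Henstock_Kurzweil_Integration.integral_diff)
    then show "integral {0..x} w = integral {0..x} (\<lambda>y. c + integral {0..y} g)"
      using i x Henstock_Kurzweil_Integration.integral_add[OF integrable_const_ivl[of c 0 x] i(2)]
      by (simp add: G_def mult.commute)
  qed
qed

text \<open>One step down a chain of weak derivatives: if \<open>g\<close> has a continuous representative \<open>g'\<close> (meaning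
  equal indefinite integrals), then \<open>w\<close> has a continuously differentiable one.\<close>
lemma weak_primitive_C1:
  assumes w: "bdd_meas w" and g: "bdd_meas g"
    and eq: "\<And>\<phi>. test_function \<phi> \<Longrightarrow> integral {0..1} (\<lambda>x. w x * deriv \<phi> x) = - integral {0..1} (\<lambda>x. g x * \<phi> x)"
    and g': "continuous_on {0..1} g'" "\<And>x. x \<in> {0..1} \<Longrightarrow> integral {0..x} g = integral {0..x} g'"
  obtains w' where "C1 w' g'" "\<And>x. x \<in> {0..1} \<Longrightarrow> integral {0..x} w = integral {0..x} w'"
proof -
  obtain c where c: "\<And>x. x \<in> {0..1} \<Longrightarrow> integral {0..x} w = integral {0..x} (\<lambda>y. c + integral {0..y} g)"
    by (rule weak_primitive[OF w g eq]) (assumption | (rule that; assumption))+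
  show thesis
  proof (rule that[of "\<lambda>y. c + integral {0..y} g'"])
    show "C1 (\<lambda>y. c + integral {0..y} g') g'" unfolding C1_def
      using integral_has_real_derivative[OF g'(1)] g'(1) by (auto intro!: derivative_eq_intros)
    fix x :: real assume x: "x \<in> {0..1}"
    have "integral {0..x} (\<lambda>y. c + integral {0..y} g) = integral {0..x} (\<lambda>y. c + integral {0..y} g')"
    proof (rule integral_cong)
      fix y assume "y \<in> {0..x}"
      then have "y \<in> {0..1}" using x by simp
      from g'(2)[OF this] show "c + integral {0..y} g = c + integral {0..y} g'" by (rule arg_cong)
    qed
    with c[OF x] show "integral {0..x} w = integral {0..x} (\<lambda>y. c + integral {0..y} g')" by (rule trans)
  qed
qed

lemma I01_measurable_AE:
  fixes f g :: "real \<Rightarrow> real"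
  assumes f: "f \<in> borel_measurable I01" and ae: "AE x in I01. f x = g x" shows "g \<in> borel_measurable I01"
proof -
  have "(\<lambda>x. if x \<in> {0<..<1} then f x else 0) \<in> borel_measurable lebesgue" using f by (subst borel_measurable_if) auto
  moreover have "AE x in lebesgue. (if x \<in> {0<..<1} then f x else 0) = (if x \<in> {0<..<1} then g x else 0)"
    using ae by (subst (asm) AE_restrict_space_iff) (auto elim: eventually_mono)
  ultimately have "(\<lambda>x. if x \<in> {0<..<1} then g x else 0) \<in> borel_measurable lebesgue" by (rule borel_measurable_AE)
  then show ?thesis by (subst (asm) borel_measurable_if) auto
qed

section \<open>Classical regularity of functions in \<open>W\<^sub>\<infinity>\<^sup>4\<close>\<close>

text \<open>The weak derivatives entering the norm are chosen representatives. They agree almost everywhere with an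
  essentially bounded one, and setting that one to zero where it exceeds the norm makes the bound hold
  pointwise. The absolute value makes the bound meaningful without knowing the sign of the norm.\<close>
lemma bounded_weak_deriv:
  assumes v: "v \<in> W_inf k" and j: "j \<le> k"
  obtains g where "bdd_meas g" "\<And>x. \<bar>g x\<bar> \<le> \<bar>W_inf_norm k v\<bar>"
    "\<And>\<phi>. test_function \<phi> \<Longrightarrow> (LINT x|I01. v x * (deriv ^^ j) \<phi> x) = (-1) ^ j * integral {0..1} (\<lambda>x. g x * \<phi> x)"
proof -
  obtain g0 where g0: "g0 \<in> Linf_space" "has_weak_deriv j v g0" using v j by (auto simp: W_inf_def)
  let ?d = "weak_deriv j v"
  let ?N = "esssup I01 (\<lambda>x. ereal \<bar>g0 x\<bar>)"
  have m0[measurable]: "g0 \<in> borel_measurable I01" and fin: "?N < \<infinity>" using g0(1) by (auto simp: Linf_space_def)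
  have ae: "AE x in I01. g0 x = ?d x" using weak_deriv_AE[OF g0(2)] by eventually_elim simp
  define h where "h x = (if x \<in> {0<..<1} then g0 x else 0)" for x
  have hm[measurable]: "h \<in> borel_measurable lebesgue"
    unfolding h_def using m0 by (subst borel_measurable_if) auto
  have dm: "?d \<in> borel_measurable I01" by (rule I01_measurable_AE[OF m0 ae])
  have dN: "esssup I01 (\<lambda>x. ereal \<bar>?d x\<bar>) = ?N"
    using ae m0 dm by (intro esssup_AE_cong) (auto elim: eventually_mono)
  have "Linf_norm ?d \<le> W_inf_norm k v" unfolding W_inf_norm_def using j by (intro Max_ge) auto
  then have NW: "real_of_ereal ?N \<le> \<bar>W_inf_norm k v\<bar>" by (simp add: Linf_norm_def dN)
  have bd: "AE x in I01. \<bar>g0 x\<bar> \<le> \<bar>W_inf_norm k v\<bar>"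
    using esssup_AE[of "\<lambda>x. ereal \<bar>g0 x\<bar>" I01]
  proof eventually_elim
    case (elim x)
    then have "\<bar>g0 x\<bar> \<le> real_of_ereal ?N" using fin by (cases ?N) auto
    then show ?case using NW by simp
  qed
  define g where "g x = (if \<bar>h x\<bar> \<le> \<bar>W_inf_norm k v\<bar> then h x else 0)" for x
  have "g \<in> borel_measurable lebesgue" unfolding g_def by measurable
  then have "g \<in> borel_measurable (lebesgue_on {0..1})" by (rule measurable_restrict_space1)
  then have bg: "bdd_meas g" unfolding bdd_meas_def
    by (intro conjI exI[of _ "\<bar>W_inf_norm k v\<bar>"]) (auto simp: g_def)
  show thesis
  proof (rule that[OF bg])
    fix \<phi> assume t: "test_function \<phi>"
    note b = bdd_meas_mult[OF bg test_function_bdd_meas[OF t]]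
    have "(LINT x|I01. v x * (deriv ^^ j) \<phi> x) = (-1) ^ j * (LINT x|I01. g0 x * \<phi> x)"
      using g0(2) t by (simp add: has_weak_deriv_def)
    also have "(LINT x|I01. g0 x * \<phi> x) = (LINT x|I01. g x * \<phi> x)"
    proof (rule integral_cong_AE)
      have "continuous_on {0<..<1} \<phi>" using t by (auto simp: test_function_iff smooth_fun_continuous)
      then have "\<phi> \<in> borel_measurable I01" by (intro continuous_imp_measurable_on_sets_lebesgue) auto
      then show "(\<lambda>x. g0 x * \<phi> x) \<in> borel_measurable I01" by simp
      show "(\<lambda>x. g x * \<phi> x) \<in> borel_measurable I01" using bdd_meas_LINT(1)[OF b] by auto
      show "AE x in I01. g0 x * \<phi> x = g x * \<phi> x"
        using bd AE_space by eventually_elim (auto simp: g_def h_def)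
    qed
    also have "\<dots> = integral {0..1} (\<lambda>x. g x * \<phi> x)" by (rule bdd_meas_LINT(2)[OF b])
    finally show "(LINT x|I01. v x * (deriv ^^ j) \<phi> x) = (-1) ^ j * integral {0..1} (\<lambda>x. g x * \<phi> x)" .
  qed (auto simp: g_def)
qed

text \<open>The fourth weak derivative is bounded, so the third has a Lipschitz representative; integrating three times
  produces continuous representatives of the lower ones, the last of which must be \<open>v\<close> itself.\<close>
lemma W_inf_4_regularity:
  assumes v: "v \<in> W_inf 4" and cv: "continuous_on {0..1} v"
  obtains v1 v2 v3 where "C1 v v1" "C1 v1 v2" "C1 v2 v3"
    "\<And>x y. 0 \<le> x \<Longrightarrow> x \<le> y \<Longrightarrow> y \<le> 1 \<Longrightarrow> \<bar>v3 y - v3 x\<bar> \<le> \<bar>W_inf_norm 4 v\<bar> * (y - x)"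
proof -
  let ?M = "\<bar>W_inf_norm 4 v\<bar>"
  define P where "P j g \<longleftrightarrow> bdd_meas g \<and> (\<forall>x. \<bar>g x\<bar> \<le> ?M) \<and> (\<forall>\<phi>. test_function \<phi> \<longrightarrow>
     (LINT x|I01. v x * (deriv ^^ j) \<phi> x) = (-1) ^ j * integral {0..1} (\<lambda>x. g x * \<phi> x))" for j g
  have "\<exists>g. j \<le> 4 \<longrightarrow> P j g" for j
  proof (cases "j \<le> 4")
    case True
    show ?thesis by (rule bounded_weak_deriv[OF v True]) (auto simp: P_def)
  qed simp
  then obtain g where "\<And>j. j \<le> 4 \<longrightarrow> P j (g j)" by metis
  then have bg: "\<And>j. j \<le> 4 \<Longrightarrow> bdd_meas (g j)" and gM: "\<And>j x. j \<le> 4 \<Longrightarrow> \<bar>g j x\<bar> \<le> ?M"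
    and gw: "\<And>j \<phi>. j \<le> 4 \<Longrightarrow> test_function \<phi> \<Longrightarrow>
     (LINT x|I01. v x * (deriv ^^ j) \<phi> x) = (-1) ^ j * integral {0..1} (\<lambda>x. g j x * \<phi> x)"
    by (auto simp: P_def)
  have chain: "integral {0..1} (\<lambda>x. g j x * deriv \<phi> x) = - integral {0..1} (\<lambda>x. g (Suc j) x * \<phi> x)"
    if "j < 4" "test_function \<phi>" for j \<phi>
  proof -
    have "(-1) ^ j * integral {0..1} (\<lambda>x. g j x * deriv \<phi> x) = (-1) ^ Suc j * integral {0..1} (\<lambda>x. g (Suc j) x * \<phi> x)"
      using gw[of j "deriv \<phi>"] gw[of "Suc j" \<phi>] test_function_deriv[of \<phi>] that by (simp add: funpow_swap1)
    also have "\<dots> = (-1) ^ j * (- integral {0..1} (\<lambda>x. g (Suc j) x * \<phi> x))" by simp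
    finally show ?thesis by (subst (asm) mult_cancel_left) simp
  qed
  have bv: "bdd_meas v" by (rule bdd_meas_continuous[OF cv])
  have chain0: "integral {0..1} (\<lambda>x. v x * deriv \<phi> x) = - integral {0..1} (\<lambda>x. g 1 x * \<phi> x)" if "test_function \<phi>" for \<phi>
    using gw[of 1 \<phi>] that bdd_meas_LINT(2)[OF bdd_meas_mult[OF bv test_function_bdd_meas[OF test_function_deriv[OF that]]]]
    by simp
  have b: "bdd_meas (g 2)" "bdd_meas (g 1)" "bdd_meas (g 3)" "bdd_meas (g 4)" using bg by auto
  have ch3: "integral {0..1} (\<lambda>x. g 3 x * deriv \<phi> x) = - integral {0..1} (\<lambda>x. g 4 x * \<phi> x)"
    and ch2: "integral {0..1} (\<lambda>x. g 2 x * deriv \<phi> x) = - integral {0..1} (\<lambda>x. g 3 x * \<phi> x)"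
    and ch1: "integral {0..1} (\<lambda>x. g 1 x * deriv \<phi> x) = - integral {0..1} (\<lambda>x. g 2 x * \<phi> x)"
    if "test_function \<phi>" for \<phi>
    using chain[OF _ that, of 3] chain[OF _ that, of 2] chain[OF _ that, of 1] by (simp_all add: eval_nat_numeral)
  obtain c where c: "\<And>x. x \<in> {0..1} \<Longrightarrow> integral {0..x} (g 3) = integral {0..x} (\<lambda>y. c + integral {0..y} (g 4))"
    by (rule weak_primitive[OF b(3) b(4) ch3]) (assumption | (rule that; assumption))+
  define v3 where "v3 y = c + integral {0..y} (g 4)" for y
  note gi = bdd_meas_integrable(2)[OF bg, of 4]
  have lip: "\<bar>v3 y - v3 x\<bar> \<le> ?M * (y - x)" if "0 \<le> x" "x \<le> y" "y \<le> 1" for x y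
  proof -
    have "v3 y - v3 x = integral {x..y} (g 4)" unfolding v3_def
      using Henstock_Kurzweil_Integration.integral_combine[of 0 x y "g 4"] that gi by auto
    moreover have "norm (integral {x..y} (g 4)) \<le> integral {x..y} (\<lambda>_. ?M)"
      by (rule integral_norm_bound_integral) (use that gi gM in auto)
    ultimately show ?thesis using that by (simp add: mult.commute)
  qed
  have c3: "continuous_on {0..1} v3" unfolding v3_def
    by (intro continuous_intros indefinite_integral_continuous_1) (use gi in auto)
  have c': "integral {0..x} (g 3) = integral {0..x} v3" if "x \<in> {0..1}" for x
    using c[OF that] by (simp only: v3_def[abs_def])
  obtain v2 where v2: "C1 v2 v3" "\<And>x. x \<in> {0..1} \<Longrightarrow> integral {0..x} (g 2) = integral {0..x} v2"
    by (rule weak_primitive_C1[OF b(1) b(3) ch2 c3 c']) (assumption | (rule that; assumption))+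
  obtain v1 where v1: "C1 v1 v2" "\<And>x. x \<in> {0..1} \<Longrightarrow> integral {0..x} (g 1) = integral {0..x} v1"
    by (rule weak_primitive_C1[OF b(2) b(1) ch1 C1_continuous(1)[OF v2(1)] v2(2)])
       (assumption | (rule that; assumption))+
  obtain v0 where v0: "C1 v0 v1" "\<And>x. x \<in> {0..1} \<Longrightarrow> integral {0..x} v = integral {0..x} v0"
    by (rule weak_primitive_C1[OF bv b(2) chain0 C1_continuous(1)[OF v1(1)] v1(2)])
       (assumption | (rule that; assumption))+
  have "v x = v0 x" if x: "x \<in> {0..1}" for x
  proof -
    have "((\<lambda>x. integral {0..x} v) has_real_derivative v x) (at x within {0..1})"
      using integral_has_real_derivative[OF cv x] .
    moreover have "((\<lambda>x. integral {0..x} v) has_real_derivative v0 x) (at x within {0..1})"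
    proof (rule has_field_derivative_transform_within[OF integral_has_real_derivative[OF C1_continuous(1)[OF v0(1)] x], of 1])
      show "integral {0..y} v0 = integral {0..y} v" if "y \<in> {0..1}" for y using v0(2)[OF that] by (rule sym)
    qed (use x in auto)
    ultimately show ?thesis
      using x vector_derivative_within_closed_interval[of 0 1 x "\<lambda>x. integral {0..x} v"]
      by (metis has_real_derivative_iff_has_vector_derivative zero_less_one)
  qed
  then have "(v has_real_derivative v1 x) (at x within {0..1})" if "x \<in> {0..1}" for x
    using v0(1) that by (intro has_field_derivative_transform_within[of v0 "v1 x" x "{0..1}" 1 v]) (auto simp: C1_def)
  then have "C1 v v1" using v0(1) unfolding C1_def by simp
  then show thesis using v1(1) v2(1) lip by (rule that)
qed

section \<open>Gronwall's inequality and continuation\<close>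

lemma gronwall_differential:
  fixes E :: "real \<Rightarrow> real"
  assumes der: "\<And>t. t \<in> {0..s} \<Longrightarrow> (E has_real_derivative E' t) (at t within {0..s})"
    and bd: "\<And>t. t \<in> {0..s} \<Longrightarrow> E' t \<le> K * (E t + \<delta>)" and s: "0 \<le> s"
  shows "E s + \<delta> \<le> (E 0 + \<delta>) * exp (K * s)"
proof -
  define F where "F t = (E t + \<delta>) * exp (- K * t)" for t
  have F': "(F has_real_derivative (E' t - K * (E t + \<delta>)) * exp (- K * t)) (at t within {0..s})" if "t \<in> {0..s}" for t
    unfolding F_def by (rule derivative_eq_intros der[OF that] refl)+ (simp add: algebra_simps)
  have "F s \<le> F 0"
  proof (rule DERIV_nonpos_imp_decreasing_open[OF s])
    show "continuous_on {0..s} F" using F' by (rule DERIV_continuous_on)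
    fix t assume t: "0 < t" "t < s"
    then have "(F has_real_derivative (E' t - K * (E t + \<delta>)) * exp (- K * t)) (at t)"
      using F'[of t] by (simp add: at_within_Icc_at)
    moreover have "(E' t - K * (E t + \<delta>)) * exp (- K * t) \<le> 0"
      using bd[of t] t by (intro mult_nonpos_nonneg) auto
    ultimately show "\<exists>y. (F has_real_derivative y) (at t) \<and> y \<le> 0" by blast
  qed
  then show ?thesis by (simp add: F_def exp_minus field_simps)
qed

text \<open>The bootstrap principle: a bound that improves itself on every initial interval on which it
  holds, and that holds strictly at time zero, holds throughout.\<close>
lemma continuation_bound:
  fixes E :: "real \<Rightarrow> real"
  assumes cont: "continuous_on {0..T} E" and zero: "E 0 < \<delta>"
    and step: "\<And>t. t \<in> {0..T} \<Longrightarrow> (\<And>s. s \<in> {0..t} \<Longrightarrow> E s \<le> \<delta>) \<Longrightarrow> E t < \<delta>"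
    and t: "t \<in> {0..T}"
  shows "E t < \<delta>"
proof (rule ccontr)
  assume bad: "\<not> E t < \<delta>"
  define S where "S = {s \<in> {0..T}. \<delta> \<le> E s}"
  have "S = {0..T} \<inter> E -` {\<delta>..}" by (auto simp: S_def)
  then have cl: "closed S" using continuous_closed_preimage[OF cont] by simp
  have ne: "S \<noteq> {}" using bad t by (auto simp: S_def)
  have bb: "bdd_below S" by (auto simp: S_def intro!: bdd_belowI[of _ 0])
  define m where "m = Inf S"
  have mS: "m \<in> S" unfolding m_def by (rule closed_contains_Inf[OF ne bb cl])
  have below: "E s < \<delta>" if "0 \<le> s" "s < m" for s
    using cInf_lower[OF _ bb, of s] that mS by (force simp: m_def S_def)
  have "E m \<le> \<delta>"
  proof (rule ccontr)
    assume gt: "\<not> E m \<le> \<delta>"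
    have "continuous_on {0..m} E" using cont mS by (rule_tac continuous_on_subset) (auto simp: S_def)
    then obtain s where "0 \<le> s" "s \<le> m" "E s = \<delta>"
      using IVT'[of E 0 \<delta> m] zero gt mS by (auto simp: S_def)
    then show False using below[of s] gt by (cases "s = m") auto
  qed
  then have "E s \<le> \<delta>" if "s \<in> {0..m}" for s using below[of s] that by (cases "s = m") auto
  with step[of m] mS show False by (auto simp: S_def)
qed

section \<open>Orthonormal bases of function spaces\<close>

text \<open>A subspace of functions on \<open>D\<close> whose members are determined by their values at finitely many
  points has an orthonormal basis for any positive definite form, and the coordinates are finite linear
  combinations of those point values. Each point of \<open>X\<close> adds at most one basis vector: the functions
  vanishing at the point are handled by induction, and one Gram-Schmidt step supplies the missing
  direction.\<close>
lemma orthonormal_basis_exists: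
  fixes V :: "('a \<Rightarrow> real) set"
  assumes "finite X" and "X \<subseteq> D"
    and "\<And>f g c. f \<in> V \<Longrightarrow> g \<in> V \<Longrightarrow> (\<lambda>x. f x + c * g x) \<in> V"
    and "(\<lambda>x. 0) \<in> V"
    and "\<And>f. f \<in> V \<Longrightarrow> (\<forall>p\<in>X. f p = 0) \<Longrightarrow> \<forall>x\<in>D. f x = 0"
    and "\<And>f g h c. f \<in> V \<Longrightarrow> g \<in> V \<Longrightarrow> h \<in> V \<Longrightarrow> B (\<lambda>x. f x + c * g x) h = B f h + c * B g h"
    and "\<And>f g. f \<in> V \<Longrightarrow> g \<in> V \<Longrightarrow> B f g = B g f"
    and "\<And>f x. f \<in> V \<Longrightarrow> x \<in> D \<Longrightarrow> f x \<noteq> 0 \<Longrightarrow> B f f > 0"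
    and "\<And>f f' g. f \<in> V \<Longrightarrow> f' \<in> V \<Longrightarrow> g \<in> V \<Longrightarrow> \<forall>x\<in>D. f x = f' x \<Longrightarrow> B f g = B f' g"
  shows "\<exists>n e. (\<forall>i<n::nat. e i \<in> V) \<and> (\<forall>i<n. \<forall>j<n. B (e i) (e j) = (if i = j then 1 else 0)) \<and>
      (\<forall>f\<in>V. \<forall>x\<in>D. f x = (\<Sum>i<n. B f (e i) * e i x)) \<and>
      (\<forall>i<n. \<exists>c. \<forall>f\<in>V. B f (e i) = (\<Sum>p\<in>X. c p * f p))"
  using assms
proof (induction X arbitrary: V rule: finite_induct)
  case empty
  have "\<forall>x\<in>D. f x = 0" if "f \<in> V" for f using empty.prems(4)[OF that] by simp
  then show ?case by (intro exI[of _ 0]) simp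
next
  case (insert p X)
  note lin = insert.prems(2) and zero = insert.prems(3) and det = insert.prems(4)
    and Blin = insert.prems(5) and Bsym = insert.prems(6) and Bpos = insert.prems(7) and Bcong = insert.prems(8)
  define V' where "V' = {f \<in> V. f p = 0}"
  have V'V: "f \<in> V" if "f \<in> V'" for f using that by (simp add: V'_def)
  have "\<exists>n e. (\<forall>i<n::nat. e i \<in> V') \<and> (\<forall>i<n. \<forall>j<n. B (e i) (e j) = (if i = j then 1 else 0)) \<and>
      (\<forall>f\<in>V'. \<forall>x\<in>D. f x = (\<Sum>i<n. B f (e i) * e i x)) \<and>
      (\<forall>i<n. \<exists>c. \<forall>f\<in>V'. B f (e i) = (\<Sum>p\<in>X. c p * f p))"
  proof (rule insert.IH)
    show "\<forall>x\<in>D. f x = 0" if "f \<in> V'" "\<forall>p\<in>X. f p = 0" for f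
      using det[OF V'V[OF that(1)]] that by (auto simp: V'_def)
    show "X \<subseteq> D" using insert.prems(1) by simp
    show "(\<lambda>x. 0) \<in> V'" using zero by (simp add: V'_def)
    show "(\<lambda>x. f x + c * g x) \<in> V'" if "f \<in> V'" "g \<in> V'" for f g c
      using lin[of f g c] that by (simp add: V'_def)
    show "B (\<lambda>x. f x + c * g x) h = B f h + c * B g h" if "f \<in> V'" "g \<in> V'" "h \<in> V'" for f g h c
      using Blin that V'V by blast
    show "B f g = B g f" if "f \<in> V'" "g \<in> V'" for f g using Bsym that V'V by blast
    show "B f f > 0" if "f \<in> V'" "x \<in> D" "f x \<noteq> 0" for f x using Bpos that V'V by blast
    show "B f g = B f' g" if "f \<in> V'" "f' \<in> V'" "g \<in> V'" "\<forall>x\<in>D. f x = f' x" for f f' g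
      using Bcong that V'V by blast
  qed
  then obtain n :: nat and e where E: "(\<forall>i<n. e i \<in> V') \<and> (\<forall>i<n. \<forall>j<n. B (e i) (e j) = (if i = j then 1 else 0)) \<and>
      (\<forall>f\<in>V'. \<forall>x\<in>D. f x = (\<Sum>i<n. B f (e i) * e i x)) \<and>
      (\<forall>i<n. \<exists>c. \<forall>f\<in>V'. B f (e i) = (\<Sum>p\<in>X. c p * f p))"
    by (elim exE) (rule that)
  have e: "e i \<in> V'" if "i < n" for i using E that by blast
  have on: "B (e i) (e j) = (if i = j then 1 else 0)" if "i < n" "j < n" for i j using E that by blast
  have ex: "f x = (\<Sum>i<n. B f (e i) * e i x)" if "f \<in> V'" "x \<in> D" for f x using E that by blast
  have co: "\<exists>c. \<forall>f\<in>V'. B f (e i) = (\<Sum>p\<in>X. c p * f p)" if "i < n" for i using E that by blast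
  have eV: "e i \<in> V" if "i < n" for i using V'V e that by blast
  have ep: "e i p = 0" if "i < n" for i using e[OF that] by (simp add: V'_def)
  show ?case
  proof (cases "\<exists>\<phi>\<in>V. \<phi> p \<noteq> 0")
    case False
    then have VV: "V' = V" by (auto simp: V'_def)
    have "\<exists>c. \<forall>f\<in>V. B f (e i) = (\<Sum>q\<in>insert p X. c q * f q)" if "i < n" for i
    proof -
      obtain c where "\<And>f. f \<in> V \<Longrightarrow> B f (e i) = (\<Sum>q\<in>X. c q * f q)" using co[OF \<open>i < n\<close>] VV by auto
      then show ?thesis using False insert.hyps by (intro exI[of _ c]) auto
    qed
    then show ?thesis using on ex eV unfolding VV by (intro exI[of _ n] exI[of _ e]) blast
  next
    case True
    then obtain \<phi> where \<phi>: "\<phi> \<in> V" "\<phi> p \<noteq> 0" by blast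
    have B0: "B (\<lambda>x. 0) h = 0" if "h \<in> V" for h
      using Blin[OF zero zero that, of 1] by simp
    have sumV: "(\<lambda>x. \<Sum>i<k. a i * e i x) \<in> V" if "k \<le> n" for k a
      using that
    proof (induction k)
      case (Suc k)
      then show ?case using lin[OF Suc.IH eV[of k], of "a k"] by simp
    qed (simp add: zero)
    have Bsum: "B (\<lambda>x. \<Sum>i<k. a i * e i x) h = (\<Sum>i<k. a i * B (e i) h)" if "k \<le> n" "h \<in> V" for k a h
      using that
    proof (induction k)
      case (Suc k)
      then show ?case using Blin[OF sumV[of k a] eV[of k] that(2), of "a k"] by simp
    qed (simp add: B0)
    define \<psi> where "\<psi> = (\<lambda>x. \<phi> x + (-1) * (\<Sum>i<n. B \<phi> (e i) * e i x))"
    have \<psi>: "\<psi> \<in> V" unfolding \<psi>_def by (intro lin \<phi> sumV order_refl)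
    have \<psi>e: "B \<psi> (e j) = 0" if "j < n" for j
    proof -
      have "B \<psi> (e j) = B \<phi> (e j) - (\<Sum>i<n. B \<phi> (e i) * B (e i) (e j))"
        unfolding \<psi>_def using Blin[OF \<phi>(1) sumV[OF order_refl] eV[OF that], of "-1"] Bsum[OF order_refl eV[OF that]] by simp
      also have "(\<Sum>i<n. B \<phi> (e i) * B (e i) (e j)) = (\<Sum>i<n. if i = j then B \<phi> (e i) else 0)"
        by (rule sum.cong) (use on that in auto)
      also have "\<dots> = B \<phi> (e j)" using that by simp
      finally show ?thesis by simp
    qed
    have \<psi>p: "\<psi> p = \<phi> p" using ep by (simp add: \<psi>_def)
    have pos: "B \<psi> \<psi> > 0" using Bpos[OF \<psi>, of p] \<psi>p \<phi>(2) insert.prems(1) by auto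
    define s where "s = sqrt (B \<psi> \<psi>)"
    have s: "s > 0" "s * s = B \<psi> \<psi>" using pos by (auto simp: s_def)
    define e0 where "e0 = (\<lambda>x. 0 + (1 / s) * \<psi> x)"
    have e0: "e0 \<in> V" unfolding e0_def by (rule lin[OF zero \<psi>])
    have Be0: "B e0 h = B \<psi> h / s" if "h \<in> V" for h
      unfolding e0_def using Blin[OF zero \<psi> that, of "1 / s"] B0[OF that] by simp
    have e0e: "B e0 (e j) = 0" "B (e j) e0 = 0" if "j < n" for j
      using Be0[OF eV[OF that]] \<psi>e[OF that] Bsym[OF e0 eV[OF that]] by auto
    have e00: "B e0 e0 = 1"
      using Be0[OF e0] Bsym[OF \<psi> e0] Be0[OF \<psi>] s pos by (simp add: field_simps)
    have e0p: "e0 p \<noteq> 0" using \<psi>p \<phi>(2) s by (simp add: e0_def)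
    define r where "r f = (\<lambda>x. f x + (- (f p / e0 p)) * e0 x)" for f
    have rV: "r f \<in> V" if "f \<in> V" for f unfolding r_def by (rule lin[OF that e0])
    have rV': "r f \<in> V'" if "f \<in> V" for f using rV[OF that] e0p by (simp add: V'_def r_def)
    have Br: "B (r f) (e i) = B f (e i)" if "f \<in> V" "i < n" for f i
      unfolding r_def Blin[OF that(1) e0 eV[OF that(2)]] e0e(1)[OF that(2)] by (simp only: mult_zero_right add_0_right)
    have Bf0: "B f e0 = f p / e0 p" if f: "f \<in> V" for f
    proof -
      have "B (r f) e0 = B (\<lambda>x. \<Sum>i<n. B (r f) (e i) * e i x) e0"
        by (rule Bcong[OF rV[OF f] sumV[OF order_refl] e0]) (use ex[OF rV'[OF f]] in blast)
      also have "\<dots> = 0" using Bsum[OF order_refl e0] e0e by simp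
      finally show ?thesis unfolding r_def Blin[OF f e0 e0] e00 by (simp only: mult_1_right add_eq_0_iff2 minus_minus)
    qed
    have fx: "f x = (\<Sum>i<n. B f (e i) * e i x) + B f e0 * e0 x" if f: "f \<in> V" and x: "x \<in> D" for f x
    proof -
      have "r f x = (\<Sum>i<n. B f (e i) * e i x)" using ex[OF rV'[OF f] x] Br[OF f] by simp
      then show ?thesis using Bf0[OF f] by (simp add: r_def)
    qed
    have ci: "\<exists>c. \<forall>f\<in>V. B f (e i) = (\<Sum>q\<in>insert p X. c q * f q)" if i: "i < n" for i
    proof -
      obtain c where c: "\<And>f. f \<in> V' \<Longrightarrow> B f (e i) = (\<Sum>q\<in>X. c q * f q)" using co[OF i] by auto
      define c' where "c' = c(p := - (\<Sum>q\<in>X. c q * e0 q) / e0 p)"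
      have "B f (e i) = (\<Sum>q\<in>insert p X. c' q * f q)" if f: "f \<in> V" for f
      proof -
        have "B f (e i) = (\<Sum>q\<in>X. c q * r f q)" using c[OF rV'[OF f]] Br[OF f i] by simp
        also have "\<dots> = (\<Sum>q\<in>X. c q * f q) - (f p / e0 p) * (\<Sum>q\<in>X. c q * e0 q)"
          unfolding r_def sum_distrib_left sum_subtractf[symmetric] by (rule sum.cong) (auto simp: algebra_simps)
        also have "\<dots> = c' p * f p + (\<Sum>q\<in>X. c' q * f q)"
        proof -
          have "(\<Sum>q\<in>X. c' q * f q) = (\<Sum>q\<in>X. c q * f q)"
            by (rule sum.cong) (use insert.hyps in \<open>auto simp: c'_def\<close>)
          then show ?thesis by (simp add: c'_def)
        qed
        finally show ?thesis using insert.hyps by simp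
      qed
      then show ?thesis by blast
    qed
    have c0: "\<exists>c. \<forall>f\<in>V. B f e0 = (\<Sum>q\<in>insert p X. c q * f q)"
    proof (intro exI ballI)
      fix f assume f: "f \<in> V"
      have "(\<Sum>q\<in>X. (if q = p then 1 / e0 p else 0) * f q) = 0" using insert.hyps by (intro sum.neutral) auto
      then show "B f e0 = (\<Sum>q\<in>insert p X. (if q = p then 1 / e0 p else 0) * f q)"
        using Bf0[OF f] insert.hyps by simp
    qed
    have "(\<forall>i<Suc n. (e(n := e0)) i \<in> V) \<and>
      (\<forall>i<Suc n. \<forall>j<Suc n. B ((e(n := e0)) i) ((e(n := e0)) j) = (if i = j then 1 else 0)) \<and>
      (\<forall>f\<in>V. \<forall>x\<in>D. f x = (\<Sum>i<Suc n. B f ((e(n := e0)) i) * (e(n := e0)) i x)) \<and>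
      (\<forall>i<Suc n. \<exists>c. \<forall>f\<in>V. B f ((e(n := e0)) i) = (\<Sum>p\<in>insert p X. c p * f p))"
    proof (intro conjI)
      show "\<forall>i<Suc n. (e(n := e0)) i \<in> V" using eV e0 by (auto simp: less_Suc_eq)
      show "\<forall>i<Suc n. \<forall>j<Suc n. B ((e(n := e0)) i) ((e(n := e0)) j) = (if i = j then 1 else 0)"
        using on e0e e00 by (auto simp: less_Suc_eq)
      show "\<forall>f\<in>V. \<forall>x\<in>D. f x = (\<Sum>i<Suc n. B f ((e(n := e0)) i) * (e(n := e0)) i x)"
      proof (intro ballI)
        fix f x assume "f \<in> V" "x \<in> D"
        moreover have "(\<Sum>i<n. B f ((e(n := e0)) i) * (e(n := e0)) i x) = (\<Sum>i<n. B f (e i) * e i x)"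
          by (rule sum.cong) auto
        ultimately show "f x = (\<Sum>i<Suc n. B f ((e(n := e0)) i) * (e(n := e0)) i x)" using fx by simp
      qed
      show "\<forall>i<Suc n. \<exists>c. \<forall>f\<in>V. B f ((e(n := e0)) i) = (\<Sum>p\<in>insert p X. c p * f p)"
        using ci c0 by (simp add: less_Suc_eq)
    qed
    then show ?thesis by blast
  qed
qed

section \<open>Systems of ordinary differential equations with Lipschitz right-hand side\<close>
lemma continuous_on_lipschitz_comp:
  fixes G :: "(nat \<Rightarrow> real) \<Rightarrow> real"
  assumes lip: "\<And>y z. \<bar>G y - G z\<bar> \<le> L * (\<Sum>i<N. \<bar>y i - z i\<bar>)"
    and y: "\<And>i. i < N \<Longrightarrow> continuous_on S (y i)"
  shows "continuous_on S (\<lambda>s. G (\<lambda>i. y i s))"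
  unfolding continuous_on_def
proof
  fix x assume x: "x \<in> S"
  have "((\<lambda>s. L * (\<Sum>i<N. \<bar>y i s - y i x\<bar>)) \<longlongrightarrow> L * (\<Sum>i<N. \<bar>y i x - y i x\<bar>)) (at x within S)"
    using y x by (intro tendsto_intros) (auto simp: continuous_on_def)
  then have "((\<lambda>s. L * (\<Sum>i<N. \<bar>y i s - y i x\<bar>)) \<longlongrightarrow> 0) (at x within S)" by simp
  then have "((\<lambda>s. G (\<lambda>i. y i s) - G (\<lambda>i. y i x)) \<longlongrightarrow> 0) (at x within S)"
    by (rule Lim_null_comparison[rotated]) (use lip in simp)
  then show "((\<lambda>s. G (\<lambda>i. y i s)) \<longlongrightarrow> G (\<lambda>i. y i x)) (at x within S)" by (simp add: LIM_zero_iff)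
qed

text \<open>Global existence for a globally Lipschitz system of \<open>N\<close> equations. The \<open>N\<close> components are stored in
  one bounded continuous function on the plane, component \<open>k\<close> on the line \<open>{k} \<times> \<real>\<close> and hat functions
  interpolating between these lines, so that the space is complete. Weighting the solution
  by \<open>exp (-K t)\<close> with large \<open>K\<close> makes Picard's operator a contraction on the whole interval at once.\<close>
lemma lipschitz_ode_existence:
  fixes G :: "nat \<Rightarrow> (nat \<Rightarrow> real) \<Rightarrow> real" and y0 :: "nat \<Rightarrow> real"
  assumes lip: "\<And>k y z. k < N \<Longrightarrow> \<bar>G k y - G k z\<bar> \<le> L * (\<Sum>i<N. \<bar>y i - z i\<bar>)"
    and L: "0 \<le> L" and T: "0 \<le> T"
  obtains y :: "nat \<Rightarrow> real \<Rightarrow> real" where "\<And>k. k < N \<Longrightarrow> y k 0 = y0 k"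
    "\<And>k t. k < N \<Longrightarrow> t \<in> {0..T} \<Longrightarrow> (y k has_real_derivative G k (\<lambda>i. y i t)) (at t within {0..T})"
proof -
  define K where "K = 2 * (L * real N * real N) + 1"
  have K: "K > 0" "2 * (L * real N * real N) \<le> K" using L by (auto simp: K_def add_nonneg_pos)
  define cl where "cl t = max 0 (min T t)" for t
  have cl: "0 \<le> cl t" "cl t \<le> T" for t using T by (auto simp: cl_def)
  have ccl: "continuous_on UNIV cl" unfolding cl_def by (intro continuous_intros)
  define I where "I z k = (\<lambda>s. G k (\<lambda>i. exp (K * s) * apply_bcontfun z (real i, s)))" for z :: "(real \<times> real) \<Rightarrow>\<^sub>C real" and k
  define h where "h z k \<tau> = exp (- (K * \<tau>)) * (y0 k + integral {0..\<tau>} (I z k))" for z k \<tau>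
  define hat where "hat k r = max 0 (1 - \<bar>r - real k\<bar>)" for k :: nat and r :: real
  have hat: "0 \<le> hat k r" "hat k r \<le> 1" for k r by (auto simp: hat_def)
  have hat_nat: "hat k (real j) = (if k = j then 1 else 0)" for k j
  proof -
    have "\<bar>real j - real k\<bar> \<ge> 1" if "k \<noteq> j" using that by (cases "k < j") auto
    then show ?thesis by (auto simp: hat_def)
  qed
  define \<Psi>0 where "\<Psi>0 z p = (\<Sum>k<N. hat k (fst p) * h z k (cl (snd p)))" for z p
  have cz: "continuous_on S (\<lambda>s. apply_bcontfun z (real i, s))" for S z i
    by (rule continuous_on_compose2[OF continuous_on_apply_bcontfun[of UNIV z], of S "\<lambda>s. (real i, s)"])
       (intro continuous_on_Pair continuous_on_const continuous_on_id, simp)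
  have cI: "continuous_on S (I z k)" if "k < N" for S z k
    unfolding I_def by (rule continuous_on_lipschitz_comp[OF lip[OF that]]) (intro continuous_intros cz)
  have Ii: "I z k integrable_on {0..\<tau>}" if "k < N" for z k \<tau>
    by (intro integrable_continuous_interval cI that)
  have ch: "continuous_on {0..T} (h z k)" if "k < N" for z k
    unfolding h_def by (intro continuous_intros indefinite_integral_continuous_1 Ii that)
  have bc: "\<Psi>0 z \<in> bcontfun" for z
    unfolding bcontfun_def mem_Collect_eq
  proof
    have chc: "continuous_on UNIV (\<lambda>p::real \<times> real. h z k (cl (snd p)))" if "k < N" for k
      by (rule continuous_on_compose2[OF ch[OF that] continuous_on_compose2[OF ccl continuous_on_snd]])
         (use cl in \<open>auto intro: continuous_on_id\<close>)
    have "continuous_on UNIV (\<lambda>p. \<Sum>k<N. hat k (fst p) * h z k (cl (snd p)))"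
      unfolding hat_def by (intro continuous_intros chc) auto
    then show "continuous_on UNIV (\<Psi>0 z)" by (simp only: \<Psi>0_def[abs_def])
    have "\<exists>B. \<forall>\<tau>\<in>{0..T}. \<bar>h z k \<tau>\<bar> \<le> B" if "k < N" for k
    proof -
      have "compact (h z k ` {0..T})" using ch[OF that] by (intro compact_continuous_image) auto
      then show ?thesis using compact_imp_bounded by (fastforce simp: bounded_iff)
    qed
    then obtain B where B: "\<And>k \<tau>. k < N \<Longrightarrow> \<tau> \<in> {0..T} \<Longrightarrow> \<bar>h z k \<tau>\<bar> \<le> B k" by metis
    have "norm (\<Psi>0 z p) \<le> (\<Sum>k<N. B k)" for p unfolding \<Psi>0_def
    proof (rule sum_norm_le)
      fix k assume "k \<in> {..<N}"
      then have "\<bar>h z k (cl (snd p))\<bar> \<le> B k" using B cl by auto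
      then have "hat k (fst p) * \<bar>h z k (cl (snd p))\<bar> \<le> 1 * B k" using hat by (intro mult_mono) auto
      then show "norm (hat k (fst p) * h z k (cl (snd p))) \<le> B k" using hat by (simp add: abs_mult)
    qed
    then show "bounded (range (\<Psi>0 z))" by (intro boundedI) auto
  qed
  define \<Psi> where "\<Psi> z = Bcontfun (\<Psi>0 z)" for z
  have ap: "apply_bcontfun (\<Psi> z) = \<Psi>0 z" for z unfolding \<Psi>_def by (rule Bcontfun_inverse[OF bc])
  have "\<exists>!z. \<Psi> z = z"
  proof (rule banach_fix_type[where c = "1/2" and f = \<Psi>])
    show "\<forall>z w. dist (\<Psi> z) (\<Psi> w) \<le> 1 / 2 * dist z w"
    proof (intro allI dist_bound)
      fix z w :: "(real \<times> real) \<Rightarrow>\<^sub>C real" and p :: "real \<times> real"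
      let ?d = "dist z w"
      have hh: "\<bar>h z k \<tau> - h w k \<tau>\<bar> \<le> L * real N / K * ?d" if k: "k < N" and \<tau>: "0 \<le> \<tau>" for k \<tau>
      proof -
        have Iz: "\<bar>I z k s - I w k s\<bar> \<le> L * real N * ?d * exp (K * s)" for s
        proof -
          have "\<bar>I z k s - I w k s\<bar> \<le> L * (\<Sum>i<N. \<bar>exp (K * s) * z (real i, s) - exp (K * s) * w (real i, s)\<bar>)"
            unfolding I_def by (rule lip[OF k])
          also have "\<dots> \<le> L * (\<Sum>i<N. exp (K * s) * ?d)"
          proof (intro mult_left_mono sum_mono L)
            fix i
            have "\<bar>z (real i, s) - w (real i, s)\<bar> \<le> ?d" using dist_bounded[of z "(real i, s)" w] by (simp add: dist_real_def)
            then show "\<bar>exp (K * s) * z (real i, s) - exp (K * s) * w (real i, s)\<bar> \<le> exp (K * s) * ?d"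
              by (simp add: right_diff_distrib[symmetric] abs_mult)
          qed
          finally show ?thesis by (simp add: mult_ac)
        qed
        have ex: "((\<lambda>s. L * real N * ?d * exp (K * s)) has_integral L * real N * ?d * ((exp (K * \<tau>) - 1) / K)) {0..\<tau>}"
        proof (rule has_integral_mult_right)
          have "((\<lambda>s. exp (K * s)) has_integral exp (K * \<tau>) / K - exp (K * 0) / K) {0..\<tau>}"
            by (rule fundamental_theorem_of_calculus[OF \<tau>])
               (use K in \<open>auto simp: has_real_derivative_iff_has_vector_derivative[symmetric] intro!: derivative_eq_intros\<close>)
          then show "((\<lambda>s. exp (K * s)) has_integral (exp (K * \<tau>) - 1) / K) {0..\<tau>}" by (simp add: diff_divide_distrib)
        qed
        have "\<bar>integral {0..\<tau>} (I z k) - integral {0..\<tau>} (I w k)\<bar> = norm (integral {0..\<tau>} (\<lambda>s. I z k s - I w k s))"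
          using Ii[OF k] by (simp add: Henstock_Kurzweil_Integration.integral_diff)
        also have "\<dots> \<le> integral {0..\<tau>} (\<lambda>s. L * real N * ?d * exp (K * s))"
          by (rule integral_norm_bound_integral) (use Ii[OF k] ex Iz in \<open>auto intro: integrable_diff\<close>)
        also have "\<dots> = L * real N * ?d * ((exp (K * \<tau>) - 1) / K)" by (rule integral_unique[OF ex])
        also have "\<dots> \<le> L * real N * ?d * (exp (K * \<tau>) / K)"
          using K L by (intro mult_left_mono divide_right_mono) auto
        finally have *: "\<bar>integral {0..\<tau>} (I z k) - integral {0..\<tau>} (I w k)\<bar> \<le> L * real N * ?d * (exp (K * \<tau>) / K)" .
        have "\<bar>h z k \<tau> - h w k \<tau>\<bar> = exp (- (K * \<tau>)) * \<bar>integral {0..\<tau>} (I z k) - integral {0..\<tau>} (I w k)\<bar>"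
          by (simp add: h_def right_diff_distrib[symmetric] abs_mult)
        also have "\<dots> \<le> exp (- (K * \<tau>)) * (L * real N * ?d * (exp (K * \<tau>) / K))" using * by (rule mult_left_mono) simp
        also have "\<dots> = L * real N / K * ?d" by (simp add: exp_minus)
        finally show ?thesis .
      qed
      have "dist (apply_bcontfun (\<Psi> z) p) (apply_bcontfun (\<Psi> w) p)
          = norm (\<Sum>k<N. hat k (fst p) * (h z k (cl (snd p)) - h w k (cl (snd p))))"
        by (simp add: ap \<Psi>0_def dist_real_def right_diff_distrib sum_subtractf)
      also have "\<dots> \<le> (\<Sum>k<N. L * real N / K * ?d)"
      proof (rule sum_norm_le)
        fix k assume "k \<in> {..<N}"
        then have "\<bar>h z k (cl (snd p)) - h w k (cl (snd p))\<bar> \<le> L * real N / K * ?d" using hh cl by auto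
        then have "hat k (fst p) * \<bar>h z k (cl (snd p)) - h w k (cl (snd p))\<bar> \<le> 1 * (L * real N / K * ?d)"
          using hat by (intro mult_mono) auto
        then show "norm (hat k (fst p) * (h z k (cl (snd p)) - h w k (cl (snd p)))) \<le> L * real N / K * ?d"
          using hat by (simp add: abs_mult)
      qed
      also have "\<dots> = (L * real N * real N / K) * ?d" by simp
      also have "\<dots> \<le> 1 / 2 * ?d" using K by (intro mult_right_mono) (auto simp: field_simps)
      finally show "dist (apply_bcontfun (\<Psi> z) p) (apply_bcontfun (\<Psi> w) p) \<le> 1 / 2 * ?d" .
    qed
  qed auto
  then obtain z where z: "\<Psi> z = z" by blast
  define y where "y k t = exp (K * t) * apply_bcontfun z (real k, t)" for k t
  have Iy: "I z k = (\<lambda>s. G k (\<lambda>i. y i s))" for k by (simp add: I_def y_def)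
  have yk: "y k t = y0 k + integral {0..t} (\<lambda>s. G k (\<lambda>i. y i s))" if "k < N" "t \<in> {0..T}" for k t
  proof -
    have "cl t = t" using that by (simp add: cl_def)
    moreover have "apply_bcontfun z (real k, t) = \<Psi>0 z (real k, t)" using ap[of z] by (simp add: z)
    moreover have "\<Psi>0 z (real k, t) = h z k (cl t)"
      using that by (simp add: \<Psi>0_def hat_nat if_distrib[of "\<lambda>x. x * _"] cong: if_cong)
    ultimately have "apply_bcontfun z (real k, t) = h z k t" by simp
    then show ?thesis by (simp add: y_def[of k t] h_def Iy exp_minus)
  qed
  show thesis
  proof (rule that[of y])
    show "y k 0 = y0 k" if "k < N" for k using yk[OF that, of 0] T by simp
    fix k t assume k: "k < N" and t: "t \<in> {0..T}"
    have "((\<lambda>t. integral {0..t} (I z k)) has_real_derivative I z k t) (at t within {0..T})"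
      by (rule integral_has_real_derivative[OF cI[OF k] t])
    then have "((\<lambda>t. y0 k + integral {0..t} (I z k)) has_real_derivative I z k t) (at t within {0..T})"
      by (auto intro!: derivative_eq_intros)
    then have "(y k has_real_derivative I z k t) (at t within {0..T})"
    proof (rule has_field_derivative_transform_within[of _ _ _ _ 1])
      show "y0 k + integral {0..s} (I z k) = y k s" if "s \<in> {0..T}" for s using yk[OF k that] by (simp add: Iy)
    qed (use t in auto)
    then show "(y k has_real_derivative G k (\<lambda>i. y i t)) (at t within {0..T})" by (simp add: Iy)
  qed
qed

lemma lipschitz_ode_uniqueness:
  fixes G :: "nat \<Rightarrow> (nat \<Rightarrow> real) \<Rightarrow> real"
  assumes lip: "\<And>k y z. k < N \<Longrightarrow> \<bar>G k y - G k z\<bar> \<le> L * (\<Sum>i<N. \<bar>y i - z i\<bar>)" and L: "0 \<le> L"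
    and y: "\<And>k t. k < N \<Longrightarrow> t \<in> {0..T} \<Longrightarrow> (y k has_real_derivative G k (\<lambda>i. y i t)) (at t within {0..T})"
    and z: "\<And>k t. k < N \<Longrightarrow> t \<in> {0..T} \<Longrightarrow> (z k has_real_derivative G k (\<lambda>i. z i t)) (at t within {0..T})"
    and init: "\<And>k. k < N \<Longrightarrow> y k 0 = z k 0"
    and k: "k < N" and t: "t \<in> {0..T}"
  shows "y k t = z k t"
proof -
  define d where "d k s = y k s - z k s" for k s
  define E where "E s = (\<Sum>k<N. (d k s)\<^sup>2)" for s
  define E' where "E' s = (\<Sum>k<N. 2 * d k s * (G k (\<lambda>i. y i s) - G k (\<lambda>i. z i s)))" for s
  have "E t + 0 \<le> (E 0 + 0) * exp (2 * L * real N * t)"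
  proof (rule gronwall_differential)
    fix s assume s: "s \<in> {0..t}"
    have sub: "{0..t} \<subseteq> {0..T}" using t by auto
    have der: "(d k has_real_derivative G k (\<lambda>i. y i s) - G k (\<lambda>i. z i s)) (at s within {0..t})" if "k < N" for k
      unfolding d_def using y[OF that, of s] z[OF that, of s] s t
      by (intro DERIV_diff) (auto intro: DERIV_subset[OF _ sub])
    show "(E has_real_derivative E' s) (at s within {0..t})" unfolding E_def E'_def
    proof (rule DERIV_sum)
      fix k assume "k \<in> {..<N}"
      then show "((\<lambda>s. (d k s)\<^sup>2) has_real_derivative 2 * d k s * (G k (\<lambda>i. y i s) - G k (\<lambda>i. z i s))) (at s within {0..t})"
        by (auto intro!: derivative_eq_intros der)
    qed
    let ?S = "\<Sum>i<N. \<bar>d i s\<bar>"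
    have "E' s \<le> (\<Sum>k<N. 2 * \<bar>d k s\<bar> * (L * ?S))" unfolding E'_def
    proof (rule sum_mono)
      fix k assume "k \<in> {..<N}"
      then have "\<bar>G k (\<lambda>i. y i s) - G k (\<lambda>i. z i s)\<bar> \<le> L * ?S" using lip by (simp add: d_def)
      then have "\<bar>2 * d k s * (G k (\<lambda>i. y i s) - G k (\<lambda>i. z i s))\<bar> \<le> 2 * \<bar>d k s\<bar> * (L * ?S)"
        by (auto simp: abs_mult intro!: mult_left_mono)
      then show "2 * d k s * (G k (\<lambda>i. y i s) - G k (\<lambda>i. z i s)) \<le> 2 * \<bar>d k s\<bar> * (L * ?S)" by linarith
    qed
    also have "\<dots> = 2 * L * ?S\<^sup>2" by (simp add: sum_distrib_left sum_distrib_right power2_eq_square mult_ac)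
    also have "\<dots> \<le> 2 * L * (E s * real N)"
      using sum_squared_le_sum_of_squares[of "\<lambda>i. \<bar>d i s\<bar>" "{..<N}"] L
      by (intro mult_left_mono) (auto simp: E_def)
    finally show "E' s \<le> 2 * L * real N * (E s + 0)" by (simp add: mult_ac)
  qed (use t in auto)
  moreover have "E 0 = 0" using init by (simp add: E_def d_def)
  ultimately have "E t \<le> 0" by simp
  then have "E t = 0" unfolding E_def by (meson antisym sum_nonneg zero_le_power2)
  then have "(d k t)\<^sup>2 = 0" unfolding E_def using k by (subst (asm) sum_nonneg_eq_0_iff) auto
  then show ?thesis by (simp add: d_def)
qed

section \<open>The inner product on continuous functions\<close>

text \<open>The \<open>L\<^sup>2\<close> inner product as a Henstock-Kurzweil integral over the closed interval, on which the fundamental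
  theorem of calculus is directly applicable.\<close>
definition ip :: "(real \<Rightarrow> real) \<Rightarrow> (real \<Rightarrow> real) \<Rightarrow> real" where
  "ip f g = integral {0..1} (\<lambda>x. f x * g x)"

lemma l2_inner_eq_ip:
  assumes "continuous_on {0..1} f" "continuous_on {0..1} g" shows "l2_inner f g = ip f g"
  unfolding l2_inner_def ip_def by (intro bdd_meas_LINT bdd_meas_mult bdd_meas_continuous assms)

lemma ip_cong: "(\<And>x. x \<in> {0..1} \<Longrightarrow> f x = f' x) \<Longrightarrow> (\<And>x. x \<in> {0..1} \<Longrightarrow> g x = g' x) \<Longrightarrow> ip f g = ip f' g'"
  unfolding ip_def by (intro integral_cong) auto

lemma ip_sym: "ip f g = ip g f" by (simp add: ip_def mult.commute)

lemma ip_integrable: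
  fixes f g :: "real \<Rightarrow> real"
  shows "continuous_on {0..1} f \<Longrightarrow> continuous_on {0..1} g \<Longrightarrow> (\<lambda>x. f x * g x) integrable_on {0..1}"
  by (intro integrable_continuous_interval continuous_on_mult)

lemma ip_lin:
  assumes "continuous_on {0..1} f" "continuous_on {0..1} g" "continuous_on {0..1} h"
  shows "ip (\<lambda>x. f x + c * g x) h = ip f h + c * ip g h"
proof -
  have "((\<lambda>x. f x * h x + c * (g x * h x)) has_integral ip f h + c * ip g h) {0..1}" unfolding ip_def
    by (intro has_integral_add has_integral_mult_right integrable_integral ip_integrable assms)
  then have "integral {0..1} (\<lambda>x. f x * h x + c * (g x * h x)) = ip f h + c * ip g h" by (rule integral_unique)
  moreover have "(\<lambda>x. f x * h x + c * (g x * h x)) = (\<lambda>x. (f x + c * g x) * h x)" by (auto simp: algebra_simps)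
  ultimately show ?thesis by (simp add: ip_def)
qed

lemma ip_nonneg: "ip f f \<ge> 0"
  unfolding ip_def by (cases "(\<lambda>x. f x * f x) integrable_on {0..1}")
    (auto intro: Henstock_Kurzweil_Integration.integral_nonneg simp: not_integrable_integral)

lemma ip_pos:
  assumes f: "continuous_on {0..1} f" and x: "x \<in> {0..1}" "f x \<noteq> 0" shows "ip f f > 0"
proof (rule ccontr)
  assume "\<not> ip f f > 0"
  then have z: "ip f f = 0" using ip_nonneg[of f] by simp
  have "((\<lambda>x. f x * f x) has_integral 0) (cbox 0 1)"
    using integrable_integral[OF ip_integrable[OF f f]] z by (simp add: ip_def)
  then have "f x * f x = 0"
    by (rule has_integral_0_cbox_imp_0[rotated 2]) (use f x in \<open>auto intro!: continuous_intros\<close>)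
  then show False using x by simp
qed

lemma ip_mono:
  assumes "continuous_on {0..1} f" "continuous_on {0..1} g" "\<And>x. x \<in> {0..1} \<Longrightarrow> \<bar>f x\<bar> \<le> \<bar>g x\<bar>"
  shows "ip f f \<le> ip g g"
  unfolding ip_def using assms
  by (intro integral_le ip_integrable) (auto simp: power2_eq_square[symmetric] abs_le_square_iff)

lemma ip_const: "ip (\<lambda>_. c) (\<lambda>_. c) = c\<^sup>2" by (simp add: ip_def power2_eq_square)

lemma ip_add_square:
  assumes f: "continuous_on {0..1} f" and g: "continuous_on {0..1} g"
  shows "ip (\<lambda>x. f x + c * g x) (\<lambda>x. f x + c * g x) = ip f f + 2 * c * ip f g + c\<^sup>2 * ip g g"
proof -
  have fg: "continuous_on {0..1} (\<lambda>x. f x + c * g x)" by (intro continuous_intros f g)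
  have "ip (\<lambda>x. f x + c * g x) (\<lambda>x. f x + c * g x) = ip f (\<lambda>x. f x + c * g x) + c * ip g (\<lambda>x. f x + c * g x)"
    by (rule ip_lin[OF f g fg])
  also have "ip f (\<lambda>x. f x + c * g x) = ip f f + c * ip f g"
    using ip_lin[OF f g f, of c] ip_sym by metis
  also have "ip g (\<lambda>x. f x + c * g x) = ip f g + c * ip g g"
    using ip_lin[OF f g g, of c] ip_sym by metis
  finally show ?thesis by (simp add: algebra_simps power2_eq_square)
qed

lemma ip_triangle2:
  assumes f: "continuous_on {0..1} f" and g: "continuous_on {0..1} g"
  shows "ip (\<lambda>x. f x + g x) (\<lambda>x. f x + g x) \<le> 2 * ip f f + 2 * ip g g"
proof -
  have "ip (\<lambda>x. f x + (-1) * g x) (\<lambda>x. f x + (-1) * g x) \<ge> 0" by (rule ip_nonneg)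
  then show ?thesis using ip_add_square[OF f g, of "-1"] ip_add_square[OF f g, of 1] by simp
qed

lemma ip_sum:
  fixes n :: nat
  assumes "\<And>i. i < n \<Longrightarrow> continuous_on {0..1} (e i)" "continuous_on {0..1} h"
  shows "ip (\<lambda>x. \<Sum>i<n. a i * e i x) h = (\<Sum>i<n. a i * ip (e i) h)"
proof -
  have "((\<lambda>x. \<Sum>i<n. a i * (e i x * h x)) has_integral (\<Sum>i<n. a i * ip (e i) h)) {0..1}"
    unfolding ip_def using assms
    by (intro has_integral_sum finite_lessThan has_integral_mult_right integrable_integral ip_integrable) auto
  then have "integral {0..1} (\<lambda>x. \<Sum>i<n. a i * (e i x * h x)) = (\<Sum>i<n. a i * ip (e i) h)" by (rule integral_unique)
  moreover have "(\<lambda>x. \<Sum>i<n. a i * (e i x * h x)) = (\<lambda>x. (\<Sum>i<n. a i * e i x) * h x)"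
    by (simp add: sum_distrib_right mult.assoc)
  ultimately show ?thesis by (simp add: ip_def)
qed

text \<open>The Cauchy-Schwarz inequality against the constant one, from the nonnegative variance of \<open>f\<close>.\<close>
lemma integral_square_le:
  fixes f :: "real \<Rightarrow> real"
  assumes f: "continuous_on {a..b} f" and ab: "a \<le> b"
  shows "(integral {a..b} f)\<^sup>2 \<le> (b - a) * integral {a..b} (\<lambda>x. (f x)\<^sup>2)"
proof (cases "a = b")
  case False
  then have p: "b - a > 0" using ab by simp
  define m where "m = integral {a..b} f / (b - a)"
  have fi: "f integrable_on {a..b}" "(\<lambda>x. (f x)\<^sup>2) integrable_on {a..b}"
    by (intro integrable_continuous_interval continuous_intros f)+
  have "((\<lambda>x. (f x)\<^sup>2 - 2 * m * f x + m\<^sup>2) has_integral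
      (integral {a..b} (\<lambda>x. (f x)\<^sup>2) - 2 * m * integral {a..b} f + (b - a) *\<^sub>R m\<^sup>2)) {a..b}"
    using ab has_integral_const_real[of "m\<^sup>2" a b]
    by (intro has_integral_add has_integral_diff has_integral_mult_right integrable_integral fi) auto
  then have "0 \<le> integral {a..b} (\<lambda>x. (f x)\<^sup>2) - 2 * m * integral {a..b} f + (b - a) *\<^sub>R m\<^sup>2"
  proof (rule has_integral_nonneg)
    fix x
    have "(f x)\<^sup>2 - 2 * m * f x + m\<^sup>2 = (f x - m)\<^sup>2" by (simp add: power2_diff)
    then show "0 \<le> (f x)\<^sup>2 - 2 * m * f x + m\<^sup>2" by simp
  qed
  moreover have mJ: "(b - a) * m = integral {a..b} f" using p by (simp add: m_def)
  moreover have "(b - a) *\<^sub>R m\<^sup>2 = integral {a..b} f * m"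
    unfolding mJ[symmetric] by (simp add: power2_eq_square)
  moreover have "2 * m * integral {a..b} f = 2 * (integral {a..b} f * m)" by simp
  ultimately have "0 \<le> integral {a..b} (\<lambda>x. (f x)\<^sup>2) - integral {a..b} f * m" by linarith
  then have "0 \<le> (b - a) * (integral {a..b} (\<lambda>x. (f x)\<^sup>2) - integral {a..b} f * m)" using p by simp
  also have "\<dots> = (b - a) * integral {a..b} (\<lambda>x. (f x)\<^sup>2) - integral {a..b} f * ((b - a) * m)" by (simp add: algebra_simps)
  finally show ?thesis by (simp add: mJ power2_eq_square)
qed simp

section \<open>One-sided derivatives on the unit interval\<close>

lemma derivative_within_Icc_unique:
  assumes "(f has_real_derivative D) (at x within {a..b})" "(f has_real_derivative D') (at x within {a..b})"
    "a < b" "x \<in> {a..b}"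
  shows "D = D'"
  using assms vector_derivative_within_closed_interval[of a b x f]
  by (metis has_real_derivative_iff_has_vector_derivative)

lemma dx_eq: "(f has_real_derivative D) (at x within {0..1}) \<Longrightarrow> x \<in> {0..1} \<Longrightarrow> dx f x = D"
  unfolding dx_def using vector_derivative_within_closed_interval[of 0 1 x f]
  by (simp add: has_real_derivative_iff_has_vector_derivative)

lemma C1_dx: "C1 f f' \<Longrightarrow> x \<in> {0..1} \<Longrightarrow> dx f x = f' x"
  by (auto simp: C1_def intro: dx_eq)

lemma C1_cong:
  assumes "C1 f f'" "\<And>x. x \<in> {0..1} \<Longrightarrow> g x = f x" "\<And>x. x \<in> {0..1} \<Longrightarrow> g' x = f' x"
  shows "C1 g g'"
  unfolding C1_def
proof (intro conjI ballI)
  fix x :: real assume x: "x \<in> {0..1}"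
  have "(f has_real_derivative g' x) (at x within {0..1})" using assms(1) assms(3)[OF x] x by (simp add: C1_def)
  then show "(g has_real_derivative g' x) (at x within {0..1})"
    by (rule has_field_derivative_transform_within[of _ _ _ _ 1]) (use x assms(2) in auto)
next
  have "continuous_on {0..1} f'" using assms(1) by (simp add: C1_def)
  then show "continuous_on {0..1} g'" by (rule continuous_on_eq) (simp add: assms(3))
qed

lemma C1_add_scaled: "C1 f f' \<Longrightarrow> C1 g g' \<Longrightarrow> C1 (\<lambda>x. f x + c * g x) (\<lambda>x. f' x + c * g' x)"
  unfolding C1_def by (auto intro!: derivative_eq_intros continuous_intros)

lemma C1_diff: "C1 f f' \<Longrightarrow> C1 g g' \<Longrightarrow> C1 (\<lambda>x. f x - g x) (\<lambda>x. f' x - g' x)"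
  using C1_add_scaled[of f f' g g' "-1"] by simp

lemma C1_sum: "(\<And>i. i < n \<Longrightarrow> C1 (e i) (e' i)) \<Longrightarrow> C1 (\<lambda>x. \<Sum>i<n. a i * e i x) (\<lambda>x. \<Sum>i<n. a i * e' i x)" for n :: nat
proof (induction n)
  case 0
  show ?case by (simp add: C1_def)
next
  case (Suc n)
  then show ?case using C1_add_scaled[of "\<lambda>x. \<Sum>i<n. a i * e i x" "\<lambda>x. \<Sum>i<n. a i * e' i x" "e n" "e' n" "a n"] by simp
qed

lemma C2_space_C1:
  "v \<in> C2_space \<longleftrightarrow> C1 v (dx v) \<and> C1 (dx v) (dx (dx v))"
proof -
  have d: "f differentiable (at x within {0..1}) \<longleftrightarrow> (f has_real_derivative dx f x) (at x within {0..1})" for f x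
    unfolding dx_def has_real_derivative_iff_has_vector_derivative by (rule vector_derivative_works)
  show ?thesis
    unfolding C2_space_def C1_def mem_Collect_eq d by (auto intro: DERIV_continuous_on)
qed

lemma C2_spaceI: assumes "C1 v v'" "C1 v' v''" shows "v \<in> C2_space"
proof -
  have 1: "C1 v (dx v)" by (rule C1_cong[OF assms(1)]) (use C1_dx[OF assms(1)] in auto)
  have "C1 (dx v) v''" by (rule C1_cong[OF assms(2)]) (use C1_dx[OF assms(1)] in auto)
  from C1_cong[OF this, of "dx v" "dx (dx v)"] C1_dx[OF this] have "C1 (dx v) (dx (dx v))" by blast
  with 1 show ?thesis by (simp add: C2_space_C1)
qed

section \<open>Meshes\<close>

context
  fixes xs :: "real list" assumes mesh: "is_mesh xs"
begin

lemma mesh_length: "length xs \<ge> 2" using mesh by (simp add: is_mesh_def)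

lemma mesh_first: "xs ! 0 = 0"
  using mesh by (metis hd_conv_nth is_mesh_def list.size(3) not_numeral_le_zero)

lemma mesh_last: "xs ! (length xs - 1) = 1"
  using mesh by (metis last_conv_nth is_mesh_def list.size(3) not_numeral_le_zero)

lemma mesh_less: "i < j \<Longrightarrow> j < length xs \<Longrightarrow> xs ! i < xs ! j"
  using mesh by (simp add: is_mesh_def sorted_wrt_nth_less)

lemma mesh_le: "i \<le> j \<Longrightarrow> j < length xs \<Longrightarrow> xs ! i \<le> xs ! j"
  using mesh_less[of i j] by (cases "i = j") auto

lemma mesh_in: "j < length xs \<Longrightarrow> xs ! j \<in> {0..1}"
  using mesh_le[of 0 j] mesh_le[of j "length xs - 1"] mesh_first mesh_last by auto

lemma mesh_cell: assumes x: "x \<in> {0..1}" obtains j where "Suc j < length xs" "x \<in> {xs ! j..xs ! Suc j}"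
proof -
  define m where "m = (LEAST m. m < length xs \<and> x \<le> xs ! m)"
  have ex: "length xs - 1 < length xs \<and> x \<le> xs ! (length xs - 1)" using mesh_length mesh_last x by auto
  have m: "m < length xs \<and> x \<le> xs ! m" unfolding m_def by (rule LeastI2_ex[where Q = "\<lambda>m. m < length xs \<and> x \<le> xs ! m"]) (use ex in blast)+
  show thesis
  proof (cases m)
    case 0
    then have "x = 0" using m mesh_first x by auto
    then show thesis using that[of 0] mesh_first mesh_length mesh_in[of "Suc 0"] by auto
  next
    case (Suc k)
    then have "\<not> (k < length xs \<and> x \<le> xs ! k)" unfolding m_def using not_less_Least[of k] by (metis lessI m_def)
    then show thesis using that[of k] m Suc by auto
  qed
qed

lemma mesh_widths_finite: "finite (mesh_widths xs)" "mesh_widths xs \<noteq> {}"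
proof -
  have "mesh_widths xs = (\<lambda>j. xs ! Suc j - xs ! j) ` {j. Suc j < length xs}" by (auto simp: mesh_widths_def)
  moreover have "finite {j. Suc j < length xs}" by (rule finite_subset[of _ "{..<length xs}"]) auto
  moreover have "0 \<in> {j. Suc j < length xs}" using mesh_length by auto
  ultimately show "finite (mesh_widths xs)" "mesh_widths xs \<noteq> {}" by auto
qed

lemma mesh_width_bounds:
  assumes "Suc j < length xs"
  shows "xs ! Suc j - xs ! j \<le> mesh_h xs" "Min (mesh_widths xs) \<le> xs ! Suc j - xs ! j" "0 < xs ! Suc j - xs ! j"
proof -
  have "xs ! Suc j - xs ! j \<in> mesh_widths xs" using assms by (auto simp: mesh_widths_def)
  then show "xs ! Suc j - xs ! j \<le> mesh_h xs" "Min (mesh_widths xs) \<le> xs ! Suc j - xs ! j"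
    unfolding mesh_h_def using mesh_widths_finite by auto
  show "0 < xs ! Suc j - xs ! j" using mesh_less[of j "Suc j"] assms by simp
qed

lemma mesh_min_pos: "0 < Min (mesh_widths xs)"
proof -
  have "Min (mesh_widths xs) \<in> mesh_widths xs" using mesh_widths_finite by (intro Min_in)
  then show ?thesis using mesh_width_bounds(3) by (auto simp: mesh_widths_def)
qed

lemma mesh_h_bounds: "0 < mesh_h xs" "mesh_h xs \<le> 1"
proof -
  have j: "Suc 0 < length xs" using mesh_length by simp
  show "0 < mesh_h xs" using mesh_width_bounds(1,3)[OF j] by linarith
  have "mesh_h xs \<in> mesh_widths xs" unfolding mesh_h_def using mesh_widths_finite by (intro Max_in)
  then obtain i where "Suc i < length xs" "mesh_h xs = xs ! Suc i - xs ! i" by (auto simp: mesh_widths_def)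
  then show "mesh_h xs \<le> 1" using mesh_in[of i] mesh_in[of "Suc i"] by auto
qed

lemma integral_mesh_split:
  fixes f :: "real \<Rightarrow> real"
  assumes f: "continuous_on {0..1} f"
  shows "integral {0..1} f = (\<Sum>j<length xs - 1. integral {xs ! j..xs ! Suc j} f)"
proof -
  have "integral {0..xs ! k} f = (\<Sum>j<k. integral {xs ! j..xs ! Suc j} f)" if "k < length xs" for k
    using that
  proof (induction k)
    case 0
    then show ?case by (simp add: mesh_first)
  next
    case (Suc k)
    have "f integrable_on {0..xs ! Suc k}"
      using mesh_in[of "Suc k"] Suc.prems
      by (intro integrable_continuous_interval continuous_on_subset[OF f]) auto
    then have "integral {0..xs ! k} f + integral {xs ! k..xs ! Suc k} f = integral {0..xs ! Suc k} f"
      using mesh_in[of k] mesh_le[of k "Suc k"] Suc.prems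
      by (intro Henstock_Kurzweil_Integration.integral_combine) auto
    then show ?case using Suc by simp
  qed
  from this[of "length xs - 1"] show ?thesis using mesh_length mesh_last by simp
qed

lemma ip_mesh_split:
  assumes f: "continuous_on {0..1} f"
  shows "ip f f = (\<Sum>j<length xs - 1. integral {xs ! j..xs ! Suc j} (\<lambda>x. (f x)\<^sup>2))"
  unfolding ip_def power2_eq_square by (rule integral_mesh_split) (intro continuous_intros f)

lemma cell_integral_le:
  assumes f: "continuous_on {0..1} f" and j: "Suc j < length xs"
  shows "integral {xs ! j..xs ! Suc j} (\<lambda>x. (f x)\<^sup>2) \<le> ip f f"
  unfolding ip_def power2_eq_square using mesh_in[of j] mesh_in[of "Suc j"] j
  by (intro integral_subset_le) (auto intro!: integrable_continuous_interval continuous_intros continuous_on_subset[OF f])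

end

section \<open>Cubic splines form a finite-dimensional space\<close>

lemma S4_C1: assumes "f \<in> S4 xs" shows "C1 f (dx f)" "C1 (dx f) (dx (dx f))"
  using assms by (auto simp: S4_def C2_space_C1)

lemma S4_cont: assumes "f \<in> S4 xs" shows "continuous_on {0..1} f" "continuous_on {0..1} (dx f)"
  using C1_continuous S4_C1[OF assms] by blast+

lemma S4_piece:
  assumes "f \<in> S4 xs" "Suc j < length xs"
  shows "\<exists>p. degree p \<le> 3 \<and> (\<forall>x\<in>{xs ! j..xs ! Suc j}. f x = poly p x)"
  using assms unfolding S4_def by blast

lemma S4_lin: assumes f: "f \<in> S4 xs" and g: "g \<in> S4 xs" shows "(\<lambda>x. f x + c * g x) \<in> S4 xs"
  unfolding S4_def
proof (intro CollectI conjI allI impI)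
  show "(\<lambda>x. f x + c * g x) \<in> C2_space"
    by (rule C2_spaceI[OF C1_add_scaled[OF S4_C1(1)[OF f] S4_C1(1)[OF g]] C1_add_scaled[OF S4_C1(2)[OF f] S4_C1(2)[OF g]]])
  fix j assume j: "Suc j < length xs"
  obtain p where p: "degree p \<le> 3" "\<forall>x\<in>{xs ! j..xs ! Suc j}. f x = poly p x" using S4_piece[OF f j] by blast
  obtain q where q: "degree q \<le> 3" "\<forall>x\<in>{xs ! j..xs ! Suc j}. g x = poly q x" using S4_piece[OF g j] by blast
  have "degree (p + smult c q) \<le> 3" using p(1) q(1) by (intro degree_add_le) (auto intro: order_trans[OF degree_smult_le])
  then show "\<exists>p. degree p \<le> 3 \<and> (\<forall>x\<in>{xs ! j..xs ! Suc j}. f x + c * g x = poly p x)"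
    using p q by (intro exI[of _ "p + smult c q"]) auto
qed

lemma S4_const: "(\<lambda>x. c) \<in> S4 xs"
proof -
  have "C1 (\<lambda>x. c) (\<lambda>x. 0)" "C1 (\<lambda>x. 0) (\<lambda>x. 0)" by (auto simp: C1_def)
  then show ?thesis unfolding S4_def
    by (auto intro!: C2_spaceI exI[of _ "[:c:]"])
qed

lemma S40_lin: "f \<in> S40 xs \<Longrightarrow> g \<in> S40 xs \<Longrightarrow> (\<lambda>x. f x + c * g x) \<in> S40 xs"
  by (auto simp: S40_def S4_lin)

lemma poly_zero_if_four_roots:
  fixes p :: "real poly"
  assumes "degree p \<le> 3" "a < b" "\<And>k. k \<in> {0..3::nat} \<Longrightarrow> poly p (a + (b - a) * real k / 3) = 0"
  shows "p = 0"
proof (rule ccontr)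
  assume p: "p \<noteq> 0"
  have "inj_on (\<lambda>k. a + (b - a) * real k / 3) {0..3::nat}" using assms(2) by (auto simp: inj_on_def)
  then have "card ((\<lambda>k. a + (b - a) * real k / 3) ` {0..3::nat}) = 4" by (simp add: card_image)
  moreover have "(\<lambda>k. a + (b - a) * real k / 3) ` {0..3::nat} \<subseteq> {x. poly p x = 0}" using assms(3) by auto
  ultimately have "4 \<le> card {x. poly p x = 0}" using card_mono[OF poly_roots_finite[OF p]] by metis
  then show False using card_poly_roots_bound[OF p] assms(1) by linarith
qed

text \<open>Four equidistant points in each cell, which determine a cubic there. Point evaluations at them serve as a finite
  set of functionals separating splines.\<close>
definition spline_points :: "real list \<Rightarrow> real set" where
  "spline_points xs = (\<lambda>(j, k). xs ! j + (xs ! Suc j - xs ! j) * real k / 3) ` ({j. Suc j < length xs} \<times> {0..3::nat})"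

lemma spline_points_finite: "finite (spline_points xs)"
proof -
  have "finite {j. Suc j < length xs}" by (rule finite_subset[of _ "{..<length xs}"]) auto
  then show ?thesis unfolding spline_points_def by (intro finite_imageI finite_cartesian_product) auto
qed

lemma spline_point_in_cell:
  assumes "is_mesh xs" "Suc j < length xs" "k \<le> (3::nat)"
  shows "xs ! j + (xs ! Suc j - xs ! j) * real k / 3 \<in> {xs ! j..xs ! Suc j}"
proof -
  have w: "xs ! Suc j - xs ! j > 0" using mesh_width_bounds(3)[OF assms(1,2)] .
  have "(xs ! Suc j - xs ! j) * (real k / 3) \<le> (xs ! Suc j - xs ! j) * 1" using assms w by (intro mult_left_mono) auto
  then show ?thesis using w by auto
qed

lemma spline_points_in: assumes m: "is_mesh xs" shows "spline_points xs \<subseteq> {0..1}"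
proof
  fix y assume "y \<in> spline_points xs"
  then obtain j k where "Suc j < length xs" "k \<le> (3::nat)" "y = xs ! j + (xs ! Suc j - xs ! j) * real k / 3"
    by (auto simp: spline_points_def)
  then show "y \<in> {0..1}" using spline_point_in_cell[OF m, of j k] mesh_in[OF m, of j] mesh_in[OF m, of "Suc j"] by auto
qed

lemma S4_determined:
  assumes m: "is_mesh xs" and f: "f \<in> S4 xs" and z: "\<forall>p\<in>spline_points xs. f p = 0"
  shows "\<forall>x\<in>{0..1}. f x = 0"
proof
  fix x :: real assume "x \<in> {0..1}"
  then obtain j where j: "Suc j < length xs" "x \<in> {xs ! j..xs ! Suc j}" using mesh_cell[OF m] by metis
  obtain p where p: "degree p \<le> 3" "\<forall>x\<in>{xs ! j..xs ! Suc j}. f x = poly p x" using S4_piece[OF f j(1)] by blast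
  have "p = 0"
  proof (rule poly_zero_if_four_roots[OF p(1)])
    show "xs ! j < xs ! Suc j" using mesh_width_bounds(3)[OF m j(1)] by simp
    fix k assume k: "k \<in> {0..3::nat}"
    then have "xs ! j + (xs ! Suc j - xs ! j) * real k / 3 \<in> spline_points xs"
      using j(1) by (auto simp: spline_points_def)
    then show "poly p (xs ! j + (xs ! Suc j - xs ! j) * real k / 3) = 0"
      using z bspec[OF p(2) spline_point_in_cell[OF m j(1), of k]] k by simp
  qed
  then show "f x = 0" using bspec[OF p(2) j(2)] by simp
qed

text \<open>Members of the spline spaces are functions on the whole line that are determined on \<open>[0, 1]\<close> only; the expansion is
  therefore required on \<open>[0, 1]\<close>, and \<open>n\<close> is the dimension of the space of restrictions.\<close>
definition onb :: "(real \<Rightarrow> real) set \<Rightarrow> ((real \<Rightarrow> real) \<Rightarrow> (real \<Rightarrow> real) \<Rightarrow> real) \<Rightarrow> nat \<Rightarrow> (nat \<Rightarrow> real \<Rightarrow> real) \<Rightarrow> bool" where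
  "onb V B n e \<longleftrightarrow> (\<forall>i<n. e i \<in> V) \<and> (\<forall>i<n. \<forall>j<n. B (e i) (e j) = (if i = j then 1 else 0)) \<and>
      (\<forall>f\<in>V. \<forall>x\<in>{0..1}. f x = (\<Sum>i<n. B f (e i) * e i x))"

text \<open>The second part, that coordinates are combinations of point values, makes the coordinates of a curve in the spline
  space differentiable as soon as the curve is differentiable at each point.\<close>
lemma S4_onb:
  assumes m: "is_mesh xs"
  shows "\<exists>n e. onb (S4 xs) ip n e \<and>
    (\<forall>i<n. \<exists>c. \<forall>f\<in>S4 xs. ip f (e i) = (\<Sum>p\<in>spline_points xs. c p * f p))"
proof -
  have "\<exists>n e. (\<forall>i<n::nat. e i \<in> S4 xs) \<and> (\<forall>i<n. \<forall>j<n. ip (e i) (e j) = (if i = j then 1 else 0)) \<and>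
      (\<forall>f\<in>S4 xs. \<forall>x\<in>{0..1}. f x = (\<Sum>i<n. ip f (e i) * e i x)) \<and>
      (\<forall>i<n. \<exists>c. \<forall>f\<in>S4 xs. ip f (e i) = (\<Sum>p\<in>spline_points xs. c p * f p))"
  proof (rule orthonormal_basis_exists[OF spline_points_finite spline_points_in[OF m]])
    show "ip (\<lambda>x. f x + c * g x) h = ip f h + c * ip g h" if "f \<in> S4 xs" "g \<in> S4 xs" "h \<in> S4 xs" for f g h c
      by (intro ip_lin S4_cont(1)[OF that(1)] S4_cont(1)[OF that(2)] S4_cont(1)[OF that(3)])
    show "ip f f > 0" if "f \<in> S4 xs" "x \<in> {0..1}" "f x \<noteq> 0" for f x
      by (rule ip_pos[OF S4_cont(1)[OF that(1)] that(2,3)])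
    show "ip f g = ip f' g" if "f \<in> S4 xs" "f' \<in> S4 xs" "g \<in> S4 xs" "\<forall>x\<in>{0..1}. f x = f' x" for f f' g
      using that(4) by (intro ip_cong) auto
    show "ip f g = ip g f" for f g by (rule ip_sym)
    show "\<forall>x\<in>{0..1}. f x = 0" if "f \<in> S4 xs" "\<forall>p\<in>spline_points xs. f p = 0" for f
      using S4_determined[OF m that] .
  qed (use S4_lin S4_const in auto)
  then show ?thesis by (simp only: onb_def conj_assoc)
qed

text \<open>The form \<open>a\<close> with classical instead of weak derivatives.\<close>
definition aip :: "(real \<Rightarrow> real) \<Rightarrow> (real \<Rightarrow> real) \<Rightarrow> real" where
  "aip f g = ip f g + 1/3 * ip (dx f) (dx g)"

lemma aip_sym: "aip f g = aip g f" by (simp add: aip_def ip_sym[of f] ip_sym[of "dx f"])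

lemma aip_lin:
  assumes f: "C1 f f'" and g: "C1 g g'" and h: "C1 h h'"
  shows "aip (\<lambda>x. f x + c * g x) h = aip f h + c * aip g h"
proof -
  have "ip (dx (\<lambda>x. f x + c * g x)) (dx h) = ip (\<lambda>x. f' x + c * g' x) h'"
    by (intro ip_cong C1_dx[OF C1_add_scaled[OF f g]] C1_dx[OF h])
  also have "\<dots> = ip f' h' + c * ip g' h'" by (intro ip_lin C1_continuous(2)[OF f] C1_continuous(2)[OF g] C1_continuous(2)[OF h])
  also have "ip f' h' = ip (dx f) (dx h)" by (intro ip_cong C1_dx[OF f, symmetric] C1_dx[OF h, symmetric])
  also have "ip g' h' = ip (dx g) (dx h)" by (intro ip_cong C1_dx[OF g, symmetric] C1_dx[OF h, symmetric])
  moreover have "ip (\<lambda>x. f x + c * g x) h = ip f h + c * ip g h"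
    by (intro ip_lin C1_continuous(1)[OF f] C1_continuous(1)[OF g] C1_continuous(1)[OF h])
  ultimately show ?thesis by (simp add: aip_def algebra_simps)
qed

lemma S40_onb:
  assumes m: "is_mesh xs"
  shows "\<exists>n e. onb (S40 xs) aip n e \<and>
    (\<forall>i<n. \<exists>c. \<forall>f\<in>S40 xs. aip f (e i) = (\<Sum>p\<in>spline_points xs. c p * f p))"
proof -
  have S: "f \<in> S4 xs" if "f \<in> S40 xs" for f using that by (simp add: S40_def)
  have C: "C1 f (dx f)" if "f \<in> S40 xs" for f using S4_C1(1)[OF S[OF that]] .
  have "\<exists>n e. (\<forall>i<n::nat. e i \<in> S40 xs) \<and> (\<forall>i<n. \<forall>j<n. aip (e i) (e j) = (if i = j then 1 else 0)) \<and>
      (\<forall>f\<in>S40 xs. \<forall>x\<in>{0..1}. f x = (\<Sum>i<n. aip f (e i) * e i x)) \<and>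
      (\<forall>i<n. \<exists>c. \<forall>f\<in>S40 xs. aip f (e i) = (\<Sum>p\<in>spline_points xs. c p * f p))"
  proof (rule orthonormal_basis_exists[OF spline_points_finite spline_points_in[OF m]])
    show "aip (\<lambda>x. f x + c * g x) h = aip f h + c * aip g h" if "f \<in> S40 xs" "g \<in> S40 xs" "h \<in> S40 xs" for f g h c
      by (rule aip_lin[OF C[OF that(1)] C[OF that(2)] C[OF that(3)]])
    show "aip f f > 0" if "f \<in> S40 xs" "x \<in> {0..1}" "f x \<noteq> 0" for f x
      using ip_pos[OF S4_cont(1)[OF S[OF that(1)]] that(2,3)] ip_nonneg[of "dx f"] by (simp add: aip_def)
    show "aip f g = aip f' g" if "f \<in> S40 xs" "f' \<in> S40 xs" "g \<in> S40 xs" "\<forall>x\<in>{0..1}. f x = f' x" for f f' g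
    proof -
      have "C1 f (dx f')" by (rule C1_cong[OF C[OF that(2)]]) (use that(4) in auto)
      from C1_dx[OF this] show ?thesis unfolding aip_def using that(4) by (intro arg_cong2[where f = "(+)"] arg_cong[where f = "(*) _"] ip_cong) auto
    qed
    show "aip f g = aip g f" for f g by (rule aip_sym)
    show "\<forall>x\<in>{0..1}. f x = 0" if "f \<in> S40 xs" "\<forall>p\<in>spline_points xs. f p = 0" for f
      using S4_determined[OF m S[OF that(1)] that(2)] .
    show "(\<lambda>x. 0) \<in> S40 xs" using S4_const[of 0] by (simp add: S40_def)
  qed (use S40_lin in auto)
  then show ?thesis by (simp only: onb_def conj_assoc)
qed

section \<open>Inverse inequalities\<close>

lemma onb_expansion:
  assumes V: "onb V ip n e" and c: "\<And>f. f \<in> V \<Longrightarrow> continuous_on {0..1} f" and g: "continuous_on {0..1} g" and f: "f \<in> V"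
  shows "ip g f = (\<Sum>i<n. ip f (e i) * ip g (e i))"
proof -
  have e: "continuous_on {0..1} (e i)" if "i < n" for i using V c that by (auto simp: onb_def)
  have "ip f g = ip (\<lambda>x. \<Sum>i<n. ip f (e i) * e i x) g"
    by (rule ip_cong) (use V f in \<open>auto simp: onb_def\<close>)
  also have "\<dots> = (\<Sum>i<n. ip f (e i) * ip (e i) g)" by (rule ip_sum) (use e g in auto)
  finally show ?thesis by (simp add: ip_sym[of g])
qed

text \<open>Equivalence of norms on cubics over the reference interval: the constant comes from bounds for
  an orthonormal basis and its derivatives.\<close>
lemma cubic_reference_bound:
  obtains C where "C > 0" "\<And>(p::real poly) x. degree p \<le> 3 \<Longrightarrow> x \<in> {0..1} \<Longrightarrow>
     (poly p x)\<^sup>2 \<le> C * integral {0..1} (\<lambda>x. (poly p x)\<^sup>2) \<and>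
     (poly (pderiv p) x)\<^sup>2 \<le> C * integral {0..1} (\<lambda>x. (poly p x)\<^sup>2)"
proof -
  define V where "V = {f. \<exists>p::real poly. degree p \<le> 3 \<and> f = poly p}"
  have cV: "continuous_on {0..1} f" if "f \<in> V" for f using that by (auto simp: V_def intro!: continuous_intros)
  define X where "X = (\<lambda>k. real k / 3) ` {0..3::nat}"
  have "\<exists>n e. (\<forall>i<n::nat. e i \<in> V) \<and> (\<forall>i<n. \<forall>j<n. ip (e i) (e j) = (if i = j then 1 else 0)) \<and>
      (\<forall>f\<in>V. \<forall>x\<in>{0..1}. f x = (\<Sum>i<n. ip f (e i) * e i x)) \<and>
      (\<forall>i<n. \<exists>c. \<forall>f\<in>V. ip f (e i) = (\<Sum>p\<in>X. c p * f p))"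
  proof (rule orthonormal_basis_exists)
    show "finite X" "X \<subseteq> {0..1}" by (auto simp: X_def)
    show "(\<lambda>x. f x + c * g x) \<in> V" if fg: "f \<in> V" "g \<in> V" for f g c
    proof -
      obtain p q where p: "degree p \<le> 3" "f = poly p" and q: "degree q \<le> 3" "g = poly q" using fg by (auto simp: V_def)
      have "degree (p + smult c q) \<le> 3" using p(1) q(1) by (intro degree_add_le) (auto intro: order_trans[OF degree_smult_le])
      moreover have "(\<lambda>x. f x + c * g x) = poly (p + smult c q)" by (auto simp: p q)
      ultimately show ?thesis unfolding V_def by blast
    qed
    show "(\<lambda>x. 0) \<in> V" unfolding V_def by (auto intro!: exI[of _ 0])
    show "\<forall>x\<in>{0..1}. f x = 0" if f: "f \<in> V" and z: "\<forall>p\<in>X. f p = 0" for f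
    proof -
      obtain p where p: "degree p \<le> 3" "f = poly p" using f by (auto simp: V_def)
      have "p = 0" by (rule poly_zero_if_four_roots[OF p(1), of 0 1]) (use z p in \<open>auto simp: X_def\<close>)
      then show ?thesis by (simp add: p)
    qed
    show "ip (\<lambda>x. f x + c * g x) h = ip f h + c * ip g h" if "f \<in> V" "g \<in> V" "h \<in> V" for f g h c
      by (intro ip_lin cV that)
    show "ip f f > 0" if "f \<in> V" "x \<in> {0..1}" "f x \<noteq> 0" for f x by (rule ip_pos[OF cV[OF that(1)] that(2,3)])
    show "ip f g = ip f' g" if "f \<in> V" "f' \<in> V" "g \<in> V" "\<forall>x\<in>{0..1}. f x = f' x" for f f' g
      using that(4) by (intro ip_cong) auto
    show "ip f g = ip g f" for f g by (rule ip_sym)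
  qed
  then obtain n :: nat and e where E: "(\<forall>i<n::nat. e i \<in> V) \<and> (\<forall>i<n. \<forall>j<n. ip (e i) (e j) = (if i = j then 1 else 0)) \<and>
      (\<forall>f\<in>V. \<forall>x\<in>{0..1}. f x = (\<Sum>i<n. ip f (e i) * e i x)) \<and>
      (\<forall>i<n. \<exists>c. \<forall>f\<in>V. ip f (e i) = (\<Sum>p\<in>X. c p * f p))"
    by (elim exE) (rule that)
  then have o: "onb V ip n e" by (simp add: onb_def)
  have "\<forall>i. \<exists>q. i < n \<longrightarrow> e i = poly q" using E unfolding V_def by blast
  then obtain q where q: "\<And>i. i < n \<longrightarrow> e i = poly (q i)" by metis
  have "\<exists>M. \<forall>x\<in>{0..1}. \<bar>poly (q i) x\<bar> \<le> M \<and> \<bar>poly (pderiv (q i)) x\<bar> \<le> M" for i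
  proof -
    have "bounded (poly r ` {0..1})" for r :: "real poly"
      by (intro compact_imp_bounded compact_continuous_image continuous_intros) auto
    then obtain M1 M2 where "\<forall>x\<in>{0..1}. \<bar>poly (q i) x\<bar> \<le> M1" "\<forall>x\<in>{0..1}. \<bar>poly (pderiv (q i)) x\<bar> \<le> M2"
      unfolding bounded_iff by (metis image_eqI real_norm_def)
    then show ?thesis by (intro exI[of _ "max M1 M2"]) (auto simp: le_max_iff_disj)
  qed
  then obtain M where M: "\<And>i. \<forall>x\<in>{0..1}. \<bar>poly (q i) x\<bar> \<le> M i \<and> \<bar>poly (pderiv (q i)) x\<bar> \<le> M i" by metis
  define C where "C = (\<Sum>i<n. M i)\<^sup>2 + 1"
  have main: "(poly p x)\<^sup>2 \<le> C * integral {0..1} (\<lambda>x. (poly p x)\<^sup>2) \<and>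
     (poly (pderiv p) x)\<^sup>2 \<le> C * integral {0..1} (\<lambda>x. (poly p x)\<^sup>2)" if p: "degree p \<le> 3" and x: "x \<in> {0..1}" for p x
  proof -
    have pV: "poly p \<in> V" using p by (auto simp: V_def)
    define J where "J = integral {0..1} (\<lambda>x. (poly p x)\<^sup>2)"
    have J: "J = ip (poly p) (poly p)" by (simp add: J_def ip_def power2_eq_square)
    have JS: "J = (\<Sum>i<n. (ip (poly p) (e i))\<^sup>2)"
      unfolding J by (subst onb_expansion[OF o cV cV[OF pV] pV]) (auto simp: power2_eq_square)
    define c where "c i = ip (poly p) (e i)" for i
    have cb: "\<bar>c i\<bar> \<le> sqrt J" if "i < n" for i
    proof -
      have "(c i)\<^sup>2 \<le> J" unfolding JS c_def using that by (intro member_le_sum) auto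
      then show ?thesis by (metis real_sqrt_abs real_sqrt_le_iff)
    qed
    have J0: "J \<ge> 0" unfolding J by (rule ip_nonneg)
    have val: "poly p y = (\<Sum>i<n. c i * poly (q i) y)" if "y \<in> {0..1}" for y
    proof -
      have "poly p y = (\<Sum>i<n. c i * e i y)" using o pV that by (auto simp: onb_def c_def)
      also have "\<dots> = (\<Sum>i<n. c i * poly (q i) y)" by (rule sum.cong) (use q in auto)
      finally show ?thesis .
    qed
    have "((\<lambda>y. \<Sum>i<n. c i * poly (q i) y) has_real_derivative (\<Sum>i<n. c i * poly (pderiv (q i)) x)) (at x within {0..1})"
      by (intro DERIV_sum DERIV_cmult) (auto intro: has_field_derivative_at_within poly_DERIV)
    then have "(poly p has_real_derivative (\<Sum>i<n. c i * poly (pderiv (q i)) x)) (at x within {0..1})"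
      by (rule has_field_derivative_transform_within[of _ _ _ _ 1]) (use x val in auto)
    then have der: "poly (pderiv p) x = (\<Sum>i<n. c i * poly (pderiv (q i)) x)"
      by (rule derivative_within_Icc_unique[OF has_field_derivative_at_within[OF poly_DERIV]]) (use x in auto)
    have bound: "(\<Sum>i<n. c i * r i)\<^sup>2 \<le> C * J" if r: "\<And>i. i < n \<Longrightarrow> \<bar>r i\<bar> \<le> M i" for r
    proof -
      have "\<bar>\<Sum>i<n. c i * r i\<bar> \<le> (\<Sum>i<n. sqrt J * M i)"
        by (rule order_trans[OF sum_abs sum_mono]) (use cb r J0 in \<open>auto simp: abs_mult intro!: mult_mono\<close>)
      also have "\<dots> = sqrt J * (\<Sum>i<n. M i)" by (simp add: sum_distrib_left)
      finally have "\<bar>\<Sum>i<n. c i * r i\<bar>\<^sup>2 \<le> (sqrt J * (\<Sum>i<n. M i))\<^sup>2" by (rule power_mono) simp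
      also have "\<dots> = J * (\<Sum>i<n. M i)\<^sup>2" using J0 by (simp add: power_mult_distrib)
      also have "\<dots> \<le> C * J" using J0 by (simp add: C_def algebra_simps)
      finally show ?thesis by simp
    qed
    show ?thesis unfolding J_def[symmetric] val[OF x] der
      by (intro conjI bound) (use M x in auto)
  qed
  show thesis by (rule that[of C]) (use main in \<open>auto simp: C_def add_nonneg_pos\<close>)
qed

text \<open>Transport of the reference estimate to \<open>[a, b]\<close> by an affine substitution; each derivative costs a factor
  \<open>1 / (b - a)\<close>.\<close>
lemma cubic_scaled_bound:
  obtains C where "C > 0" "\<And>(p::real poly) a b x. degree p \<le> 3 \<Longrightarrow> a < b \<Longrightarrow> x \<in> {a..b} \<Longrightarrow>
     (poly p x)\<^sup>2 \<le> C / (b - a) * integral {a..b} (\<lambda>x. (poly p x)\<^sup>2) \<and>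
     (poly (pderiv p) x)\<^sup>2 \<le> C / (b - a) ^ 3 * integral {a..b} (\<lambda>x. (poly p x)\<^sup>2)"
proof -
  obtain C where C: "C > 0" and ref: "\<And>(p::real poly) x. degree p \<le> 3 \<Longrightarrow> x \<in> {0..1} \<Longrightarrow>
     (poly p x)\<^sup>2 \<le> C * integral {0..1} (\<lambda>x. (poly p x)\<^sup>2) \<and>
     (poly (pderiv p) x)\<^sup>2 \<le> C * integral {0..1} (\<lambda>x. (poly p x)\<^sup>2)"
    by (rule cubic_reference_bound) (rule that; assumption)
  have "(poly p x)\<^sup>2 \<le> C / (b - a) * integral {a..b} (\<lambda>x. (poly p x)\<^sup>2) \<and>
     (poly (pderiv p) x)\<^sup>2 \<le> C / (b - a) ^ 3 * integral {a..b} (\<lambda>x. (poly p x)\<^sup>2)"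
    if p: "degree p \<le> 3" and ab: "a < b" and x: "x \<in> {a..b}" for p :: "real poly" and a b x
  proof -
    define d where "d = b - a"
    have d: "d > 0" using ab by (simp add: d_def)
    define r where "r = pcompose p [:a, d:]"
    have dr: "degree r \<le> 3" using p d by (simp add: r_def degree_pcompose)
    have rp: "poly r s = poly p (a + d * s)" for s by (simp add: r_def poly_pcompose mult.commute)
    have rd: "poly (pderiv r) s = d * poly (pderiv p) (a + d * s)" for s
      by (simp add: r_def pderiv_pcompose poly_pcompose mult.commute pderiv_pCons)
    have "((\<lambda>s. d *\<^sub>R (poly p (a + d * s))\<^sup>2) has_integral integral {a + d * 0..a + d * 1} (\<lambda>x. (poly p x)\<^sup>2)) {0..1}"
    proof (rule has_integral_substitution[where c = a and d = b])
      have "a + d * s \<in> {a..b}" if "s \<in> {0..1}" for s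
      proof -
        have "0 \<le> d * s" "d * s \<le> d * 1" using that d by (auto intro: mult_left_mono)
        then show ?thesis by (simp add: d_def)
      qed
      then show "(\<lambda>s. a + d * s) ` {0..1} \<subseteq> {a..b}" by blast
    qed (use ab d in \<open>auto intro!: continuous_intros derivative_eq_intros\<close>)
    then have "integral {0..1} (\<lambda>s. d * (poly p (a + d * s))\<^sup>2) = integral {a..b} (\<lambda>x. (poly p x)\<^sup>2)"
      by (auto simp: d_def dest: integral_unique)
    then have int: "integral {0..1} (\<lambda>s. (poly r s)\<^sup>2) = integral {a..b} (\<lambda>x. (poly p x)\<^sup>2) / d"
      using d by (simp add: rp field_simps)
    define s where "s = (x - a) / d"
    have s: "s \<in> {0..1}" "a + d * s = x" using x d by (auto simp: s_def d_def field_simps)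
    have 1: "(poly p x)\<^sup>2 \<le> C * (integral {a..b} (\<lambda>x. (poly p x)\<^sup>2) / d)"
      and 2: "(d * poly (pderiv p) x)\<^sup>2 \<le> C * (integral {a..b} (\<lambda>x. (poly p x)\<^sup>2) / d)"
      using ref[OF dr s(1), unfolded int rd rp[of s] s(2)] by simp_all
    have "(poly (pderiv p) x)\<^sup>2 = (d * poly (pderiv p) x)\<^sup>2 / d\<^sup>2" using d by (simp add: power_mult_distrib)
    also have "\<dots> \<le> C * (integral {a..b} (\<lambda>x. (poly p x)\<^sup>2) / d) / d\<^sup>2" using 2 by (rule divide_right_mono) simp
    also have "\<dots> = C / d ^ 3 * integral {a..b} (\<lambda>x. (poly p x)\<^sup>2)" by (simp add: power2_eq_square power3_eq_cube)
    finally show ?thesis using 1 by (simp add: d_def)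
  qed
  with C show thesis by (rule that)
qed

text \<open>The derivative of a spline on a cell is the derivative of its polynomial, also at the ends of the cell.\<close>
lemma S4_piece_deriv:
  assumes m: "is_mesh xs" and f: "f \<in> S4 xs" and j: "Suc j < length xs"
  shows "\<exists>p. degree p \<le> 3 \<and> (\<forall>x\<in>{xs ! j..xs ! Suc j}. f x = poly p x \<and> dx f x = poly (pderiv p) x)"
proof -
  obtain p where p: "degree p \<le> 3" "\<forall>x\<in>{xs ! j..xs ! Suc j}. f x = poly p x" using S4_piece[OF f j] by blast
  have lt: "xs ! j < xs ! Suc j" using mesh_width_bounds(3)[OF m j] by simp
  have sub: "{xs ! j..xs ! Suc j} \<subseteq> {0..1}" using mesh_in[OF m, of j] mesh_in[OF m j] j by auto
  have "dx f x = poly (pderiv p) x" if x: "x \<in> {xs ! j..xs ! Suc j}" for x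
  proof (rule derivative_within_Icc_unique[OF _ _ lt x])
    have "(f has_real_derivative dx f x) (at x within {0..1})" using S4_C1(1)[OF f] sub x by (auto simp: C1_def)
    then show "(f has_real_derivative dx f x) (at x within {xs ! j..xs ! Suc j})" by (rule DERIV_subset[OF _ sub])
    have "(poly p has_real_derivative poly (pderiv p) x) (at x within {xs ! j..xs ! Suc j})"
      by (rule has_field_derivative_at_within[OF poly_DERIV])
    then show "(f has_real_derivative poly (pderiv p) x) (at x within {xs ! j..xs ! Suc j})"
      by (rule has_field_derivative_transform_within[of _ _ _ _ 1]) (use x p(2) in auto)
  qed
  then show ?thesis using p by blast
qed

text \<open>The estimates for cubics on single cells, with the cell width bounded below by the smallest width. The second one
  applies the first to the derivative, a quadratic on each cell; the third sums over the cells.\<close>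
lemma inverse_inequalities:
  obtains C where "C > 0"
    "\<And>xs f x. is_mesh xs \<Longrightarrow> f \<in> S4 xs \<Longrightarrow> x \<in> {0..1} \<Longrightarrow> (f x)\<^sup>2 \<le> C / Min (mesh_widths xs) * ip f f"
    "\<And>xs f x. is_mesh xs \<Longrightarrow> f \<in> S4 xs \<Longrightarrow> x \<in> {0..1} \<Longrightarrow> (dx f x)\<^sup>2 \<le> C / Min (mesh_widths xs) * ip (dx f) (dx f)"
    "\<And>xs f. is_mesh xs \<Longrightarrow> f \<in> S4 xs \<Longrightarrow> ip (dx f) (dx f) \<le> C / (Min (mesh_widths xs))\<^sup>2 * ip f f"
proof -
  obtain C where C: "C > 0" and loc: "\<And>(p::real poly) a b x. degree p \<le> 3 \<Longrightarrow> a < b \<Longrightarrow> x \<in> {a..b} \<Longrightarrow>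
     (poly p x)\<^sup>2 \<le> C / (b - a) * integral {a..b} (\<lambda>x. (poly p x)\<^sup>2) \<and>
     (poly (pderiv p) x)\<^sup>2 \<le> C / (b - a) ^ 3 * integral {a..b} (\<lambda>x. (poly p x)\<^sup>2)"
    by (rule cubic_scaled_bound) (rule that; assumption)
  have cell: "(f x)\<^sup>2 \<le> C / Min (mesh_widths xs) * integral {xs ! j..xs ! Suc j} (\<lambda>x. (f x)\<^sup>2)"
    "(dx f x)\<^sup>2 \<le> C / Min (mesh_widths xs) * integral {xs ! j..xs ! Suc j} (\<lambda>x. (dx f x)\<^sup>2)"
    "integral {xs ! j..xs ! Suc j} (\<lambda>x. (dx f x)\<^sup>2) \<le> C / (Min (mesh_widths xs))\<^sup>2 * integral {xs ! j..xs ! Suc j} (\<lambda>x. (f x)\<^sup>2)"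
    if m: "is_mesh xs" and f: "f \<in> S4 xs" and j: "Suc j < length xs" and x: "x \<in> {xs ! j..xs ! Suc j}" for xs f j x
  proof -
    let ?a = "xs ! j" and ?b = "xs ! Suc j" and ?m = "Min (mesh_widths xs)"
    have w: "?m \<le> ?b - ?a" "?a < ?b" and m0: "?m > 0"
      using mesh_width_bounds[OF m j] mesh_min_pos[OF m] by auto
    obtain p where p: "degree p \<le> 3" "\<forall>x\<in>{?a..?b}. f x = poly p x \<and> dx f x = poly (pderiv p) x"
      using S4_piece_deriv[OF m f j] by blast
    have i1: "integral {?a..?b} (\<lambda>x. (f x)\<^sup>2) = integral {?a..?b} (\<lambda>x. (poly p x)\<^sup>2)"
      and i2: "integral {?a..?b} (\<lambda>x. (dx f x)\<^sup>2) = integral {?a..?b} (\<lambda>x. (poly (pderiv p) x)\<^sup>2)"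
      using p(2) by (auto intro!: integral_cong)
    have nn: "integral {?a..?b} (\<lambda>x. (poly r x)\<^sup>2) \<ge> 0" for r :: "real poly"
      by (intro Henstock_Kurzweil_Integration.integral_nonneg integrable_continuous_interval continuous_intros) auto
    have Cle: "C / (?b - ?a) \<le> C / ?m" using w m0 C by (intro divide_left_mono) auto
    have dp: "degree (pderiv p) \<le> 3" using p(1) by (simp add: degree_pderiv)
    have "(poly p x)\<^sup>2 \<le> C / ?m * integral {?a..?b} (\<lambda>x. (poly p x)\<^sup>2)"
      using loc[OF p(1) w(2) x] mult_right_mono[OF Cle nn[of p]] by linarith
    then show "(f x)\<^sup>2 \<le> C / ?m * integral {?a..?b} (\<lambda>x. (f x)\<^sup>2)" using p(2) x i1 by simp
    have "(poly (pderiv p) x)\<^sup>2 \<le> C / ?m * integral {?a..?b} (\<lambda>x. (poly (pderiv p) x)\<^sup>2)"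
      using loc[OF dp w(2) x] mult_right_mono[OF Cle nn[of "pderiv p"]] by linarith
    then show "(dx f x)\<^sup>2 \<le> C / ?m * integral {?a..?b} (\<lambda>x. (dx f x)\<^sup>2)" using p(2) x i2 by simp
    let ?J = "integral {?a..?b} (\<lambda>x. (poly p x)\<^sup>2)"
    have "integral {?a..?b} (\<lambda>x. (poly (pderiv p) x)\<^sup>2) \<le> integral {?a..?b} (\<lambda>_. C / (?b - ?a) ^ 3 * ?J)"
      using loc[OF p(1) w(2)] by (intro integral_le integrable_continuous_interval continuous_intros) auto
    also have "\<dots> = (?b - ?a) * (C / (?b - ?a) ^ 3) * ?J" using w by simp
    also have "(?b - ?a) * (C / (?b - ?a) ^ 3) = C / (?b - ?a)\<^sup>2" using w by (simp add: power2_eq_square power3_eq_cube)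
    also have "C / (?b - ?a)\<^sup>2 * ?J \<le> C / ?m\<^sup>2 * ?J"
      using w m0 C nn[of p] by (intro mult_right_mono divide_left_mono power_mono mult_pos_pos) auto
    finally show "integral {?a..?b} (\<lambda>x. (dx f x)\<^sup>2) \<le> C / ?m\<^sup>2 * integral {?a..?b} (\<lambda>x. (f x)\<^sup>2)"
      by (simp add: i1 i2)
  qed
  show thesis
  proof (rule that[OF C])
    fix xs f x assume m: "is_mesh xs" and f: "f \<in> S4 xs" and x: "x \<in> {0..1::real}"
    obtain j where j: "Suc j < length xs" "x \<in> {xs ! j..xs ! Suc j}" by (rule mesh_cell[OF m x])
    have C': "C / Min (mesh_widths xs) \<ge> 0" using C mesh_min_pos[OF m] by simp
    show "(f x)\<^sup>2 \<le> C / Min (mesh_widths xs) * ip f f"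
      by (rule order_trans[OF cell(1)[OF m f j] mult_left_mono[OF cell_integral_le[OF m S4_cont(1)[OF f] j(1)] C']])
    show "(dx f x)\<^sup>2 \<le> C / Min (mesh_widths xs) * ip (dx f) (dx f)"
      by (rule order_trans[OF cell(2)[OF m f j] mult_left_mono[OF cell_integral_le[OF m S4_cont(2)[OF f] j(1)] C']])
  next
    fix xs f assume m: "is_mesh xs" and f: "f \<in> S4 xs"
    show "ip (dx f) (dx f) \<le> C / (Min (mesh_widths xs))\<^sup>2 * ip f f"
      unfolding ip_mesh_split[OF m S4_cont(1)[OF f]] ip_mesh_split[OF m S4_cont(2)[OF f]] sum_distrib_left
    proof (rule sum_mono)
      fix j assume "j \<in> {..<length xs - 1}"
      then have j: "Suc j < length xs" by auto
      then have "xs ! j \<in> {xs ! j..xs ! Suc j}" using mesh_width_bounds(3)[OF m j] by simp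
      then show "integral {xs ! j..xs ! Suc j} (\<lambda>x. (dx f x)\<^sup>2) \<le> C / (Min (mesh_widths xs))\<^sup>2 * integral {xs ! j..xs ! Suc j} (\<lambda>x. (f x)\<^sup>2)"
        by (rule cell(3)[OF m f j])
    qed
  qed
qed

section \<open>Spline approximation\<close>

text \<open>Continuous broken lines, the space of second derivatives of cubic splines.\<close>
definition S2 :: "real list \<Rightarrow> (real \<Rightarrow> real) set" where
  "S2 xs = {q. continuous_on {0..1} q \<and>
     (\<forall>j. Suc j < length xs \<longrightarrow> (\<exists>\<alpha> \<beta>. \<forall>x\<in>{xs ! j..xs ! Suc j}. q x = \<alpha> + \<beta> * x))}"

lemma S2_lin: assumes "f \<in> S2 xs" "g \<in> S2 xs" shows "(\<lambda>x. f x + c * g x) \<in> S2 xs"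
  unfolding S2_def
proof (intro CollectI conjI allI impI)
  show "continuous_on {0..1} (\<lambda>x. f x + c * g x)" using assms by (auto simp: S2_def intro!: continuous_intros)
  fix j assume j: "Suc j < length xs"
  obtain \<alpha> \<beta> where f: "\<forall>x\<in>{xs ! j..xs ! Suc j}. f x = \<alpha> + \<beta> * x" using assms(1) j unfolding S2_def by blast
  obtain \<alpha>' \<beta>' where g: "\<forall>x\<in>{xs ! j..xs ! Suc j}. g x = \<alpha>' + \<beta>' * x" using assms(2) j unfolding S2_def by blast
  show "\<exists>\<alpha> \<beta>. \<forall>x\<in>{xs ! j..xs ! Suc j}. f x + c * g x = \<alpha> + \<beta> * x"
    by (intro exI[of _ "\<alpha> + c * \<alpha>'"] exI[of _ "\<beta> + c * \<beta>'"]) (use f g in \<open>auto simp: algebra_simps\<close>)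
qed

lemma S2_affine: "(\<lambda>x. \<alpha> + \<beta> * x) \<in> S2 xs"
  by (auto simp: S2_def intro!: continuous_intros)

lemma S2_determined:
  assumes m: "is_mesh xs" and f: "f \<in> S2 xs" and z: "\<forall>p\<in>set xs. f p = 0"
  shows "\<forall>x\<in>{0..1}. f x = 0"
proof
  fix x :: real assume "x \<in> {0..1}"
  then obtain j where j: "Suc j < length xs" "x \<in> {xs ! j..xs ! Suc j}" using mesh_cell[OF m] by metis
  obtain \<alpha> \<beta> where f: "\<forall>x\<in>{xs ! j..xs ! Suc j}. f x = \<alpha> + \<beta> * x" using f j(1) unfolding S2_def by blast
  have w: "xs ! j < xs ! Suc j" using mesh_width_bounds(3)[OF m j(1)] by simp
  then have e: "\<alpha> + \<beta> * xs ! j = 0" "\<alpha> + \<beta> * xs ! Suc j = 0"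
    using bspec[OF f, of "xs ! j"] bspec[OF f, of "xs ! Suc j"] z j(1) nth_mem[of j xs] nth_mem[of "Suc j" xs] by auto
  have "\<beta> * (xs ! Suc j - xs ! j) = (\<alpha> + \<beta> * xs ! Suc j) - (\<alpha> + \<beta> * xs ! j)" by (simp add: algebra_simps)
  then have "\<beta> * (xs ! Suc j - xs ! j) = 0" unfolding e by simp
  then have "\<beta> = 0" using w by simp
  then show "f x = 0" using bspec[OF f j(2)] e by simp
qed

lemma S2_onb:
  assumes m: "is_mesh xs"
  shows "\<exists>n e. onb (S2 xs) ip n e"
proof -
  have c: "continuous_on {0..1} f" if "f \<in> S2 xs" for f using that by (simp add: S2_def)
  have "\<exists>n e. (\<forall>i<n::nat. e i \<in> S2 xs) \<and> (\<forall>i<n. \<forall>j<n. ip (e i) (e j) = (if i = j then 1 else 0)) \<and>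
      (\<forall>f\<in>S2 xs. \<forall>x\<in>{0..1}. f x = (\<Sum>i<n. ip f (e i) * e i x)) \<and>
      (\<forall>i<n. \<exists>c. \<forall>f\<in>S2 xs. ip f (e i) = (\<Sum>p\<in>set xs. c p * f p))"
  proof (rule orthonormal_basis_exists)
    show "set xs \<subseteq> {0..1}" using mesh_in[OF m] by (metis in_set_conv_nth subsetI)
    show "ip (\<lambda>x. f x + c * g x) h = ip f h + c * ip g h" if "f \<in> S2 xs" "g \<in> S2 xs" "h \<in> S2 xs" for f g h c
      by (intro ip_lin c that)
    show "ip f f > 0" if "f \<in> S2 xs" "x \<in> {0..1}" "f x \<noteq> 0" for f x by (rule ip_pos[OF c[OF that(1)] that(2,3)])
    show "ip f g = ip f' g" if "f \<in> S2 xs" "f' \<in> S2 xs" "g \<in> S2 xs" "\<forall>x\<in>{0..1}. f x = f' x" for f f' g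
      using that(4) by (intro ip_cong) auto
    show "ip f g = ip g f" for f g by (rule ip_sym)
    show "\<forall>x\<in>{0..1}. f x = 0" if "f \<in> S2 xs" "\<forall>p\<in>set xs. f p = 0" for f by (rule S2_determined[OF m that])
    show "(\<lambda>x. 0) \<in> S2 xs" using S2_affine[of 0 0] by simp
  qed (use S2_lin in auto)
  then show ?thesis unfolding onb_def by blast
qed

text \<open>The Peano kernels of point evaluation at the nodes: integrating \<open>max 0 (x\<^sub>k - y)\<close> against the second derivative
  of a function that vanishes at \<open>0\<close> to first order gives its value at \<open>x\<^sub>k\<close>.\<close>
lemma S2_ramp:
  assumes m: "is_mesh xs" and k: "k < length xs" shows "(\<lambda>y. max 0 (xs ! k - y)) \<in> S2 xs"
  unfolding S2_def
proof (intro CollectI conjI allI impI)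
  show "continuous_on {0..1} (\<lambda>y. max 0 (xs ! k - y))" by (intro continuous_intros)
  fix j assume j: "Suc j < length xs"
  show "\<exists>\<alpha> \<beta>. \<forall>x\<in>{xs ! j..xs ! Suc j}. max 0 (xs ! k - x) = \<alpha> + \<beta> * x"
  proof (cases "k \<le> j")
    case True
    then have "xs ! k \<le> xs ! j" using mesh_le[OF m, of k j] j by auto
    then show ?thesis by (intro exI[of _ 0]) auto
  next
    case False
    then have "xs ! Suc j \<le> xs ! k" using mesh_le[OF m, of "Suc j" k] k by auto
    then show ?thesis by (intro exI[of _ "xs ! k"] exI[of _ "-1"]) auto
  qed
qed

text \<open>The piecewise linear interpolant, written as a sum of clamped increments so that its continuity
  is immediate.\<close>
lemma S2_interpolant:
  assumes m: "is_mesh xs"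
  obtains r where "r \<in> S2 xs" "\<And>j x. Suc j < length xs \<Longrightarrow> x \<in> {xs ! j..xs ! Suc j} \<Longrightarrow>
     r x = w (xs ! j) + (w (xs ! Suc j) - w (xs ! j)) / (xs ! Suc j - xs ! j) * (x - xs ! j)"
proof -
  define sl where "sl i = (w (xs ! Suc i) - w (xs ! i)) / (xs ! Suc i - xs ! i)" for i
  define cl where "cl i x = max (xs ! i) (min x (xs ! Suc i)) - xs ! i" for i x
  define r where "r x = w 0 + (\<Sum>i<length xs - 1. sl i * cl i x)" for x
  have val: "r x = w (xs ! j) + sl j * (x - xs ! j)" if j: "Suc j < length xs" and x: "x \<in> {xs ! j..xs ! Suc j}" for j x
  proof -
    have "(\<Sum>i<length xs - 1. sl i * cl i x) = (\<Sum>i<j. sl i * cl i x) + sl j * cl j x + (\<Sum>i\<in>{Suc j..<length xs - 1}. sl i * cl i x)"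
      using sum.atLeastLessThan_concat[of 0 "Suc j" "length xs - 1" "\<lambda>i. sl i * cl i x"] j
      by (simp add: lessThan_atLeast0)
    also have "(\<Sum>i\<in>{Suc j..<length xs - 1}. sl i * cl i x) = 0"
    proof (rule sum.neutral, rule ballI)
      fix i assume i: "i \<in> {Suc j..<length xs - 1}"
      then have "xs ! Suc j \<le> xs ! i" "xs ! i \<le> xs ! Suc i" using mesh_le[OF m, of "Suc j" i] mesh_le[OF m, of i "Suc i"] by auto
      then show "sl i * cl i x = 0" using x by (simp add: cl_def)
    qed
    also have "(\<Sum>i<j. sl i * cl i x) = (\<Sum>i<j. w (xs ! Suc i) - w (xs ! i))"
    proof (rule sum.cong)
      fix i assume i: "i \<in> {..<j}"
      then have "xs ! Suc i \<le> xs ! j" "0 < xs ! Suc i - xs ! i" using mesh_le[OF m, of "Suc i" j] mesh_width_bounds(3)[OF m, of i] j by auto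
      then show "sl i * cl i x = w (xs ! Suc i) - w (xs ! i)" using x by (simp add: cl_def sl_def)
    qed simp
    also have "\<dots> = w (xs ! j) - w (xs ! 0)" by (rule sum_lessThan_telescope)
    also have "cl j x = x - xs ! j" using x by (simp add: cl_def)
    finally show ?thesis by (simp add: r_def mesh_first[OF m])
  qed
  have "r \<in> S2 xs" unfolding S2_def
  proof (intro CollectI conjI allI impI)
    show "continuous_on {0..1} r" unfolding r_def cl_def by (intro continuous_intros)
    fix j assume j: "Suc j < length xs"
    show "\<exists>\<alpha> \<beta>. \<forall>x\<in>{xs ! j..xs ! Suc j}. r x = \<alpha> + \<beta> * x"
      by (intro exI[of _ "w (xs ! j) - sl j * xs ! j"] exI[of _ "sl j"]) (use val[OF j] in \<open>auto simp: algebra_simps\<close>)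
  qed
  then show thesis using val by (intro that[of r]) (simp_all add: sl_def)
qed

lemma mean_value_within:
  assumes f: "\<And>x. x \<in> {0..1} \<Longrightarrow> (f has_real_derivative f' x) (at x within {0..1})"
    and ab: "a < b" "0 \<le> a" "b \<le> 1"
  obtains \<xi> where "a < \<xi>" "\<xi> < b" "f b - f a = (b - a) * f' \<xi>"
proof -
  have c: "continuous_on {a..b} f"
    by (rule continuous_on_subset[OF DERIV_continuous_on[OF f]]) (use ab in auto)
  have d: "(f has_real_derivative f' x) (at x)" if "a < x" "x < b" for x
    using f[of x] that ab by (simp add: at_within_Icc_at)
  have dd: "f differentiable (at x)" if "a < x" "x < b" for x
    using d[OF that] real_differentiable_def by blast
  obtain l z where z: "a < z" "z < b" "(f has_real_derivative l) (at z)" "f b - f a = (b - a) * l"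
    using MVT[OF ab(1) c dd] by blast
  moreover have "l = f' z" using DERIV_unique[OF z(3) d[OF z(1,2)]] .
  ultimately show thesis using that by blast
qed

text \<open>The linear interpolation error is \<open>O(h\<^sup>2)\<close> once the first derivative is Lipschitz.\<close>
lemma interpolation_error:
  assumes w: "C1 w w'" and lip: "\<And>x y. 0 \<le> x \<Longrightarrow> x \<le> y \<Longrightarrow> y \<le> 1 \<Longrightarrow> \<bar>w' y - w' x\<bar> \<le> M * (y - x)"
    and M: "0 \<le> M" and ab: "0 \<le> a" "a < b" "b \<le> 1" and x: "x \<in> {a..b}"
  shows "\<bar>w x - (w a + (w b - w a) / (b - a) * (x - a))\<bar> \<le> M * (b - a)\<^sup>2"
proof (cases "x = a")
  case False
  then have ax: "a < x" using x by simp
  have d: "\<And>x. x \<in> {0..1} \<Longrightarrow> (w has_real_derivative w' x) (at x within {0..1})" using w by (simp add: C1_def)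
  obtain c where c: "a < c" "c < b" "w b - w a = (b - a) * w' c" by (rule mean_value_within[OF d ab(2,1,3)])
  have x1: "x \<le> 1" using x ab by simp
  obtain e where e: "a < e" "e < x" "w x - w a = (x - a) * w' e" by (rule mean_value_within[OF d ax ab(1) x1])
  have "w x - (w a + (w b - w a) / (b - a) * (x - a)) = (x - a) * (w' e - w' c)"
  proof -
    have "(w b - w a) / (b - a) = w' c" using c(3) ab by simp
    moreover have "w x = w a + (x - a) * w' e" using e(3) by simp
    ultimately show ?thesis by (simp add: algebra_simps)
  qed
  then have "\<bar>w x - (w a + (w b - w a) / (b - a) * (x - a))\<bar> = (x - a) * \<bar>w' e - w' c\<bar>" using ax by (simp add: abs_mult)
  also have "\<dots> \<le> (b - a) * (M * (b - a))"
  proof (rule mult_mono)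
    have "\<bar>w' e - w' c\<bar> \<le> M * \<bar>e - c\<bar>"
      using lip[of e c] lip[of c e] c e x ab by (cases "e \<le> c") (auto simp: abs_minus_commute)
    also have "\<dots> \<le> M * (b - a)" using c e x M by (intro mult_left_mono) auto
    finally show "\<bar>w' e - w' c\<bar> \<le> M * (b - a)" .
  qed (use x ab in auto)
  finally show ?thesis by (simp add: power2_eq_square mult_ac)
qed (use M in auto)

text \<open>A function with a zero in an interval is controlled there by its derivative.\<close>
lemma poincare_pointwise:
  assumes f: "C1 f f'" and ab: "0 \<le> a" "a \<le> b" "b \<le> 1" and \<xi>: "\<xi> \<in> {a..b}" "f \<xi> = 0" and x: "x \<in> {a..b}"
  shows "(f x)\<^sup>2 \<le> (b - a) * integral {a..b} (\<lambda>x. (f' x)\<^sup>2)"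
proof -
  define l r where "l = min x \<xi>" and "r = max x \<xi>"
  have lr: "a \<le> l" "l \<le> r" "r \<le> b" using x \<xi> by (auto simp: l_def r_def)
  have cf: "continuous_on {c..d} f'" if "a \<le> c" "d \<le> b" for c d
    by (rule continuous_on_subset[OF C1_continuous(2)[OF f]]) (use that ab in auto)
  have "(f' has_integral f r - f l) {l..r}"
  proof (rule fundamental_theorem_of_calculus[OF lr(2)])
    fix y assume y: "y \<in> {l..r}"
    then have "(f has_real_derivative f' y) (at y within {0..1})" using f lr ab by (auto simp: C1_def)
    then have "(f has_real_derivative f' y) (at y within {l..r})" by (rule DERIV_subset) (use lr ab in auto)
    then show "(f has_vector_derivative f' y) (at y within {l..r})" by (simp add: has_real_derivative_iff_has_vector_derivative)
  qed
  then have "(f x)\<^sup>2 = (integral {l..r} f')\<^sup>2" using \<xi>(2) by (auto simp: l_def r_def integral_unique min_def max_def)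
  also have "\<dots> \<le> (r - l) * integral {l..r} (\<lambda>x. (f' x)\<^sup>2)" by (rule integral_square_le[OF cf lr(2)]) (use lr in auto)
  also have "\<dots> \<le> (b - a) * integral {a..b} (\<lambda>x. (f' x)\<^sup>2)"
    using lr by (intro mult_mono integral_subset_le Henstock_Kurzweil_Integration.integral_nonneg
        integrable_continuous_interval continuous_on_power cf) auto
  finally show ?thesis .
qed

text \<open>A zero in every cell gains one power of the mesh width in \<open>L\<^sup>2\<close> and half a power pointwise.\<close>
lemma poincare_cells:
  assumes m: "is_mesh xs" and f: "C1 f f'"
    and z: "\<And>j. Suc j < length xs \<Longrightarrow> \<exists>\<xi>\<in>{xs ! j..xs ! Suc j}. f \<xi> = 0"
  shows "ip f f \<le> (mesh_h xs)\<^sup>2 * ip f' f'" "x \<in> {0..1} \<Longrightarrow> (f x)\<^sup>2 \<le> mesh_h xs * ip f' f'"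
proof -
  have cell: "(f x)\<^sup>2 \<le> mesh_h xs * integral {xs ! j..xs ! Suc j} (\<lambda>x. (f' x)\<^sup>2)"
    if j: "Suc j < length xs" and x: "x \<in> {xs ! j..xs ! Suc j}" for j x
  proof -
    obtain \<xi> where \<xi>: "\<xi> \<in> {xs ! j..xs ! Suc j}" "f \<xi> = 0" using z[OF j] by blast
    have b: "0 \<le> xs ! j" "xs ! j \<le> xs ! Suc j" "xs ! Suc j \<le> 1"
      using mesh_in[OF m, of j] mesh_in[OF m j] j mesh_le[OF m, of j "Suc j"] by auto
    have "continuous_on {xs ! j..xs ! Suc j} f'"
      by (rule continuous_on_subset[OF C1_continuous(2)[OF f]]) (use b in auto)
    then have "0 \<le> integral {xs ! j..xs ! Suc j} (\<lambda>x. (f' x)\<^sup>2)"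
      by (intro Henstock_Kurzweil_Integration.integral_nonneg integrable_continuous_interval continuous_on_power) auto
    then show ?thesis
      using poincare_pointwise[OF f b \<xi> x] mult_right_mono[OF mesh_width_bounds(1)[OF m j]] by fastforce
  qed
  have h: "0 < mesh_h xs" by (rule mesh_h_bounds(1)[OF m])
  show "(f x)\<^sup>2 \<le> mesh_h xs * ip f' f'" if x: "x \<in> {0..1}"
  proof -
    obtain j where j: "Suc j < length xs" "x \<in> {xs ! j..xs ! Suc j}" by (rule mesh_cell[OF m x])
    show ?thesis
      by (rule order_trans[OF cell[OF j] mult_left_mono[OF cell_integral_le[OF m C1_continuous(2)[OF f] j(1)]]]) (use h in simp)
  qed
  show "ip f f \<le> (mesh_h xs)\<^sup>2 * ip f' f'"
    unfolding ip_mesh_split[OF m C1_continuous(1)[OF f]] ip_mesh_split[OF m C1_continuous(2)[OF f]] sum_distrib_left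
  proof (rule sum_mono)
    fix j assume "j \<in> {..<length xs - 1}"
    then have j: "Suc j < length xs" by auto
    let ?J = "integral {xs ! j..xs ! Suc j} (\<lambda>x. (f' x)\<^sup>2)"
    have b: "xs ! j \<le> xs ! Suc j" "0 \<le> xs ! j" "xs ! Suc j \<le> 1" using mesh_le[OF m, of j "Suc j"] mesh_in[OF m, of j] mesh_in[OF m j] j by auto
    have c: "continuous_on {xs ! j..xs ! Suc j} f"
      by (rule continuous_on_subset[OF C1_continuous(1)[OF f]]) (use b in auto)
    have J0: "0 \<le> mesh_h xs * ?J" by (rule order_trans[OF zero_le_power2 cell[OF j]]) (use b in auto)
    have "integral {xs ! j..xs ! Suc j} (\<lambda>x. (f x)\<^sup>2) \<le> integral {xs ! j..xs ! Suc j} (\<lambda>x. mesh_h xs * ?J)"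
      by (intro integral_le integrable_continuous_interval continuous_on_power c continuous_on_const cell[OF j])
    also have "\<dots> = (xs ! Suc j - xs ! j) * (mesh_h xs * ?J)" using b by simp
    also have "\<dots> \<le> mesh_h xs * (mesh_h xs * ?J)" by (rule mult_right_mono[OF mesh_width_bounds(1)[OF m j] J0])
    finally show "integral {xs ! j..xs ! Suc j} (\<lambda>x. (f x)\<^sup>2) \<le> (mesh_h xs)\<^sup>2 * ?J" by (simp add: power2_eq_square mult_ac)
  qed
qed

lemma antiderivative_of_affine:
  assumes d: "\<And>x. x \<in> {a..b} \<Longrightarrow> (f has_real_derivative \<alpha> + \<beta> * x + \<gamma> * x\<^sup>2) (at x within {a..b})"
  obtains c where "\<And>x. x \<in> {a..b} \<Longrightarrow> f x = c + \<alpha> * x + \<beta> * x\<^sup>2 / 2 + \<gamma> * x ^ 3 / 3"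
proof -
  define g where "g x = f x - (\<alpha> * x + \<beta> * x\<^sup>2 / 2 + \<gamma> * x ^ 3 / 3)" for x
  have "(g has_real_derivative 0) (at x within {a..b})" if x: "x \<in> {a..b}" for x
  proof -
    have "((\<lambda>x. \<alpha> * x + \<beta> * x\<^sup>2 / 2 + \<gamma> * x ^ 3 / 3) has_real_derivative \<alpha> + \<beta> * x + \<gamma> * x\<^sup>2) (at x within {a..b})"
      by (auto intro!: derivative_eq_intros)
    from DERIV_diff[OF d[OF x] this] show ?thesis by (simp add: g_def[abs_def])
  qed
  then have "\<exists>c. \<forall>x\<in>{a..b}. g x = c" by (intro has_field_derivative_zero_constant) auto
  then obtain c where c: "\<forall>x\<in>{a..b}. g x = c" by blast
  have "f x = c + \<alpha> * x + \<beta> * x\<^sup>2 / 2 + \<gamma> * x ^ 3 / 3" if "x \<in> {a..b}" for x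
    using bspec[OF c that] by (simp add: g_def)
  then show thesis by (rule that)
qed

text \<open>The complete cubic spline interpolant. Its second derivative is the \<open>L\<^sup>2\<close> projection \<open>q\<close> of \<open>v''\<close>
  onto continuous piecewise linear functions, which is at least as accurate in \<open>L\<^sup>2\<close> as linear interpolation of \<open>v''\<close>.
  Orthogonality of \<open>v'' - q\<close> to the ramps \<open>max 0 (x\<^sub>k - y)\<close> says exactly that the error vanishes at the
  node \<open>x\<^sub>k\<close>. Hence the error has a zero in every cell, and so has its derivative by the mean value theorem; two
  applications of the Poincare inequality gain two powers of \<open>h\<close>.\<close>
lemma spline_approximation:
  assumes m: "is_mesh xs" and v: "C1 v v1" "C1 v1 v2" "C1 v2 v3"
    and lip: "\<And>x y. 0 \<le> x \<Longrightarrow> x \<le> y \<Longrightarrow> y \<le> 1 \<Longrightarrow> \<bar>v3 y - v3 x\<bar> \<le> M * (y - x)" and M: "0 \<le> M"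
  obtains s where "s \<in> S4 xs" "s 0 = v 0" "s 1 = v 1"
    "ip (\<lambda>x. v x - s x) (\<lambda>x. v x - s x) \<le> (M * mesh_h xs ^ 4)\<^sup>2"
    "ip (\<lambda>x. v1 x - dx s x) (\<lambda>x. v1 x - dx s x) \<le> (M * mesh_h xs ^ 3)\<^sup>2"
    "\<And>x. x \<in> {0..1} \<Longrightarrow> \<bar>v x - s x\<bar> \<le> M \<and> \<bar>v1 x - dx s x\<bar> \<le> M"
proof -
  let ?h = "mesh_h xs"
  note h = mesh_h_bounds[OF m]
  have cv2: "continuous_on {0..1} v2" using C1_continuous(1)[OF v(3)] .
  obtain n e where o: "onb (S2 xs) ip n e" using S2_onb[OF m] by blast
  have cS: "continuous_on {0..1} f" if "f \<in> S2 xs" for f using that by (simp add: S2_def)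
  have eS: "e i \<in> S2 xs" if "i < n" for i using o that by (simp add: onb_def)
  define q where "q x = (\<Sum>i<n. ip v2 (e i) * e i x)" for x
  have "(\<lambda>x. \<Sum>i<k. ip v2 (e i) * e i x) \<in> S2 xs" if "k \<le> n" for k using that
  proof (induction k)
    case 0
    show ?case using S2_affine[of 0 0] by simp
  next
    case (Suc k)
    then show ?case using S2_lin[OF Suc.IH eS[of k], of "ip v2 (e k)"] by simp
  qed
  then have qS: "q \<in> S2 xs" unfolding q_def[abs_def] by simp
  have cq: "continuous_on {0..1} q" by (rule cS[OF qS])
  have qproj: "ip q \<phi> = ip v2 \<phi>" if \<phi>: "\<phi> \<in> S2 xs" for \<phi>
  proof -
    have "ip q \<phi> = (\<Sum>i<n. ip v2 (e i) * ip (e i) \<phi>)" unfolding q_def[abs_def]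
      by (rule ip_sum) (use cS eS \<phi> in auto)
    also have "\<dots> = (\<Sum>i<n. ip \<phi> (e i) * ip v2 (e i))"
      by (rule sum.cong) (simp_all add: ip_sym[of _ \<phi>])
    also have "\<dots> = ip v2 \<phi>" by (rule onb_expansion[symmetric, OF o _ cv2 \<phi>]) (rule cS)
    finally show ?thesis .
  qed
  define d where "d = (\<lambda>x. v2 x + (-1) * q x)"
  have cd: "continuous_on {0..1} d" unfolding d_def by (intro continuous_intros cv2 cq)
  have orth: "ip d \<phi> = 0" if "\<phi> \<in> S2 xs" for \<phi>
    unfolding d_def using ip_lin[OF cv2 cq cS[OF that], of "-1"] qproj[OF that] by simp
  obtain r where r: "r \<in> S2 xs" and rv: "\<And>j x. Suc j < length xs \<Longrightarrow> x \<in> {xs ! j..xs ! Suc j} \<Longrightarrow>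
     r x = v2 (xs ! j) + (v2 (xs ! Suc j) - v2 (xs ! j)) / (xs ! Suc j - xs ! j) * (x - xs ! j)"
    by (rule S2_interpolant[OF m]) (rule that; assumption)
  have rerr: "\<bar>v2 x - r x\<bar> \<le> M * ?h\<^sup>2" if x: "x \<in> {0..1}" for x
  proof -
    obtain j where j: "Suc j < length xs" "x \<in> {xs ! j..xs ! Suc j}" by (rule mesh_cell[OF m x])
    have b: "0 \<le> xs ! j" "xs ! j < xs ! Suc j" "xs ! Suc j \<le> 1"
      using mesh_in[OF m, of j] mesh_in[OF m j(1)] j(1) mesh_width_bounds(3)[OF m j(1)] by auto
    have "\<bar>v2 x - r x\<bar> \<le> M * (xs ! Suc j - xs ! j)\<^sup>2"
      unfolding rv[OF j] by (rule interpolation_error[OF v(3) lip M b j(2)])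
    also have "\<dots> \<le> M * ?h\<^sup>2" using mesh_width_bounds(1)[OF m j(1)] b M by (intro mult_left_mono power_mono) auto
    finally show ?thesis .
  qed
  have dbound: "ip d d \<le> (M * ?h\<^sup>2)\<^sup>2"
  proof -
    define g where "g = (\<lambda>x. q x + (-1) * r x)"
    have g: "g \<in> S2 xs" unfolding g_def by (rule S2_lin[OF qS r])
    have "ip d d \<le> ip (\<lambda>x. d x + 1 * g x) (\<lambda>x. d x + 1 * g x)"
      using ip_add_square[OF cd cS[OF g], of 1] orth[OF g] ip_nonneg[of g] by simp
    also have "\<dots> \<le> ip (\<lambda>_. M * ?h\<^sup>2) (\<lambda>_. M * ?h\<^sup>2)"
      by (rule ip_mono) (use rerr cd cS[OF g] M in \<open>auto simp: d_def g_def intro!: continuous_intros cv2 cq cS[OF r]\<close>)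
    finally show ?thesis by (simp add: ip_const)
  qed
  define s1 where "s1 x = v1 0 + integral {0..x} q" for x
  define s where "s x = v 0 + integral {0..x} s1" for x
  have Cs1: "C1 s1 q" unfolding C1_def s1_def
    using integral_has_real_derivative[OF cq] cq by (auto intro!: derivative_eq_intros)
  have Cs: "C1 s s1" unfolding C1_def s_def
    using integral_has_real_derivative[OF C1_continuous(1)[OF Cs1]] C1_continuous(1)[OF Cs1]
    by (auto intro!: derivative_eq_intros)
  have ds: "dx s x = s1 x" if "x \<in> {0..1}" for x by (rule C1_dx[OF Cs that])
  have sS: "s \<in> S4 xs" unfolding S4_def
  proof (intro CollectI conjI allI impI)
    show "s \<in> C2_space" by (rule C2_spaceI[OF Cs Cs1])
    fix j assume j: "Suc j < length xs"
    let ?I = "{xs ! j..xs ! Suc j}"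
    have sub: "?I \<subseteq> {0..1}" using mesh_in[OF m, of j] mesh_in[OF m j] j by auto
    obtain \<alpha> \<beta> where q: "\<forall>x\<in>?I. q x = \<alpha> + \<beta> * x" using qS j unfolding S2_def by blast
    have "(s1 has_real_derivative \<alpha> + \<beta> * x + 0 * x\<^sup>2) (at x within ?I)" if x: "x \<in> ?I" for x
    proof -
      have "(s1 has_real_derivative q x) (at x within {0..1})" using Cs1 x sub by (auto simp: C1_def)
      then show ?thesis using bspec[OF q x] DERIV_subset[OF _ sub] by simp
    qed
    then obtain c where c: "\<And>x. x \<in> ?I \<Longrightarrow> s1 x = c + \<alpha> * x + \<beta> * x\<^sup>2 / 2 + 0 * x ^ 3 / 3"
      by (rule antiderivative_of_affine) (assumption | (rule that; assumption))+
    have "(s has_real_derivative c + \<alpha> * x + (\<beta> / 2) * x\<^sup>2) (at x within ?I)" if x: "x \<in> ?I" for x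
    proof -
      have "(s has_real_derivative s1 x) (at x within {0..1})" using Cs x sub by (auto simp: C1_def)
      then show ?thesis using c[OF x] DERIV_subset[OF _ sub] by simp
    qed
    then obtain c' where c': "\<And>x. x \<in> ?I \<Longrightarrow> s x = c' + c * x + \<alpha> * x\<^sup>2 / 2 + (\<beta> / 2) * x ^ 3 / 3"
      by (rule antiderivative_of_affine) (assumption | (rule that; assumption))+
    show "\<exists>p. degree p \<le> 3 \<and> (\<forall>x\<in>?I. s x = poly p x)"
      by (intro exI[of _ "[:c', c, \<alpha> / 2, \<beta> / 6:]"])
         (auto simp: c' algebra_simps power2_eq_square power3_eq_cube)
  qed
  define E where "E = (\<lambda>x. v x - s x)"
  define E1 where "E1 = (\<lambda>x. v1 x - s1 x)"
  have CE: "C1 E E1" unfolding E_def E1_def by (rule C1_diff[OF v(1) Cs])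
  have CE1: "C1 E1 d" unfolding E1_def d_def using C1_diff[OF v(2) Cs1] by simp
  have E0: "E 0 = 0" "E1 0 = 0" by (auto simp: E_def E1_def s_def s1_def)
  have node: "E (xs ! k) = 0" if k: "k < length xs" for k
  proof -
    let ?x = "xs ! k"
    have x: "?x \<in> {0..1}" by (rule mesh_in[OF m k])
    have "((\<lambda>y. (?x - y) * d y) has_integral ((?x - ?x) * E1 ?x + E ?x) - ((?x - 0) * E1 0 + E 0)) {0..?x}"
    proof (rule fundamental_theorem_of_calculus)
      fix y assume y: "y \<in> {0..?x}"
      then have y1: "y \<in> {0..1}" using x by auto
      have "((\<lambda>y. (?x - y) * E1 y + E y) has_real_derivative (?x - y) * d y) (at y within {0..1})"
        using CE CE1 y1 unfolding C1_def by (auto intro!: derivative_eq_intros)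
      then show "((\<lambda>y. (?x - y) * E1 y + E y) has_vector_derivative (?x - y) * d y) (at y within {0..?x})"
        unfolding has_real_derivative_iff_has_vector_derivative[symmetric] by (rule DERIV_subset) (use x in auto)
    qed (use x in auto)
    then have I1: "((\<lambda>y. (?x - y) * d y) has_integral E ?x) {0..?x}" using E0 by simp
    have "((\<lambda>y. d y * max 0 (?x - y)) has_integral E ?x) {0..?x}"
      by (rule has_integral_eq[OF _ I1]) (auto simp: max_def)
    moreover have "((\<lambda>y. d y * max 0 (?x - y)) has_integral 0) {?x..1}"
      by (rule has_integral_is_0) (auto simp: max_def)
    ultimately have "((\<lambda>y. d y * max 0 (?x - y)) has_integral E ?x + 0) {0..1}"
      by (rule has_integral_combine[rotated 2]) (use x in auto)
    then have "ip d (\<lambda>y. max 0 (?x - y)) = E ?x" unfolding ip_def by (simp add: integral_unique)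
    then show ?thesis using orth[OF S2_ramp[OF m k]] by simp
  qed
  have E1zero: "\<exists>\<xi>\<in>{xs ! j..xs ! Suc j}. E1 \<xi> = 0" if j: "Suc j < length xs" for j
  proof -
    have b: "xs ! j < xs ! Suc j" "0 \<le> xs ! j" "xs ! Suc j \<le> 1"
      using mesh_in[OF m, of j] mesh_in[OF m j] j mesh_width_bounds(3)[OF m j] by auto
    have D: "\<And>x. x \<in> {0..1} \<Longrightarrow> (E has_real_derivative E1 x) (at x within {0..1})" using CE by (simp add: C1_def)
    obtain \<xi> where \<xi>: "xs ! j < \<xi>" "\<xi> < xs ! Suc j" "E (xs ! Suc j) - E (xs ! j) = (xs ! Suc j - xs ! j) * E1 \<xi>"
      by (rule mean_value_within[OF D b])
    then have "E1 \<xi> = 0" using node[of j] node[OF j] j b by simp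
    then show ?thesis using \<xi> by (intro bexI[of _ \<xi>]) auto
  qed
  have Ezero: "\<exists>\<xi>\<in>{xs ! j..xs ! Suc j}. E \<xi> = 0" if j: "Suc j < length xs" for j
    using node[of j] j mesh_le[OF m, of j "Suc j"] by (intro bexI[of _ "xs ! j"]) auto
  have b1: "ip E1 E1 \<le> (M * ?h ^ 3)\<^sup>2"
  proof -
    have "ip E1 E1 \<le> ?h\<^sup>2 * (M * ?h\<^sup>2)\<^sup>2"
      using poincare_cells(1)[OF m CE1 E1zero] mult_left_mono[OF dbound, of "?h\<^sup>2"] by simp
    also have "\<dots> = (M * ?h ^ 3)\<^sup>2" by (simp add: power2_eq_square power3_eq_cube)
    finally show ?thesis .
  qed
  have b0: "ip E E \<le> (M * ?h ^ 4)\<^sup>2"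
  proof -
    have "ip E E \<le> ?h\<^sup>2 * (M * ?h ^ 3)\<^sup>2"
      using poincare_cells(1)[OF m CE Ezero] mult_left_mono[OF b1, of "?h\<^sup>2"] by simp
    also have "\<dots> = (M * ?h ^ 4)\<^sup>2" by (simp add: power2_eq_square eval_nat_numeral)
    finally show ?thesis .
  qed
  have hk: "?h * (M * ?h ^ k)\<^sup>2 \<le> M\<^sup>2" for k
  proof -
    have "((?h ^ k)\<^sup>2 * ?h) \<le> 1" using h by (intro mult_le_one power_le_one) auto
    then have "M\<^sup>2 * ((?h ^ k)\<^sup>2 * ?h) \<le> M\<^sup>2 * 1" by (rule mult_left_mono) simp
    then show ?thesis by (simp add: power_mult_distrib mult_ac)
  qed
  have pt: "\<bar>E x\<bar> \<le> M \<and> \<bar>E1 x\<bar> \<le> M" if x: "x \<in> {0..1}" for x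
  proof
    have "(E x)\<^sup>2 \<le> M\<^sup>2"
      by (rule order_trans[OF poincare_cells(2)[OF m CE Ezero x] order_trans[OF mult_left_mono[OF b1 less_imp_le[OF h(1)]] hk]])
    then show "\<bar>E x\<bar> \<le> M" using M by (metis abs_le_square_iff abs_of_nonneg)
    have "(E1 x)\<^sup>2 \<le> M\<^sup>2"
      by (rule order_trans[OF poincare_cells(2)[OF m CE1 E1zero x] order_trans[OF mult_left_mono[OF dbound less_imp_le[OF h(1)]] hk]])
    then show "\<bar>E1 x\<bar> \<le> M" using M by (metis abs_le_square_iff abs_of_nonneg)
  qed
  have e1: "ip (\<lambda>x. v1 x - dx s x) (\<lambda>x. v1 x - dx s x) = ip E1 E1"
    by (rule ip_cong) (auto simp: E1_def ds)
  show thesis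
  proof (rule that[OF sS])
    show "s 0 = v 0" by (simp add: s_def)
    show "s 1 = v 1" using node[of "length xs - 1"] mesh_last[OF m] mesh_length[OF m] by (simp add: E_def)
    show "ip (\<lambda>x. v x - s x) (\<lambda>x. v x - s x) \<le> (M * mesh_h xs ^ 4)\<^sup>2" using b0 by (simp add: E_def)
    show "ip (\<lambda>x. v1 x - dx s x) (\<lambda>x. v1 x - dx s x) \<le> (M * mesh_h xs ^ 3)\<^sup>2" using b1 e1 by simp
    show "\<bar>v x - s x\<bar> \<le> M \<and> \<bar>v1 x - dx s x\<bar> \<le> M" if "x \<in> {0..1}" for x
      using pt[OF that] ds[OF that] by (simp add: E_def E1_def)
  qed
qed

section \<open>Projections in orthonormal coordinates\<close>

text \<open>A finite-dimensional space \<open>V\<close> with orthonormal basis inside a larger space \<open>W\<close> of admissible functions. It is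
  used twice: with the \<open>L\<^sup>2\<close> inner product, where the projection of \<open>W\<close> onto \<open>V\<close> is \<open>P\<close>, and with
  the form \<open>a\<close>, where it is \<open>R\<^sub>h\<close>.\<close>
locale form_space =
  fixes W V :: "(real \<Rightarrow> real) set" and B :: "(real \<Rightarrow> real) \<Rightarrow> (real \<Rightarrow> real) \<Rightarrow> real"
    and n :: nat and e :: "nat \<Rightarrow> real \<Rightarrow> real"
  assumes W_zero: "(\<lambda>x. 0) \<in> W" and W_lin: "f \<in> W \<Longrightarrow> g \<in> W \<Longrightarrow> (\<lambda>x. f x + c * g x) \<in> W"
    and V_W: "f \<in> V \<Longrightarrow> f \<in> W"
    and V_zero: "(\<lambda>x. 0) \<in> V" and V_lin: "f \<in> V \<Longrightarrow> g \<in> V \<Longrightarrow> (\<lambda>x. f x + c * g x) \<in> V"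
    and B_lin: "f \<in> W \<Longrightarrow> g \<in> W \<Longrightarrow> h \<in> W \<Longrightarrow> B (\<lambda>x. f x + c * g x) h = B f h + c * B g h"
    and B_sym: "B f g = B g f" and B_nonneg: "B f f \<ge> 0"
    and B_cong: "f \<in> W \<Longrightarrow> f' \<in> W \<Longrightarrow> g \<in> W \<Longrightarrow> \<forall>x\<in>{0..1}. f x = f' x \<Longrightarrow> B f g = B f' g"
    and basis: "onb V B n e"
begin

lemma e_V: "i < n \<Longrightarrow> e i \<in> V" using basis by (simp add: onb_def)

lemma e_W: "i < n \<Longrightarrow> e i \<in> W" using e_V V_W by blast

lemma expansion: "f \<in> V \<Longrightarrow> x \<in> {0..1} \<Longrightarrow> f x = (\<Sum>i<n. B f (e i) * e i x)"
  using basis by (simp add: onb_def)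

lemma orthonormal: "i < n \<Longrightarrow> j < n \<Longrightarrow> B (e i) (e j) = (if i = j then 1 else 0)"
  using basis by (simp add: onb_def)

lemma comb_V: "k \<le> n \<Longrightarrow> (\<lambda>x. \<Sum>i<k. a i * e i x) \<in> V"
proof (induction k)
  case (Suc k)
  then show ?case using V_lin[OF Suc.IH e_V[of k], of "a k"] by simp
qed (simp add: V_zero)

lemma B_zero: "h \<in> W \<Longrightarrow> B (\<lambda>x. 0) h = 0" using B_lin[OF W_zero W_zero, of h 1] by simp

lemma B_comb: "k \<le> n \<Longrightarrow> h \<in> W \<Longrightarrow> B (\<lambda>x. \<Sum>i<k. a i * e i x) h = (\<Sum>i<k. a i * B (e i) h)"
proof (induction k)
  case (Suc k)
  then show ?case using B_lin[OF V_W[OF comb_V[of k a]] e_W[of k] Suc.prems(2), of "a k"] by simp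
qed (simp add: B_zero)

lemma coordinate_comb: assumes "j < n" shows "B (\<lambda>x. \<Sum>i<n. a i * e i x) (e j) = a j"
proof -
  have "B (\<lambda>x. \<Sum>i<n. a i * e i x) (e j) = (\<Sum>i<n. a i * B (e i) (e j))" by (rule B_comb) (use assms e_W in auto)
  also have "\<dots> = (\<Sum>i<n. if i = j then a i else 0)" by (rule sum.cong) (use orthonormal assms in auto)
  finally show ?thesis using assms by simp
qed

lemma parseval: "B (\<lambda>x. \<Sum>i<n. a i * e i x) (\<lambda>x. \<Sum>i<n. a i * e i x) = (\<Sum>i<n. (a i)\<^sup>2)"
proof -
  have "B (\<lambda>x. \<Sum>i<n. a i * e i x) (\<lambda>x. \<Sum>i<n. a i * e i x) = (\<Sum>i<n. a i * B (e i) (\<lambda>x. \<Sum>i<n. a i * e i x))"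
    by (rule B_comb) (use V_W comb_V in auto)
  also have "\<dots> = (\<Sum>i<n. (a i)\<^sup>2)"
    by (rule sum.cong) (use coordinate_comb B_sym in \<open>auto simp: power2_eq_square\<close>)
  finally show ?thesis .
qed

lemma B_expand: assumes f: "f \<in> V" and g: "g \<in> W" shows "B g f = (\<Sum>i<n. B f (e i) * B g (e i))"
proof -
  have "B g f = B f g" by (rule B_sym)
  also have "\<dots> = B (\<lambda>x. \<Sum>i<n. B f (e i) * e i x) g"
    by (rule B_cong) (use expansion[OF f] V_W[OF f] V_W[OF comb_V] g in auto)
  also have "\<dots> = (\<Sum>i<n. B f (e i) * B (e i) g)" by (rule B_comb) (use g in auto)
  finally show ?thesis by (simp add: B_sym[of g])
qed

lemma projection_property:
  assumes f: "f \<in> V" and v: "v \<in> W" shows "B (\<lambda>x. \<Sum>i<n. B v (e i) * e i x) f = B v f"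
proof -
  have "B (\<lambda>x. \<Sum>i<n. B v (e i) * e i x) f = (\<Sum>i<n. B v (e i) * B (e i) f)" by (rule B_comb) (use V_W f in auto)
  also have "\<dots> = B v f" unfolding B_expand[OF f v] by (rule sum.cong) (simp_all add: B_sym[of f])
  finally show ?thesis .
qed

lemma best_approximation:
  assumes v: "v \<in> W" and s: "s \<in> V"
  defines "p \<equiv> (\<lambda>x. \<Sum>i<n. B v (e i) * e i x)"
  shows "B (\<lambda>x. v x + (-1) * p x) (\<lambda>x. v x + (-1) * p x) \<le> B (\<lambda>x. v x + (-1) * s x) (\<lambda>x. v x + (-1) * s x)"
proof -
  have p: "p \<in> V" unfolding p_def by (rule comb_V) simp
  define d g where "d = (\<lambda>x. v x + (-1) * p x)" and "g = (\<lambda>x. p x + (-1) * s x)"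
  have dW: "d \<in> W" unfolding d_def by (rule W_lin[OF v V_W[OF p]])
  have gV: "g \<in> V" unfolding g_def by (rule V_lin[OF p s])
  note gW = V_W[OF gV]
  have dg: "B d g = 0" unfolding d_def B_lin[OF v V_W[OF p] gW] using projection_property[OF gV v] by (simp add: p_def)
  have "(\<lambda>x. v x + (-1) * s x) = (\<lambda>x. d x + 1 * g x)" by (auto simp: d_def g_def)
  moreover have "B (\<lambda>x. d x + 1 * g x) (\<lambda>x. d x + 1 * g x) = B d (\<lambda>x. d x + 1 * g x) + 1 * B g (\<lambda>x. d x + 1 * g x)"
    by (rule B_lin[OF dW gW W_lin[OF dW gW]])
  moreover have "B d (\<lambda>x. d x + 1 * g x) = B d d + 1 * B d g"
    by (subst B_sym, subst B_lin[OF dW gW dW]) (simp add: B_sym[of g])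
  moreover have "B g (\<lambda>x. d x + 1 * g x) = B d g + 1 * B g g"
    by (subst B_sym, subst B_lin[OF dW gW gW]) simp
  ultimately have "B (\<lambda>x. v x + (-1) * s x) (\<lambda>x. v x + (-1) * s x) = B d d + B g g" using dg by simp
  then show ?thesis using B_nonneg[of g] by (simp add: d_def)
qed

end

lemma C1_dx_self: "C1 f f' \<Longrightarrow> C1 f (dx f)"
  by (rule C1_cong[of f f']) (auto intro: C1_dx)

lemma form_space_S4: assumes "onb (S4 xs) ip n e" shows "form_space {f. continuous_on {0..1} f} (S4 xs) ip n e"
proof
  show "ip f g = ip g f" for f g by (rule ip_sym)
qed (use assms in \<open>auto intro: ip_lin ip_nonneg S4_cont S4_lin S4_const ip_cong intro!: continuous_intros\<close>)

lemma form_space_S40: assumes "onb (S40 xs) aip n e" shows "form_space {f. C1 f (dx f)} (S40 xs) aip n e"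
proof
  show "aip f g = aip g f" for f g by (rule aip_sym)
  show "aip f f \<ge> 0" for f using ip_nonneg[of f] ip_nonneg[of "dx f"] by (simp add: aip_def)
  show "(\<lambda>x. 0) \<in> {f. C1 f (dx f)}" using C1_dx_self[of "\<lambda>x. 0" "\<lambda>x. 0"] by (simp add: C1_def)
  show "(\<lambda>x. f x + c * g x) \<in> {f. C1 f (dx f)}" if "f \<in> {f. C1 f (dx f)}" "g \<in> {f. C1 f (dx f)}" for f g c
    using that C1_add_scaled C1_dx_self by blast
  show "f \<in> {f. C1 f (dx f)}" if "f \<in> S40 xs" for f using that S4_C1(1)[of f xs] by (simp add: S40_def)
  show "aip (\<lambda>x. f x + c * g x) h = aip f h + c * aip g h" if "f \<in> {f. C1 f (dx f)}" "g \<in> {f. C1 f (dx f)}" "h \<in> {f. C1 f (dx f)}" for f g h c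
    using that by (intro aip_lin) auto
  show "aip f g = aip f' g" if "f \<in> {f. C1 f (dx f)}" "f' \<in> {f. C1 f (dx f)}" "g \<in> {f. C1 f (dx f)}" "\<forall>x\<in>{0..1}. f x = f' x" for f f' g
  proof -
    have "C1 f (dx f')" by (rule C1_cong[of f' "dx f'"]) (use that in auto)
    then have 1: "dx f x = dx f' x" if "x \<in> {0..1}" for x using C1_dx that by blast
    have "ip f g = ip f' g" "ip (dx f) (dx g) = ip (dx f') (dx g)" by (auto intro!: ip_cong simp: that(4) 1)
    then show ?thesis by (simp add: aip_def)
  qed
  show "(\<lambda>x. 0) \<in> S40 xs" using S4_const[of 0] by (simp add: S40_def)
qed (use assms S40_lin in auto)

section \<open>The forms of the problem on continuously differentiable functions\<close>

lemma l2_inner_AE: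
  assumes f: "AE x in I01. f x = f' x" "continuous_on {0..1} f'" and g: "AE x in I01. g x = g' x" "continuous_on {0..1} g'"
  shows "l2_inner f g = ip f' g'"
proof -
  have m: "(\<lambda>x. f' x * g' x) \<in> borel_measurable I01"
    using bdd_meas_LINT(1)[OF bdd_meas_mult[OF bdd_meas_continuous[OF f(2)] bdd_meas_continuous[OF g(2)]]] by auto
  have ae: "AE x in I01. f' x * g' x = f x * g x" using f(1) g(1) by eventually_elim simp
  have "(LINT x|I01. f x * g x) = (LINT x|I01. f' x * g' x)"
    by (rule integral_cong_AE) (use I01_measurable_AE[OF m ae] m ae in \<open>auto elim: eventually_mono\<close>)
  then show ?thesis using l2_inner_eq_ip[OF f(2) g(2)] by (simp add: l2_inner_def)
qed

lemma AE_I01_eq: "(\<And>x. x \<in> {0..1} \<Longrightarrow> f x = g x) \<Longrightarrow> AE x in I01. f x = g x"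
  by (rule AE_I2) auto

lemma l2_inner_ip:
  assumes "\<And>x. x \<in> {0..1} \<Longrightarrow> f x = f' x" "continuous_on {0..1} f'" "\<And>x. x \<in> {0..1} \<Longrightarrow> g x = g' x" "continuous_on {0..1} g'"
  shows "l2_inner f g = ip f' g'"
  by (rule l2_inner_AE) (use assms in \<open>auto intro: AE_I01_eq\<close>)

lemma a_form_C1:
  assumes f: "C1 f f'" and g: "C1 g g'" shows "a_form f g = ip f g + 1/3 * ip f' g'"
  unfolding a_form_def
  using l2_inner_AE[OF weak_deriv_C1[OF f] C1_continuous(2)[OF f] weak_deriv_C1[OF g] C1_continuous(2)[OF g]]
    l2_inner_eq_ip[OF C1_continuous(1)[OF f] C1_continuous(1)[OF g]] by simp

lemma a_form_aip: assumes "C1 f f'" "C1 g g'" shows "a_form f g = aip f g"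
  unfolding aip_def by (rule a_form_C1[OF C1_dx_self[OF assms(1)] C1_dx_self[OF assms(2)]])

lemma l2_norm_sq: assumes "continuous_on {0..1} f" shows "(l2_norm f)\<^sup>2 = ip f f"
  unfolding l2_norm_def using l2_inner_eq_ip[OF assms assms] ip_nonneg[of f] by simp

lemma norm1_C1: assumes f: "C1 f f'" shows "norm1 f = sqrt (ip f f + 1/3 * ip f' f')"
proof -
  have "(l2_norm (weak_deriv 1 f))\<^sup>2 = ip f' f'"
    unfolding l2_norm_def
    using l2_inner_AE[OF weak_deriv_C1[OF f] C1_continuous(2)[OF f] weak_deriv_C1[OF f] C1_continuous(2)[OF f]] ip_nonneg[of f'] by simp
  then show ?thesis unfolding norm1_def using l2_norm_sq[OF C1_continuous(1)[OF f]] by simp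
qed

section \<open>The energy estimate\<close>

text \<open>Errors are split as \<open>\<eta> - g = \<rho> + \<theta>\<close> and \<open>u - w = \<sigma> + \<xi>\<close>. Three products lose a derivative:
  \<open>\<theta>' \<theta> w\<close>, \<open>\<theta>' \<xi>\<close> and \<open>(\<eta> \<eta>' - g g') \<xi>\<close>. Each is an exact derivative up to bounded products,
  and the corresponding primitives vanish at both ends because \<open>w\<close> and \<open>\<xi>\<close> do. What remains is
  pointwise a quadratic form in the seven small quantities, with coefficients bounded in terms of \<open>M\<close>.\<close>
lemma energy_estimate:
  fixes c1 c2 c3 M :: real
  assumes \<eta>: "C1 \<eta> \<eta>x" and u: "C1 u ux" and p: "C1 p px" and r: "C1 r rx" and g: "C1 g gx" and w: "C1 w wx"
    and bw: "w 0 = 0" "w 1 = 0" and br: "r 0 = 0" "r 1 = 0"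
    and M: "\<And>x. x \<in> {0..1} \<Longrightarrow> \<bar>\<eta> x\<bar> \<le> M \<and> \<bar>\<eta>x x\<bar> \<le> M \<and> \<bar>u x\<bar> \<le> M \<and> \<bar>g x\<bar> \<le> M \<and> \<bar>w x\<bar> \<le> M \<and> \<bar>wx x\<bar> \<le> M"
  defines "\<theta> \<equiv> \<lambda>x. p x - g x" and "\<xi> \<equiv> \<lambda>x. r x - w x" and "\<xi>' \<equiv> \<lambda>x. rx x - wx x"
    and "\<rho> \<equiv> \<lambda>x. \<eta> x - p x" and "\<rho>' \<equiv> \<lambda>x. \<eta>x x - px x" and "\<sigma> \<equiv> \<lambda>x. u x - r x" and "\<sigma>' \<equiv> \<lambda>x. ux x - rx x"
  defines "A1 \<equiv> \<lambda>x. ux x + c1 * (\<eta>x x * u x + \<eta> x * ux x) - (wx x + c1 * (gx x * w x + g x * wx x))"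
    and "A2 \<equiv> \<lambda>x. \<eta>x x + c2 * (u x * ux x) + c3 * (\<eta> x * \<eta>x x) - (gx x + c2 * (w x * wx x) + c3 * (g x * gx x))"
  shows "- (ip A1 \<theta> + ip A2 \<xi>) \<le> (4 + (7 * \<bar>c1\<bar> + 4 * \<bar>c2\<bar> + 2 * \<bar>c3\<bar>) * M) *
      (ip \<rho> \<rho> + ip \<rho>' \<rho>' + ip \<sigma> \<sigma> + ip \<sigma>' \<sigma>' + ip \<theta> \<theta> + ip \<xi> \<xi> + ip \<xi>' \<xi>')"
proof -
  define \<theta>' where "\<theta>' = (\<lambda>x. px x - gx x)"
  note cc = C1_continuous[OF \<eta>] C1_continuous[OF u] C1_continuous[OF p] C1_continuous[OF r] C1_continuous[OF g] C1_continuous[OF w]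
  have cs: "continuous_on {0..1} \<theta>" "continuous_on {0..1} \<xi>" "continuous_on {0..1} \<xi>'" "continuous_on {0..1} \<rho>"
    "continuous_on {0..1} \<rho>'" "continuous_on {0..1} \<sigma>" "continuous_on {0..1} \<sigma>'" "continuous_on {0..1} A1" "continuous_on {0..1} A2"
    unfolding \<theta>_def \<xi>_def \<xi>'_def \<rho>_def \<rho>'_def \<sigma>_def \<sigma>'_def A1_def A2_def by (intro continuous_intros cc)+
  let ?K = "4 + (7 * \<bar>c1\<bar> + 4 * \<bar>c2\<bar> + 2 * \<bar>c3\<bar>) * M"
  \<comment> \<open>The primitive of the three terms that contain \<open>\<theta>'\<close>.\<close>
  define D where "D x = c1 / 2 * (\<theta> x * \<theta> x * w x) + \<theta> x * \<xi> x + c3 / 2 * ((\<eta> x * \<eta> x - g x * g x) * \<xi> x)" for x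
  define D' where "D' x = c1 / 2 * (2 * \<theta> x * \<theta>' x * w x + \<theta> x * \<theta> x * wx x) + (\<theta>' x * \<xi> x + \<theta> x * \<xi>' x)
     + c3 / 2 * (2 * (\<eta> x * \<eta>x x - g x * gx x) * \<xi> x + (\<eta> x * \<eta> x - g x * g x) * \<xi>' x)" for x
  have CD: "C1 D D'" unfolding C1_def
  proof
    have "continuous_on {0..1} \<theta>'" unfolding \<theta>'_def by (intro continuous_intros cc)
    then show "continuous_on {0..1} D'" unfolding D'_def by (intro continuous_intros cc cs)
    show "\<forall>x\<in>{0..1}. (D has_real_derivative D' x) (at x within {0..1})"
    proof
      fix x :: real assume x: "x \<in> {0..1}"
      have d: "(\<theta> has_real_derivative \<theta>' x) (at x within {0..1})" "(\<xi> has_real_derivative \<xi>' x) (at x within {0..1})"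
        unfolding \<theta>_def \<theta>'_def \<xi>_def \<xi>'_def using p g r w x by (auto simp: C1_def intro!: DERIV_diff)
      have d2: "(\<eta> has_real_derivative \<eta>x x) (at x within {0..1})" "(g has_real_derivative gx x) (at x within {0..1})"
        "(w has_real_derivative wx x) (at x within {0..1})" using \<eta> g w x by (auto simp: C1_def)
      show "(D has_real_derivative D' x) (at x within {0..1})" unfolding D_def D'_def
        by (rule derivative_eq_intros d d2 refl)+ (simp add: algebra_simps)
    qed
  qed
  have D0: "integral {0..1} D' = 0"
    unfolding C1_integral[OF CD] using bw br by (simp add: D_def \<xi>_def)
  define Q where "Q x = A1 x * \<theta> x + A2 x * \<xi> x - D' x" for x
  have i: "(\<lambda>x. A1 x * \<theta> x) integrable_on {0..1}" "(\<lambda>x. A2 x * \<xi> x) integrable_on {0..1}" "D' integrable_on {0..1}"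
    using ip_integrable[OF cs(8,1)] ip_integrable[OF cs(9,2)] CD
    by (auto simp: C1_def intro!: integrable_continuous_interval)
  have "(Q has_integral ip A1 \<theta> + ip A2 \<xi> - integral {0..1} D') {0..1}"
    unfolding Q_def ip_def by (intro has_integral_diff has_integral_add integrable_integral i)
  then have Qi: "(Q has_integral ip A1 \<theta> + ip A2 \<xi>) {0..1}" using D0 by simp
  define S where "S x = \<rho> x * \<rho> x + \<rho>' x * \<rho>' x + \<sigma> x * \<sigma> x + \<sigma>' x * \<sigma>' x + \<theta> x * \<theta> x + \<xi> x * \<xi> x + \<xi>' x * \<xi>' x" for x
  have "(S has_integral ip \<rho> \<rho> + ip \<rho>' \<rho>' + ip \<sigma> \<sigma> + ip \<sigma>' \<sigma>' + ip \<theta> \<theta> + ip \<xi> \<xi> + ip \<xi>' \<xi>') {0..1}"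
    unfolding S_def ip_def by (intro has_integral_add integrable_integral ip_integrable cs)
  then have Si: "((\<lambda>x. ?K * S x) has_integral ?K * (ip \<rho> \<rho> + ip \<rho>' \<rho>' + ip \<sigma> \<sigma> + ip \<sigma>' \<sigma>' + ip \<theta> \<theta> + ip \<xi> \<xi> + ip \<xi>' \<xi>')) {0..1}"
    by (rule has_integral_mult_right)
  have "((\<lambda>x. - Q x) has_integral - (ip A1 \<theta> + ip A2 \<xi>)) {0..1}" using Qi by (rule has_integral_neg)
  then show ?thesis
  proof (rule has_integral_le[OF _ Si])
    fix x :: real assume x: "x \<in> {0..1}"
    have M': "\<bar>\<eta> x\<bar> \<le> M" "\<bar>\<eta>x x\<bar> \<le> M" "\<bar>u x\<bar> \<le> M" "\<bar>g x\<bar> \<le> M" "\<bar>w x\<bar> \<le> M" "\<bar>wx x\<bar> \<le> M"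
      using M[OF x] by auto
    have M0: "0 \<le> M" using M'(1) by linarith
    have sq: "2 * \<bar>a * b\<bar> \<le> a * a + b * b" for a b :: real
      using zero_le_square[of "\<bar>a\<bar> - \<bar>b\<bar>"] by (simp add: algebra_simps abs_mult)
    have nn: "0 \<le> \<rho> x * \<rho> x" "0 \<le> \<rho>' x * \<rho>' x" "0 \<le> \<sigma> x * \<sigma> x" "0 \<le> \<sigma>' x * \<sigma>' x" "0 \<le> \<theta> x * \<theta> x" "0 \<le> \<xi> x * \<xi> x" "0 \<le> \<xi>' x * \<xi>' x"
      by simp_all
    have b0: "\<bar>a * b\<bar> \<le> S x" if "a \<in> {\<rho> x, \<rho>' x, \<sigma> x, \<sigma>' x, \<theta> x, \<xi> x, \<xi>' x}" "b \<in> {\<rho> x, \<rho>' x, \<sigma> x, \<sigma>' x, \<theta> x, \<xi> x, \<xi>' x}" for a b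
    proof -
      have "a * a \<le> S x" "b * b \<le> S x" using that nn unfolding S_def by auto
      then show ?thesis using sq[of a b] by linarith
    qed
    have S0: "0 \<le> S x" using nn by (simp add: S_def)
    have b1: "\<bar>k * m * (a * b)\<bar> \<le> \<bar>k\<bar> * M * S x" if "\<bar>m\<bar> \<le> M" "\<bar>a * b\<bar> \<le> S x" for k m a b
      unfolding abs_mult[of "k * m"] abs_mult[of k] using that M0 by (intro mult_mono) auto
    have Qx: "- Q x = - (\<sigma>' x * \<theta> x) - \<xi>' x * \<theta> x - \<rho>' x * \<xi> x + \<theta> x * \<xi>' x
      - c1 * \<eta>x x * (\<sigma> x * \<theta> x) - c1 * \<eta>x x * (\<xi> x * \<theta> x) - c1 * w x * (\<rho>' x * \<theta> x)
      - c1 * \<eta> x * (\<sigma>' x * \<theta> x) - c1 * \<eta> x * (\<xi>' x * \<theta> x) - c1 * wx x * (\<rho> x * \<theta> x) - c1 * (wx x / 2) * (\<theta> x * \<theta> x)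
      - c2 * u x * (\<sigma>' x * \<xi> x) - c2 * u x * (\<xi>' x * \<xi> x) - c2 * wx x * (\<sigma> x * \<xi> x) - c2 * wx x * (\<xi> x * \<xi> x)
      + c3 * ((\<eta> x + g x) / 2) * (\<rho> x * \<xi>' x) + c3 * ((\<eta> x + g x) / 2) * (\<theta> x * \<xi>' x)"
      unfolding Q_def D'_def A1_def A2_def \<theta>_def \<theta>'_def \<xi>_def \<xi>'_def \<rho>_def \<rho>'_def \<sigma>_def \<sigma>'_def
      by (simp add: field_simps)
    have t: "- (\<sigma>' x * \<theta> x) \<le> S x" "- (\<xi>' x * \<theta> x) \<le> S x" "- (\<rho>' x * \<xi> x) \<le> S x" "\<theta> x * \<xi>' x \<le> S x"
      using b0[of "\<sigma>' x" "\<theta> x"] b0[of "\<xi>' x" "\<theta> x"] b0[of "\<rho>' x" "\<xi> x"] b0[of "\<theta> x" "\<xi>' x"] by (auto simp: abs_le_iff)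
    have h1: "\<bar>wx x / 2\<bar> \<le> M" "\<bar>(\<eta> x + g x) / 2\<bar> \<le> M" using M' by auto
    have t1: "- (c1 * \<eta>x x * (\<sigma> x * \<theta> x)) \<le> \<bar>c1\<bar> * M * S x" "- (c1 * \<eta>x x * (\<xi> x * \<theta> x)) \<le> \<bar>c1\<bar> * M * S x"
      "- (c1 * w x * (\<rho>' x * \<theta> x)) \<le> \<bar>c1\<bar> * M * S x" "- (c1 * \<eta> x * (\<sigma>' x * \<theta> x)) \<le> \<bar>c1\<bar> * M * S x"
      "- (c1 * \<eta> x * (\<xi>' x * \<theta> x)) \<le> \<bar>c1\<bar> * M * S x" "- (c1 * wx x * (\<rho> x * \<theta> x)) \<le> \<bar>c1\<bar> * M * S x"
      "- (c1 * (wx x / 2) * (\<theta> x * \<theta> x)) \<le> \<bar>c1\<bar> * M * S x"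
      by (rule order_trans[OF abs_ge_minus_self b1], use M' h1 in blast, rule b0; blast)+
    have t2: "- (c2 * u x * (\<sigma>' x * \<xi> x)) \<le> \<bar>c2\<bar> * M * S x" "- (c2 * u x * (\<xi>' x * \<xi> x)) \<le> \<bar>c2\<bar> * M * S x"
      "- (c2 * wx x * (\<sigma> x * \<xi> x)) \<le> \<bar>c2\<bar> * M * S x" "- (c2 * wx x * (\<xi> x * \<xi> x)) \<le> \<bar>c2\<bar> * M * S x"
      by (rule order_trans[OF abs_ge_minus_self b1], use M' h1 in blast, rule b0; blast)+
    have t3: "c3 * ((\<eta> x + g x) / 2) * (\<rho> x * \<xi>' x) \<le> \<bar>c3\<bar> * M * S x" "c3 * ((\<eta> x + g x) / 2) * (\<theta> x * \<xi>' x) \<le> \<bar>c3\<bar> * M * S x"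
      by (rule order_trans[OF abs_ge_self b1], use M' h1 in blast, rule b0; blast)+
    have "?K * S x = 4 * S x + 7 * (\<bar>c1\<bar> * M * S x) + 4 * (\<bar>c2\<bar> * M * S x) + 2 * (\<bar>c3\<bar> * M * S x)"
      by (simp add: algebra_simps)
    then show "- Q x \<le> ?K * S x" unfolding Qx using t t1 t2 t3 by linarith
  qed
qed

section \<open>The semidiscrete problem as a system of ordinary differential equations\<close>

text \<open>Both semidiscrete problems are instances of one system with three coefficients:
  \<open>(1, 1, 0)\<close> for (CB) and \<open>(1/2, 3/2, 1/2)\<close> for (SCB).\<close>
definition semidiscrete_solution ::
  "real \<Rightarrow> real \<Rightarrow> real \<Rightarrow> real \<Rightarrow> (real \<Rightarrow> real) \<Rightarrow> (real \<Rightarrow> real) \<Rightarrow> real list \<Rightarrow>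
   (real \<Rightarrow> real \<Rightarrow> real) \<Rightarrow> (real \<Rightarrow> real \<Rightarrow> real) \<Rightarrow> bool" where
  "semidiscrete_solution T c1 c2 c3 \<eta>0 u0 xs \<eta>h uh \<longleftrightarrow>
     semidiscrete_curve T xs \<eta>h uh \<and>
     is_L2_projection xs \<eta>0 (\<eta>h 0) \<and> is_elliptic_projection xs u0 (uh 0) \<and>
     (\<forall>t\<in>{0..T}.
        (\<forall>\<phi>\<in>S4 xs.
           l2_inner (dt T \<eta>h t) \<phi> + (l2_inner (dx (uh t)) \<phi>
             + c1 * l2_inner (dx (\<lambda>x. \<eta>h t x * uh t x)) \<phi>) = 0) \<and>
        (\<forall>\<psi>\<in>S40 xs.
           a_form (dt T uh t) \<psi> + (l2_inner (dx (\<eta>h t)) \<psi>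
             + c2 * l2_inner (\<lambda>x. uh t x * dx (uh t) x) \<psi>
             + c3 * l2_inner (\<lambda>x. \<eta>h t x * dx (\<eta>h t) x) \<psi>) = 0))"

lemma CBh_semidiscrete: "CBh_solution T \<eta>0 u0 xs \<eta>h uh \<longleftrightarrow> semidiscrete_solution T 1 1 0 \<eta>0 u0 xs \<eta>h uh"
  by (simp add: CBh_solution_def semidiscrete_solution_def add.assoc)

lemma SCBh_semidiscrete:
  "SCBh_solution T \<eta>0 u0 xs \<eta>h uh \<longleftrightarrow> semidiscrete_solution T (1/2) (3/2) (1/2) \<eta>0 u0 xs \<eta>h uh"
  by (simp add: SCBh_solution_def semidiscrete_solution_def add.assoc)

lemma sum_lessThan_add: "(\<Sum>i<n + m. g i) = (\<Sum>i<n. g i) + (\<Sum>j<m. g (n + j))" for n m :: nat and g :: "nat \<Rightarrow> real"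
  by (induction m) simp_all

definition clip :: "real \<Rightarrow> (nat \<Rightarrow> real) \<Rightarrow> nat \<Rightarrow> real" where
  "clip R y i = max (- R) (min R (y i))"

lemma clip_lipschitz: "\<bar>clip R y i - clip R z i\<bar> \<le> \<bar>y i - z i\<bar>"
  by (auto simp: clip_def max_def min_def abs_if)

lemma clip_bound: "0 \<le> R \<Longrightarrow> \<bar>clip R y i\<bar> \<le> R"
  by (auto simp: clip_def max_def min_def abs_if)

lemma clip_id: "\<bar>y i\<bar> \<le> R \<Longrightarrow> clip R y i = y i"
  by (auto simp: clip_def max_def min_def abs_if split: if_splits)

text \<open>The coordinate vector has length \<open>n + m\<close>: the first \<open>n\<close> entries are coordinates of \<open>\<eta>\<^sub>h\<close> in the
  \<open>L\<^sup>2\<close>-orthonormal basis \<open>e\<close>, the last \<open>m\<close> are coordinates of \<open>u\<^sub>h\<close> in the \<open>a\<close>-orthonormal basis \<open>f\<close>. In these bases the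
  mass matrices are identities, so the scheme is an explicit system.\<close>
locale galerkin =
  fixes xs :: "real list" and n m :: nat and e f :: "nat \<Rightarrow> real \<Rightarrow> real" and c1 c2 c3 :: real
  assumes mesh: "is_mesh xs"
    and onb_e: "onb (S4 xs) ip n e" and onb_f: "onb (S40 xs) aip m f"
    and coord_e: "i < n \<Longrightarrow> \<exists>c. \<forall>v\<in>S4 xs. ip v (e i) = (\<Sum>p\<in>spline_points xs. c p * v p)"
    and coord_f: "j < m \<Longrightarrow> \<exists>c. \<forall>v\<in>S40 xs. aip v (f j) = (\<Sum>p\<in>spline_points xs. c p * v p)"
begin

sublocale E: form_space "{v. continuous_on {0..1} v}" "S4 xs" ip n e by (rule form_space_S4[OF onb_e])
sublocale F: form_space "{v. C1 v (dx v)}" "S40 xs" aip m f by (rule form_space_S40[OF onb_f])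

lemma f_S4: "j < m \<Longrightarrow> f j \<in> S4 xs" using F.e_V by (simp add: S40_def)

lemma S40_S4: "v \<in> S40 xs \<Longrightarrow> v \<in> S4 xs" by (simp add: S40_def)

text \<open>The splines \<open>\<eta>\<^sub>h\<close> and \<open>u\<^sub>h\<close> with given coordinates, and their spatial derivatives.\<close>
definition He where "He y x = (\<Sum>i<n. y i * e i x)"
definition He' where "He' y x = (\<Sum>i<n. y i * dx (e i) x)"
definition Hu where "Hu y x = (\<Sum>j<m. y (n + j) * f j x)"
definition Hu' where "Hu' y x = (\<Sum>j<m. y (n + j) * dx (f j) x)"

text \<open>The spatial terms of the two equations, and the vector field \<open>G\<close> of the resulting system.\<close>
definition flux1 where "flux1 y x = Hu' y x + c1 * (He' y x * Hu y x + He y x * Hu' y x)"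
definition flux2 where "flux2 y x = He' y x + c2 * (Hu y x * Hu' y x) + c3 * (He y x * He' y x)"

definition G where "G k y = (if k < n then - ip (flux1 y) (e k) else - ip (flux2 y) (f (k - n)))"

lemma C1_He: "C1 (He y) (He' y)"
  unfolding He_def[abs_def] He'_def[abs_def] by (rule C1_sum) (use S4_C1(1) E.e_V in auto)

lemma C1_Hu: "C1 (Hu y) (Hu' y)"
  unfolding Hu_def[abs_def] Hu'_def[abs_def] by (rule C1_sum) (use S4_C1(1) f_S4 in auto)

lemma He_S4: "He y \<in> S4 xs" using E.comb_V[of n y] by (simp add: He_def[abs_def])
lemma Hu_S40: "Hu y \<in> S40 xs" using F.comb_V[of m "\<lambda>j. y (n + j)"] by (simp add: Hu_def[abs_def])

lemmas cH = C1_continuous(1)[OF C1_He] C1_continuous(2)[OF C1_He] C1_continuous(1)[OF C1_Hu] C1_continuous(2)[OF C1_Hu]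

lemma flux_cont: "continuous_on {0..1} (flux1 y)" "continuous_on {0..1} (flux2 y)"
  unfolding flux1_def[abs_def] flux2_def[abs_def] by (intro continuous_intros cH)+

lemma e_cont: "i < n \<Longrightarrow> continuous_on {0..1} (e i)" using S4_cont(1) E.e_V by blast
lemma f_cont: "j < m \<Longrightarrow> continuous_on {0..1} (f j)" using S4_cont(1) f_S4 by blast

lemma H_cong: assumes "\<And>i. i < n + m \<Longrightarrow> y i = z i"
  shows "He y = He z" "He' y = He' z" "Hu y = Hu z" "Hu' y = Hu' z"
  using assms by (auto simp: He_def He'_def Hu_def Hu'_def fun_eq_iff intro!: sum.cong)

lemma G_cong: assumes "\<And>i. i < n + m \<Longrightarrow> y i = z i" shows "G k y = G k z"
  using H_cong[of y z] assms by (simp add: G_def flux1_def[abs_def] flux2_def[abs_def])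

lemma basis_bound: "\<exists>b\<ge>0. \<forall>x\<in>{0..1}. (\<forall>i<n. \<bar>e i x\<bar> \<le> b \<and> \<bar>dx (e i) x\<bar> \<le> b) \<and> (\<forall>j<m. \<bar>f j x\<bar> \<le> b \<and> \<bar>dx (f j) x\<bar> \<le> b)"
proof -
  define \<F> where "\<F> = e ` {..<n} \<union> (\<lambda>i. dx (e i)) ` {..<n} \<union> f ` {..<m} \<union> (\<lambda>j. dx (f j)) ` {..<m}"
  have "bounded (v ` {0..1})" if "v \<in> \<F>" for v
  proof -
    have "continuous_on {0..1} v" using that S4_cont[where xs = xs] E.e_V f_S4 by (auto simp: \<F>_def)
    then show ?thesis by (intro compact_imp_bounded compact_continuous_image) auto
  qed
  then have "bounded (\<Union>v\<in>\<F>. v ` {0..1})" by (intro bounded_UN) (auto simp: \<F>_def)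
  then obtain b where b: "\<forall>y\<in>(\<Union>v\<in>\<F>. v ` {0..1}). norm y \<le> b" unfolding bounded_iff by blast
  have "\<bar>v x\<bar> \<le> \<bar>b\<bar>" if "v \<in> \<F>" "x \<in> {0..1}" for v x
  proof -
    have "norm (v x) \<le> b" using b that by blast
    then show ?thesis by simp
  qed
  then show ?thesis by (intro exI[of _ "\<bar>b\<bar>"]) (auto simp: \<F>_def)
qed

text \<open>Clipping the coordinates makes the quadratic vector field globally Lipschitz.\<close>
lemma G_lipschitz:
  assumes R: "0 \<le> R"
  obtains L where "0 \<le> L"
    "\<And>k y z. k < n + m \<Longrightarrow> \<bar>G k (clip R y) - G k (clip R z)\<bar> \<le> L * (\<Sum>i<n + m. \<bar>y i - z i\<bar>)"
proof -
  obtain b where b0: "0 \<le> b" and b: "\<forall>x\<in>{0..1}. (\<forall>i<n. \<bar>e i x\<bar> \<le> b \<and> \<bar>dx (e i) x\<bar> \<le> b) \<and> (\<forall>j<m. \<bar>f j x\<bar> \<le> b \<and> \<bar>dx (f j) x\<bar> \<le> b)"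
    using basis_bound by blast
  define S where "S = real (n + m) * R * b"
  have S0: "0 \<le> S" using R b0 by (simp add: S_def)
  define c where "c = \<bar>c1\<bar> + \<bar>c2\<bar> + \<bar>c3\<bar>"
  define L where "L = (1 + 4 * c * S) * b * b"
  have c0: "0 \<le> c" by (simp add: c_def)
  have L0: "0 \<le> L" using S0 b0 by (simp add: L_def c_def)
  have key: "\<bar>G k (clip R y) - G k (clip R z)\<bar> \<le> L * (\<Sum>i<n + m. \<bar>y i - z i\<bar>)" if k: "k < n + m" for k y z
  proof -
    define D where "D = (\<Sum>i<n + m. \<bar>y i - z i\<bar>)"
    have D0: "0 \<le> D" by (simp add: D_def sum_nonneg)
    let ?y = "clip R y" and ?z = "clip R z"
    have sumdiff: "\<bar>(\<Sum>i<q. ?y (s + i) * g i) - (\<Sum>i<q. ?z (s + i) * g i)\<bar> \<le> b * D" if "\<And>i. i < q \<Longrightarrow> \<bar>g i\<bar> \<le> b" "s + q \<le> n + m" for q s and g :: "nat \<Rightarrow> real"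
    proof -
      have "\<bar>(\<Sum>i<q. ?y (s + i) * g i) - (\<Sum>i<q. ?z (s + i) * g i)\<bar> = \<bar>\<Sum>i<q. (?y (s + i) - ?z (s + i)) * g i\<bar>"
        by (simp add: sum_subtractf left_diff_distrib)
      also have "\<dots> \<le> (\<Sum>i<q. \<bar>y (s + i) - z (s + i)\<bar> * b)"
        by (rule order_trans[OF sum_abs sum_mono]) (use that clip_lipschitz b0 in \<open>auto simp: abs_mult intro!: mult_mono\<close>)
      also have "\<dots> = (\<Sum>i<q. \<bar>y (s + i) - z (s + i)\<bar>) * b" by (simp add: sum_distrib_right)
      finally have 1: "\<bar>(\<Sum>i<q. ?y (s + i) * g i) - (\<Sum>i<q. ?z (s + i) * g i)\<bar> \<le> (\<Sum>i<q. \<bar>y (s + i) - z (s + i)\<bar>) * b" .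
      have "(\<Sum>i<q. \<bar>y (s + i) - z (s + i)\<bar>) = (\<Sum>i\<in>(\<lambda>i. s + i) ` {..<q}. \<bar>y i - z i\<bar>)"
        by (subst sum.reindex) (auto simp: inj_on_def)
      also have "\<dots> \<le> D" unfolding D_def using that(2) by (intro sum_mono2) auto
      finally have "(\<Sum>i<q. \<bar>y (s + i) - z (s + i)\<bar>) * b \<le> D * b" using b0 by (rule mult_right_mono)
      with 1 show ?thesis by (simp only: mult.commute[of b])
    qed
    have sumbd: "\<bar>\<Sum>i<q. clip R w (s + i) * g i\<bar> \<le> S" if "\<And>i. i < q \<Longrightarrow> \<bar>g i\<bar> \<le> b" "q \<le> n + m" for q s w and g :: "nat \<Rightarrow> real"
    proof -
      have "\<bar>\<Sum>i<q. clip R w (s + i) * g i\<bar> \<le> (\<Sum>i<q. R * b)"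
        by (rule order_trans[OF sum_abs sum_mono]) (use that clip_bound[OF R] b0 R in \<open>auto simp: abs_mult intro!: mult_mono\<close>)
      also have "\<dots> = real q * (R * b)" by simp
      also have "\<dots> \<le> real (n + m) * (R * b)" using that(2) R b0 by (intro mult_right_mono) auto
      finally show ?thesis by (simp add: S_def mult.assoc)
    qed
    have prod: "\<bar>p * q - p' * q'\<bar> \<le> 2 * S * (b * D)" if "\<bar>p - p'\<bar> \<le> b * D" "\<bar>q - q'\<bar> \<le> b * D" "\<bar>q\<bar> \<le> S" "\<bar>p'\<bar> \<le> S" for p q p' q'
    proof -
      have "p * q - p' * q' = (p - p') * q + p' * (q - q')" by (simp add: algebra_simps)
      then have "\<bar>p * q - p' * q'\<bar> \<le> \<bar>p - p'\<bar> * \<bar>q\<bar> + \<bar>p'\<bar> * \<bar>q - q'\<bar>" by (metis abs_mult abs_triangle_ineq)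
      also have "\<dots> \<le> (b * D) * S + S * (b * D)" using that b0 D0 S0 by (intro add_mono mult_mono) auto
      also have "\<dots> = 2 * S * (b * D)" by simp
      finally show ?thesis .
    qed
    have fl: "\<bar>flux1 ?y x - flux1 ?z x\<bar> \<le> (1 + 4 * c * S) * (b * D) \<and> \<bar>flux2 ?y x - flux2 ?z x\<bar> \<le> (1 + 4 * c * S) * (b * D)"
      if x: "x \<in> {0..1}" for x
    proof -
      have d: "\<bar>He ?y x - He ?z x\<bar> \<le> b * D" "\<bar>He' ?y x - He' ?z x\<bar> \<le> b * D" "\<bar>Hu ?y x - Hu ?z x\<bar> \<le> b * D" "\<bar>Hu' ?y x - Hu' ?z x\<bar> \<le> b * D"
        unfolding He_def He'_def Hu_def Hu'_def
        using sumdiff[of n "\<lambda>i. e i x" 0] sumdiff[of n "\<lambda>i. dx (e i) x" 0] sumdiff[of m "\<lambda>i. f i x" n] sumdiff[of m "\<lambda>i. dx (f i) x" n] b x by auto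
      have v: "\<bar>He (clip R w) x\<bar> \<le> S" "\<bar>He' (clip R w) x\<bar> \<le> S" "\<bar>Hu (clip R w) x\<bar> \<le> S" "\<bar>Hu' (clip R w) x\<bar> \<le> S" for w
        unfolding He_def He'_def Hu_def Hu'_def
        using sumbd[of n "\<lambda>i. e i x" w 0] sumbd[of n "\<lambda>i. dx (e i) x" w 0] sumbd[of m "\<lambda>i. f i x" w n] sumbd[of m "\<lambda>i. dx (f i) x" w n] b x by auto
      let ?P = "2 * S * (b * D)"
      have P0: "0 \<le> ?P" using S0 b0 D0 by simp
      have sc: "\<bar>a * t\<bar> \<le> \<bar>a\<bar> * ?P" if "\<bar>t\<bar> \<le> ?P" for a t using that by (simp add: abs_mult mult_left_mono)
      have p1: "\<bar>c1 * (He' ?y x * Hu ?y x - He' ?z x * Hu ?z x)\<bar> \<le> \<bar>c1\<bar> * ?P" "\<bar>c1 * (He ?y x * Hu' ?y x - He ?z x * Hu' ?z x)\<bar> \<le> \<bar>c1\<bar> * ?P"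
        "\<bar>c2 * (Hu ?y x * Hu' ?y x - Hu ?z x * Hu' ?z x)\<bar> \<le> \<bar>c2\<bar> * ?P" "\<bar>c3 * (He ?y x * He' ?y x - He ?z x * He' ?z x)\<bar> \<le> \<bar>c3\<bar> * ?P"
        by (intro sc prod d v)+
      have "flux1 ?y x - flux1 ?z x = (Hu' ?y x - Hu' ?z x) + c1 * (He' ?y x * Hu ?y x - He' ?z x * Hu ?z x) + c1 * (He ?y x * Hu' ?y x - He ?z x * Hu' ?z x)"
        by (simp add: flux1_def algebra_simps)
      then have 1: "\<bar>flux1 ?y x - flux1 ?z x\<bar> \<le> b * D + 2 * \<bar>c1\<bar> * ?P" using d(4) p1(1,2) by linarith
      have "flux2 ?y x - flux2 ?z x = (He' ?y x - He' ?z x) + c2 * (Hu ?y x * Hu' ?y x - Hu ?z x * Hu' ?z x) + c3 * (He ?y x * He' ?y x - He ?z x * He' ?z x)"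
        by (simp add: flux2_def algebra_simps)
      then have 2: "\<bar>flux2 ?y x - flux2 ?z x\<bar> \<le> b * D + (\<bar>c2\<bar> + \<bar>c3\<bar>) * ?P" using d(2) p1(3,4) unfolding distrib_right by linarith
      have "2 * \<bar>c1\<bar> * ?P \<le> (2 * c) * ?P" "(\<bar>c2\<bar> + \<bar>c3\<bar>) * ?P \<le> (2 * c) * ?P"
        by (rule mult_right_mono[OF _ P0], simp add: c_def)+
      moreover have "b * D + (2 * c) * ?P = (1 + 4 * c * S) * (b * D)" by (simp add: algebra_simps)
      ultimately show ?thesis using 1 2 by linarith
    qed
    have ipd: "\<bar>ip v g - ip w g\<bar> \<le> (1 + 4 * c * S) * (b * D) * b"
      if "continuous_on {0..1} v" "continuous_on {0..1} w" "continuous_on {0..1} g" and bd: "\<And>x. x \<in> {0..1} \<Longrightarrow> \<bar>v x - w x\<bar> \<le> (1 + 4 * c * S) * (b * D) \<and> \<bar>g x\<bar> \<le> b" for v w g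
    proof -
      have "ip v g - ip w g = integral {0..1} (\<lambda>x. v x * g x - w x * g x)"
        unfolding ip_def using that by (intro Henstock_Kurzweil_Integration.integral_diff[symmetric] ip_integrable)
      also have "norm \<dots> \<le> integral {0..1} (\<lambda>x::real. (1 + 4 * c * S) * (b * D) * b)"
      proof (rule integral_norm_bound_integral)
        show "(\<lambda>x. v x * g x - w x * g x) integrable_on {0..1}" using that by (intro integrable_diff ip_integrable)
        fix x :: real assume "x \<in> {0..1}"
        then show "norm (v x * g x - w x * g x) \<le> (1 + 4 * c * S) * (b * D) * b"
          unfolding left_diff_distrib[symmetric] real_norm_def abs_mult using bd S0 b0 D0 c0 by (intro mult_mono) auto
      qed auto
      finally show ?thesis by simp
    qed
    have "\<bar>G k ?y - G k ?z\<bar> \<le> (1 + 4 * c * S) * (b * D) * b"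
    proof (cases "k < n")
      case True
      have "\<bar>ip (flux1 ?y) (e k) - ip (flux1 ?z) (e k)\<bar> \<le> (1 + 4 * c * S) * (b * D) * b"
        by (rule ipd[OF flux_cont(1) flux_cont(1) e_cont[OF True]]) (use fl b True in blast)
      then show ?thesis using True by (simp add: G_def abs_minus_commute)
    next
      case False
      then have j: "k - n < m" using k by simp
      have "\<bar>ip (flux2 ?y) (f (k - n)) - ip (flux2 ?z) (f (k - n))\<bar> \<le> (1 + 4 * c * S) * (b * D) * b"
        by (rule ipd[OF flux_cont(2) flux_cont(2) f_cont[OF j]]) (use fl b j in blast)
      then show ?thesis using False by (simp add: G_def abs_minus_commute)
    qed
    then show ?thesis by (simp add: L_def D_def mult_ac)
  qed
  show thesis by (rule that[OF L0 key])
qed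

text \<open>The spatial terms are evaluated for arbitrary functions that agree with the splines on \<open>[0, 1]\<close>, since a semidiscrete
  solution is known to coincide with its expansion there only.\<close>
lemma residual1:
  assumes v: "\<And>x. x \<in> {0..1} \<Longrightarrow> v x = He y x" and w: "\<And>x. x \<in> {0..1} \<Longrightarrow> w x = Hu y x" and \<phi>: "continuous_on {0..1} \<phi>"
  shows "l2_inner (dx w) \<phi> + c1 * l2_inner (dx (\<lambda>x. v x * w x)) \<phi> = ip (flux1 y) \<phi>"
proof -
  have Cw: "C1 w (Hu' y)" by (rule C1_cong[OF C1_Hu[of y]]) (use w in auto)
  have Cvw: "C1 (\<lambda>x. v x * w x) (\<lambda>x. He' y x * Hu y x + He y x * Hu' y x)"
    by (rule C1_cong[OF C1_mult[OF C1_He[of y] C1_Hu[of y]]]) (use v w in auto)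
  have "l2_inner (dx w) \<phi> = ip (Hu' y) \<phi>" by (rule l2_inner_ip[OF C1_dx[OF Cw] cH(4) refl \<phi>])
  moreover have "l2_inner (dx (\<lambda>x. v x * w x)) \<phi> = ip (\<lambda>x. He' y x * Hu y x + He y x * Hu' y x) \<phi>"
    by (rule l2_inner_ip[OF C1_dx[OF Cvw] C1_continuous(2)[OF Cvw] refl \<phi>])
  ultimately show ?thesis unfolding flux1_def[abs_def] using ip_lin[OF cH(4) C1_continuous(2)[OF Cvw] \<phi>] by simp
qed

lemma residual2:
  assumes v: "\<And>x. x \<in> {0..1} \<Longrightarrow> v x = He y x" and w: "\<And>x. x \<in> {0..1} \<Longrightarrow> w x = Hu y x" and \<phi>: "continuous_on {0..1} \<phi>"
  shows "l2_inner (dx v) \<phi> + c2 * l2_inner (\<lambda>x. w x * dx w x) \<phi> + c3 * l2_inner (\<lambda>x. v x * dx v x) \<phi> = ip (flux2 y) \<phi>"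
proof -
  have Cv: "C1 v (He' y)" by (rule C1_cong[OF C1_He[of y]]) (use v in auto)
  have Cw: "C1 w (Hu' y)" by (rule C1_cong[OF C1_Hu[of y]]) (use w in auto)
  have p: "continuous_on {0..1} (\<lambda>x. Hu y x * Hu' y x)" "continuous_on {0..1} (\<lambda>x. He y x * He' y x)" by (intro continuous_intros cH)+
  have "l2_inner (dx v) \<phi> = ip (He' y) \<phi>" by (rule l2_inner_ip[OF C1_dx[OF Cv] cH(2) refl \<phi>])
  moreover have "l2_inner (\<lambda>x. w x * dx w x) \<phi> = ip (\<lambda>x. Hu y x * Hu' y x) \<phi>"
    by (rule l2_inner_ip[OF _ p(1) refl \<phi>]) (simp add: w C1_dx[OF Cw])
  moreover have "l2_inner (\<lambda>x. v x * dx v x) \<phi> = ip (\<lambda>x. He y x * He' y x) \<phi>"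
    by (rule l2_inner_ip[OF _ p(2) refl \<phi>]) (simp add: v C1_dx[OF Cv])
  moreover have "ip (flux2 y) \<phi> = ip (He' y) \<phi> + c2 * ip (\<lambda>x. Hu y x * Hu' y x) \<phi> + c3 * ip (\<lambda>x. He y x * He' y x) \<phi>"
    unfolding flux2_def[abs_def]
    using ip_lin[OF continuous_on_add[OF cH(2) continuous_on_mult[OF continuous_on_const p(1)]] p(2) \<phi>] ip_lin[OF cH(2) p(1) \<phi>] by simp
  ultimately show ?thesis by simp
qed

lemma Hu_ip: assumes "\<phi> \<in> S40 xs" "continuous_on {0..1} g" shows "ip g \<phi> = (\<Sum>j<m. aip \<phi> (f j) * ip g (f j))"
proof -
  have "ip g \<phi> = ip \<phi> g" by (rule ip_sym)
  also have "\<dots> = ip (\<lambda>x. \<Sum>j<m. aip \<phi> (f j) * f j x) g" by (rule ip_cong) (use F.expansion[OF assms(1)] in auto)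
  also have "\<dots> = (\<Sum>j<m. aip \<phi> (f j) * ip (f j) g)" by (rule ip_sum) (use f_cont assms in auto)
  finally show ?thesis by (simp add: ip_sym[of g])
qed

lemma dt_eq:
  assumes T: "0 < T" and t: "t \<in> {0..T}" and "((\<lambda>s. v s x) has_real_derivative D) (at t within {0..T})"
  shows "dt T v t x = D"
  unfolding dt_def using vector_derivative_within_closed_interval[OF T t] assms(3)
  by (simp add: has_real_derivative_iff_has_vector_derivative)

lemma dt_coordinates:
  assumes T: "0 < T" and t: "t \<in> {0..T}" and x: "x \<in> {0..1}"
    and y: "\<And>k. k < n + m \<Longrightarrow> (y k has_real_derivative y' k) (at t within {0..T})"
  shows "(\<And>s. s \<in> {0..T} \<Longrightarrow> v s x = He (\<lambda>i. y i s) x) \<Longrightarrow> ((\<lambda>s. v s x) has_real_derivative He y' x) (at t within {0..T})"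
    "(\<And>s. s \<in> {0..T} \<Longrightarrow> v s x = Hu (\<lambda>i. y i s) x) \<Longrightarrow> ((\<lambda>s. v s x) has_real_derivative Hu y' x) (at t within {0..T})"
proof -
  have 1: "((\<lambda>s. He (\<lambda>i. y i s) x) has_real_derivative He y' x) (at t within {0..T})" unfolding He_def
    by (intro DERIV_sum DERIV_cmult_right y) auto
  have 2: "((\<lambda>s. Hu (\<lambda>i. y i s) x) has_real_derivative Hu y' x) (at t within {0..T})" unfolding Hu_def
    by (intro DERIV_sum DERIV_cmult_right y) auto
  show "((\<lambda>s. v s x) has_real_derivative He y' x) (at t within {0..T})" if "\<And>s. s \<in> {0..T} \<Longrightarrow> v s x = He (\<lambda>i. y i s) x"
    by (rule has_field_derivative_transform_within[OF 1, of 1]) (use t that in auto)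
  show "((\<lambda>s. v s x) has_real_derivative Hu y' x) (at t within {0..T})" if "\<And>s. s \<in> {0..T} \<Longrightarrow> v s x = Hu (\<lambda>i. y i s) x"
    by (rule has_field_derivative_transform_within[OF 2, of 1]) (use t that in auto)
qed

text \<open>The coordinates of \<open>(P v, R\<^sub>h w)\<close>.\<close>
definition initial where "initial v w k = (if k < n then ip v (e k) else aip w (f (k - n)))"

text \<open>By linearity it suffices to test with basis functions, and there the equations are those of the system.\<close>
lemma ode_imp_semidiscrete:
  assumes T: "0 < T"
    and y: "\<And>k t. k < n + m \<Longrightarrow> t \<in> {0..T} \<Longrightarrow> (y k has_real_derivative G k (\<lambda>i. y i t)) (at t within {0..T})"
    and init: "\<And>k. k < n + m \<Longrightarrow> y k 0 = initial \<eta>0 u0 k"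
    and \<eta>0: "continuous_on {0..1} \<eta>0" and u0: "C1 u0 u0'"
  shows "semidiscrete_solution T c1 c2 c3 \<eta>0 u0 xs (\<lambda>t. He (\<lambda>i. y i t)) (\<lambda>t. Hu (\<lambda>i. y i t))"
  unfolding semidiscrete_solution_def
proof (intro conjI ballI)
  have der: "((\<lambda>s. He (\<lambda>i. y i s) x) has_real_derivative He (\<lambda>k. G k (\<lambda>i. y i t)) x) (at t within {0..T})"
    "((\<lambda>s. Hu (\<lambda>i. y i s) x) has_real_derivative Hu (\<lambda>k. G k (\<lambda>i. y i t)) x) (at t within {0..T})"
    if "t \<in> {0..T}" "x \<in> {0..1}" for t x
    using dt_coordinates(1)[OF T that, of y "\<lambda>k. G k (\<lambda>i. y i t)" "\<lambda>s. He (\<lambda>i. y i s)"]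
      dt_coordinates(2)[OF T that, of y "\<lambda>k. G k (\<lambda>i. y i t)" "\<lambda>s. Hu (\<lambda>i. y i s)"] y[OF _ that(1)] by blast+
  show "semidiscrete_curve T xs (\<lambda>t. He (\<lambda>i. y i t)) (\<lambda>t. Hu (\<lambda>i. y i t))"
    unfolding semidiscrete_curve_def t_differentiable_def
    using He_S4 Hu_S40 der real_differentiable_def by blast
  have u0': "u0 \<in> {v. C1 v (dx v)}" using C1_dx_self[OF u0] by simp
  have i1: "He (\<lambda>i. y i 0) = (\<lambda>x. \<Sum>i<n. ip \<eta>0 (e i) * e i x)"
    unfolding He_def[abs_def] by (intro ext sum.cong) (auto simp: init initial_def)
  have i2: "Hu (\<lambda>i. y i 0) = (\<lambda>x. \<Sum>j<m. aip u0 (f j) * f j x)"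
    unfolding Hu_def[abs_def] by (intro ext sum.cong) (auto simp: init initial_def)
  show "is_L2_projection xs \<eta>0 (He (\<lambda>i. y i 0))" unfolding is_L2_projection_def
  proof (intro conjI ballI He_S4)
    fix \<phi> assume \<phi>: "\<phi> \<in> S4 xs"
    show "l2_inner (He (\<lambda>i. y i 0)) \<phi> = l2_inner \<eta>0 \<phi>"
      unfolding l2_inner_eq_ip[OF cH(1) S4_cont(1)[OF \<phi>]] l2_inner_eq_ip[OF \<eta>0 S4_cont(1)[OF \<phi>]]
      unfolding i1 by (rule E.projection_property[OF \<phi>]) (use \<eta>0 in simp)
  qed
  show "is_elliptic_projection xs u0 (Hu (\<lambda>i. y i 0))" unfolding is_elliptic_projection_def
  proof (intro conjI ballI Hu_S40)
    fix \<psi> assume \<psi>: "\<psi> \<in> S40 xs"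
    note C\<psi> = S4_C1(1)[OF S40_S4[OF \<psi>]]
    show "a_form (Hu (\<lambda>i. y i 0)) \<psi> = a_form u0 \<psi>"
      unfolding a_form_aip[OF C1_Hu C\<psi>] a_form_aip[OF u0 C\<psi>]
      unfolding i2 by (rule F.projection_property[OF \<psi> u0'])
  qed
  fix t assume t: "t \<in> {0..T}"
  let ?y = "\<lambda>i. y i t"
  let ?y' = "\<lambda>k. G k ?y"
  fix \<phi> assume \<phi>: "\<phi> \<in> S4 xs"
  note c\<phi> = S4_cont(1)[OF \<phi>]
  have "l2_inner (dt T (\<lambda>t. He (\<lambda>i. y i t)) t) \<phi> = ip (He ?y') \<phi>"
    by (rule l2_inner_ip[OF _ cH(1) refl c\<phi>]) (rule dt_eq[OF T t der(1)[OF t]])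
  also have "\<dots> = (\<Sum>k<n. ?y' k * ip (e k) \<phi>)" unfolding He_def[abs_def] by (rule ip_sum) (use e_cont c\<phi> in auto)
  also have "\<dots> = - ip (flux1 ?y) \<phi>" unfolding E.B_expand[OF \<phi>, of "flux1 ?y", simplified, OF flux_cont(1)] sum_negf[symmetric]
    by (rule sum.cong) (auto simp: G_def ip_sym[of \<phi>])
  finally show "l2_inner (dt T (\<lambda>t. He (\<lambda>i. y i t)) t) \<phi> + (l2_inner (dx (Hu ?y)) \<phi> + c1 * l2_inner (dx (\<lambda>x. He ?y x * Hu ?y x)) \<phi>) = 0"
    using residual1[OF refl refl c\<phi>, of ?y] by simp
next
  fix t assume t: "t \<in> {0..T}"
  let ?y = "\<lambda>i. y i t"
  let ?y' = "\<lambda>k. G k ?y"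
  have der: "dt T (\<lambda>t. Hu (\<lambda>i. y i t)) t x = Hu ?y' x" if "x \<in> {0..1}" for x
    using dt_coordinates(2)[OF T t that, of y ?y' "\<lambda>t. Hu (\<lambda>i. y i t)"] y[OF _ t] by (intro dt_eq[OF T t]) blast
  fix \<psi> assume \<psi>: "\<psi> \<in> S40 xs"
  note c\<psi> = S4_cont(1)[OF S40_S4[OF \<psi>]] and C\<psi> = S4_C1(1)[OF S40_S4[OF \<psi>]]
  have Cd: "C1 (dt T (\<lambda>t. Hu (\<lambda>i. y i t)) t) (Hu' ?y')" by (rule C1_cong[OF C1_Hu[of ?y']]) (use der in auto)
  have "a_form (dt T (\<lambda>t. Hu (\<lambda>i. y i t)) t) \<psi> = aip (dt T (\<lambda>t. Hu (\<lambda>i. y i t)) t) \<psi>" by (rule a_form_aip[OF Cd C\<psi>])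
  also have "\<dots> = aip (Hu ?y') \<psi>"
    by (rule F.B_cong) (use der C1_dx_self[OF Cd] C1_dx_self[OF C1_Hu] C\<psi> in auto)
  also have "\<dots> = (\<Sum>j<m. ?y' (n + j) * aip (f j) \<psi>)" unfolding Hu_def[abs_def]
    using F.B_comb[of m \<psi> "\<lambda>j. ?y' (n + j)"] C\<psi> by simp
  also have "\<dots> = - ip (flux2 ?y) \<psi>" unfolding Hu_ip[OF \<psi> flux_cont(2)] sum_negf[symmetric]
    by (rule sum.cong) (auto simp: G_def aip_sym[of \<psi>])
  finally show "a_form (dt T (\<lambda>t. Hu (\<lambda>i. y i t)) t) \<psi> + (l2_inner (dx (He ?y)) \<psi> + c2 * l2_inner (\<lambda>x. Hu ?y x * dx (Hu ?y) x) \<psi>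
      + c3 * l2_inner (\<lambda>x. He ?y x * dx (He ?y) x) \<psi>) = 0"
    using residual2[OF refl refl c\<psi>, of ?y] by simp
qed

text \<open>The coordinates of a semidiscrete solution are differentiable because they are combinations of point values; their
  derivatives are then read off by testing with the basis functions.\<close>
lemma semidiscrete_imp_ode:
  assumes T: "0 < T" and sol: "semidiscrete_solution T c1 c2 c3 \<eta>0 u0 xs \<eta>h uh"
    and \<eta>0: "continuous_on {0..1} \<eta>0" and u0: "C1 u0 u0'"
  defines "y \<equiv> \<lambda>k t. initial (\<eta>h t) (uh t) k"
  shows "\<And>t x. t \<in> {0..T} \<Longrightarrow> x \<in> {0..1} \<Longrightarrow> \<eta>h t x = He (\<lambda>i. y i t) x \<and> uh t x = Hu (\<lambda>i. y i t) x"
    and "\<And>k. k < n + m \<Longrightarrow> y k 0 = initial \<eta>0 u0 k"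
    and "\<And>k t. k < n + m \<Longrightarrow> t \<in> {0..T} \<Longrightarrow> (y k has_real_derivative G k (\<lambda>i. y i t)) (at t within {0..T})"
proof -
  have curve: "\<eta>h t \<in> S4 xs" "uh t \<in> S40 xs" if "t \<in> {0..T}" for t
    using sol that by (auto simp: semidiscrete_solution_def semidiscrete_curve_def)
  have diff: "((\<lambda>s. v s x) has_real_derivative dt T v t x) (at t within {0..T})"
    if "v = \<eta>h \<or> v = uh" "t \<in> {0..T}" "x \<in> {0..1}" for v t x
  proof -
    have "(\<lambda>s. v s x) differentiable (at t within {0..T})"
      using sol that by (auto simp: semidiscrete_solution_def semidiscrete_curve_def t_differentiable_def)
    then show ?thesis unfolding dt_def has_real_derivative_iff_has_vector_derivative by (simp add: vector_derivative_works)
  qed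
  show rep: "\<eta>h t x = He (\<lambda>i. y i t) x \<and> uh t x = Hu (\<lambda>i. y i t) x" if "t \<in> {0..T}" "x \<in> {0..1}" for t x
    using E.expansion[OF curve(1)[OF that(1)] that(2)] F.expansion[OF curve(2)[OF that(1)] that(2)]
    by (simp add: y_def initial_def He_def Hu_def)
  have T0: "0 \<in> {0..T}" using T by simp
  show "y k 0 = initial \<eta>0 u0 k" if k: "k < n + m" for k
  proof (cases "k < n")
    case True
    have "l2_inner (\<eta>h 0) (e k) = l2_inner \<eta>0 (e k)"
      using sol E.e_V[OF True] by (auto simp: semidiscrete_solution_def is_L2_projection_def)
    then show ?thesis unfolding l2_inner_eq_ip[OF \<eta>0 e_cont[OF True]] l2_inner_eq_ip[OF S4_cont(1)[OF curve(1)[OF T0]] e_cont[OF True]]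
      using True by (simp add: y_def initial_def)
  next
    case False
    then have j: "k - n < m" using k by simp
    have "a_form (uh 0) (f (k - n)) = a_form u0 (f (k - n))"
      using sol F.e_V[OF j] by (auto simp: semidiscrete_solution_def is_elliptic_projection_def)
    then show ?thesis unfolding a_form_aip[OF u0 S4_C1(1)[OF f_S4[OF j]]] a_form_aip[OF S4_C1(1)[OF S40_S4[OF curve(2)[OF T0]]] S4_C1(1)[OF f_S4[OF j]]]
      using False by (simp add: y_def initial_def)
  qed
  have ydiff: "\<exists>D. (y k has_real_derivative D) (at t within {0..T})" if k: "k < n + m" and t: "t \<in> {0..T}" for k t
  proof -
    obtain c v where v: "v = \<eta>h \<or> v = uh" and yk: "\<And>s. s \<in> {0..T} \<Longrightarrow> y k s = (\<Sum>p\<in>spline_points xs. c p * v s p)"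
    proof (cases "k < n")
      case True
      obtain c where "\<forall>v\<in>S4 xs. ip v (e k) = (\<Sum>p\<in>spline_points xs. c p * v p)" using coord_e[OF True] by blast
      then have "y k s = (\<Sum>p\<in>spline_points xs. c p * \<eta>h s p)" if "s \<in> {0..T}" for s
        using True curve(1)[OF that] by (simp add: y_def initial_def)
      then show thesis by (rule that[of \<eta>h c, rotated]) simp_all
    next
      case False
      then have j: "k - n < m" using k by simp
      obtain c where "\<forall>v\<in>S40 xs. aip v (f (k - n)) = (\<Sum>p\<in>spline_points xs. c p * v p)" using coord_f[OF j] by blast
      then have "y k s = (\<Sum>p\<in>spline_points xs. c p * uh s p)" if "s \<in> {0..T}" for s
        using False curve(2)[OF that] by (simp add: y_def initial_def)
      then show thesis by (rule that[of uh c, rotated]) simp_all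
    qed
    have "((\<lambda>s. \<Sum>p\<in>spline_points xs. c p * v s p) has_real_derivative (\<Sum>p\<in>spline_points xs. c p * dt T v t p)) (at t within {0..T})"
      by (intro DERIV_sum DERIV_cmult diff v t) (use spline_points_in[OF mesh] in auto)
    then have "(y k has_real_derivative (\<Sum>p\<in>spline_points xs. c p * dt T v t p)) (at t within {0..T})"
      by (rule has_field_derivative_transform_within[of _ _ _ _ 1]) (use t yk in auto)
    then show ?thesis by blast
  qed
  show "(y k has_real_derivative G k (\<lambda>i. y i t)) (at t within {0..T})" if k: "k < n + m" and t: "t \<in> {0..T}" for k t
  proof -
    have "\<forall>k. \<exists>D. k < n + m \<longrightarrow> (y k has_real_derivative D) (at t within {0..T})" using ydiff[OF _ t] by blast
    then obtain y' where y': "\<And>k. k < n + m \<longrightarrow> (y k has_real_derivative y' k) (at t within {0..T})" by metis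
    let ?y = "\<lambda>i. y i t"
    have d1: "dt T \<eta>h t x = He y' x" and d2: "dt T uh t x = Hu y' x" if x: "x \<in> {0..1}" for x
      using dt_coordinates[OF T t x, of y y'] y' rep[OF _ x] by (auto intro!: dt_eq[OF T t])
    have "y' k = G k ?y"
    proof (cases "k < n")
      case True
      have "l2_inner (dt T \<eta>h t) (e k) = ip (He y') (e k)" by (rule l2_inner_ip[OF d1 cH(1) refl e_cont[OF True]])
      also have "\<dots> = y' k" unfolding He_def[abs_def] by (rule E.coordinate_comb[OF True])
      finally have 1: "l2_inner (dt T \<eta>h t) (e k) = y' k" .
      have "l2_inner (dt T \<eta>h t) (e k) + (l2_inner (dx (uh t)) (e k) + c1 * l2_inner (dx (\<lambda>x. \<eta>h t x * uh t x)) (e k)) = 0"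
        using sol t E.e_V[OF True] by (auto simp: semidiscrete_solution_def)
      then show ?thesis using residual1[of "\<eta>h t" ?y "uh t", OF _ _ e_cont[OF True]] rep[OF t] 1 True by (simp add: G_def)
    next
      case False
      then have j: "k - n < m" and kj: "n + (k - n) = k" using k by auto
      have Cd: "C1 (dt T uh t) (Hu' y')" by (rule C1_cong[OF C1_Hu[of y']]) (use d2 in auto)
      have "a_form (dt T uh t) (f (k - n)) = aip (dt T uh t) (f (k - n))" by (rule a_form_aip[OF Cd S4_C1(1)[OF f_S4[OF j]]])
      also have "\<dots> = aip (Hu y') (f (k - n))"
        by (rule F.B_cong) (use d2 C1_dx_self[OF Cd] C1_dx_self[OF C1_Hu] S4_C1(1)[OF f_S4[OF j]] in auto)
      also have "\<dots> = y' k" unfolding Hu_def[abs_def] using F.coordinate_comb[OF j, of "\<lambda>j. y' (n + j)"] kj by simp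
      finally have 1: "a_form (dt T uh t) (f (k - n)) = y' k" .
      have "a_form (dt T uh t) (f (k - n)) + (l2_inner (dx (\<eta>h t)) (f (k - n)) + c2 * l2_inner (\<lambda>x. uh t x * dx (uh t) x) (f (k - n))
             + c3 * l2_inner (\<lambda>x. \<eta>h t x * dx (\<eta>h t) x) (f (k - n))) = 0"
        using sol t F.e_V[OF j] by (auto simp: semidiscrete_solution_def)
      then show ?thesis using residual2[of "\<eta>h t" ?y "uh t", OF _ _ f_cont[OF j]] rep[OF t] 1 False by (simp add: G_def)
    qed
    then show ?thesis using y' k by metis
  qed
qed

end

section \<open>Convergence for a smooth solution\<close>

lemma ip_uminus: "ip (\<lambda>x. - f x) g = - ip f g"
  by (simp add: ip_def)

lemma ip_diff:
  assumes "continuous_on {0..1} f" "continuous_on {0..1} g" "continuous_on {0..1} h"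
  shows "ip (\<lambda>x. f x - g x) h = ip f h - ip g h"
  using ip_lin[OF assms, of "-1"] by simp

text \<open>Differentiation under the integral sign, with one-sided derivatives at the ends of the time interval.\<close>
lemma ip_time_derivative:
  assumes d: "\<And>s x. s \<in> {0..T} \<Longrightarrow> x \<in> {0..1} \<Longrightarrow> ((\<lambda>s. v s x) has_real_derivative vt s x) (at s within {0..T})"
    and vt: "continuous_on ({0..T} \<times> {0..1}) (\<lambda>(s, x). vt s x)"
    and v: "\<And>s. s \<in> {0..T} \<Longrightarrow> continuous_on {0..1} (v s)" and \<phi>: "continuous_on {0..1} \<phi>" and t: "t \<in> {0..T}"
  shows "((\<lambda>s. ip (v s) \<phi>) has_real_derivative ip (vt t) \<phi>) (at t within {0..T})"
proof -
  have "((\<lambda>s. integral (cbox 0 1) (\<lambda>x. v s x * \<phi> x)) has_field_derivative integral (cbox 0 1) (\<lambda>x. vt t x * \<phi> x)) (at t within {0..T})"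
  proof (rule leibniz_rule_field_derivative)
    show "((\<lambda>s. v s x * \<phi> x) has_field_derivative vt s x * \<phi> x) (at s within {0..T})" if "s \<in> {0..T}" "x \<in> cbox 0 1" for s x
      using d[of s x] that by (auto intro!: derivative_eq_intros)
    show "(\<lambda>x. v s x * \<phi> x) integrable_on cbox 0 1" if "s \<in> {0..T}" for s
      using ip_integrable[OF v[OF that] \<phi>] by simp
    have "continuous_on ({0..T} \<times> {0..1}) (\<lambda>p. \<phi> (snd p))"
      by (rule continuous_on_compose2[OF \<phi> continuous_on_snd[OF continuous_on_id]]) auto
    then have "continuous_on ({0..T} \<times> {0..1}) (\<lambda>p. (case p of (s, x) \<Rightarrow> vt s x) * \<phi> (snd p))" by (rule continuous_on_mult[OF vt])
    then show "continuous_on ({0..T} \<times> cbox 0 1) (\<lambda>(s, x). vt s x * \<phi> x)" by (simp add: case_prod_beta)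
  qed (use t in auto)
  then show ?thesis by (simp add: ip_def)
qed

text \<open>What the convergence proof uses of the exact solution: the equations with all derivatives named, a uniform bound
  \<open>M1\<close> for the functions in the nonlinear terms, and approximability by splines on every mesh with one
  constant \<open>M\<close> for all times.\<close>
locale smooth_solution =
  fixes T M M1 c1 c2 c3 :: real and \<eta> \<eta>x \<eta>t u ux uxx ut uxxt :: "real \<Rightarrow> real \<Rightarrow> real"
  assumes T: "0 < T"
    and C1_\<eta>: "t \<in> {0..T} \<Longrightarrow> C1 (\<eta> t) (\<eta>x t)"
    and C1_u: "t \<in> {0..T} \<Longrightarrow> C1 (u t) (ux t)" and C1_ux: "t \<in> {0..T} \<Longrightarrow> C1 (ux t) (uxx t)"
    and u_boundary: "t \<in> {0..T} \<Longrightarrow> u t 0 = 0 \<and> u t 1 = 0"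
    and d\<eta>: "t \<in> {0..T} \<Longrightarrow> x \<in> {0..1} \<Longrightarrow> ((\<lambda>s. \<eta> s x) has_real_derivative \<eta>t t x) (at t within {0..T})"
    and du: "t \<in> {0..T} \<Longrightarrow> x \<in> {0..1} \<Longrightarrow> ((\<lambda>s. u s x) has_real_derivative ut t x) (at t within {0..T})"
    and duxx: "t \<in> {0..T} \<Longrightarrow> x \<in> {0..1} \<Longrightarrow> ((\<lambda>s. uxx s x) has_real_derivative uxxt t x) (at t within {0..T})"
    and cont_t: "continuous_on ({0..T} \<times> {0..1}) (\<lambda>(s, x). \<eta>t s x)" "continuous_on ({0..T} \<times> {0..1}) (\<lambda>(s, x). ut s x)"
      "continuous_on ({0..T} \<times> {0..1}) (\<lambda>(s, x). uxxt s x)"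
    and eq1: "t \<in> {0..T} \<Longrightarrow> x \<in> {0..1} \<Longrightarrow> \<eta>t t x + (ux t x + c1 * (\<eta>x t x * u t x + \<eta> t x * ux t x)) = 0"
    and eq2: "t \<in> {0..T} \<Longrightarrow> x \<in> {0..1} \<Longrightarrow>
        ut t x - 1/3 * uxxt t x + (\<eta>x t x + c2 * (u t x * ux t x) + c3 * (\<eta> t x * \<eta>x t x)) = 0"
    and M1: "t \<in> {0..T} \<Longrightarrow> x \<in> {0..1} \<Longrightarrow> \<bar>\<eta> t x\<bar> \<le> M1 \<and> \<bar>\<eta>x t x\<bar> \<le> M1 \<and> \<bar>u t x\<bar> \<le> M1 \<and> \<bar>ux t x\<bar> \<le> M1"
    and M: "0 \<le> M"
    and approx_\<eta>: "t \<in> {0..T} \<Longrightarrow> is_mesh zs \<Longrightarrow> \<exists>s\<in>S4 zs. ip (\<lambda>x. \<eta> t x - s x) (\<lambda>x. \<eta> t x - s x) \<le> (M * mesh_h zs ^ 4)\<^sup>2 \<and>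
        ip (\<lambda>x. \<eta>x t x - dx s x) (\<lambda>x. \<eta>x t x - dx s x) \<le> (M * mesh_h zs ^ 3)\<^sup>2 \<and> (\<forall>x\<in>{0..1}. \<bar>\<eta> t x - s x\<bar> \<le> M)"
    and approx_u: "t \<in> {0..T} \<Longrightarrow> is_mesh zs \<Longrightarrow> \<exists>s\<in>S40 zs. ip (\<lambda>x. u t x - s x) (\<lambda>x. u t x - s x) \<le> (M * mesh_h zs ^ 4)\<^sup>2 \<and>
        ip (\<lambda>x. ux t x - dx s x) (\<lambda>x. ux t x - dx s x) \<le> (M * mesh_h zs ^ 3)\<^sup>2 \<and> (\<forall>x\<in>{0..1}. \<bar>ux t x - dx s x\<bar> \<le> M)"

text \<open>The inverse inequalities are assumed with the largest cell width and a constant \<open>q\<close>, which therefore absorbs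
  the quasiuniformity constant.\<close>
locale scheme = smooth_solution T M M1 c1 c2 c3 \<eta> \<eta>x \<eta>t u ux uxx ut uxxt + galerkin xs n m e f c1 c2 c3
  for T M M1 c1 c2 c3 \<eta> \<eta>x \<eta>t u ux uxx ut uxxt xs n m e f +
  fixes q :: real
  assumes q: "0 \<le> q"
    and inv1: "v \<in> S4 xs \<Longrightarrow> x \<in> {0..1} \<Longrightarrow> (v x)\<^sup>2 \<le> q / mesh_h xs * ip v v"
    and inv2: "v \<in> S4 xs \<Longrightarrow> x \<in> {0..1} \<Longrightarrow> (dx v x)\<^sup>2 \<le> q / mesh_h xs * ip (dx v) (dx v)"
    and inv3: "v \<in> S4 xs \<Longrightarrow> ip (dx v) (dx v) \<le> q / (mesh_h xs)\<^sup>2 * ip v v"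
begin

abbreviation h where "h \<equiv> mesh_h xs"

lemma h: "0 < h" "h \<le> 1" using mesh_h_bounds[OF mesh] by auto

lemma h_pow: "h ^ (6 + k) \<le> h ^ 6" using h by (intro power_decreasing) auto

text \<open>Coordinates of \<open>(P \<eta>, R\<^sub>h u)\<close>.\<close>
definition Y where "Y k t = initial (\<eta> t) (u t) k"

text \<open>The weak form of the spatial terms of the exact solution, the counterpart of the vector field \<open>G\<close>.\<close>
definition F where "F k t = (if k < n then - ip (\<lambda>x. ux t x + c1 * (\<eta>x t x * u t x + \<eta> t x * ux t x)) (e k)
   else - ip (\<lambda>x. \<eta>x t x + c2 * (u t x * ux t x) + c3 * (\<eta> t x * \<eta>x t x)) (f (k - n)))"

text \<open>The projections commute with the time derivative, so the consistency error contains no projection of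
  \<open>\<eta>\<^sub>t\<close> or \<open>u\<^sub>t\<close>. For \<open>R\<^sub>h\<close> one integration by parts turns \<open>a(u, f)\<close> into \<open>(u - u\<^sub>x\<^sub>x/3, f)\<close>, whose time derivative
  is given by the equation.\<close>
lemma Y_derivative:
  assumes k: "k < n + m" and t: "t \<in> {0..T}"
  shows "(Y k has_real_derivative F k t) (at t within {0..T})"
proof (cases "k < n")
  case True
  have 1: "((\<lambda>s. ip (\<eta> s) (e k)) has_real_derivative ip (\<eta>t t) (e k)) (at t within {0..T})"
    by (rule ip_time_derivative[OF d\<eta> cont_t(1) C1_continuous(1)[OF C1_\<eta>] e_cont[OF True] t])
  have "ip (\<eta>t t) (e k) = ip (\<lambda>x. - (ux t x + c1 * (\<eta>x t x * u t x + \<eta> t x * ux t x))) (e k)"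
  proof (rule ip_cong)
    fix x :: real assume x: "x \<in> {0..1}"
    show "\<eta>t t x = - (ux t x + c1 * (\<eta>x t x * u t x + \<eta> t x * ux t x))" using eq1[OF t x] by linarith
  qed simp
  also have "\<dots> = - ip (\<lambda>x. ux t x + c1 * (\<eta>x t x * u t x + \<eta> t x * ux t x)) (e k)" by (rule ip_uminus)
  finally show ?thesis using 1 True by (simp add: Y_def[abs_def] F_def initial_def)
next
  case False
  then have j: "k - n < m" using k by simp
  let ?f = "f (k - n)"
  note Cf = S4_C1(1)[OF f_S4[OF j]]
  have f0: "?f 0 = 0" "?f 1 = 0" using F.e_V[OF j] by (auto simp: S40_def)
  have Ys: "aip (u s) ?f = ip (\<lambda>x. u s x + (-1/3) * uxx s x) ?f" if s: "s \<in> {0..T}" for s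
  proof -
    have cc: "continuous_on {0..1} (u s)" "continuous_on {0..1} (uxx s)" "continuous_on {0..1} (ux s)" "continuous_on {0..1} ?f" "continuous_on {0..1} (dx ?f)"
      using C1_continuous[OF C1_u[OF s]] C1_continuous[OF C1_ux[OF s]] C1_continuous[OF Cf] by auto
    have "integral {0..1} (\<lambda>x. uxx s x * ?f x + ux s x * dx ?f x) = 0"
      using C1_integral[OF C1_mult[OF C1_ux[OF s] Cf]] f0 by simp
    then have "ip (uxx s) ?f + ip (ux s) (dx ?f) = 0"
      using Henstock_Kurzweil_Integration.integral_add[OF ip_integrable[OF cc(2,4)] ip_integrable[OF cc(3,5)]] by (simp add: ip_def)
    moreover have "ip (dx (u s)) (dx ?f) = ip (ux s) (dx ?f)" by (rule ip_cong) (use C1_dx[OF C1_u[OF s]] in auto)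
    ultimately show ?thesis using ip_lin[OF cc(1,2,4), of "-1/3"] by (simp add: aip_def)
  qed
  have "((\<lambda>s. ip (\<lambda>x. u s x + (-1/3) * uxx s x) ?f) has_real_derivative ip (\<lambda>x. ut t x + (-1/3) * uxxt t x) ?f) (at t within {0..T})"
  proof (rule ip_time_derivative[OF _ _ _ f_cont[OF j] t])
    show "((\<lambda>s. u s x + (-1/3) * uxx s x) has_real_derivative ut s x + (-1/3) * uxxt s x) (at s within {0..T})"
      if "s \<in> {0..T}" "x \<in> {0..1}" for s x
      by (intro DERIV_add DERIV_cmult du duxx that)
    show "continuous_on ({0..T} \<times> {0..1}) (\<lambda>(s, x). ut s x + (-1/3) * uxxt s x)"
      using cont_t(2,3) by (auto simp: case_prod_beta intro!: continuous_intros)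
    show "continuous_on {0..1} (\<lambda>x. u s x + (-1/3) * uxx s x)" if "s \<in> {0..T}" for s
      using C1_continuous[OF C1_u[OF that]] C1_continuous[OF C1_ux[OF that]] by (intro continuous_intros)
  qed
  then have 1: "((\<lambda>s. aip (u s) ?f) has_real_derivative ip (\<lambda>x. ut t x + (-1/3) * uxxt t x) ?f) (at t within {0..T})"
    by (rule has_field_derivative_transform_within[of _ _ _ _ 1]) (use t Ys in auto)
  have "ip (\<lambda>x. ut t x + (-1/3) * uxxt t x) ?f = ip (\<lambda>x. - (\<eta>x t x + c2 * (u t x * ux t x) + c3 * (\<eta> t x * \<eta>x t x))) ?f"
  proof (rule ip_cong)
    fix x :: real assume x: "x \<in> {0..1}"
    show "ut t x + (-1/3) * uxxt t x = - (\<eta>x t x + c2 * (u t x * ux t x) + c3 * (\<eta> t x * \<eta>x t x))"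
      using eq2[OF t x] by linarith
  qed simp
  also have "\<dots> = - ip (\<lambda>x. \<eta>x t x + c2 * (u t x * ux t x) + c3 * (\<eta> t x * \<eta>x t x)) ?f" by (rule ip_uminus)
  finally show ?thesis using 1 False by (simp add: Y_def[abs_def] F_def initial_def)
qed

lemma Y_spline:
  "He (\<lambda>k. Y k t) = (\<lambda>x. \<Sum>i<n. ip (\<eta> t) (e i) * e i x)" "Hu (\<lambda>k. Y k t) = (\<lambda>x. \<Sum>j<m. aip (u t) (f j) * f j x)"
  unfolding He_def[abs_def] Hu_def[abs_def] Y_def initial_def by (auto intro!: ext sum.cong)

lemma abs_le_one_plus_square: "\<bar>a\<bar> \<le> 1 + a\<^sup>2" for a :: real
  using zero_le_power2[of "\<bar>a\<bar> - 1 / 2"] by (simp add: power2_diff power_divide)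

text \<open>Approximation by \<open>P\<close> and \<open>R\<^sub>h\<close>, in \<open>L\<^sup>2\<close> to third order and pointwise boundedly. Best approximation handles the
  norm each projection minimises; the inverse inequalities carry this over to the others.\<close>
lemma projection_bounds:
  assumes t: "t \<in> {0..T}"
  defines "p \<equiv> He (\<lambda>k. Y k t)" and "px \<equiv> He' (\<lambda>k. Y k t)" and "r \<equiv> Hu (\<lambda>k. Y k t)" and "rx \<equiv> Hu' (\<lambda>k. Y k t)"
  shows "ip (\<lambda>x. \<eta> t x - p x) (\<lambda>x. \<eta> t x - p x) \<le> M\<^sup>2 * h ^ 6"
    "ip (\<lambda>x. \<eta>x t x - px x) (\<lambda>x. \<eta>x t x - px x) \<le> (2 + 8 * q) * (M\<^sup>2 * h ^ 6)"
    "ip (\<lambda>x. u t x - r x) (\<lambda>x. u t x - r x) + 1/3 * ip (\<lambda>x. ux t x - rx x) (\<lambda>x. ux t x - rx x) \<le> 2 * (M\<^sup>2 * h ^ 6)"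
    "x \<in> {0..1} \<Longrightarrow> \<bar>p x\<bar> \<le> M1 + M + 1 + 4 * q * M\<^sup>2"
    "x \<in> {0..1} \<Longrightarrow> \<bar>rx x\<bar> \<le> M1 + M + 1 + 14 * q * M\<^sup>2"
proof -
  have pS: "p \<in> S4 xs" unfolding p_def by (rule He_S4)
  have rS: "r \<in> S40 xs" unfolding r_def by (rule Hu_S40)
  have Cp: "C1 p px" unfolding p_def px_def by (rule C1_He)
  have Cr: "C1 r rx" unfolding r_def rx_def by (rule C1_Hu)
  note C\<eta> = C1_\<eta>[OF t] and Cu = C1_u[OF t]
  obtain s where s: "s \<in> S4 xs" and s0: "ip (\<lambda>x. \<eta> t x - s x) (\<lambda>x. \<eta> t x - s x) \<le> (M * h ^ 4)\<^sup>2"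
    and s1: "ip (\<lambda>x. \<eta>x t x - dx s x) (\<lambda>x. \<eta>x t x - dx s x) \<le> (M * h ^ 3)\<^sup>2" and sM: "\<forall>x\<in>{0..1}. \<bar>\<eta> t x - s x\<bar> \<le> M"
    using approx_\<eta>[OF t mesh] by blast
  note Cs = S4_C1(1)[OF s]
  note cc = C1_continuous[OF C\<eta>] C1_continuous[OF Cu] C1_continuous[OF Cp] C1_continuous[OF Cr] C1_continuous[OF Cs]
  have h8: "(M * h ^ 4)\<^sup>2 = M\<^sup>2 * h ^ 8" and h6: "(M * h ^ 3)\<^sup>2 = M\<^sup>2 * h ^ 6" by (simp_all add: power_mult_distrib)
  have h86: "M\<^sup>2 * h ^ 8 \<le> M\<^sup>2 * h ^ 6" using h_pow[of 2] by (intro mult_left_mono) auto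
  have best: "ip (\<lambda>x. \<eta> t x - p x) (\<lambda>x. \<eta> t x - p x) \<le> M\<^sup>2 * h ^ 8"
    using E.best_approximation[of "\<eta> t" s] s s0 cc(1) by (simp add: p_def Y_spline h8)
  then show "ip (\<lambda>x. \<eta> t x - p x) (\<lambda>x. \<eta> t x - p x) \<le> M\<^sup>2 * h ^ 6" using h86 by linarith
  define d where "d = (\<lambda>x. s x + (-1) * p x)"
  have dS: "d \<in> S4 xs" unfolding d_def by (rule S4_lin[OF s pS])
  have Cd: "C1 d (\<lambda>x. dx s x + (-1) * px x)" unfolding d_def by (rule C1_add_scaled[OF Cs Cp])
  have dd: "ip d d \<le> 4 * (M\<^sup>2 * h ^ 8)"
  proof -
    have "d = (\<lambda>x. (\<eta> t x - p x) + (-1) * (\<eta> t x - s x))" by (auto simp: d_def)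
    then have "ip d d = ip (\<lambda>x. (\<eta> t x - p x) + (-1) * (\<eta> t x - s x)) (\<lambda>x. (\<eta> t x - p x) + (-1) * (\<eta> t x - s x))" by simp
    also have "\<dots> \<le> 2 * ip (\<lambda>x. \<eta> t x - p x) (\<lambda>x. \<eta> t x - p x) + 2 * ip (\<lambda>x. (-1) * (\<eta> t x - s x)) (\<lambda>x. (-1) * (\<eta> t x - s x))"
      by (rule ip_triangle2) (intro continuous_intros cc)+
    also have "ip (\<lambda>x. (-1) * (\<eta> t x - s x)) (\<lambda>x. (-1) * (\<eta> t x - s x)) = ip (\<lambda>x. \<eta> t x - s x) (\<lambda>x. \<eta> t x - s x)"
      by (simp add: ip_def algebra_simps)
    finally show ?thesis using best s0 h8 by linarith
  qed
  have "ip (dx d) (dx d) \<le> q / h\<^sup>2 * (4 * (M\<^sup>2 * h ^ 8))"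
    by (rule order_trans[OF inv3[OF dS] mult_left_mono[OF dd]]) (use q in simp)
  also have "\<dots> = 4 * q * (M\<^sup>2 * h ^ 6)" using h by (simp add: field_simps eval_nat_numeral)
  finally have dd': "ip (dx d) (dx d) \<le> 4 * q * (M\<^sup>2 * h ^ 6)" .
  have "ip (\<lambda>x. \<eta>x t x - px x) (\<lambda>x. \<eta>x t x - px x) = ip (\<lambda>x. (\<eta>x t x - dx s x) + dx d x) (\<lambda>x. (\<eta>x t x - dx s x) + dx d x)"
    by (rule ip_cong) (simp_all add: C1_dx[OF Cd])
  also have "\<dots> \<le> 2 * ip (\<lambda>x. \<eta>x t x - dx s x) (\<lambda>x. \<eta>x t x - dx s x) + 2 * ip (dx d) (dx d)"
    by (rule ip_triangle2) (intro continuous_intros cc S4_cont(2)[OF dS])+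
  also have "\<dots> \<le> 2 * (M\<^sup>2 * h ^ 6) + 2 * (4 * q * (M\<^sup>2 * h ^ 6))" using s1 dd' h6 by linarith
  finally show "ip (\<lambda>x. \<eta>x t x - px x) (\<lambda>x. \<eta>x t x - px x) \<le> (2 + 8 * q) * (M\<^sup>2 * h ^ 6)" by (simp add: algebra_simps)
  show "\<bar>p x\<bar> \<le> M1 + M + 1 + 4 * q * M\<^sup>2" if x: "x \<in> {0..1}"
  proof -
    have "(d x)\<^sup>2 \<le> q / h * (4 * (M\<^sup>2 * h ^ 8))"
      by (rule order_trans[OF inv1[OF dS x] mult_left_mono[OF dd]]) (use q h in simp)
    also have "\<dots> = 4 * q * M\<^sup>2 * h ^ 7" using h by (simp add: field_simps eval_nat_numeral)
    also have "\<dots> \<le> 4 * q * M\<^sup>2 * 1" using h q by (intro mult_left_mono power_le_one) auto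
    finally have "\<bar>d x\<bar> \<le> 1 + 4 * q * M\<^sup>2" using abs_le_one_plus_square[of "d x"] by linarith
    moreover have "\<bar>\<eta> t x - s x\<bar> \<le> M" "\<bar>\<eta> t x\<bar> \<le> M1" using sM M1[OF t x] x by auto
    moreover have "p x = \<eta> t x - (\<eta> t x - s x) - d x" by (simp add: d_def)
    ultimately show ?thesis by linarith
  qed
  obtain z where z: "z \<in> S40 xs" and z0: "ip (\<lambda>x. u t x - z x) (\<lambda>x. u t x - z x) \<le> (M * h ^ 4)\<^sup>2"
    and z1: "ip (\<lambda>x. ux t x - dx z x) (\<lambda>x. ux t x - dx z x) \<le> (M * h ^ 3)\<^sup>2" and zM: "\<forall>x\<in>{0..1}. \<bar>ux t x - dx z x\<bar> \<le> M"
    using approx_u[OF t mesh] by blast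
  note Cz = S4_C1(1)[OF S40_S4[OF z]]
  have aip_diff: "aip (\<lambda>x. u t x + (-1) * w x) (\<lambda>x. u t x + (-1) * w x) = ip (\<lambda>x. u t x - w x) (\<lambda>x. u t x - w x) + 1/3 * ip (\<lambda>x. ux t x - w' x) (\<lambda>x. ux t x - w' x)"
    if Cw: "C1 w w'" for w w'
  proof -
    have "ip (dx (\<lambda>x. u t x + (-1) * w x)) (dx (\<lambda>x. u t x + (-1) * w x)) = ip (\<lambda>x. ux t x - w' x) (\<lambda>x. ux t x - w' x)"
      by (rule ip_cong) (simp_all add: C1_dx[OF C1_add_scaled[OF Cu Cw, of "-1"], simplified])
    then show ?thesis by (simp add: aip_def)
  qed
  have "aip (\<lambda>x. u t x + (-1) * r x) (\<lambda>x. u t x + (-1) * r x) \<le> aip (\<lambda>x. u t x + (-1) * z x) (\<lambda>x. u t x + (-1) * z x)"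
    unfolding r_def Y_spline by (rule F.best_approximation[OF _ z]) (use C1_dx_self[OF Cu] in simp)
  then show R: "ip (\<lambda>x. u t x - r x) (\<lambda>x. u t x - r x) + 1/3 * ip (\<lambda>x. ux t x - rx x) (\<lambda>x. ux t x - rx x) \<le> 2 * (M\<^sup>2 * h ^ 6)"
    unfolding aip_diff[OF Cr] aip_diff[OF Cz] using z0 z1 h8 h6 h86 zero_le_power2[of "M * h ^ 3"] by linarith
  define g where "g = (\<lambda>x. z x + (-1) * r x)"
  have gS: "g \<in> S4 xs" unfolding g_def by (rule S4_lin[OF S40_S4[OF z] S40_S4[OF rS]])
  have Cg: "C1 g (\<lambda>x. dx z x + (-1) * rx x)" unfolding g_def by (rule C1_add_scaled[OF Cz Cr])
  have "ip (dx g) (dx g) = ip (\<lambda>x. (ux t x - rx x) + (-1) * (ux t x - dx z x)) (\<lambda>x. (ux t x - rx x) + (-1) * (ux t x - dx z x))"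
    by (rule ip_cong) (simp_all add: C1_dx[OF Cg])
  also have "\<dots> \<le> 2 * ip (\<lambda>x. ux t x - rx x) (\<lambda>x. ux t x - rx x) + 2 * ip (\<lambda>x. (-1) * (ux t x - dx z x)) (\<lambda>x. (-1) * (ux t x - dx z x))"
    by (rule ip_triangle2) (intro continuous_intros cc C1_continuous(2)[OF Cz])+
  also have "ip (\<lambda>x. (-1) * (ux t x - dx z x)) (\<lambda>x. (-1) * (ux t x - dx z x)) = ip (\<lambda>x. ux t x - dx z x) (\<lambda>x. ux t x - dx z x)"
    by (simp add: ip_def algebra_simps)
  finally have gg: "ip (dx g) (dx g) \<le> 14 * (M\<^sup>2 * h ^ 6)"
    using R z1 h6 ip_nonneg[of "\<lambda>x. u t x - r x"] by linarith
  show "\<bar>rx x\<bar> \<le> M1 + M + 1 + 14 * q * M\<^sup>2" if x: "x \<in> {0..1}"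
  proof -
    have "(dx g x)\<^sup>2 \<le> q / h * (14 * (M\<^sup>2 * h ^ 6))"
      by (rule order_trans[OF inv2[OF gS x] mult_left_mono[OF gg]]) (use q h in simp)
    also have "\<dots> = 14 * q * M\<^sup>2 * h ^ 5" using h by (simp add: field_simps eval_nat_numeral)
    also have "\<dots> \<le> 14 * q * M\<^sup>2 * 1" using h q by (intro mult_left_mono power_le_one) auto
    finally have "\<bar>dx g x\<bar> \<le> 1 + 14 * q * M\<^sup>2" using abs_le_one_plus_square[of "dx g x"] by linarith
    moreover have "\<bar>ux t x - dx z x\<bar> \<le> M" "\<bar>ux t x\<bar> \<le> M1" using zM M1[OF t x] x by auto
    moreover have "rx x = ux t x - (ux t x - dx z x) - dx g x" by (simp add: C1_dx[OF Cg x])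
    ultimately show ?thesis by linarith
  qed
qed

lemma H_diff: "He (\<lambda>k. a k - b k) x = He a x - He b x" "He' (\<lambda>k. a k - b k) x = He' a x - He' b x"
  "Hu (\<lambda>k. a k - b k) x = Hu a x - Hu b x" "Hu' (\<lambda>k. a k - b k) x = Hu' a x - Hu' b x"
  by (simp_all add: He_def He'_def Hu_def Hu'_def left_diff_distrib sum_subtractf)

lemma H_parseval:
  "ip (He d) (He d) + (ip (Hu d) (Hu d) + 1/3 * ip (Hu' d) (Hu' d)) = (\<Sum>k<n + m. (d k)\<^sup>2)"
proof -
  have "ip (He d) (He d) = (\<Sum>k<n. (d k)\<^sup>2)" using E.parseval[of d] by (simp add: He_def[abs_def])
  moreover have "aip (Hu d) (Hu d) = (\<Sum>j<m. (d (n + j))\<^sup>2)" using F.parseval[of "\<lambda>j. d (n + j)"] by (simp add: Hu_def[abs_def])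
  moreover have "aip (Hu d) (Hu d) = ip (Hu d) (Hu d) + 1/3 * ip (Hu' d) (Hu' d)"
    unfolding aip_def using ip_cong[of "dx (Hu d)" "Hu' d" "dx (Hu d)" "Hu' d"] C1_dx[OF C1_Hu] by simp
  ultimately show ?thesis by (simp add: sum_lessThan_add)
qed

lemma ip_He: assumes "continuous_on {0..1} g" shows "ip g (He d) = (\<Sum>k<n. d k * ip g (e k))"
  using ip_sum[of n e g d] e_cont assms by (simp add: He_def[abs_def] ip_sym[of g])

lemma ip_Hu: assumes "continuous_on {0..1} g" shows "ip g (Hu d) = (\<Sum>j<m. d (n + j) * ip g (f j))"
  using ip_sum[of m f g "\<lambda>j. d (n + j)"] f_cont assms by (simp add: Hu_def[abs_def] ip_sym[of g])

text \<open>\<open>M2\<close> bounds the exact and the discrete solution: \<open>projection_bounds\<close> with \<open>1 + 4 q\<close> added for the error against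
  the projections. In \<open>K\<close> the factor \<open>2\<close> stems from differentiating squares and \<open>3\<close> from the weight \<open>1/3\<close> in the
  form \<open>a\<close>. \<open>B h\<^sup>6\<close> dominates all projection errors.\<close>
definition M2 where "M2 = M1 + M + 2 + 18 * q * M\<^sup>2 + 4 * q"
definition K where "K = 6 * (4 + (7 * \<bar>c1\<bar> + 4 * \<bar>c2\<bar> + 2 * \<bar>c3\<bar>) * M2)"
definition B where "B = (11 + 8 * q) * M\<^sup>2"

text \<open>Growth of the error, valid as long as its square is at most \<open>h\<close>: the inverse inequality costs
  \<open>h\<^bsup>-1/2\<^esup>\<close>, which such an error can afford, and bounds the discrete solution pointwise.\<close>
lemma error_growth:
  assumes t: "t \<in> {0..T}" and small: "(\<Sum>k<n + m. (Y k t - a k)\<^sup>2) \<le> h"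
  shows "(\<Sum>k<n + m. 2 * (Y k t - a k) * (F k t - G k a)) \<le> K * ((\<Sum>k<n + m. (Y k t - a k)\<^sup>2) + B * h ^ 6)"
proof -
  define d where "d k = Y k t - a k" for k
  define Ed where "Ed = (\<Sum>k<n + m. (d k)\<^sup>2)"
  have Edh: "Ed \<le> h" using small by (simp add: Ed_def d_def)
  let ?y = "\<lambda>k. Y k t"
  have HD: "He d x = He ?y x - He a x" "Hu d x = Hu ?y x - Hu a x" "Hu' d x = Hu' ?y x - Hu' a x" for x
    using H_diff[of ?y a] by (simp_all add: d_def[abs_def])
  note par = H_parseval[of d, folded Ed_def]
  have nn: "0 \<le> ip (He d) (He d)" "0 \<le> ip (Hu d) (Hu d)" "0 \<le> ip (Hu' d) (Hu' d)" by (rule ip_nonneg)+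
  have M10: "0 \<le> M1" using M1[OF t, of 0] by auto
  have qM: "0 \<le> q * M\<^sup>2" using q by simp
  have bHe: "\<bar>He a x\<bar> \<le> M2" if x: "x \<in> {0..1}" for x
  proof -
    have "ip (He d) (He d) \<le> h" using par nn Edh by linarith
    then have "(He d x)\<^sup>2 \<le> q / h * h" using inv1[OF He_S4 x, of d] q h by (meson divide_nonneg_pos mult_left_mono order_trans)
    then have "\<bar>He d x\<bar> \<le> 1 + q" using abs_le_one_plus_square[of "He d x"] h by simp
    then show ?thesis using projection_bounds(4)[OF t x] HD(1)[of x] qM q unfolding M2_def mult.assoc by linarith
  qed
  have bHu': "\<bar>Hu' a x\<bar> \<le> M2" if x: "x \<in> {0..1}" for x
  proof -
    have "ip (dx (Hu d)) (dx (Hu d)) = ip (Hu' d) (Hu' d)" by (rule ip_cong) (simp_all add: C1_dx[OF C1_Hu])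
    also have "\<dots> \<le> 3 * h" using par nn Edh by linarith
    finally have "(dx (Hu d) x)\<^sup>2 \<le> q / h * (3 * h)"
      using inv2[OF S40_S4[OF Hu_S40] x, of d] q h by (meson divide_nonneg_pos mult_left_mono order_trans)
    then have "\<bar>Hu' d x\<bar> \<le> 1 + 3 * q" using abs_le_one_plus_square[of "Hu' d x"] h C1_dx[OF C1_Hu x, of d] by simp
    then show ?thesis using projection_bounds(5)[OF t x] HD(3)[of x] qM q unfolding M2_def mult.assoc by linarith
  qed
  have M20: "0 \<le> M2" using M10 M qM q unfolding M2_def mult.assoc by linarith
  have Hu0: "Hu a 0 = 0" "Hu a 1 = 0" "Hu ?y 0 = 0" "Hu ?y 1 = 0" using Hu_S40[of a] Hu_S40[of ?y] by (auto simp: S40_def)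
  have bHu: "\<bar>Hu a x\<bar> \<le> M2" if x: "x \<in> {0..1}" for x
  proof (cases "x = 0")
    case False
    then have x0: "0 < x" using x by simp
    have x1: "x \<le> 1" using x by simp
    have D: "\<And>x. x \<in> {0..1} \<Longrightarrow> (Hu a has_real_derivative Hu' a x) (at x within {0..1})" using C1_Hu by (simp add: C1_def)
    obtain \<xi> where \<xi>: "0 < \<xi>" "\<xi> < x" "Hu a x - Hu a 0 = (x - 0) * Hu' a \<xi>"
      by (rule mean_value_within[OF D x0 order_refl x1])
    then have "\<bar>Hu a x\<bar> = x * \<bar>Hu' a \<xi>\<bar>" using Hu0 x0 by (simp add: abs_mult)
    also have "\<dots> \<le> 1 * M2" using bHu'[of \<xi>] \<xi> x by (intro mult_mono) auto
    finally show ?thesis by simp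
  qed (use Hu0 M20 in simp)
  have M12: "M1 \<le> M2" using M qM q unfolding M2_def mult.assoc by linarith
  note C\<eta> = C1_\<eta>[OF t] and Cu = C1_u[OF t]
  let ?A1 = "\<lambda>x. ux t x + c1 * (\<eta>x t x * u t x + \<eta> t x * ux t x) - (Hu' a x + c1 * (He' a x * Hu a x + He a x * Hu' a x))"
  let ?A2 = "\<lambda>x. \<eta>x t x + c2 * (u t x * ux t x) + c3 * (\<eta> t x * \<eta>x t x) - (He' a x + c2 * (Hu a x * Hu' a x) + c3 * (He a x * He' a x))"
  let ?r0 = "\<lambda>x. \<eta> t x - He ?y x" and ?r1 = "\<lambda>x. \<eta>x t x - He' ?y x" and ?s0 = "\<lambda>x. u t x - Hu ?y x" and ?s1 = "\<lambda>x. ux t x - Hu' ?y x"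
  have en: "- (ip ?A1 (He d) + ip ?A2 (Hu d)) \<le> (4 + (7 * \<bar>c1\<bar> + 4 * \<bar>c2\<bar> + 2 * \<bar>c3\<bar>) * M2) *
      (ip ?r0 ?r0 + ip ?r1 ?r1 + ip ?s0 ?s0 + ip ?s1 ?s1 + ip (He d) (He d) + ip (Hu d) (Hu d) + ip (Hu' d) (Hu' d))"
    unfolding HD[abs_def]
  proof (rule energy_estimate[OF C\<eta> Cu C1_He C1_Hu C1_He C1_Hu])
    fix x :: real assume x: "x \<in> {0..1}"
    show "\<bar>\<eta> t x\<bar> \<le> M2 \<and> \<bar>\<eta>x t x\<bar> \<le> M2 \<and> \<bar>u t x\<bar> \<le> M2 \<and> \<bar>He a x\<bar> \<le> M2 \<and> \<bar>Hu a x\<bar> \<le> M2 \<and> \<bar>Hu' a x\<bar> \<le> M2"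
      using M1[OF t x] M12 bHe[OF x] bHu[OF x] bHu'[OF x] by linarith
  qed (use Hu0 in auto)
  have lhs: "(\<Sum>k<n + m. 2 * d k * (F k t - G k a)) = 2 * (- (ip ?A1 (He d) + ip ?A2 (Hu d)))"
  proof -
    have c: "continuous_on {0..1} (\<lambda>x. ux t x + c1 * (\<eta>x t x * u t x + \<eta> t x * ux t x))"
      "continuous_on {0..1} (\<lambda>x. \<eta>x t x + c2 * (u t x * ux t x) + c3 * (\<eta> t x * \<eta>x t x))"
      by (intro continuous_intros C1_continuous[OF C\<eta>] C1_continuous[OF Cu])+
    have cA: "continuous_on {0..1} ?A1" "continuous_on {0..1} ?A2"
      using continuous_on_diff[OF c(1) flux_cont(1)[of a]] continuous_on_diff[OF c(2) flux_cont(2)[of a]]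
      by (simp_all add: flux1_def flux2_def)
    have 1: "F k t - G k a = - ip ?A1 (e k)" if "k < n" for k
    proof -
      have "ip ?A1 (e k) = ip (\<lambda>x. ux t x + c1 * (\<eta>x t x * u t x + \<eta> t x * ux t x)) (e k) - ip (flux1 a) (e k)"
        using ip_diff[OF c(1) flux_cont(1)[of a] e_cont[OF that]] by (simp only: flux1_def[of a])
      then show ?thesis using that by (simp add: F_def G_def)
    qed
    have 2: "F (n + j) t - G (n + j) a = - ip ?A2 (f j)" if "j < m" for j
    proof -
      have "ip ?A2 (f j) = ip (\<lambda>x. \<eta>x t x + c2 * (u t x * ux t x) + c3 * (\<eta> t x * \<eta>x t x)) (f j) - ip (flux2 a) (f j)"
        using ip_diff[OF c(2) flux_cont(2)[of a] f_cont[OF that]] by (simp only: flux2_def[of a])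
      then show ?thesis by (simp add: F_def G_def)
    qed
    have i1: "ip ?A1 (He d) = (\<Sum>k<n. d k * ip ?A1 (e k))"
      by (rule ip_He[OF cA(1)])
    have i2: "ip ?A2 (Hu d) = (\<Sum>j<m. d (n + j) * ip ?A2 (f j))"
      by (rule ip_Hu[OF cA(2)])
    have s1: "(\<Sum>k<n. 2 * d k * (F k t - G k a)) = (\<Sum>k<n. (- 2) * (d k * ip ?A1 (e k)))"
    proof (rule sum.cong[OF refl])
      fix k assume "k \<in> {..<n}"
      then have "k < n" by simp
      from 1[OF this] show "2 * d k * (F k t - G k a) = (- 2) * (d k * ip ?A1 (e k))" by simp
    qed
    have s2: "(\<Sum>j<m. 2 * d (n + j) * (F (n + j) t - G (n + j) a)) = (\<Sum>j<m. (- 2) * (d (n + j) * ip ?A2 (f j)))"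
    proof (rule sum.cong[OF refl])
      fix j assume "j \<in> {..<m}"
      then have "j < m" by simp
      from 2[OF this] show "2 * d (n + j) * (F (n + j) t - G (n + j) a) = (- 2) * (d (n + j) * ip ?A2 (f j))" by simp
    qed
    show ?thesis unfolding sum_lessThan_add s1 s2 sum_distrib_left[symmetric] i1[symmetric] i2[symmetric] by simp
  qed
  note pb = projection_bounds[OF t]
  have total: "ip ?r0 ?r0 + ip ?r1 ?r1 + ip ?s0 ?s0 + ip ?s1 ?s1 + ip (He d) (He d) + ip (Hu d) (Hu d) + ip (Hu' d) (Hu' d)
      \<le> 3 * (Ed + B * h ^ 6)"
  proof -
    define X where "X = M\<^sup>2 * h ^ 6"
    define Z where "Z = (2 + 8 * q) * X"
    have nonneg: "0 \<le> X" "0 \<le> Z" using q h by (simp_all add: X_def Z_def)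
    have BX: "B * h ^ 6 = 9 * X + Z" by (simp add: B_def X_def Z_def algebra_simps)
    have r: "ip ?r0 ?r0 \<le> X" "ip ?r1 ?r1 \<le> Z" "ip ?s0 ?s0 + 1/3 * ip ?s1 ?s1 \<le> 2 * X"
      using pb(1,2,3) by (simp_all add: X_def Z_def mult.assoc)
    have combine: "a0 + a1 + b0 + b1 + d0 + d1 + d2 \<le> 3 * (Ed + (9 * X + Z))"
      if "a0 \<le> X" "a1 \<le> Z" "b0 + 1/3 * b1 \<le> 2 * X" "0 \<le> b0" "0 \<le> b1" "0 \<le> d0" "0 \<le> d1" "0 \<le> d2"
        "d0 + (d1 + 1/3 * d2) = Ed" for a0 a1 b0 b1 d0 d1 d2 :: real
      using that nonneg by (simp add: field_simps)
    show ?thesis unfolding BX by (rule combine[OF r ip_nonneg ip_nonneg nn par])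
  qed
  have K0: "0 \<le> 4 + (7 * \<bar>c1\<bar> + 4 * \<bar>c2\<bar> + 2 * \<bar>c3\<bar>) * M2" using M20 by (intro add_nonneg_nonneg mult_nonneg_nonneg) auto
  have "(\<Sum>k<n + m. 2 * d k * (F k t - G k a)) \<le> 2 * ((4 + (7 * \<bar>c1\<bar> + 4 * \<bar>c2\<bar> + 2 * \<bar>c3\<bar>) * M2) * (3 * (Ed + B * h ^ 6)))"
    unfolding lhs by (intro mult_left_mono order_trans[OF en mult_left_mono[OF total K0]]) auto
  also have "\<dots> = K * (Ed + B * h ^ 6)" by (simp add: K_def algebra_simps)
  finally show ?thesis by (simp add: Ed_def d_def)
qed

text \<open>The constant that Gronwall's inequality yields at the final time.\<close>
definition B2 where "B2 = B * exp (K * T)"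

lemma B_nonneg: "0 \<le> B" using q by (simp add: B_def)

lemma K_nonneg: "0 \<le> K"
proof -
  have "0 \<le> M1" using M1[of 0 0] T by auto
  then show ?thesis using q M unfolding K_def M2_def by (intro mult_nonneg_nonneg add_nonneg_nonneg) auto
qed

lemma Y_continuous: "k < n + m \<Longrightarrow> continuous_on {0..T} (Y k)"
  using Y_derivative by (intro DERIV_continuous_on)

lemma bounded_family:
  fixes y :: "nat \<Rightarrow> real \<Rightarrow> real"
  assumes "\<And>k. k < N \<Longrightarrow> continuous_on {0..T} (y k)"
  shows "\<exists>R\<ge>0. \<forall>k<N. \<forall>t\<in>{0..T}. \<bar>y k t\<bar> \<le> R"
proof -
  have "bounded (y k ` {0..T})" if "k < N" for k using assms[OF that] by (intro compact_imp_bounded compact_continuous_image) auto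
  then have "bounded (\<Union>k<N. y k ` {0..T})" by (intro bounded_UN) auto
  then obtain R where R: "\<forall>z\<in>(\<Union>k<N. y k ` {0..T}). norm z \<le> R" unfolding bounded_iff by blast
  have "\<bar>y k t\<bar> \<le> \<bar>R\<bar>" if "k < N" "t \<in> {0..T}" for k t
  proof -
    have "norm (y k t) \<le> R" using R that by blast
    then show ?thesis by simp
  qed
  then show ?thesis by (intro exI[of _ "\<bar>R\<bar>"]) auto
qed

text \<open>The clipping level exceeds the coordinates of the projections by one, and these differ by at most one from the
  coordinates of the solution while the squared error is at most \<open>h \<le> 1\<close>. So the clipped system coincides with the
  scheme as long as the error bound holds, and the error bound persists by continuation because
  \<open>B2 h\<^sup>6 < h\<close>.\<close>
lemma existence:
  assumes small: "B2 * h < 1"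
  obtains y where "\<And>k. k < n + m \<Longrightarrow> y k 0 = Y k 0"
    "\<And>k t. k < n + m \<Longrightarrow> t \<in> {0..T} \<Longrightarrow> (y k has_real_derivative G k (\<lambda>i. y i t)) (at t within {0..T})"
    "\<And>t. t \<in> {0..T} \<Longrightarrow> (\<Sum>k<n + m. (Y k t - y k t)\<^sup>2) \<le> B2 * h ^ 6"
proof -
  obtain R where R0: "0 \<le> R" and R: "\<forall>k<n + m. \<forall>t\<in>{0..T}. \<bar>Y k t\<bar> \<le> R" using bounded_family[of "n + m" Y] Y_continuous by blast
  have R1: "0 \<le> R + 1" using R0 by simp
  obtain L where L: "0 \<le> L"
    "\<And>k y z. k < n + m \<Longrightarrow> \<bar>G k (clip (R + 1) y) - G k (clip (R + 1) z)\<bar> \<le> L * (\<Sum>i<n + m. \<bar>y i - z i\<bar>)"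
    by (rule G_lipschitz[OF R1]) (rule that; assumption)
  obtain y where y0: "\<And>k. k < n + m \<Longrightarrow> y k 0 = Y k 0"
    and yd: "\<And>k t. k < n + m \<Longrightarrow> t \<in> {0..T} \<Longrightarrow> (y k has_real_derivative G k (clip (R + 1) (\<lambda>i. y i t))) (at t within {0..T})"
    by (rule lipschitz_ode_existence[of "n + m" "\<lambda>k y. G k (clip (R + 1) y)" L T "\<lambda>k. Y k 0", OF L(2) L(1) less_imp_le[OF T]]) (assumption | (rule that; assumption))+
  define Err where "Err t = (\<Sum>k<n + m. (Y k t - y k t)\<^sup>2)" for t
  have yc: "continuous_on {0..T} (y k)" if "k < n + m" for k using yd[OF that] by (rule DERIV_continuous_on)
  have unclip: "G k (clip (R + 1) (\<lambda>i. y i t)) = G k (\<lambda>i. y i t)" if t: "t \<in> {0..T}" and E: "Err t \<le> h" for k t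
  proof (rule G_cong)
    fix i assume i: "i < n + m"
    have "(Y i t - y i t)\<^sup>2 \<le> Err t" unfolding Err_def by (rule member_le_sum) (use i in auto)
    then have "(Y i t - y i t)\<^sup>2 \<le> 1\<^sup>2" using E h by simp
    then have "\<bar>Y i t - y i t\<bar> \<le> 1" by (simp only: abs_le_square_iff[symmetric] abs_one)
    moreover have "\<bar>Y i t\<bar> \<le> R" using R i t by blast
    ultimately show "clip (R + 1) (\<lambda>i. y i t) i = y i t" by (intro clip_id) linarith
  qed
  have bound: "Err t \<le> B2 * h ^ 6" if t: "t \<in> {0..T}" and E: "\<And>s. s \<in> {0..t} \<Longrightarrow> Err s \<le> h" for t
  proof -
    have "Err t + B * h ^ 6 \<le> (Err 0 + B * h ^ 6) * exp (K * t)"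
    proof (rule gronwall_differential[where E' = "\<lambda>s. \<Sum>k<n + m. 2 * (Y k s - y k s) * (F k s - G k (\<lambda>i. y i s))"])
      fix s assume s: "s \<in> {0..t}"
      then have sT: "s \<in> {0..T}" using t by auto
      have sub: "{0..t} \<subseteq> {0..T}" using t by auto
      show "(\<Sum>k<n + m. 2 * (Y k s - y k s) * (F k s - G k (\<lambda>i. y i s))) \<le> K * (Err s + B * h ^ 6)"
        unfolding Err_def by (rule error_growth[OF sT]) (use E[OF s] in \<open>simp add: Err_def\<close>)
      show "(Err has_real_derivative (\<Sum>k<n + m. 2 * (Y k s - y k s) * (F k s - G k (\<lambda>i. y i s)))) (at s within {0..t})"
        unfolding Err_def
      proof (rule DERIV_sum)
        fix k assume k: "k \<in> {..<n + m}"
        have d: "((\<lambda>s. Y k s - y k s) has_real_derivative F k s - G k (\<lambda>i. y i s)) (at s within {0..t})"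
          using DERIV_subset[OF DERIV_diff[OF Y_derivative[of k, OF _ sT] yd[of k, OF _ sT]] sub] k unclip[OF sT E[OF s]] by simp
        show "((\<lambda>s. (Y k s - y k s)\<^sup>2) has_real_derivative 2 * (Y k s - y k s) * (F k s - G k (\<lambda>i. y i s))) (at s within {0..t})"
          by (rule DERIV_cong[OF DERIV_power[OF d, of 2]]) (simp add: algebra_simps)
      qed
    qed (use t in auto)
    also have "Err 0 = 0" using y0 by (simp add: Err_def)
    also have "(0 + B * h ^ 6) * exp (K * t) \<le> B * h ^ 6 * exp (K * T)"
      using B_nonneg K_nonneg h t by (auto intro!: mult_left_mono)
    finally show ?thesis using B_nonneg h by (simp add: B2_def mult_ac add_increasing2 order_trans[rotated])
  qed
  have hs: "B2 * h ^ 6 < h"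
  proof -
    have B20: "0 \<le> B2" using B_nonneg by (simp add: B2_def)
    have "B2 * h ^ 6 = B2 * h * h ^ 5" by (simp add: eval_nat_numeral)
    also have "\<dots> \<le> B2 * h * h"
      using h B20 power_decreasing[of 1 5 h] by (intro mult_left_mono) auto
    also have "\<dots> < 1 * h" using small h by (intro mult_strict_right_mono) auto
    finally show ?thesis by simp
  qed
  have all: "Err t < h" if t: "t \<in> {0..T}" for t
  proof (rule continuation_bound[OF _ _ _ t])
    show "continuous_on {0..T} Err" unfolding Err_def by (intro continuous_intros Y_continuous yc) auto
    show "Err 0 < h" using y0 h by (simp add: Err_def)
    show "Err t < h" if "t \<in> {0..T}" "\<And>s. s \<in> {0..t} \<Longrightarrow> Err s \<le> h" for t using bound[OF that] hs by linarith
  qed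
  show thesis
  proof (rule that[of y])
    show "y k 0 = Y k 0" if "k < n + m" for k by (rule y0[OF that])
    show "(y k has_real_derivative G k (\<lambda>i. y i t)) (at t within {0..T})" if "k < n + m" "t \<in> {0..T}" for k t
      using yd[OF that] unclip[OF that(2) less_imp_le[OF all[OF that(2)]]] by simp
    show "(\<Sum>k<n + m. (Y k t - y k t)\<^sup>2) \<le> B2 * h ^ 6" if t: "t \<in> {0..T}" for t
    proof -
      have "Err s \<le> h" if "s \<in> {0..t}" for s using all[of s] that t by auto
      from bound[OF t this] show ?thesis by (simp add: Err_def)
    qed
  qed
qed

text \<open>Two solutions are bounded on the compact time interval, so both solve the system clipped at a common level.\<close>
lemma uniqueness:
  assumes y: "\<And>k t. k < n + m \<Longrightarrow> t \<in> {0..T} \<Longrightarrow> (y k has_real_derivative G k (\<lambda>i. y i t)) (at t within {0..T})"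
    and z: "\<And>k t. k < n + m \<Longrightarrow> t \<in> {0..T} \<Longrightarrow> (z k has_real_derivative G k (\<lambda>i. z i t)) (at t within {0..T})"
    and init: "\<And>k. k < n + m \<Longrightarrow> y k 0 = z k 0" and k: "k < n + m" and t: "t \<in> {0..T}"
  shows "y k t = z k t"
proof -
  have c: "continuous_on {0..T} (y k)" "continuous_on {0..T} (z k)" if "k < n + m" for k
    by (rule DERIV_continuous_on[OF y[OF that]] DERIV_continuous_on[OF z[OF that]]; assumption)+
  obtain R1 where R1: "R1 \<ge> 0" "\<forall>k<n + m. \<forall>t\<in>{0..T}. \<bar>y k t\<bar> \<le> R1" using bounded_family[of "n + m" y] c by blast
  obtain R2 where R2: "R2 \<ge> 0" "\<forall>k<n + m. \<forall>t\<in>{0..T}. \<bar>z k t\<bar> \<le> R2" using bounded_family[of "n + m" z] c by blast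
  define R where "R = R1 + R2"
  have R0: "0 \<le> R" using R1 R2 by (simp add: R_def)
  have cy: "G k (clip R (\<lambda>i. y i t)) = G k (\<lambda>i. y i t)" if "t \<in> {0..T}" for k t
  proof (rule G_cong)
    fix i assume "i < n + m"
    then have "\<bar>y i t\<bar> \<le> R1" using R1 that by blast
    then show "clip R (\<lambda>i. y i t) i = y i t" using R2(1) by (intro clip_id) (simp add: R_def)
  qed
  have cz: "G k (clip R (\<lambda>i. z i t)) = G k (\<lambda>i. z i t)" if "t \<in> {0..T}" for k t
  proof (rule G_cong)
    fix i assume "i < n + m"
    then have "\<bar>z i t\<bar> \<le> R2" using R2 that by blast
    then show "clip R (\<lambda>i. z i t) i = z i t" using R1(1) by (intro clip_id) (simp add: R_def)
  qed
  obtain L where L: "0 \<le> L"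
    "\<And>k y z. k < n + m \<Longrightarrow> \<bar>G k (clip R y) - G k (clip R z)\<bar> \<le> L * (\<Sum>i<n + m. \<bar>y i - z i\<bar>)"
    by (rule G_lipschitz[OF R0]) (rule that; assumption)
  show ?thesis
  proof (rule lipschitz_ode_uniqueness[where G = "\<lambda>k y. G k (clip R y)" and N = "n + m" and L = L and T = T and y = y and z = z and k = k and t = t])
    show "\<bar>G k (clip R y) - G k (clip R z)\<bar> \<le> L * (\<Sum>i<n + m. \<bar>y i - z i\<bar>)" if "k < n + m" for k y z by (rule L(2)[OF that])
    show "(y k has_real_derivative G k (clip R (\<lambda>i. y i t))) (at t within {0..T})" if "k < n + m" "t \<in> {0..T}" for k t
      using y[OF that] cy[OF that(2)] by simp
    show "(z k has_real_derivative G k (clip R (\<lambda>i. z i t))) (at t within {0..T})" if "k < n + m" "t \<in> {0..T}" for k t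
      using z[OF that] cz[OF that(2)] by simp
  qed (use L(1) init k t in auto)
qed

text \<open>The total error is the projection error plus the error against the projections, and the factor \<open>2\<close> under
  the root comes from \<open>(a + b)\<^sup>2 \<le> 2 a\<^sup>2 + 2 b\<^sup>2\<close>.\<close>
lemma scheme_converges:
  assumes small: "B2 * h < 1" and \<eta>0: "\<And>x. x \<in> {0..1} \<Longrightarrow> \<eta>0 x = \<eta> 0 x" and u0: "\<And>x. x \<in> {0..1} \<Longrightarrow> u0 x = u 0 x"
  shows "\<exists>\<eta>h uh. semidiscrete_solution T c1 c2 c3 \<eta>0 u0 xs \<eta>h uh \<and>
    (\<forall>\<eta>h' uh'. semidiscrete_solution T c1 c2 c3 \<eta>0 u0 xs \<eta>h' uh' \<longrightarrow>
       (\<forall>t\<in>{0..T}. \<forall>x\<in>{0..1}. \<eta>h' t x = \<eta>h t x \<and> uh' t x = uh t x)) \<and>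
    (\<forall>t\<in>{0..T}. l2_norm (\<lambda>x. \<eta> t x - \<eta>h t x) \<le> sqrt (4 * M\<^sup>2 + 2 * B2) * h ^ 3) \<and>
    (\<forall>t\<in>{0..T}. norm1 (\<lambda>x. u t x - uh t x) \<le> sqrt (4 * M\<^sup>2 + 2 * B2) * h ^ 3)"
proof -
  have T0: "0 \<in> {0..T}" using T by simp
  have c\<eta>0: "continuous_on {0..1} \<eta>0" using continuous_on_eq[OF C1_continuous(1)[OF C1_\<eta>[OF T0]]] \<eta>0 by auto
  have Cu0: "C1 u0 (ux 0)" by (rule C1_cong[OF C1_u[OF T0]]) (use u0 in auto)
  have Y0: "Y k 0 = initial \<eta>0 u0 k" if k: "k < n + m" for k
  proof (cases "k < n")
    case True
    then show ?thesis using ip_cong[of \<eta>0 "\<eta> 0" "e k" "e k"] \<eta>0 by (simp add: Y_def initial_def)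
  next
    case False
    then have j: "k - n < m" using k by simp
    have "aip (u 0) (f (k - n)) = aip u0 (f (k - n))"
      by (rule F.B_cong) (use C1_dx_self[OF C1_u[OF T0]] C1_dx_self[OF Cu0] F.e_W[OF j] u0 in auto)
    then show ?thesis using False by (simp add: Y_def initial_def)
  qed
  obtain y where y0: "\<And>k. k < n + m \<Longrightarrow> y k 0 = Y k 0"
    and yd: "\<And>k t. k < n + m \<Longrightarrow> t \<in> {0..T} \<Longrightarrow> (y k has_real_derivative G k (\<lambda>i. y i t)) (at t within {0..T})"
    and yE: "\<And>t. t \<in> {0..T} \<Longrightarrow> (\<Sum>k<n + m. (Y k t - y k t)\<^sup>2) \<le> B2 * h ^ 6"
    by (rule existence[OF small]) (rule that; assumption)
  define \<eta>h where "\<eta>h t = He (\<lambda>i. y i t)" for t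
  define uh where "uh t = Hu (\<lambda>i. y i t)" for t
  have sol: "semidiscrete_solution T c1 c2 c3 \<eta>0 u0 xs \<eta>h uh" unfolding \<eta>h_def[abs_def] uh_def[abs_def]
    by (rule ode_imp_semidiscrete[OF T yd _ c\<eta>0 Cu0]) (use y0 Y0 in auto)
  have uniq: "\<eta>h' t x = \<eta>h t x \<and> uh' t x = uh t x"
    if s: "semidiscrete_solution T c1 c2 c3 \<eta>0 u0 xs \<eta>h' uh'" and t: "t \<in> {0..T}" and x: "x \<in> {0..1}" for \<eta>h' uh' t x
  proof -
    define z where "z k t = initial (\<eta>h' t) (uh' t) k" for k t
    note ode = semidiscrete_imp_ode[OF T s c\<eta>0 Cu0, folded z_def]
    have "z k t = y k t" if k: "k < n + m" for k
      by (rule uniqueness[OF ode(3) yd _ k t]) (use ode(2) y0 Y0 in auto)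
    then have "He (\<lambda>i. z i t) = He (\<lambda>i. y i t)" "Hu (\<lambda>i. z i t) = Hu (\<lambda>i. y i t)" by (intro H_cong; simp)+
    then show ?thesis using ode(1)[OF t x] by (simp add: \<eta>h_def uh_def)
  qed
  have sq: "sqrt X \<le> sqrt (4 * M\<^sup>2 + 2 * B2) * h ^ 3" if "X \<le> (4 * M\<^sup>2 + 2 * B2) * h ^ 6" for X
  proof -
    have "sqrt X \<le> sqrt ((4 * M\<^sup>2 + 2 * B2) * h ^ 6)" using that by simp
    moreover have "sqrt (h ^ 6) = h ^ 3" by (rule real_sqrt_unique) (use h in simp_all)
    ultimately show ?thesis by (simp add: real_sqrt_mult)
  qed
  have errs: "l2_norm (\<lambda>x. \<eta> t x - \<eta>h t x) \<le> sqrt (4 * M\<^sup>2 + 2 * B2) * h ^ 3 \<and> norm1 (\<lambda>x. u t x - uh t x) \<le> sqrt (4 * M\<^sup>2 + 2 * B2) * h ^ 3"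
    if t: "t \<in> {0..T}" for t
  proof -
    let ?y = "\<lambda>k. Y k t" and ?a = "\<lambda>k. y k t"
    define d where "d k = Y k t - y k t" for k
    have HD: "He d x = He ?y x - He ?a x" "Hu d x = Hu ?y x - Hu ?a x" "Hu' d x = Hu' ?y x - Hu' ?a x" for x
      using H_diff[of ?y ?a] by (simp_all add: d_def[abs_def])
    have par: "ip (He d) (He d) + (ip (Hu d) (Hu d) + 1/3 * ip (Hu' d) (Hu' d)) \<le> B2 * h ^ 6"
      unfolding H_parseval using yE[OF t] by (simp add: d_def)
    note nn = ip_nonneg[of "He d"] ip_nonneg[of "Hu d"] ip_nonneg[of "Hu' d"]
    note C\<eta> = C1_\<eta>[OF t] and Cu = C1_u[OF t] and pb = projection_bounds[OF t]
    note cc = C1_continuous[OF C\<eta>] C1_continuous[OF Cu] cH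
    have Mh: "0 \<le> M\<^sup>2 * h ^ 6" using h by simp
    have split: "ip (\<lambda>x. a x - c x) (\<lambda>x. a x - c x) \<le> 2 * ip (\<lambda>x. a x - b x) (\<lambda>x. a x - b x) + 2 * ip D D"
      if "\<And>x. D x = b x - c x" "continuous_on {0..1} a" "continuous_on {0..1} b" "continuous_on {0..1} D" for a b c D
    proof -
      have "(\<lambda>x. a x - c x) = (\<lambda>x. (a x - b x) + D x)" by (simp add: that(1))
      then show ?thesis using ip_triangle2[of "\<lambda>x. a x - b x" D] that by (auto intro!: continuous_intros)
    qed
    have 1: "ip (\<lambda>x. \<eta> t x - \<eta>h t x) (\<lambda>x. \<eta> t x - \<eta>h t x) \<le> (4 * M\<^sup>2 + 2 * B2) * h ^ 6"
    proof -
      have "ip (\<lambda>x. \<eta> t x - \<eta>h t x) (\<lambda>x. \<eta> t x - \<eta>h t x) \<le> 2 * ip (\<lambda>x. \<eta> t x - He ?y x) (\<lambda>x. \<eta> t x - He ?y x) + 2 * ip (He d) (He d)"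
        unfolding \<eta>h_def by (rule split[OF HD(1) cc(1) cH(1) cH(1)])
      also have "\<dots> \<le> 4 * (M\<^sup>2 * h ^ 6) + 2 * (B2 * h ^ 6)" using pb(1) par nn Mh by linarith
      finally show ?thesis by (simp add: algebra_simps)
    qed
    have 2: "ip (\<lambda>x. u t x - uh t x) (\<lambda>x. u t x - uh t x) + 1/3 * ip (\<lambda>x. ux t x - Hu' ?a x) (\<lambda>x. ux t x - Hu' ?a x) \<le> (4 * M\<^sup>2 + 2 * B2) * h ^ 6"
    proof -
      have "ip (\<lambda>x. u t x - uh t x) (\<lambda>x. u t x - uh t x) \<le> 2 * ip (\<lambda>x. u t x - Hu ?y x) (\<lambda>x. u t x - Hu ?y x) + 2 * ip (Hu d) (Hu d)"
        unfolding uh_def by (rule split[OF HD(2) cc(3) cH(3) cH(3)])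
      moreover have "ip (\<lambda>x. ux t x - Hu' ?a x) (\<lambda>x. ux t x - Hu' ?a x) \<le> 2 * ip (\<lambda>x. ux t x - Hu' ?y x) (\<lambda>x. ux t x - Hu' ?y x) + 2 * ip (Hu' d) (Hu' d)"
        by (rule split[OF HD(3) cc(4) cH(4) cH(4)])
      ultimately have "ip (\<lambda>x. u t x - uh t x) (\<lambda>x. u t x - uh t x) + 1/3 * ip (\<lambda>x. ux t x - Hu' ?a x) (\<lambda>x. ux t x - Hu' ?a x)
         \<le> 4 * (M\<^sup>2 * h ^ 6) + 2 * (B2 * h ^ 6)" using pb(3) par nn by linarith
      then show ?thesis by (simp add: algebra_simps)
    qed
    have c1: "continuous_on {0..1} (\<lambda>x. \<eta> t x - \<eta>h t x)" unfolding \<eta>h_def by (intro continuous_intros cc)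
    have "l2_norm (\<lambda>x. \<eta> t x - \<eta>h t x) = sqrt (ip (\<lambda>x. \<eta> t x - \<eta>h t x) (\<lambda>x. \<eta> t x - \<eta>h t x))"
      unfolding l2_norm_def l2_inner_eq_ip[OF c1 c1] ..
    moreover have "C1 (\<lambda>x. u t x - uh t x) (\<lambda>x. ux t x - Hu' ?a x)" unfolding uh_def by (rule C1_diff[OF Cu C1_Hu])
    ultimately show ?thesis using sq[OF 1] sq[OF 2] norm1_C1 by simp
  qed
  show ?thesis using sol uniq errs by blast
qed

end

section \<open>Convergence under the Sobolev hypotheses\<close>

text \<open>The constant is the norm itself, so it is uniform in time for a function in \<open>C(0,T;W\<^sub>\<infinity>\<^sup>4)\<close>.\<close>
lemma spline_approximation_W_inf:
  assumes m: "is_mesh xs" and v: "v \<in> W_inf 4" "continuous_on {0..1} v" and M: "\<bar>W_inf_norm 4 v\<bar> \<le> M"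
  obtains s where "s \<in> S4 xs" "s 0 = v 0" "s 1 = v 1"
    "ip (\<lambda>x. v x - s x) (\<lambda>x. v x - s x) \<le> (M * mesh_h xs ^ 4)\<^sup>2"
    "ip (\<lambda>x. dx v x - dx s x) (\<lambda>x. dx v x - dx s x) \<le> (M * mesh_h xs ^ 3)\<^sup>2"
    "\<forall>x\<in>{0..1}. \<bar>v x - s x\<bar> \<le> M \<and> \<bar>dx v x - dx s x\<bar> \<le> M"
proof -
  obtain v1 v2 v3 where C: "C1 v v1" "C1 v1 v2" "C1 v2 v3"
    and lip0: "\<And>x y. 0 \<le> x \<Longrightarrow> x \<le> y \<Longrightarrow> y \<le> 1 \<Longrightarrow> \<bar>v3 y - v3 x\<bar> \<le> \<bar>W_inf_norm 4 v\<bar> * (y - x)"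
    by (rule W_inf_4_regularity[OF v]) (rule that; assumption)
  have lip: "\<bar>v3 y - v3 x\<bar> \<le> M * (y - x)" if "0 \<le> x" "x \<le> y" "y \<le> 1" for x y
    by (rule order_trans[OF lip0[OF that] mult_right_mono[OF M]]) (use that in simp)
  have M0: "0 \<le> M" using M by linarith
  have d: "dx v x = v1 x" if "x \<in> {0..1}" for x by (rule C1_dx[OF C(1) that])
  obtain s where s: "s \<in> S4 xs" "s 0 = v 0" "s 1 = v 1"
    "ip (\<lambda>x. v x - s x) (\<lambda>x. v x - s x) \<le> (M * mesh_h xs ^ 4)\<^sup>2"
    "ip (\<lambda>x. v1 x - dx s x) (\<lambda>x. v1 x - dx s x) \<le> (M * mesh_h xs ^ 3)\<^sup>2"
    and b: "\<And>x. x \<in> {0..1} \<Longrightarrow> \<bar>v x - s x\<bar> \<le> M \<and> \<bar>v1 x - dx s x\<bar> \<le> M"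
    by (rule spline_approximation[OF m C lip M0]) (assumption | (rule that; assumption))+
  have "ip (\<lambda>x. dx v x - dx s x) (\<lambda>x. dx v x - dx s x) = ip (\<lambda>x. v1 x - dx s x) (\<lambda>x. v1 x - dx s x)"
    by (rule ip_cong) (simp_all add: d)
  then show thesis using s b d by (intro that[of s]) auto
qed

lemma jointly_continuous_slice: "jointly_continuous T g \<Longrightarrow> t \<in> {0..T} \<Longrightarrow> continuous_on {0..1} (g t)"
  unfolding jointly_continuous_def
  by (drule continuous_on_compose2[where f = "\<lambda>x. (t, x)" and s = "{0..1}"]) (auto intro!: continuous_intros)

lemma jointly_continuous_bounded:
  assumes "jointly_continuous T g" shows "\<exists>B. \<forall>t\<in>{0..T}. \<forall>x\<in>{0..1}. \<bar>g t x\<bar> \<le> B"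
proof -
  have "compact ((\<lambda>(t, x). g t x) ` ({0..T} \<times> {0..1}))"
    using assms unfolding jointly_continuous_def by (intro compact_continuous_image compact_Times) auto
  then have "bounded ((\<lambda>(t, x). g t x) ` ({0..T} \<times> {0..1}))" by (rule compact_imp_bounded)
  then obtain B where "\<forall>y\<in>(\<lambda>(t, x). g t x) ` ({0..T} \<times> {0..1}). norm y \<le> B" unfolding bounded_iff by blast
  then show ?thesis by (intro exI[of _ B]) auto
qed

lemma C_time_bounded:
  assumes "v \<in> C_time T X nrm" shows "\<exists>B\<ge>0. \<forall>t\<in>{0..T}. \<bar>nrm (v t)\<bar> \<le> B"
proof -
  have "bounded ((\<lambda>t. nrm (v t)) ` {0..T})"
    using assms unfolding C_time_def by (intro compact_imp_bounded compact_continuous_image) auto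
  then obtain B where "\<forall>y\<in>(\<lambda>t. nrm (v t)) ` {0..T}. norm y \<le> B" unfolding bounded_iff by blast
  then have "\<bar>nrm (v t)\<bar> \<le> B" if "t \<in> {0..T}" for t using that by simp
  then show ?thesis by (intro exI[of _ "\<bar>B\<bar>"]) (auto intro: order_trans[OF _ abs_ge_self])
qed

lemma x_differentiable_C1:
  assumes "x_differentiable T g" "jointly_continuous T (\<lambda>t. dx (g t))" "t \<in> {0..T}"
  shows "C1 (g t) (dx (g t))"
  unfolding C1_def
proof (intro conjI ballI)
  show "continuous_on {0..1} (dx (g t))" using jointly_continuous_slice[OF assms(2,3)] .
  show "(g t has_real_derivative dx (g t) x) (at x within {0..1})" if "x \<in> {0..1}" for x
    using assms that unfolding x_differentiable_def dx_def has_real_derivative_iff_has_vector_derivative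
    by (simp add: vector_derivative_works)
qed

lemma t_differentiable_derivative:
  assumes "t_differentiable T g" "t \<in> {0..T}" "x \<in> {0..1}"
  shows "((\<lambda>s. g s x) has_real_derivative dt T g t x) (at t within {0..T})"
  using assms unfolding t_differentiable_def dt_def has_real_derivative_iff_has_vector_derivative
  by (simp add: vector_derivative_works)

text \<open>Classical smoothness supplies the bounds for the functions and their first derivatives by compactness, the Sobolev
  hypothesis supplies spline approximation. An approximating spline interpolates at both ends, so for \<open>u\<close>
  it satisfies the boundary conditions.\<close>
lemma smooth_solution_exists:
  assumes T: "0 < T" and smooth: "classically_smooth T \<eta> u" and ibv: "initial_boundary_values T \<eta>0 u0 \<eta> u"
    and eq: "\<And>t x. t \<in> {0..T} \<Longrightarrow> x \<in> {0..1} \<Longrightarrow>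
        dt T \<eta> t x + (dx (u t) x + c1 * dx (\<lambda>y. \<eta> t y * u t y) x) = 0 \<and>
        dt T u t x - 1/3 * dt T (\<lambda>s. dx (dx (u s))) t x
          + (dx (\<eta> t) x + c2 * (u t x * dx (u t) x) + c3 * (\<eta> t x * dx (\<eta> t) x)) = 0"
    and \<eta>: "\<eta> \<in> C_time T (W_inf 4) (W_inf_norm 4)" and u: "u \<in> C_time T (W_inf 4 \<inter> H10_space) (W_inf_norm 4)"
  shows "\<exists>M M1. smooth_solution T M M1 c1 c2 c3 \<eta> (\<lambda>t. dx (\<eta> t)) (dt T \<eta>) u (\<lambda>t. dx (u t))
     (\<lambda>t. dx (dx (u t))) (dt T u) (dt T (\<lambda>t. dx (dx (u t))))"
proof -
  note S = smooth[unfolded classically_smooth_def]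
  have jc: "jointly_continuous T \<eta>" "jointly_continuous T (\<lambda>t. dx (\<eta> t))" "jointly_continuous T (dt T \<eta>)"
    "jointly_continuous T u" "jointly_continuous T (\<lambda>t. dx (u t))" "jointly_continuous T (dt T u)"
    "jointly_continuous T (\<lambda>t. dx (dx (u t)))" "jointly_continuous T (dt T (\<lambda>t. dx (dx (u t))))" using S by auto
  have xd: "x_differentiable T \<eta>" "x_differentiable T u" "x_differentiable T (\<lambda>t. dx (u t))" using S by auto
  have td: "t_differentiable T \<eta>" "t_differentiable T u" "t_differentiable T (\<lambda>t. dx (dx (u t)))" using S by auto
  have C\<eta>: "C1 (\<eta> t) (dx (\<eta> t))" if "t \<in> {0..T}" for t by (rule x_differentiable_C1[OF xd(1) jc(2) that])
  have Cu: "C1 (u t) (dx (u t))" if "t \<in> {0..T}" for t by (rule x_differentiable_C1[OF xd(2) jc(5) that])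
  have Cux: "C1 (dx (u t)) (dx (dx (u t)))" if "t \<in> {0..T}" for t by (rule x_differentiable_C1[OF xd(3) jc(7) that])
  obtain B1 where B1: "\<forall>t\<in>{0..T}. \<forall>x\<in>{0..1}. \<bar>\<eta> t x\<bar> \<le> B1" using jointly_continuous_bounded[OF jc(1)] by blast
  obtain B2 where B2: "\<forall>t\<in>{0..T}. \<forall>x\<in>{0..1}. \<bar>dx (\<eta> t) x\<bar> \<le> B2" using jointly_continuous_bounded[OF jc(2)] by blast
  obtain B3 where B3: "\<forall>t\<in>{0..T}. \<forall>x\<in>{0..1}. \<bar>u t x\<bar> \<le> B3" using jointly_continuous_bounded[OF jc(4)] by blast
  obtain B4 where B4: "\<forall>t\<in>{0..T}. \<forall>x\<in>{0..1}. \<bar>dx (u t) x\<bar> \<le> B4" using jointly_continuous_bounded[OF jc(5)] by blast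
  define M1 where "M1 = max (max B1 B2) (max B3 B4)"
  obtain N1 where N1: "0 \<le> N1" "\<forall>t\<in>{0..T}. \<bar>W_inf_norm 4 (\<eta> t)\<bar> \<le> N1" using C_time_bounded[OF \<eta>] by blast
  obtain N2 where N2: "0 \<le> N2" "\<forall>t\<in>{0..T}. \<bar>W_inf_norm 4 (u t)\<bar> \<le> N2" using C_time_bounded[OF u] by blast
  define M where "M = max N1 N2"
  have W: "\<eta> t \<in> W_inf 4" "u t \<in> W_inf 4" if "t \<in> {0..T}" for t using \<eta> u that by (auto simp: C_time_def)
  have bd: "u t 0 = 0 \<and> u t 1 = 0" if "t \<in> {0..T}" for t using ibv that by (simp add: initial_boundary_values_def)
  have "smooth_solution T M M1 c1 c2 c3 \<eta> (\<lambda>t. dx (\<eta> t)) (dt T \<eta>) u (\<lambda>t. dx (u t))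
     (\<lambda>t. dx (dx (u t))) (dt T u) (dt T (\<lambda>t. dx (dx (u t))))"
  proof
    fix t x :: real assume t: "t \<in> {0..T}" and x: "x \<in> {0..1}"
    have p: "dx (\<lambda>y. \<eta> t y * u t y) x = dx (\<eta> t) x * u t x + \<eta> t x * dx (u t) x"
      by (rule C1_dx[OF C1_mult[OF C\<eta>[OF t] Cu[OF t]] x])
    show "dt T \<eta> t x + (dx (u t) x + c1 * (dx (\<eta> t) x * u t x + \<eta> t x * dx (u t) x)) = 0"
      using eq[OF t x] unfolding p by blast
    show "dt T u t x - 1/3 * dt T (\<lambda>t. dx (dx (u t))) t x + (dx (\<eta> t) x + c2 * (u t x * dx (u t) x) + c3 * (\<eta> t x * dx (\<eta> t) x)) = 0"
      using eq[OF t x] by blast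
    show "\<bar>\<eta> t x\<bar> \<le> M1 \<and> \<bar>dx (\<eta> t) x\<bar> \<le> M1 \<and> \<bar>u t x\<bar> \<le> M1 \<and> \<bar>dx (u t) x\<bar> \<le> M1"
      using B1 B2 B3 B4 t x by (simp add: M1_def le_max_iff_disj)
    show "((\<lambda>s. \<eta> s x) has_real_derivative dt T \<eta> t x) (at t within {0..T})" by (rule t_differentiable_derivative[OF td(1) t x])
    show "((\<lambda>s. u s x) has_real_derivative dt T u t x) (at t within {0..T})" by (rule t_differentiable_derivative[OF td(2) t x])
    show "((\<lambda>s. dx (dx (u s)) x) has_real_derivative dt T (\<lambda>t. dx (dx (u t))) t x) (at t within {0..T})"
      by (rule t_differentiable_derivative[OF td(3) t x])
  next
    fix t :: real assume t: "t \<in> {0..T}"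
    show "C1 (\<eta> t) (dx (\<eta> t))" "C1 (u t) (dx (u t))" "C1 (dx (u t)) (dx (dx (u t)))" "u t 0 = 0 \<and> u t 1 = 0"
      by (rule C\<eta>[OF t] Cu[OF t] Cux[OF t] bd[OF t])+
  next
    fix t zs assume t: "t \<in> {0..T}" and zs: "is_mesh zs"
    have "\<bar>W_inf_norm 4 (\<eta> t)\<bar> \<le> N1" "\<bar>W_inf_norm 4 (u t)\<bar> \<le> N2" using N1 N2 t by blast+
    then have nM: "\<bar>W_inf_norm 4 (\<eta> t)\<bar> \<le> M" "\<bar>W_inf_norm 4 (u t)\<bar> \<le> M" by (simp_all add: M_def)
    show "\<exists>s\<in>S4 zs. ip (\<lambda>x. \<eta> t x - s x) (\<lambda>x. \<eta> t x - s x) \<le> (M * mesh_h zs ^ 4)\<^sup>2 \<and>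
        ip (\<lambda>x. dx (\<eta> t) x - dx s x) (\<lambda>x. dx (\<eta> t) x - dx s x) \<le> (M * mesh_h zs ^ 3)\<^sup>2 \<and> (\<forall>x\<in>{0..1}. \<bar>\<eta> t x - s x\<bar> \<le> M)"
      by (rule spline_approximation_W_inf[OF zs W(1)[OF t] C1_continuous(1)[OF C\<eta>[OF t]] nM(1)]) blast
    show "\<exists>s\<in>S40 zs. ip (\<lambda>x. u t x - s x) (\<lambda>x. u t x - s x) \<le> (M * mesh_h zs ^ 4)\<^sup>2 \<and>
        ip (\<lambda>x. dx (u t) x - dx s x) (\<lambda>x. dx (u t) x - dx s x) \<le> (M * mesh_h zs ^ 3)\<^sup>2 \<and> (\<forall>x\<in>{0..1}. \<bar>dx (u t) x - dx s x\<bar> \<le> M)"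
    proof (rule spline_approximation_W_inf[OF zs W(2)[OF t] C1_continuous(1)[OF Cu[OF t]] nM(2)])
      fix s assume "s \<in> S4 zs" "s 0 = u t 0" "s 1 = u t 1"
      then have "s \<in> S40 zs" using bd[OF t] by (simp add: S40_def)
      moreover assume "ip (\<lambda>x. u t x - s x) (\<lambda>x. u t x - s x) \<le> (M * mesh_h zs ^ 4)\<^sup>2"
        "ip (\<lambda>x. dx (u t) x - dx s x) (\<lambda>x. dx (u t) x - dx s x) \<le> (M * mesh_h zs ^ 3)\<^sup>2"
        "\<forall>x\<in>{0..1}. \<bar>u t x - s x\<bar> \<le> M \<and> \<bar>dx (u t) x - dx s x\<bar> \<le> M"
      ultimately show ?thesis by blast
    qed
  next
    show "continuous_on ({0..T} \<times> {0..1}) (\<lambda>(s, x). dt T \<eta> s x)" using jc(3) by (simp only: jointly_continuous_def)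
    show "continuous_on ({0..T} \<times> {0..1}) (\<lambda>(s, x). dt T u s x)" using jc(6) by (simp only: jointly_continuous_def)
    show "continuous_on ({0..T} \<times> {0..1}) (\<lambda>(s, x). dt T (\<lambda>t. dx (dx (u t))) s x)" using jc(8) by (simp only: jointly_continuous_def)
    show "0 < T" by (rule T)
    show "0 \<le> M" using N1 by (simp add: M_def)
  qed
  then show ?thesis by blast
qed

text \<open>All constants of the convergence proof depend on the mesh through \<open>q\<close> only, and quasiuniformity makes \<open>q\<close>
  common to the family; \<open>h0\<close> is chosen so small that the bootstrap condition \<open>B2 h < 1\<close> holds.\<close>
lemma quasiuniform_convergence:
  assumes qu: "quasiuniform_family \<M>"
    and sm: "smooth_solution T M M1 c1 c2 c3 \<eta> \<eta>x \<eta>t u ux uxx ut uxxt"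
    and \<eta>0: "\<And>x. x \<in> {0..1} \<Longrightarrow> \<eta>0 x = \<eta> 0 x" and u0: "\<And>x. x \<in> {0..1} \<Longrightarrow> u0 x = u 0 x"
  shows "\<exists>h0>0. \<exists>C. \<forall>xs\<in>\<M>. mesh_h xs \<le> h0 \<longrightarrow>
    (\<exists>\<eta>h uh. semidiscrete_solution T c1 c2 c3 \<eta>0 u0 xs \<eta>h uh \<and>
      (\<forall>\<eta>h' uh'. semidiscrete_solution T c1 c2 c3 \<eta>0 u0 xs \<eta>h' uh' \<longrightarrow>
         (\<forall>t\<in>{0..T}. \<forall>x\<in>{0..1}. \<eta>h' t x = \<eta>h t x \<and> uh' t x = uh t x)) \<and>
      (\<forall>t\<in>{0..T}. l2_norm (\<lambda>x. \<eta> t x - \<eta>h t x) \<le> C * mesh_h xs ^ 3) \<and>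
      (\<forall>t\<in>{0..T}. norm1 (\<lambda>x. u t x - uh t x) \<le> C * mesh_h xs ^ 3))"
proof -
  obtain \<kappa>0 where meshes: "\<forall>xs\<in>\<M>. is_mesh xs" and \<kappa>0: "\<forall>xs\<in>\<M>. Max (mesh_widths xs) / Min (mesh_widths xs) \<le> \<kappa>0"
    using qu unfolding quasiuniform_family_def by blast
  \<comment> \<open>With \<open>\<kappa> \<ge> 1\<close> also \<open>\<kappa> \<le> \<kappa>\<^sup>2\<close>, so that \<open>\<kappa>\<^sup>2\<close> serves all three inverse inequalities.\<close>
  define \<kappa> where "\<kappa> = max 1 \<kappa>0"
  have \<kappa>1: "1 \<le> \<kappa>" by (simp add: \<kappa>_def)
  obtain C where C: "C > 0"
    and I1: "\<And>xs f x. is_mesh xs \<Longrightarrow> f \<in> S4 xs \<Longrightarrow> x \<in> {0..1} \<Longrightarrow> (f x)\<^sup>2 \<le> C / Min (mesh_widths xs) * ip f f"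
    and I2: "\<And>xs f x. is_mesh xs \<Longrightarrow> f \<in> S4 xs \<Longrightarrow> x \<in> {0..1} \<Longrightarrow> (dx f x)\<^sup>2 \<le> C / Min (mesh_widths xs) * ip (dx f) (dx f)"
    and I3: "\<And>xs f. is_mesh xs \<Longrightarrow> f \<in> S4 xs \<Longrightarrow> ip (dx f) (dx f) \<le> C / (Min (mesh_widths xs))\<^sup>2 * ip f f"
    by (rule inverse_inequalities) (rule that; assumption)
  define q where "q = C * \<kappa>\<^sup>2"
  have q0: "0 \<le> q" using C by (simp add: q_def)
  \<comment> \<open>The value of the constant \<open>B2\<close> of the convergence proof, written out so that it is visibly independent of the mesh.\<close>
  define Bd where "Bd = (11 + 8 * q) * M\<^sup>2 * exp (6 * (4 + (7 * \<bar>c1\<bar> + 4 * \<bar>c2\<bar> + 2 * \<bar>c3\<bar>) * (M1 + M + 2 + 18 * q * M\<^sup>2 + 4 * q)) * T)"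
  have Bd0: "0 \<le> Bd" using q0 by (simp add: Bd_def)
  define h0 where "h0 = 1 / (Bd + 1)"
  have h0: "0 < h0" using Bd0 by (simp add: h0_def)
  have main: "\<exists>\<eta>h uh. semidiscrete_solution T c1 c2 c3 \<eta>0 u0 xs \<eta>h uh \<and>
      (\<forall>\<eta>h' uh'. semidiscrete_solution T c1 c2 c3 \<eta>0 u0 xs \<eta>h' uh' \<longrightarrow>
         (\<forall>t\<in>{0..T}. \<forall>x\<in>{0..1}. \<eta>h' t x = \<eta>h t x \<and> uh' t x = uh t x)) \<and>
      (\<forall>t\<in>{0..T}. l2_norm (\<lambda>x. \<eta> t x - \<eta>h t x) \<le> sqrt (4 * M\<^sup>2 + 2 * Bd) * mesh_h xs ^ 3) \<and>
      (\<forall>t\<in>{0..T}. norm1 (\<lambda>x. u t x - uh t x) \<le> sqrt (4 * M\<^sup>2 + 2 * Bd) * mesh_h xs ^ 3)"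
    if xs: "xs \<in> \<M>" and hh: "mesh_h xs \<le> h0" for xs
  proof -
    have mesh: "is_mesh xs" using meshes xs by blast
    let ?m = "Min (mesh_widths xs)" and ?h = "mesh_h xs"
    have m0: "0 < ?m" by (rule mesh_min_pos[OF mesh])
    have hp: "0 < ?h" by (rule mesh_h_bounds(1)[OF mesh])
    have "?h / ?m \<le> \<kappa>" using \<kappa>0 xs by (simp add: mesh_h_def \<kappa>_def le_max_iff_disj)
    then have hm: "?h \<le> \<kappa> * ?m" using m0 by (simp add: divide_le_eq)
    have k1: "C / ?m \<le> q / ?h"
    proof -
      have "C * ?h \<le> C * (\<kappa> * ?m)" using hm C by (intro mult_left_mono) auto
      also have "\<dots> \<le> C * (\<kappa>\<^sup>2 * ?m)" using C m0 \<kappa>1 self_le_power[of \<kappa> 2] by (intro mult_left_mono mult_right_mono) auto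
      finally show ?thesis using m0 hp by (simp add: q_def divide_simps mult_ac)
    qed
    have k2: "C / ?m\<^sup>2 \<le> q / ?h\<^sup>2"
    proof -
      have "C * ?h\<^sup>2 \<le> C * (\<kappa> * ?m)\<^sup>2" using hm C hp by (intro mult_left_mono power_mono) auto
      then show ?thesis using m0 hp by (simp add: q_def divide_simps power_mult_distrib mult_ac)
    qed
    obtain n e where e: "onb (S4 xs) ip n e" "\<forall>i<n. \<exists>c. \<forall>f\<in>S4 xs. ip f (e i) = (\<Sum>p\<in>spline_points xs. c p * f p)"
      using S4_onb[OF mesh] by blast
    obtain m f where f: "onb (S40 xs) aip m f" "\<forall>j<m. \<exists>c. \<forall>v\<in>S40 xs. aip v (f j) = (\<Sum>p\<in>spline_points xs. c p * v p)"
      using S40_onb[OF mesh] by blast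
    interpret sol: smooth_solution T M M1 c1 c2 c3 \<eta> \<eta>x \<eta>t u ux uxx ut uxxt by (rule sm)
    interpret gal: galerkin xs n m e f c1 c2 c3 using mesh e f by unfold_locales auto
    interpret scheme T M M1 c1 c2 c3 \<eta> \<eta>x \<eta>t u ux uxx ut uxxt xs n m e f q
    proof
      show "0 \<le> q" by (rule q0)
      show "(v x)\<^sup>2 \<le> q / ?h * ip v v" if "v \<in> S4 xs" "x \<in> {0..1}" for v x
        by (rule order_trans[OF I1[OF mesh that] mult_right_mono[OF k1 ip_nonneg]])
      show "(dx v x)\<^sup>2 \<le> q / ?h * ip (dx v) (dx v)" if "v \<in> S4 xs" "x \<in> {0..1}" for v x
        by (rule order_trans[OF I2[OF mesh that] mult_right_mono[OF k1 ip_nonneg]])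
      show "ip (dx v) (dx v) \<le> q / ?h\<^sup>2 * ip v v" if "v \<in> S4 xs" for v
        by (rule order_trans[OF I3[OF mesh that] mult_right_mono[OF k2 ip_nonneg]])
    qed
    have BB: "B2 = Bd" by (simp add: B2_def B_def K_def M2_def Bd_def)
    have "Bd * ?h \<le> Bd * h0" using hh Bd0 by (rule mult_left_mono)
    also have "\<dots> < 1" using Bd0 by (simp add: h0_def)
    finally have "B2 * ?h < 1" by (simp add: BB)
    from scheme_converges[OF this \<eta>0 u0, unfolded BB] show ?thesis .
  qed
  show ?thesis using h0 main by blast
qed

theorem proposition3p1:
  fixes T :: real and \<M> :: "real list set"
  assumes "0 < T" and "quasiuniform_family \<M>"
  shows
    "(\<forall>\<eta>0 u0 \<eta> u.
        CB_solution T \<eta>0 u0 \<eta> u \<and>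
        \<eta> \<in> C_time T (W_inf 4) (W_inf_norm 4) \<and>
        u \<in> C_time T (W_inf 4 \<inter> H10_space) (W_inf_norm 4) \<longrightarrow>
        (\<exists>h0>0. \<exists>C. \<forall>xs\<in>\<M>. mesh_h xs \<le> h0 \<longrightarrow>
           (\<exists>\<eta>h uh. CBh_solution T \<eta>0 u0 xs \<eta>h uh \<and>
              (\<forall>\<eta>h' uh'. CBh_solution T \<eta>0 u0 xs \<eta>h' uh' \<longrightarrow>
                 (\<forall>t\<in>{0..T}. \<forall>x\<in>{0..1}. \<eta>h' t x = \<eta>h t x \<and> uh' t x = uh t x)) \<and>
              (\<forall>t\<in>{0..T}. l2_norm (\<lambda>x. \<eta> t x - \<eta>h t x) \<le> C * mesh_h xs ^ 3) \<and>
              (\<forall>t\<in>{0..T}. norm1 (\<lambda>x. u t x - uh t x) \<le> C * mesh_h xs ^ 3)))) \<and>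
     (\<forall>\<eta>0 u0 \<eta> u.
        SCB_solution T \<eta>0 u0 \<eta> u \<and>
        \<eta> \<in> C_time T (W_inf 4) (W_inf_norm 4) \<and>
        u \<in> C_time T (W_inf 4 \<inter> H10_space) (W_inf_norm 4) \<longrightarrow>
        (\<exists>h0>0. \<exists>C. \<forall>xs\<in>\<M>. mesh_h xs \<le> h0 \<longrightarrow>
           (\<exists>\<eta>h uh. SCBh_solution T \<eta>0 u0 xs \<eta>h uh \<and>
              (\<forall>\<eta>h' uh'. SCBh_solution T \<eta>0 u0 xs \<eta>h' uh' \<longrightarrow>
                 (\<forall>t\<in>{0..T}. \<forall>x\<in>{0..1}. \<eta>h' t x = \<eta>h t x \<and> uh' t x = uh t x)) \<and>
              (\<forall>t\<in>{0..T}. l2_norm (\<lambda>x. \<eta> t x - \<eta>h t x) \<le> C * mesh_h xs ^ 3) \<and>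
              (\<forall>t\<in>{0..T}. norm1 (\<lambda>x. u t x - uh t x) \<le> C * mesh_h xs ^ 3))))"
  unfolding CBh_semidiscrete SCBh_semidiscrete
proof (intro conjI allI impI; elim conjE)
  fix \<eta>0 u0 \<eta> u
  assume sol: "CB_solution T \<eta>0 u0 \<eta> u" and W: "\<eta> \<in> C_time T (W_inf 4) (W_inf_norm 4)" "u \<in> C_time T (W_inf 4 \<inter> H10_space) (W_inf_norm 4)"
  note S = sol[unfolded CB_solution_def]
  have ibv: "initial_boundary_values T \<eta>0 u0 \<eta> u" using S by blast
  have eq: "dt T \<eta> t x + (dx (u t) x + 1 * dx (\<lambda>y. \<eta> t y * u t y) x) = 0 \<and>
        dt T u t x - 1/3 * dt T (\<lambda>s. dx (dx (u s))) t x + (dx (\<eta> t) x + 1 * (u t x * dx (u t) x) + 0 * (\<eta> t x * dx (\<eta> t) x)) = 0"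
    if "t \<in> {0..T}" "x \<in> {0..1}" for t x
  proof -
    have "dt T \<eta> t x + dx (u t) x + dx (\<lambda>y. \<eta> t y * u t y) x = 0 \<and>
        dt T u t x + dx (\<eta> t) x + u t x * dx (u t) x - 1/3 * dt T (\<lambda>s. dx (dx (u s))) t x = 0" using S that by blast
    then show ?thesis by simp
  qed
  obtain M M1 where sm: "smooth_solution T M M1 1 1 0 \<eta> (\<lambda>t. dx (\<eta> t)) (dt T \<eta>) u (\<lambda>t. dx (u t))
     (\<lambda>t. dx (dx (u t))) (dt T u) (dt T (\<lambda>t. dx (dx (u t))))"
    using smooth_solution_exists[OF assms(1) conjunct1[OF S] ibv eq W] by blast
  show "\<exists>h0>0. \<exists>C. \<forall>xs\<in>\<M>. mesh_h xs \<le> h0 \<longrightarrow>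
    (\<exists>\<eta>h uh. semidiscrete_solution T 1 1 0 \<eta>0 u0 xs \<eta>h uh \<and>
      (\<forall>\<eta>h' uh'. semidiscrete_solution T 1 1 0 \<eta>0 u0 xs \<eta>h' uh' \<longrightarrow>
         (\<forall>t\<in>{0..T}. \<forall>x\<in>{0..1}. \<eta>h' t x = \<eta>h t x \<and> uh' t x = uh t x)) \<and>
      (\<forall>t\<in>{0..T}. l2_norm (\<lambda>x. \<eta> t x - \<eta>h t x) \<le> C * mesh_h xs ^ 3) \<and>
      (\<forall>t\<in>{0..T}. norm1 (\<lambda>x. u t x - uh t x) \<le> C * mesh_h xs ^ 3))"
    by (rule quasiuniform_convergence[OF assms(2) sm]) (use ibv in \<open>auto simp: initial_boundary_values_def\<close>)
next
  fix \<eta>0 u0 \<eta> u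
  assume sol: "SCB_solution T \<eta>0 u0 \<eta> u" and W: "\<eta> \<in> C_time T (W_inf 4) (W_inf_norm 4)" "u \<in> C_time T (W_inf 4 \<inter> H10_space) (W_inf_norm 4)"
  note S = sol[unfolded SCB_solution_def]
  have ibv: "initial_boundary_values T \<eta>0 u0 \<eta> u" using S by blast
  have eq: "dt T \<eta> t x + (dx (u t) x + 1/2 * dx (\<lambda>y. \<eta> t y * u t y) x) = 0 \<and>
        dt T u t x - 1/3 * dt T (\<lambda>s. dx (dx (u s))) t x + (dx (\<eta> t) x + 3/2 * (u t x * dx (u t) x) + 1/2 * (\<eta> t x * dx (\<eta> t) x)) = 0"
    if "t \<in> {0..T}" "x \<in> {0..1}" for t x
  proof -
    have "dt T \<eta> t x + dx (u t) x + 1/2 * dx (\<lambda>y. \<eta> t y * u t y) x = 0 \<and>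
        dt T u t x + dx (\<eta> t) x + 3/2 * (u t x * dx (u t) x) + 1/2 * (\<eta> t x * dx (\<eta> t) x)
          - 1/3 * dt T (\<lambda>s. dx (dx (u s))) t x = 0" using S that by blast
    then show ?thesis by simp
  qed
  obtain M M1 where sm: "smooth_solution T M M1 (1/2) (3/2) (1/2) \<eta> (\<lambda>t. dx (\<eta> t)) (dt T \<eta>) u (\<lambda>t. dx (u t))
     (\<lambda>t. dx (dx (u t))) (dt T u) (dt T (\<lambda>t. dx (dx (u t))))"
    using smooth_solution_exists[OF assms(1) conjunct1[OF S] ibv eq W] by blast
  show "\<exists>h0>0. \<exists>C. \<forall>xs\<in>\<M>. mesh_h xs \<le> h0 \<longrightarrow>
    (\<exists>\<eta>h uh. semidiscrete_solution T (1/2) (3/2) (1/2) \<eta>0 u0 xs \<eta>h uh \<and>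
      (\<forall>\<eta>h' uh'. semidiscrete_solution T (1/2) (3/2) (1/2) \<eta>0 u0 xs \<eta>h' uh' \<longrightarrow>
         (\<forall>t\<in>{0..T}. \<forall>x\<in>{0..1}. \<eta>h' t x = \<eta>h t x \<and> uh' t x = uh t x)) \<and>
      (\<forall>t\<in>{0..T}. l2_norm (\<lambda>x. \<eta> t x - \<eta>h t x) \<le> C * mesh_h xs ^ 3) \<and>
      (\<forall>t\<in>{0..T}. norm1 (\<lambda>x. u t x - uh t x) \<le> C * mesh_h xs ^ 3))"
    by (rule quasiuniform_convergence[OF assms(2) sm]) (use ibv in \<open>auto simp: initial_boundary_values_def\<close>)
qed

end
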